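(* Let $A$ be a commutative noetherian ring and $\mathfrak a$ an ideal of $A$. There is an inclusion $\mathcal{L}(A,\mathfrak a)_{\rm cof}\subseteq \mathcal{M}^0(A,\mathfrak a)_{\rm cof}$. Moreover, if $\mathcal{M}^0(A,\mathfrak a)_{\rm cof}$ is an abelian subcategory of $\operatorname{Mod} A$, then $\mathcal{L}(A,\mathfrak a)_{\rm cof}=\mathcal{M}^0(A,\mathfrak a)_{\rm cof}$.
   Context: $\mathcal{M}^0(A,\mathfrak a)_{\rm cof}$ is the full subcategory of $\operatorname{Mod}A$ of modules $M$ with $\operatorname{Ext}^i_A(A/\mathfrak a,M)$ finitely generated for all $i\ge 0$; it is an abelian subcategory if it is closed under kernels and cokernels of its morphisms. A module $N$ is $\mathfrak a$-cofinite if $N\in\mathcal{M}^0(A,\mathfrak a)_{\rm cof}$ and $\operatorname{Supp}_A N\subseteq V(\mathfrak a)$. $\mathcal{L}(A,\mathfrak a)_{\rm cof}$ is the full subcategory of modules $M$ such that the local cohomology module $H^i_{\mathfrak a}(M)$ is $\mathfrak a$-cofinite for all $i$. *)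

theory Defs
  imports "HOL-Algebra.Algebra"
begin

section \<open>Modules over a commutative ring\<close>

text \<open>
  The library has modules and submodules, but no linear maps, quotient modules or finite
  generation. All modules below use the library record; its fields \<open>mult\<close> and \<open>one\<close>
  play no role for modules and are left unspecified.
\<close>

definition mod_hom ::
    "('a, 'r) ring_scheme \<Rightarrow> ('a, 'm) module \<Rightarrow> ('a, 'n) module \<Rightarrow> ('m \<Rightarrow> 'n) set" where
  "mod_hom R M N = {f \<in> carrier M \<rightarrow> carrier N.
     (\<forall>x\<in>carrier M. \<forall>y\<in>carrier M. f (x \<oplus>\<^bsub>M\<^esub> y) = f x \<oplus>\<^bsub>N\<^esub> f y) \<and>
     (\<forall>r\<in>carrier R. \<forall>x\<in>carrier M. f (r \<odot>\<^bsub>M\<^esub> x) = r \<odot>\<^bsub>N\<^esub> f x)}"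

definition mod_isomorphic ::
    "('a, 'r) ring_scheme \<Rightarrow> ('a, 'm) module \<Rightarrow> ('a, 'n) module \<Rightarrow> bool" where
  "mod_isomorphic R M N \<longleftrightarrow> (\<exists>f \<in> mod_hom R M N. bij_betw f (carrier M) (carrier N))"

definition mod_ker :: "('a, 'm) module \<Rightarrow> ('a, 'n) module \<Rightarrow> ('m \<Rightarrow> 'n) \<Rightarrow> 'm set" where
  "mod_ker M N f = {x \<in> carrier M. f x = \<zero>\<^bsub>N\<^esub>}"

definition quotient_module :: "('a, 'm) module \<Rightarrow> 'm set \<Rightarrow> ('a, 'm set) module" where
  "quotient_module M N = \<lparr>carrier = a_rcosets\<^bsub>M\<^esub> N, monoid.mult = undefined, monoid.one = undefined,
     ring.zero = N, ring.add = set_add M, smult = (\<lambda>r K. \<Union>x\<in>K. N +>\<^bsub>M\<^esub> (r \<odot>\<^bsub>M\<^esub> x))\<rparr>"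

definition kernel_module ::
    "('a, 'm) module \<Rightarrow> ('a, 'n) module \<Rightarrow> ('m \<Rightarrow> 'n) \<Rightarrow> ('a, 'm) module" where
  "kernel_module M N f = M\<lparr>carrier := mod_ker M N f\<rparr>"

definition cokernel_module ::
    "('a, 'm) module \<Rightarrow> ('a, 'n) module \<Rightarrow> ('m \<Rightarrow> 'n) \<Rightarrow> ('a, 'n set) module" where
  "cokernel_module M N f = quotient_module N (f ` carrier M)"

definition regular_module :: "('a, 'r) ring_scheme \<Rightarrow> ('a, 'a) module" where
  "regular_module R = \<lparr>carrier = carrier R, monoid.mult = undefined, monoid.one = undefined,
     ring.zero = \<zero>\<^bsub>R\<^esub>, ring.add = ring.add R, smult = monoid.mult R\<rparr>"

text \<open>The members of \<open>Hom(N, M)\<close> are taken extensional, so that equal maps are equal functions.\<close>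

definition hom_module ::
    "('a, 'r) ring_scheme \<Rightarrow> ('a, 'n) module \<Rightarrow> ('a, 'm) module \<Rightarrow> ('a, 'n \<Rightarrow> 'm) module" where
  "hom_module R N M = \<lparr>carrier = mod_hom R N M \<inter> extensional (carrier N),
     monoid.mult = undefined, monoid.one = undefined,
     ring.zero = (\<lambda>x\<in>carrier N. \<zero>\<^bsub>M\<^esub>),
     ring.add = (\<lambda>f g. \<lambda>x\<in>carrier N. f x \<oplus>\<^bsub>M\<^esub> g x),
     smult = (\<lambda>r f. \<lambda>x\<in>carrier N. r \<odot>\<^bsub>M\<^esub> f x)\<rparr>"

definition fin_gen_module :: "('a, 'r) ring_scheme \<Rightarrow> ('a, 'm) module \<Rightarrow> bool" where
  "fin_gen_module R M \<longleftrightarrow> (\<exists>S. finite S \<and> S \<subseteq> carrier M \<and>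
     carrier M = {(\<Oplus>\<^bsub>M\<^esub>s\<in>S. c s \<odot>\<^bsub>M\<^esub> s) | c. c \<in> S \<rightarrow> carrier R})"


section \<open>Support\<close>

text \<open>Only the underlying set of the localization \<open>M\<^sub>P\<close> is needed: the fractions \<open>x/s\<close> with
  \<open>s \<notin> P\<close>, as equivalence classes of pairs.\<close>

definition fraction_rel ::
    "('a, 'r) ring_scheme \<Rightarrow> ('a, 'm) module \<Rightarrow> 'a set \<Rightarrow> (('m \<times> 'a) \<times> ('m \<times> 'a)) set" where
  "fraction_rel R M P = {((x, s), (y, t)).
     x \<in> carrier M \<and> y \<in> carrier M \<and> s \<in> carrier R - P \<and> t \<in> carrier R - P \<and>
     (\<exists>u\<in>carrier R - P. u \<odot>\<^bsub>M\<^esub> (t \<odot>\<^bsub>M\<^esub> x) = u \<odot>\<^bsub>M\<^esub> (s \<odot>\<^bsub>M\<^esub> y))}"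

definition localized_carrier ::
    "('a, 'r) ring_scheme \<Rightarrow> ('a, 'm) module \<Rightarrow> 'a set \<Rightarrow> ('m \<times> 'a) set set" where
  "localized_carrier R M P = (carrier M \<times> (carrier R - P)) // fraction_rel R M P"

definition Supp :: "('a, 'r) ring_scheme \<Rightarrow> ('a, 'm) module \<Rightarrow> 'a set set" where
  "Supp R M = {P. primeideal P R \<and>
     localized_carrier R M P \<noteq> {fraction_rel R M P `` {(\<zero>\<^bsub>M\<^esub>, \<one>\<^bsub>R\<^esub>)}}}"

definition V_ideal :: "('a, 'r) ring_scheme \<Rightarrow> 'a set \<Rightarrow> 'a set set" where
  "V_ideal R I = {P. primeideal P R \<and> I \<subseteq> P}"


section \<open>Injective resolutions and right derived functors\<close>

text \<open>
  HOL cannot quantify over types inside a formula, so the modules with carrier in a type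
  \<open>'e\<close> play the role of a universe. Injectivity of a module on \<open>'e\<close> is tested against the
  modules on \<open>'e\<close>. As soon as the ring type injects into \<open>'e\<close>, every ideal has a copy on
  \<open>'e\<close>, and by Baer's criterion this is injectivity with respect to modules on all types.
\<close>

definition injective_module :: "('a, 'r) ring_scheme \<Rightarrow> ('a, 'e) module \<Rightarrow> bool" where
  "injective_module R E \<longleftrightarrow> module R E \<and>
     (\<forall>(Y :: ('a, 'e) module) (Z :: ('a, 'e) module) j g.
        module R Y \<and> module R Z \<and> j \<in> mod_hom R Y Z \<and> inj_on j (carrier Y) \<and> g \<in> mod_hom R Y E
        \<longrightarrow> (\<exists>h \<in> mod_hom R Z E. \<forall>x\<in>carrier Y. h (j x) = g x))"

definition injective_resolution ::
    "('a, 'r) ring_scheme \<Rightarrow> ('a, 'm) module \<Rightarrow> ('m \<Rightarrow> 'e) \<Rightarrow>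
     (nat \<Rightarrow> ('a, 'e) module) \<Rightarrow> (nat \<Rightarrow> 'e \<Rightarrow> 'e) \<Rightarrow> bool" where
  "injective_resolution R M \<epsilon> E d \<longleftrightarrow>
     (\<forall>n. injective_module R (E n)) \<and>
     (\<forall>n. d n \<in> mod_hom R (E n) (E (Suc n))) \<and>
     \<epsilon> \<in> mod_hom R M (E 0) \<and> inj_on \<epsilon> (carrier M) \<and>
     \<epsilon> ` carrier M = mod_ker (E 0) (E 1) (d 0) \<and>
     (\<forall>n. d n ` carrier (E n) = mod_ker (E (Suc n)) (E (Suc (Suc n))) (d (Suc n)))"

text \<open>
  Over a noetherian ring on \<open>'a\<close>, every module on \<open>'m\<close> has an injective resolution on the
  type \<open>('a + 'm) list\<close>: a module of cardinality at most \<open>\<kappa> = max(|'a|, |'m|, \<aleph>\<^sub>0)\<close> embeds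
  into an injective module, and closing it up there under chosen solutions of the (finite)
  extension problems from Baer's criterion yields an injective module of cardinality at most
  \<open>\<kappa>\<close>, which is the cardinality of \<open>('a + 'm) list\<close>. Hence the choice below is effective in
  the noetherian case, and derived functors do not depend on it up to isomorphism.
\<close>

type_synonym ('a, 'm) res = "('a + 'm) list"

definition chosen_resolution ::
    "('a, 'r) ring_scheme \<Rightarrow> ('a, 'm) module \<Rightarrow>
     (nat \<Rightarrow> ('a, ('a, 'm) res) module) \<times> (nat \<Rightarrow> ('a, 'm) res \<Rightarrow> ('a, 'm) res)" where
  "chosen_resolution R M = (SOME (E, d). \<exists>\<epsilon>. injective_resolution R M \<epsilon> E d)"

definition cohomology_module ::
    "(nat \<Rightarrow> ('a, 'e) module) \<Rightarrow> (nat \<Rightarrow> 'e \<Rightarrow> 'e) \<Rightarrow> nat \<Rightarrow> ('a, 'e set) module" where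
  "cohomology_module C d i = quotient_module (kernel_module (C i) (C (Suc i)) (d i))
     (case i of 0 \<Rightarrow> {\<zero>\<^bsub>C 0\<^esub>} | Suc j \<Rightarrow> d j ` carrier (C j))"

text \<open>A functor is given by its action \<open>F\<close> on modules and \<open>Fm\<close> on linear maps.\<close>

definition right_derived ::
    "('a, 'r) ring_scheme \<Rightarrow> (('a, ('a, 'm) res) module \<Rightarrow> ('a, 'f) module) \<Rightarrow>
     ((('a, 'm) res \<Rightarrow> ('a, 'm) res) \<Rightarrow> 'f \<Rightarrow> 'f) \<Rightarrow> nat \<Rightarrow> ('a, 'm) module \<Rightarrow> ('a, 'f set) module" where
  "right_derived R F Fm i M = (case chosen_resolution R M of
     (E, d) \<Rightarrow> cohomology_module (\<lambda>n. F (E n)) (\<lambda>n. Fm (d n)) i)"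

definition Ext ::
    "('a, 'r) ring_scheme \<Rightarrow> nat \<Rightarrow> ('a, 'n) module \<Rightarrow> ('a, 'm) module \<Rightarrow>
     ('a, ('n \<Rightarrow> ('a, 'm) res) set) module" where
  "Ext R i N M = right_derived R (hom_module R N) (compose (carrier N)) i M"

definition ideal_power :: "('a, 'r) ring_scheme \<Rightarrow> 'a set \<Rightarrow> nat \<Rightarrow> 'a set" where
  "ideal_power R I n = ((\<lambda>J. I \<cdot>\<^bsub>R\<^esub> J) ^^ n) (carrier R)"

definition torsion_module ::
    "('a, 'r) ring_scheme \<Rightarrow> 'a set \<Rightarrow> ('a, 'm) module \<Rightarrow> ('a, 'm) module" where
  "torsion_module R I M =
     M\<lparr>carrier := {x \<in> carrier M. \<exists>n. \<forall>r\<in>ideal_power R I n. r \<odot>\<^bsub>M\<^esub> x = \<zero>\<^bsub>M\<^esub>}\<rparr>"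

text \<open>The \<open>I\<close>-torsion functor acts on maps by restriction, hence by the identity on the
  underlying HOL functions.\<close>

definition local_cohomology ::
    "('a, 'r) ring_scheme \<Rightarrow> 'a set \<Rightarrow> nat \<Rightarrow> ('a, 'm) module \<Rightarrow> ('a, ('a, 'm) res set) module" where
  "local_cohomology R I i M = right_derived R (torsion_module R I) (\<lambda>f. f) i M"


section \<open>Cofiniteness\<close>

definition M0_cof :: "('a, 'r) ring_scheme \<Rightarrow> 'a set \<Rightarrow> ('a, 'm) module set" where
  "M0_cof R I = {M. module R M \<and>
     (\<forall>i. fin_gen_module R (Ext R i (quotient_module (regular_module R) I) M))}"

definition cofinite_module :: "('a, 'r) ring_scheme \<Rightarrow> 'a set \<Rightarrow> ('a, 'm) module \<Rightarrow> bool" where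
  "cofinite_module R I N \<longleftrightarrow> N \<in> M0_cof R I \<and> Supp R N \<subseteq> V_ideal R I"

definition L_cof :: "('a, 'r) ring_scheme \<Rightarrow> 'a set \<Rightarrow> ('a, 'm) module set" where
  "L_cof R I = {M. module R M \<and> (\<forall>i. cofinite_module R I (local_cohomology R I i M))}"

text \<open>
  A full subcategory of the category of modules on \<open>'m\<close> is given by its class \<open>C\<close> of objects.
  Kernels and cokernels are only determined up to isomorphism (and the standard cokernel lives
  on \<open>'m set\<close>), so every module on \<open>'m\<close> isomorphic to one of them is required to be in \<open>C\<close>;
  each of them does have an isomorphic copy on \<open>'m\<close>.
\<close>

definition abelian_subcategory ::
    "('a, 'r) ring_scheme \<Rightarrow> ('a, 'm) module set \<Rightarrow> bool" where
  "abelian_subcategory R C \<longleftrightarrow>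
     (\<forall>M\<in>C. \<forall>N\<in>C. \<forall>f\<in>mod_hom R M N. \<forall>K.
        module R K \<and>
        (mod_isomorphic R K (kernel_module M N f) \<or> mod_isomorphic R K (cokernel_module M N f))
        \<longrightarrow> K \<in> C)"

end

theory Submission
  imports Defs "HOL-Library.Equipollence"
begin

text \<open>
  Let \<open>E\<close> be an injective resolution of \<open>M\<close>. The torsion part of an injective module is injective, by
  a weak Artin--Rees lemma, so the torsion part \<open>G\<close> of \<open>E\<close> is a complex of injective modules with
  cohomology \<open>H\<^sup>i(M)\<close>, the local cohomology of \<open>M\<close>, and with \<open>Hom(R/I, G) = Hom(R/I, E)\<close>. Dimension
  shifting along the cocycles and coboundaries of \<open>G\<close> transports finiteness from the modules
  \<open>Ext\<^sup>j(R/I, H\<^sup>i(M))\<close> to \<open>Ext\<^sup>i(R/I, M)\<close>.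

  Conversely, let \<open>x\<^sub>1, \<dots>, x\<^sub>k\<close> generate \<open>I\<close>. The torsion part of \<open>M\<close> is the kernel of the map from
  \<open>M\<close> to \<open>E = \<Oplus> M[1/x\<^sub>i]\<close>, and \<open>E\<close> lies in \<open>M\<^sup>0\<close> because the identity of \<open>E\<close> is a combination of
  endomorphisms with coefficients in \<open>I\<close>, which annihilates \<open>Ext\<^sup>i(R/I, E)\<close> and \<open>H\<^sup>i(E)\<close>. If \<open>M\<^sup>0\<close> is
  abelian, the torsion part of \<open>M\<close> and the cokernel \<open>C\<close> lie in it, and \<open>H\<^sup>i\<^sup>+\<^sup>1(M)\<close> is isomorphic to
  \<open>H\<^sup>i(C)\<close>, so one concludes by induction on \<open>i\<close>. The module \<open>E\<close> must live on the type of \<open>M\<close>. If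
  that type is infinite, \<open>E\<close> is no larger than the type; if it is finite, \<open>I\<close> contains an element
  that acts on \<open>M\<close> as a projection with kernel the torsion part, and its image replaces \<open>E\<close>.
\<close>

section \<open>Modules and linear maps\<close>

text \<open>Over a noetherian ring, finite generation passes through any sequence that is exact in
  the middle. So no long exact sequence is built: a short exact sequence is resolved by a direct sum
  of resolutions with a twisted differential, and connecting maps are read off from it.

  The vanishing for \<open>E\<close> has an elementary cause. The identity of \<open>E\<close> lifts
  to a chain map with coefficients in \<open>I\<close>. Such a map lowers the power of
  \<open>I\<close> that kills a cocycle, yet it is homotopic to the identity, so by iteration every
  torsion cocycle is a coboundary.

  The obstacle is the universe. Modules range over a fixed type, so each object of an argument has
  to be found on a prescribed type, which takes cardinality bounds. Baer's criterion, which speaks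
  of ideals only, is the notion of injectivity that is independent of types. Localizations are
  encoded by sequences because finite data then determine a class: an index and one value for each
  generator. Over a finite type the sum of the localizations can have more elements than the type,
  whence the case distinction.\<close>

context cring
begin

text \<open>Additive inverses come from the scalars: \<open>(\<ominus> \<one>) \<odot> x\<close> is
  one, because \<open>\<zero> \<odot> x\<close> is assumed to be zero. Structures given by explicit
  records can then be checked by rewriting.\<close>

lemma moduleI':
  assumes "\<And>x y. \<lbrakk>x \<in> carrier M; y \<in> carrier M\<rbrakk> \<Longrightarrow> x \<oplus>\<^bsub>M\<^esub> y \<in> carrier M"
    and "\<zero>\<^bsub>M\<^esub> \<in> carrier M"
    and "\<And>r x. \<lbrakk>r \<in> carrier R; x \<in> carrier M\<rbrakk> \<Longrightarrow> r \<odot>\<^bsub>M\<^esub> x \<in> carrier M"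
    and "\<And>x y z. \<lbrakk>x \<in> carrier M; y \<in> carrier M; z \<in> carrier M\<rbrakk> \<Longrightarrow>
      (x \<oplus>\<^bsub>M\<^esub> y) \<oplus>\<^bsub>M\<^esub> z = x \<oplus>\<^bsub>M\<^esub> (y \<oplus>\<^bsub>M\<^esub> z)"
    and "\<And>x y. \<lbrakk>x \<in> carrier M; y \<in> carrier M\<rbrakk> \<Longrightarrow> x \<oplus>\<^bsub>M\<^esub> y = y \<oplus>\<^bsub>M\<^esub> x"
    and "\<And>x. x \<in> carrier M \<Longrightarrow> \<zero>\<^bsub>M\<^esub> \<oplus>\<^bsub>M\<^esub> x = x"
    and "\<And>r s x. \<lbrakk>r \<in> carrier R; s \<in> carrier R; x \<in> carrier M\<rbrakk> \<Longrightarrow>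
      (r \<oplus> s) \<odot>\<^bsub>M\<^esub> x = r \<odot>\<^bsub>M\<^esub> x \<oplus>\<^bsub>M\<^esub> s \<odot>\<^bsub>M\<^esub> x"
    and "\<And>r x y. \<lbrakk>r \<in> carrier R; x \<in> carrier M; y \<in> carrier M\<rbrakk> \<Longrightarrow>
      r \<odot>\<^bsub>M\<^esub> (x \<oplus>\<^bsub>M\<^esub> y) = r \<odot>\<^bsub>M\<^esub> x \<oplus>\<^bsub>M\<^esub> r \<odot>\<^bsub>M\<^esub> y"
    and "\<And>r s x. \<lbrakk>r \<in> carrier R; s \<in> carrier R; x \<in> carrier M\<rbrakk> \<Longrightarrow>
      (r \<otimes> s) \<odot>\<^bsub>M\<^esub> x = r \<odot>\<^bsub>M\<^esub> (s \<odot>\<^bsub>M\<^esub> x)"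
    and "\<And>x. x \<in> carrier M \<Longrightarrow> \<one> \<odot>\<^bsub>M\<^esub> x = x"
    and "\<And>x. x \<in> carrier M \<Longrightarrow> \<zero> \<odot>\<^bsub>M\<^esub> x = \<zero>\<^bsub>M\<^esub>"
  shows "module R M"
proof (rule moduleI)
  show "abelian_group M"
  proof (rule abelian_groupI)
    fix x assume x: "x \<in> carrier M"
    have "(\<ominus> \<one>) \<odot>\<^bsub>M\<^esub> x \<oplus>\<^bsub>M\<^esub> x = (\<ominus> \<one> \<oplus> \<one>) \<odot>\<^bsub>M\<^esub> x"
      using assms(7)[of "\<ominus> \<one>" \<one> x] assms(10) x by simp
    also have "\<dots> = \<zero>\<^bsub>M\<^esub>"
      using assms(11) x by (simp add: l_neg)
    finally show "\<exists>y\<in>carrier M. y \<oplus>\<^bsub>M\<^esub> x = \<zero>\<^bsub>M\<^esub>"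
      using assms(3)[of "\<ominus> \<one>" x] x by auto
  qed (use assms in auto)
qed (use assms is_cring in auto)

section \<open>Calculation in a module, with negatives written as multiples by
  \<open>\<ominus> \<one>\<close>\<close>

context
  fixes M assumes M: "module R M"
begin

interpretation M: module R M by (rule M)

lemma madd_closed [simp]: "\<lbrakk>x \<in> carrier M; y \<in> carrier M\<rbrakk> \<Longrightarrow> x \<oplus>\<^bsub>M\<^esub> y \<in> carrier M"
  by simp
lemma mzero_closed [simp]: "\<zero>\<^bsub>M\<^esub> \<in> carrier M"
  by simp
lemma msmult_closed [simp]: "\<lbrakk>r \<in> carrier R; x \<in> carrier M\<rbrakk> \<Longrightarrow> r \<odot>\<^bsub>M\<^esub> x \<in> carrier M"
  by simp
lemma madd_assoc: "\<lbrakk>x \<in> carrier M; y \<in> carrier M; z \<in> carrier M\<rbrakk> \<Longrightarrow>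
    (x \<oplus>\<^bsub>M\<^esub> y) \<oplus>\<^bsub>M\<^esub> z = x \<oplus>\<^bsub>M\<^esub> (y \<oplus>\<^bsub>M\<^esub> z)"
  by (rule M.a_assoc)
lemma madd_comm: "\<lbrakk>x \<in> carrier M; y \<in> carrier M\<rbrakk> \<Longrightarrow> x \<oplus>\<^bsub>M\<^esub> y = y \<oplus>\<^bsub>M\<^esub> x"
  by (rule M.a_comm)
lemma madd_lcomm: "\<lbrakk>x \<in> carrier M; y \<in> carrier M; z \<in> carrier M\<rbrakk> \<Longrightarrow>
    x \<oplus>\<^bsub>M\<^esub> (y \<oplus>\<^bsub>M\<^esub> z) = y \<oplus>\<^bsub>M\<^esub> (x \<oplus>\<^bsub>M\<^esub> z)"
  by (rule M.a_lcomm)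
lemma madd_0_left [simp]: "x \<in> carrier M \<Longrightarrow> \<zero>\<^bsub>M\<^esub> \<oplus>\<^bsub>M\<^esub> x = x"
  by simp
lemma madd_0_right [simp]: "x \<in> carrier M \<Longrightarrow> x \<oplus>\<^bsub>M\<^esub> \<zero>\<^bsub>M\<^esub> = x"
  by simp
lemma msmult_add_right: "\<lbrakk>r \<in> carrier R; x \<in> carrier M; y \<in> carrier M\<rbrakk> \<Longrightarrow>
    r \<odot>\<^bsub>M\<^esub> (x \<oplus>\<^bsub>M\<^esub> y) = r \<odot>\<^bsub>M\<^esub> x \<oplus>\<^bsub>M\<^esub> r \<odot>\<^bsub>M\<^esub> y"
  by (rule M.smult_r_distr)
lemma msmult_add_left: "\<lbrakk>r \<in> carrier R; s \<in> carrier R; x \<in> carrier M\<rbrakk> \<Longrightarrow>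
    (r \<oplus> s) \<odot>\<^bsub>M\<^esub> x = r \<odot>\<^bsub>M\<^esub> x \<oplus>\<^bsub>M\<^esub> s \<odot>\<^bsub>M\<^esub> x"
  by (rule M.smult_l_distr)
lemma msmult_mult: "\<lbrakk>r \<in> carrier R; s \<in> carrier R; x \<in> carrier M\<rbrakk> \<Longrightarrow>
    (r \<otimes> s) \<odot>\<^bsub>M\<^esub> x = r \<odot>\<^bsub>M\<^esub> (s \<odot>\<^bsub>M\<^esub> x)"
  by (rule M.smult_assoc1)
lemma msmult_comm: "\<lbrakk>r \<in> carrier R; s \<in> carrier R; x \<in> carrier M\<rbrakk> \<Longrightarrow>
    r \<odot>\<^bsub>M\<^esub> (s \<odot>\<^bsub>M\<^esub> x) = s \<odot>\<^bsub>M\<^esub> (r \<odot>\<^bsub>M\<^esub> x)"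
  by (metis M.smult_assoc1 m_comm)
lemma msmult_one [simp]: "x \<in> carrier M \<Longrightarrow> \<one> \<odot>\<^bsub>M\<^esub> x = x"
  by simp
lemma msmult_zero_left [simp]: "x \<in> carrier M \<Longrightarrow> \<zero> \<odot>\<^bsub>M\<^esub> x = \<zero>\<^bsub>M\<^esub>"
  by simp
lemma msmult_zero_right [simp]: "r \<in> carrier R \<Longrightarrow> r \<odot>\<^bsub>M\<^esub> \<zero>\<^bsub>M\<^esub> = \<zero>\<^bsub>M\<^esub>"
  by simp
lemma madd_neg [simp]: "x \<in> carrier M \<Longrightarrow> x \<oplus>\<^bsub>M\<^esub> (\<ominus> \<one>) \<odot>\<^bsub>M\<^esub> x = \<zero>\<^bsub>M\<^esub>"
  by (simp add: M.smult_l_minus M.r_neg)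
lemma mneg_add [simp]: "x \<in> carrier M \<Longrightarrow> (\<ominus> \<one>) \<odot>\<^bsub>M\<^esub> x \<oplus>\<^bsub>M\<^esub> x = \<zero>\<^bsub>M\<^esub>"
  by (simp add: M.smult_l_minus M.l_neg)
lemma madd_neg_cancel [simp]: "\<lbrakk>x \<in> carrier M; y \<in> carrier M\<rbrakk> \<Longrightarrow>
    x \<oplus>\<^bsub>M\<^esub> ((\<ominus> \<one>) \<odot>\<^bsub>M\<^esub> x \<oplus>\<^bsub>M\<^esub> y) = y"
  by (simp add: M.a_assoc[symmetric])
lemma mneg_add_cancel [simp]: "\<lbrakk>x \<in> carrier M; y \<in> carrier M\<rbrakk> \<Longrightarrow>
    (\<ominus> \<one>) \<odot>\<^bsub>M\<^esub> x \<oplus>\<^bsub>M\<^esub> (x \<oplus>\<^bsub>M\<^esub> y) = y"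
  by (simp add: M.a_assoc[symmetric])
lemma madd_neg_cancel2: "\<lbrakk>x \<in> carrier M; y \<in> carrier M\<rbrakk> \<Longrightarrow>
    y \<oplus>\<^bsub>M\<^esub> (x \<oplus>\<^bsub>M\<^esub> (\<ominus> \<one>) \<odot>\<^bsub>M\<^esub> y) = x"
  by (simp add: M.a_lcomm[of y])
lemma mneg_neg [simp]: "x \<in> carrier M \<Longrightarrow> (\<ominus> \<one>) \<odot>\<^bsub>M\<^esub> ((\<ominus> \<one>) \<odot>\<^bsub>M\<^esub> x) = x"
  by (simp add: M.smult_assoc1[symmetric] l_minus r_minus)
lemma meq_iff_diff: "\<lbrakk>x \<in> carrier M; y \<in> carrier M\<rbrakk> \<Longrightarrow>
    x \<oplus>\<^bsub>M\<^esub> (\<ominus> \<one>) \<odot>\<^bsub>M\<^esub> y = \<zero>\<^bsub>M\<^esub> \<longleftrightarrow> x = y"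
  by (metis M.a_comm madd_neg_cancel2 madd_neg M.r_zero msmult_closed one_closed a_inv_closed)
lemma madd_eq_0_iff: "\<lbrakk>x \<in> carrier M; y \<in> carrier M\<rbrakk> \<Longrightarrow>
    x \<oplus>\<^bsub>M\<^esub> y = \<zero>\<^bsub>M\<^esub> \<longleftrightarrow> x = (\<ominus> \<one>) \<odot>\<^bsub>M\<^esub> y"
  by (metis M.a_comm mneg_add_cancel mneg_add M.r_zero msmult_closed one_closed a_inv_closed)

lemma submoduleI':
  assumes "N \<subseteq> carrier M" "\<zero>\<^bsub>M\<^esub> \<in> N" "\<And>x y. \<lbrakk>x \<in> N; y \<in> N\<rbrakk> \<Longrightarrow> x \<oplus>\<^bsub>M\<^esub> y \<in> N"
    "\<And>r x. \<lbrakk>r \<in> carrier R; x \<in> N\<rbrakk> \<Longrightarrow> r \<odot>\<^bsub>M\<^esub> x \<in> N"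
  shows "submodule N R M"
proof (rule M.submoduleI)
  fix x assume x: "x \<in> N"
  then show "\<ominus>\<^bsub>M\<^esub> x \<in> N"
    using assms(4)[of "\<ominus> \<one>" x] assms(1) by (auto simp: M.smult_l_minus)
qed (use assms in auto)

lemma submodule_carr: "submodule N R M \<Longrightarrow> N \<subseteq> carrier M"
  by (rule M.submoduleE)
lemma submodule_zero: "submodule N R M \<Longrightarrow> \<zero>\<^bsub>M\<^esub> \<in> N"
  by (metis M.submoduleE(1,2,4) ex_in_conv msmult_zero_left zero_closed subsetD)
lemma submodule_add: "\<lbrakk>submodule N R M; x \<in> N; y \<in> N\<rbrakk> \<Longrightarrow> x \<oplus>\<^bsub>M\<^esub> y \<in> N"
  by (rule M.submoduleE)
lemma submodule_smult: "\<lbrakk>submodule N R M; r \<in> carrier R; x \<in> N\<rbrakk> \<Longrightarrow> r \<odot>\<^bsub>M\<^esub> x \<in> N"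
  by (rule M.submoduleE)
lemma submodule_restrict: "submodule N R M \<Longrightarrow> module R (M\<lparr>carrier := N\<rparr>)"
  using submodule.submodule_is_module M by blast
lemma submodule_carrier: "submodule (carrier M) R M"
  by (rule M.carrier_is_submodule)
lemma submodule_triv: "submodule {\<zero>\<^bsub>M\<^esub>} R M"
  by (rule submoduleI') auto
lemma submodule_Int: "\<lbrakk>submodule N R M; submodule N' R M\<rbrakk> \<Longrightarrow> submodule (N \<inter> N') R M"
  by (rule submoduleI') (auto dest: submodule_carr submodule_zero submodule_add submodule_smult)
end

lemma submodule_in_restrict:
  assumes "module R M" "submodule N R M" "submodule B R M" "B \<subseteq> N"
  shows "submodule B R (M\<lparr>carrier := N\<rparr>)"
  using assms by (intro submoduleI' submodule_restrict)
    (auto intro: submodule_zero submodule_add submodule_smult subsetD[OF submodule_carr])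

section \<open>Linear maps, kernels and images\<close>

lemma mod_homI:
  assumes "\<And>x. x \<in> carrier M \<Longrightarrow> f x \<in> carrier N"
    and "\<And>x y. \<lbrakk>x \<in> carrier M; y \<in> carrier M\<rbrakk> \<Longrightarrow> f (x \<oplus>\<^bsub>M\<^esub> y) = f x \<oplus>\<^bsub>N\<^esub> f y"
    and "\<And>r x. \<lbrakk>r \<in> carrier R; x \<in> carrier M\<rbrakk> \<Longrightarrow> f (r \<odot>\<^bsub>M\<^esub> x) = r \<odot>\<^bsub>N\<^esub> f x"
  shows "f \<in> mod_hom R M N"
  using assms by (auto simp: mod_hom_def)

lemma hom_closed: "\<lbrakk>f \<in> mod_hom R M N; x \<in> carrier M\<rbrakk> \<Longrightarrow> f x \<in> carrier N"
  by (auto simp: mod_hom_def)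
lemma hom_add: "\<lbrakk>f \<in> mod_hom R M N; x \<in> carrier M; y \<in> carrier M\<rbrakk> \<Longrightarrow>
    f (x \<oplus>\<^bsub>M\<^esub> y) = f x \<oplus>\<^bsub>N\<^esub> f y"
  by (auto simp: mod_hom_def)
lemma hom_smult: "\<lbrakk>f \<in> mod_hom R M N; r \<in> carrier R; x \<in> carrier M\<rbrakk> \<Longrightarrow>
    f (r \<odot>\<^bsub>M\<^esub> x) = r \<odot>\<^bsub>N\<^esub> f x"
  by (auto simp: mod_hom_def)
lemma hom_zero:
  assumes "module R M" "module R N" "f \<in> mod_hom R M N"
  shows "f \<zero>\<^bsub>M\<^esub> = \<zero>\<^bsub>N\<^esub>"
  using hom_smult[OF assms(3) zero_closed, of "\<zero>\<^bsub>M\<^esub>"] assms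
  by (simp add: hom_closed[OF assms(3)])

lemma hom_comp: "\<lbrakk>f \<in> mod_hom R M N; g \<in> mod_hom R N K\<rbrakk> \<Longrightarrow> (\<lambda>x. g (f x)) \<in> mod_hom R M K"
  by (auto simp: mod_hom_def Pi_iff)
lemma hom_id: "(\<lambda>x. x) \<in> mod_hom R M M"
  by (auto simp: mod_hom_def)
lemma hom_const_zero: "module R N \<Longrightarrow> (\<lambda>x. \<zero>\<^bsub>N\<^esub>) \<in> mod_hom R M N"
  by (auto simp: mod_hom_def)
lemma hom_plus:
  assumes "module R M" "module R N" "f \<in> mod_hom R M N" "g \<in> mod_hom R M N"
  shows "(\<lambda>x. f x \<oplus>\<^bsub>N\<^esub> g x) \<in> mod_hom R M N"
  using assms by (intro mod_homI)
    (auto simp: hom_closed[of f M N] hom_closed[of g M N] hom_add[of f M N] hom_add[of g M N]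
      hom_smult[of f M N] hom_smult[of g M N] madd_assoc madd_lcomm msmult_add_right)
lemma hom_times:
  assumes "module R M" "module R N" "f \<in> mod_hom R M N" "r \<in> carrier R"
  shows "(\<lambda>x. r \<odot>\<^bsub>N\<^esub> f x) \<in> mod_hom R M N"
  using assms by (intro mod_homI)
    (auto simp: hom_closed[of f M N] hom_add[of f M N]
      hom_smult[of f M N] msmult_comm msmult_add_right)
lemma hom_cong: "\<lbrakk>module R M; f \<in> mod_hom R M N; \<And>x. x \<in> carrier M \<Longrightarrow> g x = f x\<rbrakk> \<Longrightarrow> g \<in> mod_hom R M N"
  by (auto simp: mod_hom_def Pi_iff)
lemma hom_restrict_dom: "\<lbrakk>f \<in> mod_hom R M N; S \<subseteq> carrier M\<rbrakk> \<Longrightarrow> f \<in> mod_hom R (M\<lparr>carrier := S\<rparr>) N"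
  by (rule mod_homI) (auto simp: hom_closed hom_add hom_smult subsetD)
lemma hom_restrict_cod: "\<lbrakk>f \<in> mod_hom R M N; \<And>x. x \<in> carrier M \<Longrightarrow> f x \<in> S\<rbrakk> \<Longrightarrow> f \<in> mod_hom R M (N\<lparr>carrier := S\<rparr>)"
  by (auto simp: mod_hom_def Pi_iff)
lemma hom_enlarge_cod: "\<lbrakk>f \<in> mod_hom R M (N\<lparr>carrier := S\<rparr>); S \<subseteq> carrier N\<rbrakk> \<Longrightarrow> f \<in> mod_hom R M N"
  by (auto simp: mod_hom_def Pi_iff)

lemma hom_inj_iff:
  assumes "module R M" "module R N" "f \<in> mod_hom R M N"
  shows "inj_on f (carrier M) \<longleftrightarrow> (\<forall>x\<in>carrier M. f x = \<zero>\<^bsub>N\<^esub> \<longrightarrow> x = \<zero>\<^bsub>M\<^esub>)"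
proof
  assume "inj_on f (carrier M)"
  then show "\<forall>x\<in>carrier M. f x = \<zero>\<^bsub>N\<^esub> \<longrightarrow> x = \<zero>\<^bsub>M\<^esub>"
    using assms hom_zero[OF assms] by (metis inj_onD mzero_closed)
next
  assume *: "\<forall>x\<in>carrier M. f x = \<zero>\<^bsub>N\<^esub> \<longrightarrow> x = \<zero>\<^bsub>M\<^esub>"
  show "inj_on f (carrier M)"
  proof (rule inj_onI)
    fix x y assume xy: "x \<in> carrier M" "y \<in> carrier M" "f x = f y"
    then have "f (x \<oplus>\<^bsub>M\<^esub> (\<ominus> \<one>) \<odot>\<^bsub>M\<^esub> y) = \<zero>\<^bsub>N\<^esub>"
      using assms by (simp add: hom_add[OF assms(3)] hom_smult[OF assms(3)] hom_closed[OF assms(3)])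
    then show "x = y"
      using * xy assms by (metis meq_iff_diff madd_closed msmult_closed one_closed a_inv_closed)
  qed
qed

lemma ker_submodule:
  assumes "module R M" "module R N" "f \<in> mod_hom R M N"
  shows "submodule (mod_ker M N f) R M"
  using assms by (intro submoduleI')
    (auto simp: mod_ker_def hom_zero hom_add[OF assms(3)] hom_smult[OF assms(3)])

lemma img_submodule:
  assumes "module R M" "module R N" "f \<in> mod_hom R M N" "submodule S R M"
  shows "submodule (f ` S) R N"
proof (rule submoduleI'[OF assms(2)])
  have S: "S \<subseteq> carrier M" by (rule submodule_carr[OF assms(1,4)])
  show "f ` S \<subseteq> carrier N" using S hom_closed[OF assms(3)] by auto
  show "\<zero>\<^bsub>N\<^esub> \<in> f ` S"
    using hom_zero[OF assms(1-3)] submodule_zero[OF assms(1,4)] by (metis imageI)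
  show "x \<oplus>\<^bsub>N\<^esub> y \<in> f ` S" if "x \<in> f ` S" "y \<in> f ` S" for x y
    using that S submodule_add[OF assms(1,4)] hom_add[OF assms(3), symmetric]
    by (auto simp: subset_iff)
  show "r \<odot>\<^bsub>N\<^esub> x \<in> f ` S" if "r \<in> carrier R" "x \<in> f ` S" for r x
    using that S submodule_smult[OF assms(1,4)] hom_smult[OF assms(3), symmetric]
    by (auto simp: subset_iff)
qed

section \<open>Isomorphisms and transport of structure\<close>

lemma mod_isomorphicI: "\<lbrakk>f \<in> mod_hom R M N; inj_on f (carrier M); f ` carrier M = carrier N\<rbrakk> \<Longrightarrow> mod_isomorphic R M N"
  by (auto simp: mod_isomorphic_def bij_betw_def)

lemma mod_isomorphic_refl: "mod_isomorphic R M M"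
  by (rule mod_isomorphicI[OF hom_id]) auto

lemma hom_inv:
  assumes "f \<in> mod_hom R M N" "module R M" "module R N" "inj_on f (carrier M)" "f ` carrier M = carrier N"
  shows "inv_into (carrier M) f \<in> mod_hom R N M"
proof (rule mod_homI)
  let ?g = "inv_into (carrier M) f"
  show cl: "?g x \<in> carrier M" if "x \<in> carrier N" for x
    using that assms(5) by (auto intro: inv_into_into)
  have fg: "f (?g x) = x" if "x \<in> carrier N" for x
    using that assms(5) by (simp add: f_inv_into_f)
  show "?g (x \<oplus>\<^bsub>N\<^esub> y) = ?g x \<oplus>\<^bsub>M\<^esub> ?g y" if "x \<in> carrier N" "y \<in> carrier N" for x y
    using that assms by (intro inv_into_f_eq) (auto simp: cl fg hom_add[OF assms(1)])
  show "?g (r \<odot>\<^bsub>N\<^esub> x) = r \<odot>\<^bsub>M\<^esub> ?g x" if "r \<in> carrier R" "x \<in> carrier N" for r x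
    using that assms by (intro inv_into_f_eq) (auto simp: cl fg hom_smult[OF assms(1)])
qed

lemma mod_isomorphic_sym:
  assumes "module R M" "module R N" "mod_isomorphic R M N"
  shows "mod_isomorphic R N M"
proof -
  obtain f where f: "f \<in> mod_hom R M N" "inj_on f (carrier M)" "f ` carrier M = carrier N"
    using assms(3) by (auto simp: mod_isomorphic_def bij_betw_def)
  then show ?thesis
    using hom_inv[OF f(1) assms(1,2) f(2,3)] inj_on_inv_into[of "carrier N" f "carrier M"]
      inv_into_image_cancel[OF f(2), of "carrier M"]
    by (intro mod_isomorphicI[of "inv_into (carrier M) f"]) auto
qed

lemma mod_isomorphic_trans: "\<lbrakk>mod_isomorphic R M N; mod_isomorphic R N K\<rbrakk> \<Longrightarrow> mod_isomorphic R M K"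
  unfolding mod_isomorphic_def using hom_comp bij_betw_trans[unfolded comp_def] by fast

text \<open>The structure is carried along \<open>\<iota>\<close> to the image. Constructions that
  leave the type of a module, such as quotients, submodules of products and localizations, are
  brought to a prescribed type this way as soon as a cardinality bound provides the
  injection.\<close>

lemma transport_module:
  fixes \<iota> :: "'m \<Rightarrow> 'e"
  assumes "module R (M :: ('a, 'm) module)" "inj_on \<iota> (carrier M)"
  shows "\<exists>M' :: ('a, 'e) module. module R M' \<and> \<iota> \<in> mod_hom R M M' \<and> \<iota> ` carrier M = carrier M'"
proof -
  define p where "p = inv_into (carrier M) \<iota>"
  have p: "p (\<iota> x) = x" if "x \<in> carrier M" for x
    using that assms(2) by (simp add: p_def)
  define M' :: "('a, 'e) module" where "M' = \<lparr>carrier = \<iota> ` carrier M, monoid.mult = undefined, monoid.one = undefined,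
     ring.zero = \<iota> \<zero>\<^bsub>M\<^esub>, ring.add = (\<lambda>x y. \<iota> (p x \<oplus>\<^bsub>M\<^esub> p y)), smult = (\<lambda>r x. \<iota> (r \<odot>\<^bsub>M\<^esub> p x))\<rparr>"
  have "module R M'"
    by (rule moduleI') (auto simp: M'_def p assms(1) madd_assoc msmult_add_left msmult_add_right msmult_mult
       intro!: arg_cong[of _ _ \<iota>] madd_comm)
  moreover have "\<iota> \<in> mod_hom R M M'"
    using assms(1) by (intro mod_homI) (auto simp: M'_def p)
  ultimately show ?thesis
    by (intro exI[of _ M']) (auto simp: M'_def)
qed

end

section \<open>Direct sums and the ring as a module over itself\<close>

definition direct_sum_module :: "('a, 'm) module \<Rightarrow> ('a, 'n) module \<Rightarrow> ('a, 'm \<times> 'n) module" where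
  "direct_sum_module M N = \<lparr>carrier = carrier M \<times> carrier N, monoid.mult = undefined, monoid.one = undefined,
     ring.zero = (\<zero>\<^bsub>M\<^esub>, \<zero>\<^bsub>N\<^esub>), ring.add = (\<lambda>(x, y) (x', y'). (x \<oplus>\<^bsub>M\<^esub> x', y \<oplus>\<^bsub>N\<^esub> y')),
     smult = (\<lambda>r (x, y). (r \<odot>\<^bsub>M\<^esub> x, r \<odot>\<^bsub>N\<^esub> y))\<rparr>"

lemma direct_sum_module_simps [simp]:
  "carrier (direct_sum_module M N) = carrier M \<times> carrier N"
  "\<zero>\<^bsub>direct_sum_module M N\<^esub> = (\<zero>\<^bsub>M\<^esub>, \<zero>\<^bsub>N\<^esub>)"
  "(x, y) \<oplus>\<^bsub>direct_sum_module M N\<^esub> (x', y') = (x \<oplus>\<^bsub>M\<^esub> x', y \<oplus>\<^bsub>N\<^esub> y')"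
  "r \<odot>\<^bsub>direct_sum_module M N\<^esub> (x, y) = (r \<odot>\<^bsub>M\<^esub> x, r \<odot>\<^bsub>N\<^esub> y)"
  by (simp_all add: direct_sum_module_def)

lemma regular_module_simps [simp]:
  "carrier (regular_module R) = carrier R" "\<zero>\<^bsub>regular_module R\<^esub> = \<zero>\<^bsub>R\<^esub>"
  "x \<oplus>\<^bsub>regular_module R\<^esub> y = x \<oplus>\<^bsub>R\<^esub> y" "x \<odot>\<^bsub>regular_module R\<^esub> y = x \<otimes>\<^bsub>R\<^esub> y"
  by (simp_all add: regular_module_def)

context cring
begin

lemma direct_sum_is_module [simp]:
  "\<lbrakk>module R M; module R N\<rbrakk> \<Longrightarrow> module R (direct_sum_module M N)"
  by (rule moduleI') (auto simp: madd_assoc madd_comm madd_lcomm msmult_add_left msmult_add_right msmult_mult)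

lemma regular_is_module [simp]: "module R (regular_module R)"
  by (rule moduleI') (auto simp: a_assoc a_comm a_lcomm l_distr r_distr m_assoc)

lemma submodule_regular_iff: "submodule J R (regular_module R) \<longleftrightarrow> ideal J R"
proof
  assume J: "submodule J R (regular_module R)"
  have s: "J \<subseteq> carrier R" using submodule_carr[OF regular_is_module J] by simp
  show "ideal J R"
  proof (rule idealI)
    show "subgroup J (add_monoid R)"
    proof (rule add.subgroupI)
      show "J \<subseteq> carrier R" by fact
      show "J \<noteq> {}" using submodule_zero[OF regular_is_module J] by auto
      show "\<ominus> a \<in> J" if "a \<in> J" for a
        using submodule_smult[OF regular_is_module J, of "\<ominus> \<one>" a] that s by (auto simp: l_minus)
      show "a \<oplus> b \<in> J" if "a \<in> J" "b \<in> J" for a b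
        using submodule_add[OF regular_is_module J that] by simp
    qed
    show "x \<otimes> a \<in> J" if "a \<in> J" "x \<in> carrier R" for a x
      using submodule_smult[OF regular_is_module J] that by auto
    show "a \<otimes> x \<in> J" if "a \<in> J" "x \<in> carrier R" for a x
      using submodule_smult[OF regular_is_module J that(2,1)] that s by (auto simp: m_comm)
  qed (rule ring_axioms)
next
  assume J: "ideal J R"
  then interpret J: ideal J R .
  show "submodule J R (regular_module R)"
    by (rule submoduleI') (auto simp: J.Icarr J.I_l_closed)
qed

lemma ideal_intro:
  assumes "J \<subseteq> carrier R" "\<zero> \<in> J" "\<And>x y. \<lbrakk>x \<in> J; y \<in> J\<rbrakk> \<Longrightarrow> x \<oplus> y \<in> J"
    "\<And>r x. \<lbrakk>r \<in> carrier R; x \<in> J\<rbrakk> \<Longrightarrow> r \<otimes> x \<in> J"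
  shows "ideal J R"
  unfolding submodule_regular_iff[symmetric] using assms by (intro submoduleI') auto

lemma ideal_module: "ideal J R \<Longrightarrow> module R ((regular_module R)\<lparr>carrier := J\<rparr>)"
  by (rule submodule_restrict) (auto simp: submodule_regular_iff)

lemma annihilator_ideal:
  assumes "module R M" "x \<in> carrier M"
  shows "ideal {r \<in> carrier R. r \<odot>\<^bsub>M\<^esub> x = \<zero>\<^bsub>M\<^esub>} R"
  using assms by (intro ideal_intro) (auto simp: msmult_add_left msmult_mult)

section \<open>Cosets and quotient modules\<close>

context
  fixes M :: "('a, 'm) module" and N assumes M: "module R M" and N: "submodule N R M"
begin

interpretation M: module R M by (rule M)
interpretation N: abelian_subgroup N M
  using N by (intro abelian_subgroupI3 M.abelian_group_axioms) (simp add: additive_subgroup_def submodule_def)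

lemma coset_eq_iff:
  assumes "x \<in> carrier M" "y \<in> carrier M"
  shows "N +>\<^bsub>M\<^esub> x = N +>\<^bsub>M\<^esub> y \<longleftrightarrow> x \<oplus>\<^bsub>M\<^esub> (\<ominus> \<one>) \<odot>\<^bsub>M\<^esub> y \<in> N"
proof
  assume "N +>\<^bsub>M\<^esub> x = N +>\<^bsub>M\<^esub> y"
  then have "x \<in> N +>\<^bsub>M\<^esub> y"
    using N.a_rcos_self[OF assms(1)] by simp
  then obtain n where n: "n \<in> N" "x = n \<oplus>\<^bsub>M\<^esub> y"
    by (auto simp: a_r_coset_def')
  then have "n \<in> carrier M"
    using N.a_subset by auto
  then show "x \<oplus>\<^bsub>M\<^esub> (\<ominus> \<one>) \<odot>\<^bsub>M\<^esub> y \<in> N"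
    using n assms M by (simp add: madd_assoc)
next
  assume "x \<oplus>\<^bsub>M\<^esub> (\<ominus> \<one>) \<odot>\<^bsub>M\<^esub> y \<in> N"
  moreover have "x = (x \<oplus>\<^bsub>M\<^esub> (\<ominus> \<one>) \<odot>\<^bsub>M\<^esub> y) \<oplus>\<^bsub>M\<^esub> y"
    using assms M by (simp add: madd_assoc)
  ultimately have "x \<in> N +>\<^bsub>M\<^esub> y"
    by (auto simp: a_r_coset_def')
  then show "N +>\<^bsub>M\<^esub> x = N +>\<^bsub>M\<^esub> y"
    using M.a_repr_independence[OF _ assms(2) N.a_subgroup] by simp
qed

lemma coset_self: "x \<in> carrier M \<Longrightarrow> x \<in> N +>\<^bsub>M\<^esub> x"
  by (rule N.a_rcos_self)

lemma coset_zero_iff: "x \<in> carrier M \<Longrightarrow> N +>\<^bsub>M\<^esub> x = N \<longleftrightarrow> x \<in> N"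
  using coset_eq_iff[of x "\<zero>\<^bsub>M\<^esub>"] M by (simp add: N.a_subset)

lemma quotient_zero [simp]: "\<zero>\<^bsub>quotient_module M N\<^esub> = N"
  by (simp add: quotient_module_def)

lemma quotient_carrier: "carrier (quotient_module M N) = (\<lambda>x. N +>\<^bsub>M\<^esub> x) ` carrier M"
  by (auto simp: quotient_module_def A_RCOSETS_def')

lemma quotient_add: "\<lbrakk>x \<in> carrier M; y \<in> carrier M\<rbrakk> \<Longrightarrow>
    (N +>\<^bsub>M\<^esub> x) \<oplus>\<^bsub>quotient_module M N\<^esub> (N +>\<^bsub>M\<^esub> y) = N +>\<^bsub>M\<^esub> (x \<oplus>\<^bsub>M\<^esub> y)"
  by (simp add: quotient_module_def N.a_rcos_sum)

text \<open>The union in the definition of the action is over a constant family: for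
  \<open>y\<close> in the coset of \<open>x\<close>, multiplying \<open>y - x\<close> by
  \<open>r\<close> gives an element of \<open>N\<close>.\<close>

lemma quotient_smult:
  assumes "r \<in> carrier R" "x \<in> carrier M"
  shows "r \<odot>\<^bsub>quotient_module M N\<^esub> (N +>\<^bsub>M\<^esub> x) = N +>\<^bsub>M\<^esub> (r \<odot>\<^bsub>M\<^esub> x)"
proof -
  have "N +>\<^bsub>M\<^esub> (r \<odot>\<^bsub>M\<^esub> y) = N +>\<^bsub>M\<^esub> (r \<odot>\<^bsub>M\<^esub> x)" if y: "y \<in> N +>\<^bsub>M\<^esub> x" for y
  proof -
    have yc: "y \<in> carrier M" and "N +>\<^bsub>M\<^esub> y = N +>\<^bsub>M\<^esub> x"
      using y assms M.a_repr_independence[OF y assms(2) N.a_subgroup] 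
      by (auto intro: N.a_elemrcos_carrier)
    then have "r \<odot>\<^bsub>M\<^esub> (y \<oplus>\<^bsub>M\<^esub> (\<ominus> \<one>) \<odot>\<^bsub>M\<^esub> x) \<in> N"
      using assms N by (simp add: coset_eq_iff submodule_smult[OF M])
    then show ?thesis
      using yc assms M by (simp add: coset_eq_iff msmult_add_right msmult_comm)
  qed
  then have "(\<Union>y\<in>N +>\<^bsub>M\<^esub> x. N +>\<^bsub>M\<^esub> (r \<odot>\<^bsub>M\<^esub> y)) = N +>\<^bsub>M\<^esub> (r \<odot>\<^bsub>M\<^esub> x)"
    using coset_self[OF assms(2)] by (intro SUP_eq_const) blast+
  then show ?thesis
    by (simp add: quotient_module_def)
qed

lemma quotient_is_module: "module R (quotient_module M N)"
proof -
  have z: "\<zero>\<^bsub>quotient_module M N\<^esub> = N +>\<^bsub>M\<^esub> \<zero>\<^bsub>M\<^esub>"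
    using M coset_zero_iff[of "\<zero>\<^bsub>M\<^esub>"] submodule_zero[OF M N] by simp
  show ?thesis
    by (rule moduleI')
      (use M in \<open>auto simp del: quotient_zero simp: z quotient_carrier quotient_add quotient_smult madd_assoc
        madd_comm madd_lcomm msmult_add_left msmult_add_right msmult_mult\<close>)
qed

lemma quotient_proj: "(\<lambda>x. N +>\<^bsub>M\<^esub> x) \<in> mod_hom R M (quotient_module M N)"
  by (rule mod_homI) (auto simp: quotient_carrier quotient_add quotient_smult)

end

end

section \<open>Finitely generated modules\<close>

text \<open>An intersection, so that an inclusion is shown by exhibiting one submodule. For finite
  sets it agrees with the linear combinations in \<open>fin_gen_module\<close>, which is the content
  of \<open>fin_gen_iff\<close>.\<close>

definition module_span :: "('a, 'r) ring_scheme \<Rightarrow> ('a, 'm) module \<Rightarrow> 'm set \<Rightarrow> 'm set" where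
  "module_span R M S = \<Inter>{N. submodule N R M \<and> S \<subseteq> N}"

context cring
begin

lemma span_submodule:
  assumes "module R M" "S \<subseteq> carrier M"
  shows "submodule (module_span R M S) R M"
  using assms submodule_carrier[OF assms(1)]
  by (intro submoduleI') (auto simp: module_span_def intro: submodule_zero submodule_add submodule_smult)

lemma span_incl: "S \<subseteq> module_span R M S"
  by (auto simp: module_span_def)

lemma span_minimal: "\<lbrakk>submodule N R M; S \<subseteq> N\<rbrakk> \<Longrightarrow> module_span R M S \<subseteq> N"
  by (auto simp: module_span_def)

lemma span_carr: "\<lbrakk>module R M; S \<subseteq> carrier M\<rbrakk> \<Longrightarrow> module_span R M S \<subseteq> carrier M"
  by (intro span_minimal submodule_carrier)

lemma submodule_finsum:
  assumes "module R M" "submodule N R M" "finite S" "\<And>s. s \<in> S \<Longrightarrow> f s \<in> N"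
  shows "(\<Oplus>\<^bsub>M\<^esub>s\<in>S. f s) \<in> N"
proof -
  interpret M: module R M by (rule assms(1))
  have "N \<subseteq> carrier M" by (rule submodule_carr[OF assms(1,2)])
  with assms(3,4) show ?thesis
    by (induction S rule: finite_induct)
      (auto simp: submodule_zero[OF assms(1,2)] M.finsum_insert Pi_iff subset_iff submodule_add[OF assms(1,2)])
qed

lemma combinations_submodule:
  assumes "module R M" "finite S" "S \<subseteq> carrier M"
  shows "submodule {(\<Oplus>\<^bsub>M\<^esub>s\<in>S. c s \<odot>\<^bsub>M\<^esub> s) | c. c \<in> S \<rightarrow> carrier R} R M"
proof (rule submoduleI'[OF assms(1)])
  interpret M: module R M by (rule assms(1))
  let ?L = "{(\<Oplus>\<^bsub>M\<^esub>s\<in>S. c s \<odot>\<^bsub>M\<^esub> s) | c. c \<in> S \<rightarrow> carrier R}"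
  have cl: "c \<in> S \<rightarrow> carrier R \<Longrightarrow> (\<lambda>s. c s \<odot>\<^bsub>M\<^esub> s) \<in> S \<rightarrow> carrier M" for c
    using assms(3) by auto
  show "?L \<subseteq> carrier M"
    by (auto intro!: M.finsum_closed cl)
  have "(\<Oplus>\<^bsub>M\<^esub>s\<in>S. \<zero> \<odot>\<^bsub>M\<^esub> s) = \<zero>\<^bsub>M\<^esub>"
    using assms(3) by (intro M.add.finprod_one_eqI) (auto simp: subset_iff)
  then show "\<zero>\<^bsub>M\<^esub> \<in> ?L"
    by (intro CollectI exI[of _ "\<lambda>_. \<zero>"]) auto
  show "x \<oplus>\<^bsub>M\<^esub> y \<in> ?L" if "x \<in> ?L" "y \<in> ?L" for x y
  proof -
    obtain c d where c: "c \<in> S \<rightarrow> carrier R" "x = (\<Oplus>\<^bsub>M\<^esub>s\<in>S. c s \<odot>\<^bsub>M\<^esub> s)"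
      and d: "d \<in> S \<rightarrow> carrier R" "y = (\<Oplus>\<^bsub>M\<^esub>s\<in>S. d s \<odot>\<^bsub>M\<^esub> s)"
      using \<open>x \<in> ?L\<close> \<open>y \<in> ?L\<close> by auto
    have "x \<oplus>\<^bsub>M\<^esub> y = (\<Oplus>\<^bsub>M\<^esub>s\<in>S. c s \<odot>\<^bsub>M\<^esub> s \<oplus>\<^bsub>M\<^esub> d s \<odot>\<^bsub>M\<^esub> s)"
      using c d by (simp add: M.finsum_addf[OF cl cl])
    also have "\<dots> = (\<Oplus>\<^bsub>M\<^esub>s\<in>S. (c s \<oplus> d s) \<odot>\<^bsub>M\<^esub> s)"
      using c(1) d(1) assms(3)
      by (intro M.finsum_cong') (auto simp: Pi_iff subset_iff M.smult_l_distr)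
    finally show ?thesis
      using c d by (intro CollectI exI[of _ "\<lambda>s. c s \<oplus> d s"]) auto
  qed
  show "r \<odot>\<^bsub>M\<^esub> x \<in> ?L" if r: "r \<in> carrier R" and "x \<in> ?L" for r x
  proof -
    obtain c where c: "c \<in> S \<rightarrow> carrier R" "x = (\<Oplus>\<^bsub>M\<^esub>s\<in>S. c s \<odot>\<^bsub>M\<^esub> s)"
      using \<open>x \<in> ?L\<close> by auto
    have "r \<odot>\<^bsub>M\<^esub> x = (\<Oplus>\<^bsub>M\<^esub>s\<in>S. r \<odot>\<^bsub>M\<^esub> (c s \<odot>\<^bsub>M\<^esub> s))"
      using c r assms(2) by (simp add: M.finsum_smult_ldistr cl)
    also have "\<dots> = (\<Oplus>\<^bsub>M\<^esub>s\<in>S. (r \<otimes> c s) \<odot>\<^bsub>M\<^esub> s)"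
      using c(1) r assms(3)
      by (intro M.finsum_cong') (auto simp: Pi_iff subset_iff M.smult_assoc1)
    finally show ?thesis
      using c r by (intro CollectI exI[of _ "\<lambda>s. r \<otimes> c s"]) auto
  qed
qed

lemma fin_gen_iff:
  assumes "module R M"
  shows "fin_gen_module R M \<longleftrightarrow>
    (\<exists>S. finite S \<and> S \<subseteq> carrier M \<and> module_span R M S = carrier M)"
proof -
  interpret M: module R M by (rule assms(1))
  have "{(\<Oplus>\<^bsub>M\<^esub>s\<in>S. c s \<odot>\<^bsub>M\<^esub> s) | c. c \<in> S \<rightarrow> carrier R} = module_span R M S" (is "?L = _")
    if S: "finite S" "S \<subseteq> carrier M" for S
  proof
    show "?L \<subseteq> module_span R M S"
      using span_submodule[OF assms S(2)] span_incl[of S M] S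
      by (auto intro!: submodule_finsum[OF assms] submodule_smult[OF assms])
    show "module_span R M S \<subseteq> ?L"
    proof (rule span_minimal[OF combinations_submodule[OF assms S]], rule subsetI)
      fix t assume t: "t \<in> S"
      have "(\<Oplus>\<^bsub>M\<^esub>s\<in>S. (if t = s then \<one> else \<zero>) \<odot>\<^bsub>M\<^esub> s) = (\<Oplus>\<^bsub>M\<^esub>s\<in>S. if t = s then s else \<zero>\<^bsub>M\<^esub>)"
        using S by (intro M.finsum_cong') auto
      also have "\<dots> = t"
        using t S by (intro M.finsum_singleton) auto
      finally show "t \<in> ?L"
        by (intro CollectI exI[of _ "\<lambda>s. if t = s then \<one> else \<zero>"]) auto
    qed
  qed
  then have "(finite S \<and> S \<subseteq> carrier M \<and> carrier M = {(\<Oplus>\<^bsub>M\<^esub>s\<in>S. c s \<odot>\<^bsub>M\<^esub> s) | c. c \<in> S \<rightarrow> carrier R}) \<longleftrightarrow>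
      (finite S \<and> S \<subseteq> carrier M \<and> module_span R M S = carrier M)" for S
    by (intro conj_cong refl) (simp add: eq_commute)
  then show ?thesis
    unfolding fin_gen_module_def by (rule ex_cong1)
qed

lemma preimage_submodule:
  assumes "module R L" "module R Y" "f \<in> mod_hom R L Y" "submodule N R Y"
  shows "submodule {x \<in> carrier L. f x \<in> N} R L"
  using assms by (intro submoduleI') (auto simp: hom_zero[OF assms(1-3)] hom_add[OF assms(3)]
     hom_smult[OF assms(3)] submodule_zero submodule_add submodule_smult)

lemma fin_gen_zero: 
  assumes "module R M"
  shows "fin_gen_module R (M\<lparr>carrier := {\<zero>\<^bsub>M\<^esub>}\<rparr>)"
proof -
  have m: "module R (M\<lparr>carrier := {\<zero>\<^bsub>M\<^esub>}\<rparr>)"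
    using submodule_restrict submodule_triv assms by blast
  have "module_span R (M\<lparr>carrier := {\<zero>\<^bsub>M\<^esub>}\<rparr>) {} = {\<zero>\<^bsub>M\<^esub>}"
    using submodule_zero[OF m span_submodule[OF m, of "{}"]] span_carr[OF m, of "{}"] by auto
  then show ?thesis
    unfolding fin_gen_iff[OF m] by (intro exI[of _ "{}"] conjI) simp_all
qed

end

section \<open>Finite generation over noetherian rings\<close>

locale noetherian_cring = cring R + noetherian_ring R for R (structure)

context noetherian_cring
begin

text \<open>Induction on the number of generators. The coefficients of the last generator
  \<open>s\<close> in elements of \<open>N\<close> form an ideal, and finitely many elements of
  \<open>N\<close> realize its generators. Subtracting combinations of them moves an element of
  \<open>N\<close> into the span of the remaining generators, where the induction hypothesis applies
  to the intersection with \<open>N\<close>.\<close>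

lemma submodule_of_span_finite:
  fixes M :: "('a, 'm) module"
  assumes "module R M" "finite S" "S \<subseteq> carrier M" "submodule N R M" "N \<subseteq> module_span R M S"
  shows "\<exists>T. finite T \<and> T \<subseteq> N \<and> N \<subseteq> module_span R M T"
  using assms(2-5)
proof (induction S arbitrary: N rule: finite_induct)
  case empty
  have "N \<subseteq> {\<zero>\<^bsub>M\<^esub>}"
    using empty span_minimal[OF submodule_triv[OF assms(1)], of "{}"] by auto
  then show ?case
    using submodule_zero[OF assms(1) span_submodule[OF assms(1), of "{}"]] by (intro exI[of _ "{}"]) auto
next
  case (insert s S)
  note M = assms(1)
  have s: "s \<in> carrier M" and S: "S \<subseteq> carrier M" using insert by auto
  let ?W = "module_span R M S"
  note W = span_submodule[OF M S] and Wc = span_carr[OF M S] and N = \<open>submodule N R M\<close>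
  have Nc: "N \<subseteq> carrier M" by (rule submodule_carr[OF M N])
  have sub: "submodule {w \<oplus>\<^bsub>M\<^esub> r \<odot>\<^bsub>M\<^esub> s | w r. w \<in> ?W \<and> r \<in> carrier R} R M" (is "submodule ?V R M")
  proof (rule submoduleI'[OF M])
    show "?V \<subseteq> carrier M" using Wc s M by auto
    show "\<zero>\<^bsub>M\<^esub> \<in> ?V"
      using submodule_zero[OF M W] M s by (intro CollectI exI[of _ "\<zero>\<^bsub>M\<^esub>"] exI[of _ "\<zero>"]) auto
  next
    fix x y assume "x \<in> ?V" "y \<in> ?V"
    then obtain w r w' r' where *: "w \<in> ?W" "r \<in> carrier R" "x = w \<oplus>\<^bsub>M\<^esub> r \<odot>\<^bsub>M\<^esub> s"
      "w' \<in> ?W" "r' \<in> carrier R" "y = w' \<oplus>\<^bsub>M\<^esub> r' \<odot>\<^bsub>M\<^esub> s" by auto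
    have "x \<oplus>\<^bsub>M\<^esub> y = (w \<oplus>\<^bsub>M\<^esub> w') \<oplus>\<^bsub>M\<^esub> (r \<oplus> r') \<odot>\<^bsub>M\<^esub> s"
      using * Wc s M by (simp add: subset_iff msmult_add_left madd_assoc madd_lcomm)
    then show "x \<oplus>\<^bsub>M\<^esub> y \<in> ?V"
      using * submodule_add[OF M W] by blast
  next
    fix k x assume "k \<in> carrier R" "x \<in> ?V"
    then obtain w r where *: "k \<in> carrier R" "w \<in> ?W" "r \<in> carrier R" "x = w \<oplus>\<^bsub>M\<^esub> r \<odot>\<^bsub>M\<^esub> s" by auto
    have "k \<odot>\<^bsub>M\<^esub> x = k \<odot>\<^bsub>M\<^esub> w \<oplus>\<^bsub>M\<^esub> (k \<otimes> r) \<odot>\<^bsub>M\<^esub> s"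
      using * Wc s M by (simp add: subset_iff msmult_add_right msmult_mult)
    then show "k \<odot>\<^bsub>M\<^esub> x \<in> ?V"
      using * submodule_smult[OF M W] by blast
  qed
  have span_ins: "module_span R M (insert s S) \<subseteq> ?V"
  proof (rule span_minimal[OF sub])
    have "s = \<zero>\<^bsub>M\<^esub> \<oplus>\<^bsub>M\<^esub> \<one> \<odot>\<^bsub>M\<^esub> s" using s M by simp
    then have "s \<in> ?V" using submodule_zero[OF M W] by blast
    moreover have "t \<in> ?V" if "t \<in> S" for t
    proof -
      have "t = t \<oplus>\<^bsub>M\<^esub> \<zero> \<odot>\<^bsub>M\<^esub> s" using s S that M by auto
      then show ?thesis using span_incl[of S M] that by blast
    qed
    ultimately show "insert s S \<subseteq> ?V" by auto
  qed
  define J where "J = {r \<in> carrier R. \<exists>w\<in>?W. w \<oplus>\<^bsub>M\<^esub> r \<odot>\<^bsub>M\<^esub> s \<in> N}"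
  have ideal_gen: "ideal {r \<in> carrier R. \<exists>w\<in>?W. w \<oplus>\<^bsub>M\<^esub> r \<odot>\<^bsub>M\<^esub> s \<in> N'} R" if N': "submodule N' R M" for N'
  proof (rule ideal_intro)
    show "\<zero> \<in> {r \<in> carrier R. \<exists>w\<in>?W. w \<oplus>\<^bsub>M\<^esub> r \<odot>\<^bsub>M\<^esub> s \<in> N'}"
      using submodule_zero[OF M W] submodule_zero[OF M N'] s M by (auto intro!: bexI[of _ "\<zero>\<^bsub>M\<^esub>"])
  next
    fix r r' assume "r \<in> {r \<in> carrier R. \<exists>w\<in>?W. w \<oplus>\<^bsub>M\<^esub> r \<odot>\<^bsub>M\<^esub> s \<in> N'}" "r' \<in> {r \<in> carrier R. \<exists>w\<in>?W. w \<oplus>\<^bsub>M\<^esub> r \<odot>\<^bsub>M\<^esub> s \<in> N'}"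
    then obtain w w' where *: "r \<in> carrier R" "r' \<in> carrier R" "w \<in> ?W" "w' \<in> ?W"
      "w \<oplus>\<^bsub>M\<^esub> r \<odot>\<^bsub>M\<^esub> s \<in> N'" "w' \<oplus>\<^bsub>M\<^esub> r' \<odot>\<^bsub>M\<^esub> s \<in> N'" by auto
    have "(w \<oplus>\<^bsub>M\<^esub> w') \<oplus>\<^bsub>M\<^esub> (r \<oplus> r') \<odot>\<^bsub>M\<^esub> s = (w \<oplus>\<^bsub>M\<^esub> r \<odot>\<^bsub>M\<^esub> s) \<oplus>\<^bsub>M\<^esub> (w' \<oplus>\<^bsub>M\<^esub> r' \<odot>\<^bsub>M\<^esub> s)"
      using * Wc s M by (simp add: subset_iff msmult_add_left madd_assoc madd_lcomm)
    then show "r \<oplus> r' \<in> {r \<in> carrier R. \<exists>w\<in>?W. w \<oplus>\<^bsub>M\<^esub> r \<odot>\<^bsub>M\<^esub> s \<in> N'}"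
      using * submodule_add[OF M W] submodule_add[OF M N'] by (auto intro!: bexI[of _ "w \<oplus>\<^bsub>M\<^esub> w'"])
  next
    fix k r assume "k \<in> carrier R" "r \<in> {r \<in> carrier R. \<exists>w\<in>?W. w \<oplus>\<^bsub>M\<^esub> r \<odot>\<^bsub>M\<^esub> s \<in> N'}"
    then obtain w where *: "k \<in> carrier R" "r \<in> carrier R" "w \<in> ?W" "w \<oplus>\<^bsub>M\<^esub> r \<odot>\<^bsub>M\<^esub> s \<in> N'" by auto
    have "k \<odot>\<^bsub>M\<^esub> w \<oplus>\<^bsub>M\<^esub> (k \<otimes> r) \<odot>\<^bsub>M\<^esub> s = k \<odot>\<^bsub>M\<^esub> (w \<oplus>\<^bsub>M\<^esub> r \<odot>\<^bsub>M\<^esub> s)"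
      using * Wc s M by (simp add: subset_iff msmult_add_right msmult_mult)
    then show "k \<otimes> r \<in> {r \<in> carrier R. \<exists>w\<in>?W. w \<oplus>\<^bsub>M\<^esub> r \<odot>\<^bsub>M\<^esub> s \<in> N'}"
      using * submodule_smult[OF M W] submodule_smult[OF M N'] by (auto intro!: bexI[of _ "k \<odot>\<^bsub>M\<^esub> w"])
  qed auto
  have "ideal J R"
    unfolding J_def by (rule ideal_gen[OF N])
  then obtain A where A: "A \<subseteq> carrier R" "finite A" "J = Idl A"
    using finetely_gen by blast
  have "\<forall>a\<in>A. \<exists>w\<in>?W. w \<oplus>\<^bsub>M\<^esub> a \<odot>\<^bsub>M\<^esub> s \<in> N"
    using genideal_self[OF A(1)] A(3) by (auto simp: J_def)
  then obtain w where "\<forall>a\<in>A. w a \<in> ?W \<and> w a \<oplus>\<^bsub>M\<^esub> a \<odot>\<^bsub>M\<^esub> s \<in> N"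
    unfolding Bex_def by (rule bchoice[THEN exE])
  then have w: "\<And>a. a \<in> A \<Longrightarrow> w a \<in> ?W" "\<And>a. a \<in> A \<Longrightarrow> w a \<oplus>\<^bsub>M\<^esub> a \<odot>\<^bsub>M\<^esub> s \<in> N"
    by auto
  have "submodule (N \<inter> ?W) R M"
    using submodule_Int[OF M N W] .
  then have "\<exists>T. finite T \<and> T \<subseteq> N \<inter> ?W \<and> N \<inter> ?W \<subseteq> module_span R M T"
    by (rule insert.IH[OF S]) simp
  then obtain T where T: "finite T" "T \<subseteq> N \<inter> ?W" "N \<inter> ?W \<subseteq> module_span R M T"
    by (elim exE conjE)
  \<comment> \<open>Generators of the part of \<open>N\<close> without \<open>s\<close>, together
    with one element of \<open>N\<close> for each generator of the ideal of coefficients.\<close>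
  define T' where "T' = T \<union> (\<lambda>a. w a \<oplus>\<^bsub>M\<^esub> a \<odot>\<^bsub>M\<^esub> s) ` A"
  have T'N: "T' \<subseteq> N" using T w by (auto simp: T'_def)
  then have T'c: "T' \<subseteq> carrier M" using Nc by auto
  let ?X = "module_span R M T'"
  note X = span_submodule[OF M T'c]
  have XN: "?X \<subseteq> N" by (rule span_minimal[OF N T'N])
  \<comment> \<open>The coefficients of \<open>s\<close> that occur in the span of \<open>T'\<close>
    form an ideal containing \<open>A\<close>, so all of \<open>J\<close> occurs.\<close>
  have "Idl A \<subseteq> {r \<in> carrier R. \<exists>w\<in>?W. w \<oplus>\<^bsub>M\<^esub> r \<odot>\<^bsub>M\<^esub> s \<in> ?X}"
    using A(1) w(1) span_incl[of T' M] unfolding T'_def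
    by (intro genideal_minimal ideal_gen[OF X, unfolded T'_def] subsetI CollectI conjI bexI[OF _ w(1)]) auto
  then have JX: "\<exists>w\<in>?W. w \<oplus>\<^bsub>M\<^esub> r \<odot>\<^bsub>M\<^esub> s \<in> ?X" if "r \<in> J" for r
    using that A(3) by auto
  have TX: "module_span R M T \<subseteq> ?X"
    using span_incl[of T' M] by (intro span_minimal[OF X]) (auto simp: T'_def)
  have "N \<subseteq> ?X"
  proof
    fix n assume n: "n \<in> N"
    then obtain v r where v: "v \<in> ?W" "r \<in> carrier R" "n = v \<oplus>\<^bsub>M\<^esub> r \<odot>\<^bsub>M\<^esub> s"
      using insert.prems span_ins by blast
    with n have "r \<in> J" by (auto simp: J_def)
    then obtain u where u: "u \<in> ?W" "u \<oplus>\<^bsub>M\<^esub> r \<odot>\<^bsub>M\<^esub> s \<in> ?X" using JX by blast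
    let ?m = "u \<oplus>\<^bsub>M\<^esub> r \<odot>\<^bsub>M\<^esub> s"
    have c: "u \<in> carrier M" "v \<in> carrier M" using u v Wc by auto
    have "v \<oplus>\<^bsub>M\<^esub> (\<ominus> \<one>) \<odot>\<^bsub>M\<^esub> u = n \<oplus>\<^bsub>M\<^esub> (\<ominus> \<one>) \<odot>\<^bsub>M\<^esub> ?m"
      using c v s M by (simp add: msmult_add_right madd_assoc madd_lcomm[of M "r \<odot>\<^bsub>M\<^esub> s" "(\<ominus> \<one>) \<odot>\<^bsub>M\<^esub> u"])
    moreover have "v \<oplus>\<^bsub>M\<^esub> (\<ominus> \<one>) \<odot>\<^bsub>M\<^esub> u \<in> ?W"
      using u v by (auto intro: submodule_add[OF M W] submodule_smult[OF M W])
    moreover have "n \<oplus>\<^bsub>M\<^esub> (\<ominus> \<one>) \<odot>\<^bsub>M\<^esub> ?m \<in> N"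
      using u n XN by (auto intro: submodule_add[OF M N] submodule_smult[OF M N])
    ultimately have "n \<oplus>\<^bsub>M\<^esub> (\<ominus> \<one>) \<odot>\<^bsub>M\<^esub> ?m \<in> ?X"
      using T(3) TX by auto
    then have "?m \<oplus>\<^bsub>M\<^esub> (n \<oplus>\<^bsub>M\<^esub> (\<ominus> \<one>) \<odot>\<^bsub>M\<^esub> ?m) \<in> ?X"
      using u by (auto intro: submodule_add[OF M X])
    then show "n \<in> ?X"
      using c v s M by (simp add: madd_neg_cancel2)
  qed
  then show ?case
    using T(1) A(2) T'N by (intro exI[of _ T']) (auto simp: T'_def)
qed

text \<open>The image of \<open>g\<close> is finitely generated because it lies in the finitely
  generated \<open>W\<close>; lifts of its generators and images of generators of \<open>L\<close>
  span \<open>Y\<close>. The results on submodules and on images that follow are the cases where an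
  outer term is zero.\<close>

lemma fin_gen_exact:
  assumes L: "module R L" and Y: "module R Y" and W: "module R W"
    and f: "f \<in> mod_hom R L Y" and g: "g \<in> mod_hom R Y W"
    and ex: "\<And>y. \<lbrakk>y \<in> carrier Y; g y = \<zero>\<^bsub>W\<^esub>\<rbrakk> \<Longrightarrow> y \<in> f ` carrier L"
    and fgX: "fin_gen_module R L" and fgW: "fin_gen_module R W"
  shows "fin_gen_module R Y"
proof -
  obtain S where S: "finite S" "S \<subseteq> carrier L" "module_span R L S = carrier L"
    using fgX fin_gen_iff[OF L] by auto
  obtain S' where S': "finite S'" "S' \<subseteq> carrier W" "module_span R W S' = carrier W"
    using fgW fin_gen_iff[OF W] by auto
  have gY: "submodule (g ` carrier Y) R W"
    by (rule img_submodule[OF Y W g submodule_carrier[OF Y]])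
  obtain T where T: "finite T" "T \<subseteq> g ` carrier Y" "g ` carrier Y \<subseteq> module_span R W T"
    using submodule_of_span_finite[OF W S'(1,2) gY] submodule_carr[OF W gY] S'(3) by auto
  then obtain U where U: "finite U" "U \<subseteq> carrier Y" "T = g ` U"
    by (metis finite_subset_image)
  let ?V = "f ` S \<union> U"
  have Vc: "?V \<subseteq> carrier Y" using S(2) U(2) hom_closed[OF f] by auto
  note V = span_submodule[OF Y Vc]
  have "module_span R L S \<subseteq> {x \<in> carrier L. f x \<in> module_span R Y ?V}"
    using S(2) span_incl[of ?V Y] by (intro span_minimal preimage_submodule[OF L Y f V]) auto
  then have fX: "f ` carrier L \<subseteq> module_span R Y ?V"
    using S(3) by auto
  have "module_span R W T \<subseteq> g ` module_span R Y ?V"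
    using U(3) span_incl[of ?V Y] by (intro span_minimal img_submodule[OF Y W g V]) auto
  then have gV: "g ` carrier Y \<subseteq> g ` module_span R Y ?V"
    using T(3) by auto
  have "carrier Y \<subseteq> module_span R Y ?V"
  proof
    fix y assume y: "y \<in> carrier Y"
    then obtain v where v: "v \<in> module_span R Y ?V" "g y = g v"
      using gV by auto
    then have vc: "v \<in> carrier Y" using submodule_carr[OF Y V] by auto
    have "g (y \<oplus>\<^bsub>Y\<^esub> (\<ominus> \<one>) \<odot>\<^bsub>Y\<^esub> v) = \<zero>\<^bsub>W\<^esub>"
      using y vc v Y W by (simp add: hom_add[OF g] hom_smult[OF g] hom_closed[OF g])
    then have "y \<oplus>\<^bsub>Y\<^esub> (\<ominus> \<one>) \<odot>\<^bsub>Y\<^esub> v \<in> module_span R Y ?V"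
      using ex y vc Y fX by auto
    then have "v \<oplus>\<^bsub>Y\<^esub> (y \<oplus>\<^bsub>Y\<^esub> (\<ominus> \<one>) \<odot>\<^bsub>Y\<^esub> v) \<in> module_span R Y ?V"
      using v by (auto intro: submodule_add[OF Y V])
    then show "y \<in> module_span R Y ?V"
      using y vc Y by (simp add: madd_neg_cancel2)
  qed
  then show ?thesis
    unfolding fin_gen_iff[OF Y] using S(1) U(1) Vc span_carr[OF Y Vc] by (intro exI[of _ ?V]) auto
qed

lemma fin_gen_inj:
  assumes "module R Y" "module R W" "g \<in> mod_hom R Y W" "inj_on g (carrier Y)" "fin_gen_module R W"
  shows "fin_gen_module R Y"
proof (rule fin_gen_exact[OF _ assms(1,2) _ assms(3) _ fin_gen_zero[OF assms(1)] assms(5)])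
  show "module R (Y\<lparr>carrier := {\<zero>\<^bsub>Y\<^esub>}\<rparr>)"
    using submodule_restrict[OF assms(1) submodule_triv[OF assms(1)]] .
  show "(\<lambda>x. x) \<in> mod_hom R (Y\<lparr>carrier := {\<zero>\<^bsub>Y\<^esub>}\<rparr>) Y"
    using assms(1) by (intro hom_restrict_dom hom_id) auto
qed (use hom_inj_iff[OF assms(1-3)] assms(4) in auto)

lemma fin_gen_surj:
  assumes "module R L" "module R Y" "f \<in> mod_hom R L Y" "carrier Y \<subseteq> f ` carrier L" "fin_gen_module R L"
  shows "fin_gen_module R Y"
proof (rule fin_gen_exact[OF assms(1,2) _ assms(3) _ _ assms(5) fin_gen_zero[OF assms(2)]])
  show "module R (Y\<lparr>carrier := {\<zero>\<^bsub>Y\<^esub>}\<rparr>)"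
    using submodule_restrict[OF assms(2) submodule_triv[OF assms(2)]] .
  show "(\<lambda>x. \<zero>\<^bsub>Y\<^esub>) \<in> mod_hom R Y (Y\<lparr>carrier := {\<zero>\<^bsub>Y\<^esub>}\<rparr>)"
    using hom_const_zero[OF assms(2), of Y] by (intro hom_restrict_cod) auto
qed (use assms in auto)

lemma fin_gen_iso:
  assumes "module R L" "module R Y" "mod_isomorphic R L Y"
  shows "fin_gen_module R L \<longleftrightarrow> fin_gen_module R Y"
  using assms fin_gen_surj[of L Y] fin_gen_inj[of L Y] 
  by (auto simp: mod_isomorphic_def bij_betw_def)

end

section \<open>Baer's criterion\<close>

text \<open>Injectivity in the form of Baer's criterion: a linear map on an ideal is multiplication
  by some element. It quantifies over ideals of the ring and so means the same for carriers on every
  type, while \<open>injective_module\<close> tests against modules on the type of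
  \<open>E\<close>.\<close>

definition baer_module :: "('a, 'r) ring_scheme \<Rightarrow> ('a, 'e) module \<Rightarrow> bool" where
  "baer_module R E \<longleftrightarrow> module R E \<and>
     (\<forall>J g. ideal J R \<and> g \<in> mod_hom R ((regular_module R)\<lparr>carrier := J\<rparr>) E \<longrightarrow>
       (\<exists>e\<in>carrier E. \<forall>r\<in>J. g r = r \<odot>\<^bsub>E\<^esub> e))"

context cring
begin

lemma baer_is_module: "baer_module R E \<Longrightarrow> module R E"
  by (simp add: baer_module_def)

text \<open>Zorn's lemma is applied to the graphs of the partial extensions, which are submodules
  of the direct sum.\<close>

theorem baer_extend:
  fixes L :: "('a, 'l) module" and Y :: "('a, 'y) module" and E :: "('a, 'e) module"
  assumes L: "module R L" and Y: "module R Y" and E: "baer_module R E"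
    and d: "d \<in> mod_hom R L Y" and g: "g \<in> mod_hom R L E"
    and ker: "\<And>x. \<lbrakk>x \<in> carrier L; d x = \<zero>\<^bsub>Y\<^esub>\<rbrakk> \<Longrightarrow> g x = \<zero>\<^bsub>E\<^esub>"
  shows "\<exists>h\<in>mod_hom R Y E. \<forall>x\<in>carrier L. h (d x) = g x"
proof -
  have Em: "module R E" using E by (rule baer_is_module)
  let ?P = "direct_sum_module Y E"
  have P: "module R ?P" using Y Em by simp
  \<comment> \<open>The condition on kernels says that the relation between \<open>d x\<close> and
    \<open>g x\<close> is single-valued, so extension works along any linear map \<open>d\<close>.
    Differentials of complexes are the intended case.\<close>
  define F0 where "F0 = (\<lambda>x. (d x, g x)) ` carrier L"
  have dg: "(\<lambda>x. (d x, g x)) \<in> mod_hom R L ?P"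
    by (rule mod_homI) (auto simp: hom_closed[OF d] hom_closed[OF g] hom_add[OF d] hom_add[OF g]
        hom_smult[OF d] hom_smult[OF g])
  have F0: "submodule F0 R ?P"
    unfolding F0_def by (rule img_submodule[OF L P dg submodule_carrier[OF L]])
  \<comment> \<open>For a submodule it suffices to be single-valued at zero, since differences of
    pairs stay in it.\<close>
  define G where "G = {F. F0 \<subseteq> F \<and> submodule F R ?P \<and> (\<forall>e. (\<zero>\<^bsub>Y\<^esub>, e) \<in> F \<longrightarrow> e = \<zero>\<^bsub>E\<^esub>)}"
  have F0G: "F0 \<in> G" using F0 ker by (auto simp: G_def F0_def)
  have "\<Union>C \<in> G" if C: "C \<noteq> {}" "subset.chain G C" for C
  proof -
    have CG: "\<And>F. F \<in> C \<Longrightarrow> F \<in> G" and lin: "\<And>F F'. \<lbrakk>F \<in> C; F' \<in> C\<rbrakk> \<Longrightarrow> F \<subseteq> F' \<or> F' \<subseteq> F"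
      using C(2) by (auto simp: subset.chain_def)
    have sm: "\<And>F. F \<in> C \<Longrightarrow> submodule F R ?P" using CG by (auto simp: G_def)
    obtain F1 where F1: "F1 \<in> C" using C(1) by auto
    have "submodule (\<Union>C) R ?P"
    proof (rule submoduleI'[OF P])
      show "\<Union>C \<subseteq> carrier ?P" using submodule_carr[OF P sm] by blast
      show "\<zero>\<^bsub>?P\<^esub> \<in> \<Union>C" using submodule_zero[OF P sm[OF F1]] F1 by blast
      show "x \<oplus>\<^bsub>?P\<^esub> y \<in> \<Union>C" if xy: "x \<in> \<Union>C" "y \<in> \<Union>C" for x y
      proof -
        obtain F F' where "F \<in> C" "F' \<in> C" "x \<in> F" "y \<in> F'" using xy by auto
        then obtain F'' where "F'' \<in> C" "x \<in> F''" "y \<in> F''" using lin by blast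
        then show ?thesis using submodule_add[OF P sm] by blast
      qed
      show "r \<odot>\<^bsub>?P\<^esub> x \<in> \<Union>C" if "r \<in> carrier R" "x \<in> \<Union>C" for r x
        using that submodule_smult[OF P sm] by blast
    qed
    then show ?thesis using CG F1 by (auto simp: G_def)
  qed
  then obtain F where FG: "F \<in> G" and max: "\<And>F'. \<lbrakk>F' \<in> G; F \<subseteq> F'\<rbrakk> \<Longrightarrow> F' = F"
    using subset_Zorn_nonempty[of G] F0G by blast
  have F: "submodule F R ?P" and F0F: "F0 \<subseteq> F" and sv0: "\<And>e. (\<zero>\<^bsub>Y\<^esub>, e) \<in> F \<Longrightarrow> e = \<zero>\<^bsub>E\<^esub>"
    using FG by (auto simp: G_def)
  have Fc: "y \<in> carrier Y" "e \<in> carrier E" if "(y, e) \<in> F" for y e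
    using submodule_carr[OF P F] that by auto
  have Fadd: "(y \<oplus>\<^bsub>Y\<^esub> y', e \<oplus>\<^bsub>E\<^esub> e') \<in> F" if "(y, e) \<in> F" "(y', e') \<in> F" for y e y' e'
    using submodule_add[OF P F that] by simp
  have Fsm: "(r \<odot>\<^bsub>Y\<^esub> y, r \<odot>\<^bsub>E\<^esub> e) \<in> F" if "r \<in> carrier R" "(y, e) \<in> F" for r y e
    using submodule_smult[OF P F that] by simp
  have F00: "(\<zero>\<^bsub>Y\<^esub>, \<zero>\<^bsub>E\<^esub>) \<in> F" using submodule_zero[OF P F] by simp
  have sv: "e = e'" if e: "(y, e) \<in> F" "(y, e') \<in> F" for y e e'
  proof -
    have "(y \<oplus>\<^bsub>Y\<^esub> (\<ominus> \<one>) \<odot>\<^bsub>Y\<^esub> y, e \<oplus>\<^bsub>E\<^esub> (\<ominus> \<one>) \<odot>\<^bsub>E\<^esub> e') \<in> F"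
      using e by (intro Fadd Fsm) auto
    then have "e \<oplus>\<^bsub>E\<^esub> (\<ominus> \<one>) \<odot>\<^bsub>E\<^esub> e' = \<zero>\<^bsub>E\<^esub>"
      using sv0 Fc[OF e(1)] Y by simp
    then show ?thesis using Fc[OF e(1)] Fc[OF e(2)] Em by (simp add: meq_iff_diff)
  qed
  have total: "\<exists>e. (y, e) \<in> F" if y: "y \<in> carrier Y" for y
  proof -
    \<comment> \<open>The scalars that bring \<open>y\<close> into the domain of the maximal partial
      map \<open>F\<close>. Composition with \<open>F\<close> gives a linear map on this ideal, and
      the criterion represents it by an element \<open>e0\<close>.\<close>
    define J where "J = {r \<in> carrier R. \<exists>e. (r \<odot>\<^bsub>Y\<^esub> y, e) \<in> F}"
    have J: "ideal J R"
    proof (rule ideal_intro)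
      show "\<zero> \<in> J" using F00 y Y by (auto simp: J_def)
      show "r \<oplus> s \<in> J" if "r \<in> J" "s \<in> J" for r s
        using that Fadd y Y by (fastforce simp: J_def msmult_add_left)
      show "k \<otimes> s \<in> J" if "k \<in> carrier R" "s \<in> J" for k s
        using that Fsm y Y by (fastforce simp: J_def msmult_mult)
    qed (auto simp: J_def)
    define u where "u r = (SOME e. (r \<odot>\<^bsub>Y\<^esub> y, e) \<in> F)" for r
    have u: "(r \<odot>\<^bsub>Y\<^esub> y, u r) \<in> F" if "r \<in> J" for r
      using that unfolding u_def J_def by (auto intro: someI_ex)
    have u_eq: "u r = e" if "(r \<odot>\<^bsub>Y\<^esub> y, e) \<in> F" for r e
      using that sv u unfolding u_def by (blast intro: some_equality)
    have Jc: "r \<in> carrier R" if "r \<in> J" for r using that by (simp add: J_def)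
    have "u \<in> mod_hom R ((regular_module R)\<lparr>carrier := J\<rparr>) E"
    proof (rule mod_homI)
      show "u r \<in> carrier E" if "r \<in> carrier ((regular_module R)\<lparr>carrier := J\<rparr>)" for r
        using that Fc u by simp blast
      show "u (r \<oplus>\<^bsub>(regular_module R)\<lparr>carrier := J\<rparr>\<^esub> s) = u r \<oplus>\<^bsub>E\<^esub> u s"
        if "r \<in> carrier ((regular_module R)\<lparr>carrier := J\<rparr>)" "s \<in> carrier ((regular_module R)\<lparr>carrier := J\<rparr>)" for r s
        using that Fadd[OF u[of r] u[of s]] y Y Jc by (intro u_eq) (auto simp: msmult_add_left)
      show "u (k \<odot>\<^bsub>(regular_module R)\<lparr>carrier := J\<rparr>\<^esub> s) = k \<odot>\<^bsub>E\<^esub> u s"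
        if "k \<in> carrier R" "s \<in> carrier ((regular_module R)\<lparr>carrier := J\<rparr>)" for k s
        using that Fsm[OF that(1) u[of s]] y Y Jc by (intro u_eq) (auto simp: msmult_mult)
    qed
    then obtain e0 where e0: "e0 \<in> carrier E" "\<And>r. r \<in> J \<Longrightarrow> u r = r \<odot>\<^bsub>E\<^esub> e0"
      using E J unfolding baer_module_def by blast
    \<comment> \<open>Extends \<open>F\<close> by sending \<open>y\<close> to \<open>e0\<close>. The
      relation stays single-valued because \<open>F\<close> already sends \<open>r \<odot> y\<close>
      to \<open>r \<odot> e0\<close> for \<open>r\<close> in \<open>J\<close>.\<close>
    define F' where "F' = {(v \<oplus>\<^bsub>Y\<^esub> r \<odot>\<^bsub>Y\<^esub> y, w \<oplus>\<^bsub>E\<^esub> r \<odot>\<^bsub>E\<^esub> e0) | v w r. (v, w) \<in> F \<and> r \<in> carrier R}"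
    have FF': "F \<subseteq> F'"
    proof
      fix p assume p: "p \<in> F"
      then obtain v w where vw: "p = (v, w)" "(v, w) \<in> F" by (cases p) auto
      then have "p = (v \<oplus>\<^bsub>Y\<^esub> \<zero> \<odot>\<^bsub>Y\<^esub> y, w \<oplus>\<^bsub>E\<^esub> \<zero> \<odot>\<^bsub>E\<^esub> e0)"
        using Fc[OF vw(2)] y e0 Y Em by simp
      then show "p \<in> F'" using vw unfolding F'_def by blast
    qed
    have "submodule F' R ?P"
    proof (rule submoduleI'[OF P])
      show "F' \<subseteq> carrier ?P" using Fc y e0 Y Em by (auto simp: F'_def)
      show "\<zero>\<^bsub>?P\<^esub> \<in> F'" using FF' F00 by auto
    next
      fix p q assume "p \<in> F'" "q \<in> F'"
      then obtain v w r v' w' r' where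
        p: "(v, w) \<in> F" "r \<in> carrier R" "p = (v \<oplus>\<^bsub>Y\<^esub> r \<odot>\<^bsub>Y\<^esub> y, w \<oplus>\<^bsub>E\<^esub> r \<odot>\<^bsub>E\<^esub> e0)" and
        q: "(v', w') \<in> F" "r' \<in> carrier R" "q = (v' \<oplus>\<^bsub>Y\<^esub> r' \<odot>\<^bsub>Y\<^esub> y, w' \<oplus>\<^bsub>E\<^esub> r' \<odot>\<^bsub>E\<^esub> e0)"
        unfolding F'_def by blast
      have "p \<oplus>\<^bsub>?P\<^esub> q = ((v \<oplus>\<^bsub>Y\<^esub> v') \<oplus>\<^bsub>Y\<^esub> (r \<oplus> r') \<odot>\<^bsub>Y\<^esub> y, (w \<oplus>\<^bsub>E\<^esub> w') \<oplus>\<^bsub>E\<^esub> (r \<oplus> r') \<odot>\<^bsub>E\<^esub> e0)"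
        using p q Fc[OF p(1)] Fc[OF q(1)] y e0 Y Em by (simp add: msmult_add_left madd_assoc madd_lcomm)
      then show "p \<oplus>\<^bsub>?P\<^esub> q \<in> F'" using Fadd[OF p(1) q(1)] p(2) q(2) unfolding F'_def by blast
    next
      fix k p assume k: "k \<in> carrier R" and "p \<in> F'"
      then obtain v w r where
        p: "(v, w) \<in> F" "r \<in> carrier R" "p = (v \<oplus>\<^bsub>Y\<^esub> r \<odot>\<^bsub>Y\<^esub> y, w \<oplus>\<^bsub>E\<^esub> r \<odot>\<^bsub>E\<^esub> e0)"
        unfolding F'_def by blast
      have "k \<odot>\<^bsub>?P\<^esub> p = (k \<odot>\<^bsub>Y\<^esub> v \<oplus>\<^bsub>Y\<^esub> (k \<otimes> r) \<odot>\<^bsub>Y\<^esub> y, k \<odot>\<^bsub>E\<^esub> w \<oplus>\<^bsub>E\<^esub> (k \<otimes> r) \<odot>\<^bsub>E\<^esub> e0)"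
        using p k Fc[OF p(1)] y e0 Y Em by (simp add: msmult_add_right msmult_mult)
      then show "k \<odot>\<^bsub>?P\<^esub> p \<in> F'" using Fsm[OF k p(1)] p(2) k unfolding F'_def by blast
    qed
    moreover have "e = \<zero>\<^bsub>E\<^esub>" if eF: "(\<zero>\<^bsub>Y\<^esub>, e) \<in> F'" for e
    proof -
      obtain v w r where p: "(v, w) \<in> F" "r \<in> carrier R" "\<zero>\<^bsub>Y\<^esub> = v \<oplus>\<^bsub>Y\<^esub> r \<odot>\<^bsub>Y\<^esub> y" "e = w \<oplus>\<^bsub>E\<^esub> r \<odot>\<^bsub>E\<^esub> e0"
        using eF unfolding F'_def by (elim CollectE exE conjE) simp
      have "r \<odot>\<^bsub>Y\<^esub> y = (\<ominus> \<one>) \<odot>\<^bsub>Y\<^esub> v"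
        using p Fc[OF p(1)] y Y by (metis madd_eq_0_iff madd_comm msmult_closed)
      then have "(r \<odot>\<^bsub>Y\<^esub> y, (\<ominus> \<one>) \<odot>\<^bsub>E\<^esub> w) \<in> F"
        using Fsm[OF _ p(1), of "\<ominus> \<one>"] by simp
      then have "r \<in> J" "u r = (\<ominus> \<one>) \<odot>\<^bsub>E\<^esub> w"
        using p(2) u_eq by (auto simp: J_def)
      then show ?thesis
        using e0 p(4) Fc[OF p(1)] Em by (metis madd_neg)
    qed
    ultimately have "F' \<in> G" using FF' F0F by (auto simp: G_def)
    then have "F' = F" using max FF' by blast
    moreover have "(y, e0) \<in> F'"
    proof -
      have "(y, e0) = (\<zero>\<^bsub>Y\<^esub> \<oplus>\<^bsub>Y\<^esub> \<one> \<odot>\<^bsub>Y\<^esub> y, \<zero>\<^bsub>E\<^esub> \<oplus>\<^bsub>E\<^esub> \<one> \<odot>\<^bsub>E\<^esub> e0)"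
        using y e0 Y Em by simp
      then show ?thesis using F00 unfolding F'_def by blast
    qed
    ultimately show ?thesis by blast
  qed
  define h where "h y = (THE e. (y, e) \<in> F)" for y
  have h_eq: "h y = e" if "(y, e) \<in> F" for y e
    unfolding h_def using sv that by blast
  have h: "(y, h y) \<in> F" if "y \<in> carrier Y" for y
    using total[OF that] h_eq by auto
  have "h \<in> mod_hom R Y E"
    using h Fc(2) by (intro mod_homI) (auto intro!: h_eq Fadd Fsm)
  moreover have "h (d x) = g x" if "x \<in> carrier L" for x
    using that F0F by (intro h_eq) (auto simp: F0_def)
  ultimately show ?thesis by blast
qed

lemma ideal_carr: "ideal J R \<Longrightarrow> J \<subseteq> carrier R"
  by (auto dest: ideal.Icarr)

lemma baer_imp_injective:
  fixes E :: "('a, 'e) module"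
  assumes "baer_module R E"
  shows "injective_module R E"
  unfolding injective_module_def
proof (intro conjI allI impI)
  show "module R E" using assms by (rule baer_is_module)
next
  fix Y Z :: "('a, 'e) module" and j g
  assume *: "module R Y \<and> module R Z \<and> j \<in> mod_hom R Y Z \<and> inj_on j (carrier Y) \<and> g \<in> mod_hom R Y E"
  have "g x = \<zero>\<^bsub>E\<^esub>" if "x \<in> carrier Y" "j x = \<zero>\<^bsub>Z\<^esub>" for x
    using * that hom_inj_iff[of Y Z j] hom_zero[of Y E g] baer_is_module[OF assms] by auto
  then show "\<exists>h\<in>mod_hom R Z E. \<forall>x\<in>carrier Y. h (j x) = g x"
    using * assms by (intro baer_extend) auto
qed

text \<open>The definition is tested on copies of \<open>J\<close> and of the ring on the type
  \<open>'e\<close>, which exist because \<open>i\<close> embeds the ring type. The value of the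
  extension at the copy of \<open>\<one>\<close> is the required element.\<close>

lemma injective_imp_baer:
  fixes E :: "('a, 'e) module" and i :: "'a \<Rightarrow> 'e"
  assumes "injective_module R E" "inj i"
  shows "baer_module R E"
  unfolding baer_module_def
proof (intro conjI allI impI)
  show E: "module R E" using assms by (simp add: injective_module_def)
  fix J g assume *: "ideal J R \<and> g \<in> mod_hom R ((regular_module R)\<lparr>carrier := J\<rparr>) E"
  let ?J = "(regular_module R)\<lparr>carrier := J\<rparr>"
  have J: "module R ?J" using * ideal_module by blast
  have Jc: "J \<subseteq> carrier R" using *[THEN conjunct1] by (rule ideal_carr)
  obtain J' :: "('a, 'e) module" where J': "module R J'" "i \<in> mod_hom R ?J J'" "i ` J = carrier J'"
    using transport_module[OF J, of i] assms(2) by (auto simp: inj_on_def)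
  obtain R' :: "('a, 'e) module" where R': "module R R'" "i \<in> mod_hom R (regular_module R) R'" "i ` carrier R = carrier R'"
    using transport_module[OF regular_is_module, of i] assms(2) by (auto simp: inj_on_def)
  let ?p = "inv_into J i"
  have p: "?p \<in> mod_hom R J' ?J"
    using hom_inv[OF J'(2) J J'(1)] J'(3) assms(2) by (auto simp: inj_on_def)
  have pi: "?p (i x) = x" if "x \<in> J" for x
    using that assms(2) by (intro inv_into_f_f) (auto simp: inj_on_def)
  have "i \<in> mod_hom R ?J R'" using hom_restrict_dom[OF R'(2)] Jc by simp
  then have ip: "(\<lambda>x. i (?p x)) \<in> mod_hom R J' R'"
    by (rule hom_comp[OF p])
  have inj: "inj_on (\<lambda>x. i (?p x)) (carrier J')"
    unfolding J'(3)[symmetric] using pi by (auto intro!: inj_onI)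
  have gp: "(\<lambda>x. g (?p x)) \<in> mod_hom R J' E" by (rule hom_comp[OF p]) (use * in auto)
  have "\<exists>h\<in>mod_hom R R' E. \<forall>x\<in>carrier J'. h (i (?p x)) = g (?p x)"
    using J'(1) R'(1) ip inj gp
    by (intro assms(1)[unfolded injective_module_def, THEN conjunct2, rule_format]) simp
  then obtain h where h: "h \<in> mod_hom R R' E" "\<And>x. x \<in> carrier J' \<Longrightarrow> h (i (?p x)) = g (?p x)"
    by auto
  show "\<exists>e\<in>carrier E. \<forall>r\<in>J. g r = r \<odot>\<^bsub>E\<^esub> e"
  proof (intro bexI ballI)
    show "h (i \<one>) \<in> carrier E" using R' by (intro hom_closed[OF h(1)]) auto
    fix r assume r: "r \<in> J"
    then have rc: "r \<in> carrier R" using Jc by auto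
    have "g r = h (i r)" using h(2)[of "i r"] J'(3)[symmetric] pi r by auto
    also have "i r = r \<odot>\<^bsub>R'\<^esub> i \<one>" using hom_smult[OF R'(2) rc, of \<one>] rc by simp
    also have "h \<dots> = r \<odot>\<^bsub>E\<^esub> h (i \<one>)" using rc R' by (intro hom_smult[OF h(1)]) auto
    finally show "g r = r \<odot>\<^bsub>E\<^esub> h (i \<one>)" .
  qed
qed

lemma baer_transport:
  assumes "baer_module R E" "module R E'" "f \<in> mod_hom R E E'" "inj_on f (carrier E)" "f ` carrier E = carrier E'"
  shows "baer_module R E'"
  unfolding baer_module_def
proof (intro conjI allI impI)
  let ?p = "inv_into (carrier E) f"
  note E = baer_is_module[OF assms(1)]
  have p: "?p \<in> mod_hom R E' E" by (rule hom_inv[OF assms(3) E assms(2,4,5)])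
  fix J g assume *: "ideal J R \<and> g \<in> mod_hom R ((regular_module R)\<lparr>carrier := J\<rparr>) E'"
  then have Jc: "J \<subseteq> carrier R" by (intro ideal_carr) (rule conjunct1)
  have "(\<lambda>x. ?p (g x)) \<in> mod_hom R ((regular_module R)\<lparr>carrier := J\<rparr>) E"
    using * hom_comp[OF _ p] by blast
  then obtain e where e: "e \<in> carrier E" "\<And>r. r \<in> J \<Longrightarrow> ?p (g r) = r \<odot>\<^bsub>E\<^esub> e"
    using assms(1) * unfolding baer_module_def by blast
  have "g r = r \<odot>\<^bsub>E'\<^esub> f e" if r: "r \<in> J" for r
  proof -
    have "g r \<in> carrier E'" using * hom_closed[of g _ E' r] r by auto
    then have "g r = f (?p (g r))" using assms(5) by (simp add: f_inv_into_f)
    then show ?thesis using e r Jc hom_smult[OF assms(3)] by auto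
  qed
  then show "\<exists>e\<in>carrier E'. \<forall>r\<in>J. g r = r \<odot>\<^bsub>E'\<^esub> e"
    using hom_closed[OF assms(3) e(1)] by blast
qed (rule assms(2))

end

section \<open>Embedding into injective modules\<close>

text \<open>The underlying abelian group as a module over the integers, so that what holds over a
  general commutative ring, \<open>baer_extend\<close> above all, applies over
  \<open>int_ring\<close> as well.\<close>

definition int_module :: "('a, 'm) module \<Rightarrow> (int, 'm) module" where
  "int_module M = \<lparr>carrier = carrier M, monoid.mult = undefined, monoid.one = undefined,
     ring.zero = \<zero>\<^bsub>M\<^esub>, ring.add = ring.add M, smult = (\<lambda>k x. [k] \<cdot>\<^bsub>M\<^esub> x)\<rparr>"

text \<open>The multiplicative group of the complex numbers, a divisible abelian group with elements of
  every finite order.\<close>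

definition complex_units :: "(int, complex) module" where
  "complex_units = \<lparr>carrier = - {0}, monoid.mult = undefined, monoid.one = undefined,
     ring.zero = 1, ring.add = (*), smult = (\<lambda>k z. z powi k)\<rparr>"

lemma int_module_simps [simp]:
  "carrier (int_module M) = carrier M" "\<zero>\<^bsub>int_module M\<^esub> = \<zero>\<^bsub>M\<^esub>"
  "x \<oplus>\<^bsub>int_module M\<^esub> y = x \<oplus>\<^bsub>M\<^esub> y" "k \<odot>\<^bsub>int_module M\<^esub> x = [k] \<cdot>\<^bsub>M\<^esub> x"
  by (simp_all add: int_module_def)

lemma complex_units_simps [simp]:
  "carrier complex_units = - {0}" "\<zero>\<^bsub>complex_units\<^esub> = 1"
  "x \<oplus>\<^bsub>complex_units\<^esub> y = x * y" "k \<odot>\<^bsub>complex_units\<^esub> x = x powi k"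
  by (simp_all add: complex_units_def)

interpretation int: cring int_ring
  by (rule int_is_cring)

lemma powi_mult_swap: "(z :: complex) powi (k * l) = (z powi l) powi k"
  by (metis mult.commute power_int_mult)

lemma complex_units_module: "module int_ring complex_units"
  by (rule int.moduleI') (auto simp: power_int_add power_int_mult_distrib powi_mult_swap)

lemma complex_root_exists:
  assumes "n > 0"
  shows "\<exists>w :: complex. w ^ n = z"
proof -
  have "rcis (root n (cmod z)) (Arg z / real n) ^ n = rcis (cmod z) (Arg z)"
    using assms by (simp add: DeMoivre2)
  then show ?thesis
    by (auto simp: rcis_cmod_Arg)
qed

text \<open>By division with remainder, the least positive element divides all others; the zero
  ideal is covered by \<open>n = 0\<close>.\<close>

lemma int_ideal_generator:
  assumes "ideal J int_ring"
  obtains n :: int where "n \<ge> 0" "n \<in> J" "\<And>k. k \<in> J \<Longrightarrow> n dvd k"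
proof -
  interpret J: ideal J int_ring by (rule assms)
  have mul: "k * x \<in> J" if "x \<in> J" for k x
    using J.I_l_closed[OF that, of k] by simp
  have add: "x + y \<in> J" if "x \<in> J" "y \<in> J" for x y
    using J.a_closed[OF that] by simp
  have zero: "0 \<in> J"
    using J.zero_closed by simp
  show thesis
  proof (cases "\<exists>m>0. int m \<in> J")
    case False
    have "k = 0" if k: "k \<in> J" for k
    proof (rule ccontr)
      assume "k \<noteq> 0"
      then have "nat \<bar>k\<bar> > 0" "int (nat \<bar>k\<bar>) = k \<or> int (nat \<bar>k\<bar>) = - 1 * k" by auto
      then show False using False mul[OF k, of "-1"] k by metis
    qed
    then show thesis using that[of 0] zero by auto
  next
    case True
    define m where "m = (LEAST m. m > 0 \<and> int m \<in> J)"
    have m: "m > 0" "int m \<in> J"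
      using LeastI_ex[OF True] by (auto simp: m_def)
    have min: "m \<le> l" if "l > 0" "int l \<in> J" for l
      unfolding m_def by (rule Least_le) (use that in auto)
    have "int m dvd k" if k: "k \<in> J" for k
    proof (rule ccontr)
      assume "\<not> int m dvd k"
      then have "k mod int m \<noteq> 0" by (auto simp: mod_eq_0_iff_dvd)
      moreover have "k mod int m \<ge> 0" "k mod int m < int m" using m by auto
      moreover have "k mod int m \<in> J"
        using add[OF k mul[OF m(2), of "- (k div int m)"]] by (simp add: minus_div_mult_eq_mod flip: diff_conv_add_uminus)
      ultimately show False using min[of "nat (k mod int m)"] by auto
    qed
    then show thesis using that[of "int m"] m by auto
  qed
qed

text \<open>Divisibility in concrete form: an ideal of the integers has a generator
  \<open>n\<close>, and if \<open>n\<close> is not zero, an \<open>n\<close>-th root of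
  \<open>g n\<close> represents \<open>g\<close>.\<close>

lemma complex_units_baer: "baer_module int_ring complex_units"
  unfolding baer_module_def
proof (intro conjI allI impI complex_units_module)
  fix J g assume *: "ideal J int_ring \<and> g \<in> mod_hom int_ring ((regular_module int_ring)\<lparr>carrier := J\<rparr>) complex_units"
  from *[THEN conjunct1] obtain n :: int where n: "n \<ge> 0" "n \<in> J" "\<And>k. k \<in> J \<Longrightarrow> n dvd k"
    by (rule int_ideal_generator) blast
  let ?J = "(regular_module int_ring)\<lparr>carrier := J\<rparr>"
  have g: "g \<in> mod_hom int_ring ?J complex_units" and J: "module int_ring ?J"
    using * int.ideal_module by auto
  have g0: "g 0 = 1" using int.hom_zero[OF J complex_units_module g] by simp
  have gs: "g (k * x) = g x powi k" if "x \<in> J" for k x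
    using int.hom_smult[OF g, of k x] that by simp
  have gn: "g k \<noteq> 0" if "k \<in> J" for k
    using int.hom_closed[OF g, of k] that by simp
  show "\<exists>e\<in>carrier complex_units. \<forall>r\<in>J. g r = r \<odot>\<^bsub>complex_units\<^esub> e"
  proof (cases "n = 0")
    case True
    then have "k = 0" if "k \<in> J" for k using n(3)[OF that] by simp
    then show ?thesis using g0 by (intro bexI[of _ 1]) auto
  next
    case False
    then obtain w where w: "w ^ nat n = g n"
      using complex_root_exists[of "nat n" "g n"] n(1) by auto
    then have w0: "w \<noteq> 0" using gn[OF n(2)] False n(1) by (metis power_0_left nat_0_iff order_antisym)
    have "g r = w powi r" if r: "r \<in> J" for r
    proof -
      obtain k where k: "r = k * n" using n(3)[OF r] by (metis dvdE mult.commute)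
      have "g r = g n powi k" using gs[OF n(2)] k by simp
      also have "g n = w powi n" using w n(1) by (simp add: power_int_nonneg_exp)
      finally show ?thesis by (simp add: k mult.commute[of k n] power_int_mult)
    qed
    then show ?thesis using w0 by (intro bexI[of _ w]) auto
  qed
qed

context cring
begin

lemma int_module_is_module:
  assumes "module R M"
  shows "module int_ring (int_module M)"
proof -
  interpret M: module R M by (rule assms)
  show ?thesis
    by (rule int.moduleI')
      (auto simp: M.a_assoc M.a_comm M.a_lcomm M.add.int_pow_mult M.add.int_pow_distrib 
        M.add.int_pow_pow mult.commute[of _ "_ :: int"] add_pow_int_ge add_pow_def[of M "0 :: nat"])
qed

lemma additive_map_int:
  assumes "module R M" "\<And>x. x \<in> carrier M \<Longrightarrow> c x \<noteq> 0"
    "\<And>x y. \<lbrakk>x \<in> carrier M; y \<in> carrier M\<rbrakk> \<Longrightarrow> c (x \<oplus>\<^bsub>M\<^esub> y) = c x * c y"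
  shows "c \<in> mod_hom int_ring (int_module M) complex_units"
proof -
  interpret M: module R M by (rule assms(1))
  have c0: "c \<zero>\<^bsub>M\<^esub> = 1"
    using assms(3)[of "\<zero>\<^bsub>M\<^esub>" "\<zero>\<^bsub>M\<^esub>"] assms(2)[of "\<zero>\<^bsub>M\<^esub>"] by simp
  have nat: "c ([n] \<cdot>\<^bsub>M\<^esub> x) = c x ^ n" if x: "x \<in> carrier M" for x and n :: nat
  proof (induction n)
    case (Suc n)
    have "[Suc n] \<cdot>\<^bsub>M\<^esub> x = [n] \<cdot>\<^bsub>M\<^esub> x \<oplus>\<^bsub>M\<^esub> x"
      using x by simp
    then show ?case using Suc x assms(3)[of "[n] \<cdot>\<^bsub>M\<^esub> x" x] by simp
  qed (simp add: c0)
  have neg: "c (\<ominus>\<^bsub>M\<^esub> x) = inverse (c x)" if x: "x \<in> carrier M" for x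
  proof -
    have "c (\<ominus>\<^bsub>M\<^esub> x) * c x = 1" using assms(3)[of "\<ominus>\<^bsub>M\<^esub> x" x] x by (simp add: M.l_neg c0)
    then show ?thesis using assms(2)[OF x] by (simp add: field_simps)
  qed
  have "c ([k] \<cdot>\<^bsub>M\<^esub> x) = c x powi k" if x: "x \<in> carrier M" for k :: int and x
  proof (cases "k \<ge> 0")
    case True
    then show ?thesis using nat[OF x] by (simp add: add_pow_int_ge power_int_nonneg_exp)
  next
    case False
    then show ?thesis using nat[OF x] x by (simp add: add_pow_int_lt neg power_int_def power_inverse)
  qed
  then show ?thesis
    using assms(2,3) by (intro int.mod_homI) auto
qed

text \<open>The element \<open>x\<close> may go to any \<open>w \<noteq> 1\<close> that satisfies
  \<open>w powi n = 1\<close> for the order \<open>n\<close> of \<open>x\<close>. Divisibility of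
  the complex units extends this character from the multiples of \<open>x\<close> to all of
  \<open>M\<close>.\<close>

lemma separating_character:
  assumes "module R M" "x \<in> carrier M" "x \<noteq> \<zero>\<^bsub>M\<^esub>"
  shows "\<exists>c\<in>mod_hom int_ring (int_module M) complex_units. c x \<noteq> 1"
proof -
  interpret M: module R M by (rule assms(1))
  note IM = int_module_is_module[OF assms(1)]
  have d: "(\<lambda>k. [k] \<cdot>\<^bsub>M\<^esub> x) \<in> mod_hom int_ring (regular_module int_ring) (int_module M)"
    using assms(2) by (intro int.mod_homI)
      (auto simp: M.add.int_pow_mult M.add.int_pow_pow mult.commute[of _ "_ :: int"])
  have "ideal {k. [k] \<cdot>\<^bsub>M\<^esub> x = \<zero>\<^bsub>M\<^esub>} int_ring"
    using int.annihilator_ideal[OF IM, of x] assms(2) by simp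
  then obtain n :: int where n: "n \<ge> 0" "[n] \<cdot>\<^bsub>M\<^esub> x = \<zero>\<^bsub>M\<^esub>" "\<And>k :: int. [k] \<cdot>\<^bsub>M\<^esub> x = \<zero>\<^bsub>M\<^esub> \<Longrightarrow> n dvd k"
    by (elim int_ideal_generator) auto
  have n1: "n \<noteq> 1" using n(2) assms(2,3) by auto
  obtain w :: complex where w: "w \<noteq> 0" "w \<noteq> 1" "w powi n = 1"
  proof (cases "n = 0")
    case True
    \<comment> \<open>Here \<open>x\<close> has infinite order, so any number other than 0 and 1
      serves as \<open>w\<close>.\<close>
    then show thesis using that[of 2] by simp
  next
    case False
    then have n2: "nat n \<ge> 2" using n(1) n1 by auto
    have "card {z :: complex. z ^ nat n = 1} = nat n"
      using n2 by (intro card_roots_unity_eq) auto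
    then have "\<not> {z :: complex. z ^ nat n = 1} \<subseteq> {1}"
      using n2 card_mono[of "{1 :: complex}" "{z :: complex. z ^ nat n = 1}"] by auto
    then obtain z :: complex where z: "z ^ nat n = 1" "z \<noteq> 1" by auto
    then have "z \<noteq> 0" using n2 by (metis power_0_left zero_neq_one numeral_eq_Suc not_numeral_le_zero)
    then show thesis using that[of z] z n(1) by (simp add: power_int_nonneg_exp)
  qed
  have g: "(\<lambda>k. w powi k) \<in> mod_hom int_ring (regular_module int_ring) complex_units"
    using w by (intro int.mod_homI) (auto simp: power_int_add powi_mult_swap)
  have "w powi k = 1" if "[k] \<cdot>\<^bsub>M\<^esub> x = \<zero>\<^bsub>M\<^esub>" for k
    using n(3)[OF that] w(3) by (auto simp: power_int_mult)
  then obtain h where h: "h \<in> mod_hom int_ring (int_module M) complex_units"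
    "\<And>k. h ([k] \<cdot>\<^bsub>M\<^esub> x) = w powi k"
    using int.baer_extend[OF int.regular_is_module IM complex_units_baer d g] by auto
  show ?thesis
    using h(2)[of 1] w(2) assms(2) by (intro bexI[OF _ h(1)]) auto
qed

end

text \<open>A power of \<open>Hom(R, \<complex> - {0})\<close>, which is injective over \<open>R\<close> because \<open>\<complex> - {0}\<close> is divisible.\<close>

definition ring_characters :: "('a, 'r) ring_scheme \<Rightarrow> ('a \<Rightarrow> complex) set" where
  "ring_characters R = {c. (\<forall>r\<in>carrier R. c r \<noteq> 0) \<and> (\<forall>r. r \<notin> carrier R \<longrightarrow> c r = 1) \<and>
     (\<forall>r\<in>carrier R. \<forall>s\<in>carrier R. c (r \<oplus>\<^bsub>R\<^esub> s) = c r * c s)}"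

text \<open>A scalar \<open>r\<close> acts on a character by precomposition with multiplication by
  \<open>r\<close>, as usual on Hom(R, -). The value 1 outside the carrier makes equal characters
  equal functions.\<close>

definition character_product :: "('a, 'r) ring_scheme \<Rightarrow> ('a, 'i \<Rightarrow> 'a \<Rightarrow> complex) module" where
  "character_product R = \<lparr>carrier = {b. \<forall>i. b i \<in> ring_characters R},
     monoid.mult = undefined, monoid.one = undefined, ring.zero = (\<lambda>i r. 1),
     ring.add = (\<lambda>b b' i r. b i r * b' i r),
     smult = (\<lambda>r b i s. if s \<in> carrier R then b i (r \<otimes>\<^bsub>R\<^esub> s) else 1)\<rparr>"

context cring
begin

lemma character_product_module: "module R (character_product R)"
proof -
  have "c \<zero> = 1" if "\<forall>r\<in>carrier R. c r \<noteq> 0" "\<forall>r\<in>carrier R. \<forall>s\<in>carrier R. c (r \<oplus> s) = c r * c s"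
    for c :: "'a \<Rightarrow> complex"
    using that by (metis l_zero zero_closed mult_cancel_left2)
  then show ?thesis
    by (intro moduleI')
      (auto simp: character_product_def ring_characters_def fun_eq_iff r_distr l_distr m_assoc m_lcomm
        m_comm mult_ac)
qed

text \<open>Linear maps into characters of the ring correspond to additive maps into the complex
  units, by evaluation at \<open>\<one>\<close>. So each component of \<open>g\<close> becomes a
  character of \<open>J\<close>, which divisibility extends to the ring.\<close>

lemma character_product_baer:
  "baer_module R (character_product R :: ('a, 'i \<Rightarrow> 'a \<Rightarrow> complex) module)"
  unfolding baer_module_def
proof (intro conjI allI impI character_product_module)
  let ?B = "character_product R :: ('a, 'i \<Rightarrow> 'a \<Rightarrow> complex) module"
  fix J g assume *: "ideal J R \<and> g \<in> mod_hom R ((regular_module R)\<lparr>carrier := J\<rparr>) ?B"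
  let ?J = "(regular_module R)\<lparr>carrier := J\<rparr>"
  have Jm: "module R ?J" and g: "g \<in> mod_hom R ?J ?B" using * ideal_module by auto
  have Jc: "J \<subseteq> carrier R" using *[THEN conjunct1] by (rule ideal_carr)
  have gc: "g r i \<in> ring_characters R" if "r \<in> J" for r i
    using hom_closed[OF g, of r] that by (simp add: character_product_def)
  have ga: "g (r \<oplus> s) i t = g r i t * g s i t" if "r \<in> J" "s \<in> J" for r s i t
    using hom_add[OF g, of r s] that by (simp add: character_product_def)
  have gs: "g (k \<otimes> s) i t = g s i (k \<otimes> t)" if "k \<in> carrier R" "s \<in> J" "t \<in> carrier R" for k s i t
    using hom_smult[OF g, of k s] that by (simp add: character_product_def)
  have "\<exists>c. c \<in> ring_characters R \<and> (\<forall>r\<in>J. c r = g r i \<one>)" for i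
  proof -
    have "(\<lambda>r. g r i \<one>) \<in> mod_hom int_ring (int_module ?J) complex_units"
      using ga gc by (intro additive_map_int[OF Jm]) (auto simp: ring_characters_def)
    moreover have "(\<lambda>r. r) \<in> mod_hom int_ring (int_module ?J) (int_module (regular_module R))"
    proof (rule int.mod_homI; simp)
      show "x \<in> carrier R" if "x \<in> J" for x using that Jc by auto
      show "[k] \<cdot>\<^bsub>?J\<^esub> x = [k] \<cdot>\<^bsub>regular_module R\<^esub> x" if x: "x \<in> J" for k :: int and x
      proof -
        interpret J: module R ?J by (rule Jm)
        interpret A: module R "regular_module R" by simp
        have n: "[n] \<cdot>\<^bsub>?J\<^esub> x = [n] \<cdot>\<^bsub>regular_module R\<^esub> x" for n :: nat
          by (induction n) (auto simp: add_pow_def)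
        show ?thesis
        proof (cases "k \<ge> 0")
          case False
          let ?y = "[nat (- k)] \<cdot>\<^bsub>?J\<^esub> x"
          have y: "?y \<in> J" using x J.add.nat_pow_closed[of x] by simp
          have "\<ominus>\<^bsub>?J\<^esub> ?y = (\<ominus> \<one>) \<odot>\<^bsub>?J\<^esub> ?y" "\<ominus>\<^bsub>regular_module R\<^esub> ?y = (\<ominus> \<one>) \<odot>\<^bsub>regular_module R\<^esub> ?y"
            using y Jc J.smult_l_minus[of \<one> ?y] A.smult_l_minus[of \<one> ?y] J.smult_one[of ?y]
            by (auto simp: subset_iff)
          then show ?thesis using False n by (simp add: add_pow_int_lt)
        qed (simp add: add_pow_int_ge n)
      qed
    qed
    moreover have "g x i \<one> = 1" if "x \<in> J" "x = \<zero>" for x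
      using hom_zero[OF Jm character_product_module g] that by (simp add: character_product_def)
    ultimately obtain h where h: "h \<in> mod_hom int_ring (int_module (regular_module R)) complex_units"
      "\<And>r. r \<in> J \<Longrightarrow> h r = g r i \<one>"
      using int.baer_extend[OF int_module_is_module[OF Jm] int_module_is_module[OF regular_is_module] complex_units_baer,
          of "\<lambda>r. r" "\<lambda>r. g r i \<one>"] by auto
    define c where "c r = (if r \<in> carrier R then h r else 1)" for r
    have "c \<in> ring_characters R"
      using int.hom_closed[OF h(1)] int.hom_add[OF h(1)] by (auto simp: c_def ring_characters_def)
    moreover have "\<forall>r\<in>J. c r = g r i \<one>" using h(2) Jc by (auto simp: c_def)
    ultimately show ?thesis by blast
  qed
  then obtain c where c: "\<And>i. c i \<in> ring_characters R" "\<And>i r. r \<in> J \<Longrightarrow> c i r = g r i \<one>"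
    by metis
  show "\<exists>e\<in>carrier ?B. \<forall>r\<in>J. g r = r \<odot>\<^bsub>?B\<^esub> e"
  proof (intro bexI[of _ c] ballI)
    show "c \<in> carrier ?B" using c(1) by (simp add: character_product_def)
    fix r assume r: "r \<in> J"
    \<comment> \<open>Linearity of \<open>g\<close> recovers the character \<open>g r i\<close> from
      values at \<open>\<one>\<close>: its value at \<open>s\<close> is that of
      \<open>g (s \<otimes> r) i\<close> at \<open>\<one>\<close>.\<close>
    have "g r i s = c i (r \<otimes> s)" if s: "s \<in> carrier R" for i s
    proof -
      have "s \<otimes> r \<in> J" using * r s ideal.I_l_closed by fast
      then have "c i (s \<otimes> r) = g r i (s \<otimes> \<one>)" using c(2) gs[OF s r, of \<one>] by simp
      then show ?thesis using s r Jc by (auto simp: m_comm subset_iff)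
    qed
    moreover have "g r i s = 1" if "s \<notin> carrier R" for i s
      using gc[OF r, of i] that by (simp add: ring_characters_def)
    ultimately show "g r = r \<odot>\<^bsub>?B\<^esub> c"
      by (auto simp: character_product_def fun_eq_iff)
  qed
qed

text \<open>An element \<open>x\<close> goes to the family of functions
  \<open>r \<mapsto> c (r \<odot> x)\<close>. The index type contains all functions \<open>c\<close>
  on the type of \<open>M\<close>; the characters among them separate points, and the others get the
  trivial component.\<close>

lemma character_product_embedding:
  fixes M :: "('a, 'm) module"
  assumes M: "module R M"
  shows "\<exists>f\<in>mod_hom R M (character_product R :: ('a, ('m \<Rightarrow> complex) \<Rightarrow> 'a \<Rightarrow> complex) module).
    inj_on f (carrier M)"
proof -
  let ?B = "character_product R :: ('a, ('m \<Rightarrow> complex) \<Rightarrow> 'a \<Rightarrow> complex) module"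
  let ?H = "mod_hom int_ring (int_module M) complex_units"
  define f where "f x = (\<lambda>c r. if c \<in> ?H \<and> r \<in> carrier R then c (r \<odot>\<^bsub>M\<^esub> x) else 1)" for x
  have ca: "c (x \<oplus>\<^bsub>M\<^esub> y) = c x * c y" if "c \<in> ?H" "x \<in> carrier M" "y \<in> carrier M" for c x y
    using int.hom_add[OF that(1)] that(2,3) by simp
  have cn: "c x \<noteq> 0" if "c \<in> ?H" "x \<in> carrier M" for c x
    using int.hom_closed[OF that(1)] that(2) by simp
  have f: "f \<in> mod_hom R M ?B"
    using M by (intro mod_homI)
      (auto simp: f_def character_product_def ring_characters_def cn ca[OF _ msmult_closed msmult_closed, OF _ M _ _ M] 
        msmult_add_left msmult_add_right msmult_mult[symmetric] m_comm fun_eq_iff)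
  have "x = \<zero>\<^bsub>M\<^esub>" if x: "x \<in> carrier M" "f x = \<zero>\<^bsub>?B\<^esub>" for x
  proof (rule ccontr)
    assume "x \<noteq> \<zero>\<^bsub>M\<^esub>"
    then obtain c where c: "c \<in> ?H" "c x \<noteq> 1" using separating_character[OF M x(1)] by auto
    have "f x c \<one> = 1" using x(2) by (simp add: character_product_def)
    then show False using c x M by (simp add: f_def)
  qed
  then show ?thesis
    using f hom_inj_iff[OF M character_product_module f] by blast
qed

end

section \<open>Small injective modules and resolutions\<close>

lemma lists_lepoll_infinite:
  assumes "infinite (UNIV :: 'u set)"
  shows "(UNIV :: 'u list set) \<lesssim> (UNIV :: 'u set)"
proof -
  have "\<exists>p :: 'u \<times> 'u \<Rightarrow> 'u. bij_betw p (UNIV \<times> UNIV) UNIV"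
    unfolding card_of_ordIso by (rule card_of_Times_same_infinite[OF assms])
  then obtain p :: "'u \<times> 'u \<Rightarrow> 'u" where p: "inj p"
    by (auto simp: bij_betw_def)
  obtain q :: "nat \<Rightarrow> 'u" where q: "inj q"
    using assms by (auto simp: infinite_iff_countable_subset)
  \<comment> \<open>Iterated pairing is injective on lists of one fixed length; recording the length
    next to it makes the code injective on all lists.\<close>
  define enc where "enc = foldr (\<lambda>x y. p (x, y))"
  have enc: "length xs = length ys \<Longrightarrow> enc xs z = enc ys z \<Longrightarrow> xs = ys" for xs ys z
    by (induction xs ys rule: list_induct2) (auto simp: enc_def dest: injD[OF p])
  have "inj (\<lambda>xs. p (q (length xs), enc xs undefined))"
    by (rule injI) (auto dest!: injD[OF p] injD[OF q] intro: enc)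
  then show ?thesis
    by (auto simp: lepoll_def)
qed

lemma times_lepoll_infinite:
  assumes "infinite (UNIV :: 'u set)" "A \<lesssim> (UNIV :: 'u set)" "B \<lesssim> (UNIV :: 'u set)"
  shows "A \<times> B \<lesssim> (UNIV :: 'u set)"
proof -
  have "(UNIV :: 'u set) \<times> (UNIV :: 'u set) \<lesssim> (UNIV :: 'u set)"
    using card_of_Times_same_infinite[OF assms(1)] eqpoll_iff_card_of_ordIso eqpoll_imp_lepoll by blast
  then show ?thesis
    using times_lepoll_mono[OF assms(2,3)] lepoll_trans by blast
qed

lemma UN_lepoll_infinite:
  fixes F :: "nat \<Rightarrow> 'b set"
  assumes "infinite (UNIV :: 'u set)" "\<And>n. F n \<lesssim> (UNIV :: 'u set)"
  shows "(\<Union>n. F n) \<lesssim> (UNIV :: 'u set)"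
proof -
  obtain f :: "nat \<Rightarrow> 'b \<Rightarrow> 'u" where f: "\<And>n. inj_on (f n) (F n)"
    using assms(2) unfolding lepoll_def by metis
  define n where "n x = (LEAST k. x \<in> F k)" for x
  have n: "x \<in> F (n x)" if "x \<in> (\<Union>n. F n)" for x
    unfolding n_def using that by (auto intro: LeastI)
  have "inj_on (\<lambda>x. (n x, f (n x) x)) (\<Union>n. F n)"
    using n f by (auto simp: inj_on_def) metis
  then have "(\<Union>n. F n) \<lesssim> (UNIV :: nat set) \<times> (UNIV :: 'u set)"
    by (force simp: lepoll_def)
  also have "\<dots> \<lesssim> (UNIV :: 'u set)"
    using assms(1) infinite_le_lepoll by (intro times_lepoll_infinite) auto
  finally show ?thesis .
qed

text \<open>A module on a type of cardinality \<open>\<kappa> \<ge> max(|R|, \<aleph>\<^sub>0)\<close> embeds into an injective module of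
  arbitrary size; closing its image under linear combinations and chosen solutions of finite systems
  of linear equations keeps the size at most \<open>\<kappa>\<close>.\<close>

context noetherian_cring
begin

lemma small_injective:
  fixes M :: "('a, 'u) module" and i :: "'a \<Rightarrow> 'u"
  assumes M: "module R M" and inf: "infinite (UNIV :: 'u set)" and i: "inj i"
  shows "\<exists>(E :: ('a, 'u) module) f. baer_module R E \<and> f \<in> mod_hom R M E \<and> inj_on f (carrier M)"
proof -
  let ?B = "character_product R :: ('a, ('u \<Rightarrow> complex) \<Rightarrow> 'a \<Rightarrow> complex) module"
  have B: "module R ?B" and Bb: "baer_module R ?B"
    by (rule character_product_module character_product_baer)+
  obtain f where f: "f \<in> mod_hom R M ?B" "inj_on f (carrier M)"
    using character_product_embedding[OF M] by auto
  define lin where "lin ps = foldr (\<lambda>(r, x) y. r \<odot>\<^bsub>?B\<^esub> x \<oplus>\<^bsub>?B\<^esub> y) ps \<zero>\<^bsub>?B\<^esub>" for ps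
  define solves where "solves ps e \<longleftrightarrow> e \<in> carrier ?B \<and> (\<forall>(r, x)\<in>set ps. r \<odot>\<^bsub>?B\<^esub> e = x)" for ps e
  \<comment> \<open>A chosen solution, in the large module, of the finite system of equations
    \<open>r \<odot> e = x\<close>; the default zero makes it a total function on lists, with values
    in the module.\<close>
  define sol where "sol ps = (if \<exists>e. solves ps e then SOME e. solves ps e else \<zero>\<^bsub>?B\<^esub>)" for ps
  have sol: "solves ps (sol ps)" if "solves ps e" for ps e
    using that someI[of "solves ps"] by (auto simp: sol_def)
  have sol_c: "sol ps \<in> carrier ?B" for ps
    using sol[of ps] B by (cases "\<exists>e. solves ps e") (auto simp: solves_def sol_def)
  define L where "L S = lists (carrier R \<times> S)" for S :: "(('u \<Rightarrow> complex) \<Rightarrow> 'a \<Rightarrow> complex) set"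
  define F where "F = rec_nat (f ` carrier M) (\<lambda>_ S. lin ` L S \<union> sol ` L S)"
  have F0: "F 0 = f ` carrier M" and FS: "F (Suc n) = lin ` L (F n) \<union> sol ` L (F n)" for n
    by (simp_all add: F_def)
  have lin_c: "lin ps \<in> carrier ?B" if "set ps \<subseteq> carrier R \<times> carrier ?B" for ps
    using that B by (induction ps) (auto simp: lin_def)
  have Fc: "F n \<subseteq> carrier ?B" for n
  proof (induction n)
    case 0
    then show ?case using hom_closed[OF f(1)] by (auto simp: F0)
  next
    case (Suc n)
    have "lin ps \<in> carrier ?B" if "ps \<in> L (F n)" for ps
      using that Suc by (intro lin_c) (auto simp: L_def in_lists_conv_set)
    then show ?case using sol_c by (auto simp: FS)
  qed
  have lin1: "lin [(\<one>, x)] = x" if "x \<in> carrier ?B" for x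
    using that B by (simp add: lin_def)
  have "F n \<subseteq> F (Suc n)" for n
  proof
    fix x assume x: "x \<in> F n"
    then have "lin [(\<one>, x)] \<in> F (Suc n)" unfolding FS L_def by (intro UnI1 imageI) auto
    then show "x \<in> F (Suc n)" using lin1[of x] x Fc[of n] by auto
  qed
  then have mono: "F m \<subseteq> F n" if "m \<le> n" for m n
    using that by (rule lift_Suc_mono_le)
  define E where "E = (\<Union>n. F n)"
  have Ec: "E \<subseteq> carrier ?B" using Fc by (auto simp: E_def)
  have finE: "\<exists>n. S \<subseteq> F n" if "finite S" "S \<subseteq> E" for S
    using that
  proof (induction S rule: finite_induct)
    case (insert x S)
    then obtain n m where "S \<subseteq> F n" "x \<in> F m" by (auto simp: E_def)
    then show ?case using mono[of n "max n m"] mono[of m "max n m"] by (intro exI[of _ "max n m"]) auto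
  qed auto
  have LE: "lin ps \<in> E" "sol ps \<in> E" if ps: "set ps \<subseteq> carrier R \<times> E" for ps
  proof -
    obtain n where "snd ` set ps \<subseteq> F n" using finE[of "snd ` set ps"] ps by force
    then have "ps \<in> L (F n)" using ps by (force simp: L_def in_lists_conv_set)
    then show "lin ps \<in> E" "sol ps \<in> E" unfolding E_def using FS[of n] by blast+
  qed
  have sub: "submodule E R ?B"
  proof (rule submoduleI'[OF B Ec])
    show "\<zero>\<^bsub>?B\<^esub> \<in> E" using LE(1)[of "[]"] by (simp add: lin_def)
    show "x \<oplus>\<^bsub>?B\<^esub> y \<in> E" if "x \<in> E" "y \<in> E" for x y
    proof -
      have "lin [(\<one>, x), (\<one>, y)] \<in> E" using that by (intro LE) auto
      moreover have "lin [(\<one>, x), (\<one>, y)] = x \<oplus>\<^bsub>?B\<^esub> y" using that Ec B by (auto simp: lin_def subset_iff)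
      ultimately show ?thesis by simp
    qed
    show "r \<odot>\<^bsub>?B\<^esub> x \<in> E" if "r \<in> carrier R" "x \<in> E" for r x
    proof -
      have "lin [(r, x)] \<in> E" using that by (intro LE) auto
      moreover have "lin [(r, x)] = r \<odot>\<^bsub>?B\<^esub> x" using that Ec B by (auto simp: lin_def subset_iff)
      ultimately show ?thesis by simp
    qed
  qed
  let ?E = "?B\<lparr>carrier := E\<rparr>"
  have Em: "module R ?E" by (rule submodule_restrict[OF B sub])
  have baer: "baer_module R ?E"
    unfolding baer_module_def
  proof (intro conjI allI impI Em)
    fix J g assume *: "ideal J R \<and> g \<in> mod_hom R ((regular_module R)\<lparr>carrier := J\<rparr>) ?E"
    then have J: "ideal J R" and g: "g \<in> mod_hom R ((regular_module R)\<lparr>carrier := J\<rparr>) ?E" by auto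
    have Jm: "module R ((regular_module R)\<lparr>carrier := J\<rparr>)" by (rule ideal_module[OF J])
    have gB: "g \<in> mod_hom R ((regular_module R)\<lparr>carrier := J\<rparr>) ?B"
      using hom_enlarge_cod[OF g Ec] .
    obtain e0 where e0: "e0 \<in> carrier ?B" "\<forall>r\<in>J. g r = r \<odot>\<^bsub>?B\<^esub> e0"
      using Bb J gB unfolding baer_module_def by blast
    \<comment> \<open>The noetherian hypothesis enters here: with finitely many generators of
      \<open>J\<close>, the extension problem is a finite system over \<open>E\<close>. It is
      solvable in \<open>?B\<close>, so its chosen solution was put into \<open>E\<close>.\<close>
    obtain A where A: "A \<subseteq> carrier R" "finite A" "J = Idl A" using finetely_gen[OF J] by auto
    obtain rs where rs: "set rs = A" using finite_list[OF A(2)] by auto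
    have AJ: "A \<subseteq> J" using genideal_self[OF A(1)] A(3) by simp
    have gE: "g r \<in> E" if "r \<in> J" for r using hom_closed[OF g, of r] that by simp
    let ?ps = "map (\<lambda>r. (r, g r)) rs"
    have "solves ?ps e0" using e0 rs AJ by (auto simp: solves_def)
    then have "solves ?ps (sol ?ps)" by (rule sol)
    then have s: "sol ?ps \<in> carrier ?B" "\<And>r. r \<in> A \<Longrightarrow> g r = r \<odot>\<^bsub>?B\<^esub> sol ?ps"
      using rs by (auto simp: solves_def)
    have sE: "sol ?ps \<in> E" using A(1) AJ rs gE by (intro LE) auto
    \<comment> \<open>The elements at which \<open>g\<close> is multiplication by the solution form
      an ideal, so agreement on the generators gives agreement on \<open>J\<close>.\<close>
    have "ideal {r \<in> J. g r = r \<odot>\<^bsub>?B\<^esub> sol ?ps} R"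
    proof (rule ideal_intro)
      interpret J: ideal J R by (rule J)
      show "{r \<in> J. g r = r \<odot>\<^bsub>?B\<^esub> sol ?ps} \<subseteq> carrier R" using ideal_carr[OF J] by auto
      show "\<zero> \<in> {r \<in> J. g r = r \<odot>\<^bsub>?B\<^esub> sol ?ps}"
        using hom_zero[OF Jm B gB] s(1) B by simp
      show "x \<oplus> y \<in> {r \<in> J. g r = r \<odot>\<^bsub>?B\<^esub> sol ?ps}"
        if "x \<in> {r \<in> J. g r = r \<odot>\<^bsub>?B\<^esub> sol ?ps}" "y \<in> {r \<in> J. g r = r \<odot>\<^bsub>?B\<^esub> sol ?ps}" for x y
        using that hom_add[OF gB, of x y] s(1) B by (simp add: msmult_add_left J.Icarr)
      show "r \<otimes> x \<in> {r \<in> J. g r = r \<odot>\<^bsub>?B\<^esub> sol ?ps}"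
        if "r \<in> carrier R" "x \<in> {r \<in> J. g r = r \<odot>\<^bsub>?B\<^esub> sol ?ps}" for r x
        using that hom_smult[OF gB, of r x] s(1) B by (simp add: msmult_mult J.Icarr J.I_l_closed)
    qed
    then have "Idl A \<subseteq> {r \<in> J. g r = r \<odot>\<^bsub>?B\<^esub> sol ?ps}"
      using s AJ by (intro genideal_minimal) auto
    then show "\<exists>e\<in>carrier ?E. \<forall>r\<in>J. g r = r \<odot>\<^bsub>?E\<^esub> e"
      using sE A(3) by (intro bexI[of _ "sol ?ps"]) auto
  qed
  have "F n \<lesssim> (UNIV :: 'u set)" for n
  proof (induction n)
    case 0
    show ?case unfolding F0
      by (rule lepoll_trans[OF image_lepoll subset_imp_lepoll[OF subset_UNIV]])
  next
    case (Suc n)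
    have "carrier R \<lesssim> (UNIV :: 'u set)"
      using i by (auto simp: lepoll_def intro: inj_on_subset)
    then have "carrier R \<times> F n \<lesssim> (UNIV :: 'u set)" by (rule times_lepoll_infinite[OF inf _ Suc])
    then have "L (F n) \<lesssim> lists (UNIV :: 'u set)" unfolding L_def by (rule lists_lepoll_mono)
    then have "L (F n) \<lesssim> (UNIV :: 'u set)" using lists_lepoll_infinite[OF inf] by (auto intro: lepoll_trans)
    moreover have "(UNIV :: bool set) \<lesssim> (UNIV :: 'u set)"
      using inf by (intro lesspoll_imp_lepoll finite_lesspoll_infinite) auto
    ultimately have "(UNIV :: bool set) \<times> L (F n) \<lesssim> (UNIV :: 'u set)"
      by (intro times_lepoll_infinite[OF inf])
    moreover have "F (Suc n) \<subseteq> (\<lambda>(b, ps). if b then lin ps else sol ps) ` ((UNIV :: bool set) \<times> L (F n))"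
    proof
      fix x assume "x \<in> F (Suc n)"
      then consider ps where "ps \<in> L (F n)" "x = lin ps" | ps where "ps \<in> L (F n)" "x = sol ps"
        unfolding FS by blast
      then show "x \<in> (\<lambda>(b, ps). if b then lin ps else sol ps) ` ((UNIV :: bool set) \<times> L (F n))"
      proof cases
        case (1 ps)
        then show ?thesis by (intro image_eqI[of _ _ "(True, ps)"]) auto
      next
        case (2 ps)
        then show ?thesis by (intro image_eqI[of _ _ "(False, ps)"]) auto
      qed
    qed
    ultimately show ?case using subset_image_lepoll lepoll_trans by blast
  qed
  then have "E \<lesssim> (UNIV :: 'u set)" unfolding E_def by (rule UN_lepoll_infinite[OF inf])
  then obtain j :: "_ \<Rightarrow> 'u" where j: "inj_on j E" by (auto simp: lepoll_def)
  obtain E' :: "('a, 'u) module" where E': "module R E'" "j \<in> mod_hom R ?E E'" "j ` E = carrier E'"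
    using transport_module[OF Em, of j] j by auto
  have "baer_module R E'" using baer_transport[OF baer E'(1,2)] j E'(3) by simp
  moreover have fE: "f x \<in> E" if "x \<in> carrier M" for x
    using that F0 unfolding E_def by blast
  then have "(\<lambda>x. j (f x)) \<in> mod_hom R M E'"
    by (intro hom_comp[OF _ E'(2)] hom_restrict_cod[OF f(1)]) auto
  moreover have "inj_on (\<lambda>x. j (f x)) (carrier M)"
    using j f(2) fE by (auto simp: inj_on_def)
  ultimately show ?thesis by blast
qed

text \<open>A choice of representatives embeds the quotient into the type of \<open>M\<close>, while
  \<open>quotient_module\<close> would move to a type of sets at every step of a resolution.\<close>

lemma quotient_copy:
  fixes M :: "('a, 'm) module"
  assumes "module R M" "submodule N R M"
  shows "\<exists>(Q :: ('a, 'm) module) p. module R Q \<and> p \<in> mod_hom R M Q \<and> p ` carrier M = carrier Q \<and>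
    (\<forall>x\<in>carrier M. p x = \<zero>\<^bsub>Q\<^esub> \<longleftrightarrow> x \<in> N) \<and> mod_isomorphic R (quotient_module M N) Q"
proof -
  let ?Q = "quotient_module M N"
  note Qm = quotient_is_module[OF assms] and Qp = quotient_proj[OF assms] and Qc = quotient_carrier[OF assms]
  define j where "j K = (SOME x. x \<in> carrier M \<and> N +>\<^bsub>M\<^esub> x = K)" for K
  have j: "j K \<in> carrier M \<and> N +>\<^bsub>M\<^esub> j K = K" if K: "K \<in> carrier ?Q" for K
    unfolding j_def by (rule someI_ex) (use K Qc in auto)
  have inj: "inj_on j (carrier ?Q)"
    by (rule inj_onI) (metis j)
  obtain Q :: "('a, 'm) module" where Q: "module R Q" "j \<in> mod_hom R ?Q Q" "j ` carrier ?Q = carrier Q"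
    using transport_module[OF Qm inj] by auto
  have p: "(\<lambda>x. j (N +>\<^bsub>M\<^esub> x)) \<in> mod_hom R M Q" by (rule hom_comp[OF Qp Q(2)])
  have "j (N +>\<^bsub>M\<^esub> x) = \<zero>\<^bsub>Q\<^esub> \<longleftrightarrow> x \<in> N" if x: "x \<in> carrier M" for x
  proof -
    have "j (N +>\<^bsub>M\<^esub> x) = \<zero>\<^bsub>Q\<^esub> \<longleftrightarrow> N +>\<^bsub>M\<^esub> x = \<zero>\<^bsub>?Q\<^esub>"
      using hom_inj_iff[OF Qm Q(1,2)] inj hom_zero[OF Qm Q(1,2)] hom_closed[OF Qp x] by auto
    then show ?thesis using assms coset_zero_iff[OF assms x] by simp
  qed
  moreover have "(\<lambda>x. j (N +>\<^bsub>M\<^esub> x)) ` carrier M = carrier Q"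
    using Q(3) Qc by (auto simp: image_image)
  ultimately show ?thesis
    using Q p mod_isomorphicI[OF Q(2) inj Q(3)] by (intro exI[of _ Q] exI[of _ "\<lambda>x. j (N +>\<^bsub>M\<^esub> x)"]) auto
qed

text \<open>The projection onto \<open>M / N\<close> followed by an embedding into an injective
  module. With \<open>N\<close> zero this begins a resolution; with \<open>N\<close> the image of
  the previous differential it continues one.\<close>

lemma small_injective_with_kernel:
  fixes M :: "('a, 'u) module" and i :: "'a \<Rightarrow> 'u"
  assumes M: "module R M" and N: "submodule N R M" and inf: "infinite (UNIV :: 'u set)" and i: "inj i"
  shows "\<exists>(E :: ('a, 'u) module) f. baer_module R E \<and> f \<in> mod_hom R M E \<and> mod_ker M E f = N"
proof -
  obtain Q :: "('a, 'u) module" and p where Q: "module R Q" "p \<in> mod_hom R M Q"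
    "\<And>x. x \<in> carrier M \<Longrightarrow> p x = \<zero>\<^bsub>Q\<^esub> \<longleftrightarrow> x \<in> N"
    using quotient_copy[OF M N] by blast
  obtain E :: "('a, 'u) module" and f where E: "baer_module R E" "f \<in> mod_hom R Q E" "inj_on f (carrier Q)"
    using small_injective[OF Q(1) inf i] by blast
  note Em = baer_is_module[OF E(1)]
  have "f (p x) = \<zero>\<^bsub>E\<^esub> \<longleftrightarrow> x \<in> N" if "x \<in> carrier M" for x
    using E(3) hom_inj_iff[OF Q(1) Em E(2)] hom_zero[OF Q(1) Em E(2)] Q(3)[OF that] hom_closed[OF Q(2) that]
    by metis
  then have "mod_ker M E (\<lambda>x. f (p x)) = N" using submodule_carr[OF M N] by (auto simp: mod_ker_def)
  then show ?thesis using E(1) hom_comp[OF Q(2) E(2)] by blast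
qed

end

section \<open>Complexes and resolutions\<close>

definition is_complex :: "('a, 'r) ring_scheme \<Rightarrow> (nat \<Rightarrow> ('a, 'e) module) \<Rightarrow> (nat \<Rightarrow> 'e \<Rightarrow> 'e) \<Rightarrow> bool" where
  "is_complex R C d \<longleftrightarrow> (\<forall>n. module R (C n)) \<and> (\<forall>n. d n \<in> mod_hom R (C n) (C (Suc n))) \<and>
     (\<forall>n. \<forall>x\<in>carrier (C n). d (Suc n) (d n x) = \<zero>\<^bsub>C (Suc (Suc n))\<^esub>)"

text \<open>Exactness without injectivity. Comparison maps rest on exactness of the source and on
  injectivity of the target, so the two properties are kept apart.\<close>

definition coresolution :: "('a, 'r) ring_scheme \<Rightarrow> ('a, 'm) module \<Rightarrow> ('m \<Rightarrow> 'e) \<Rightarrow>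
    (nat \<Rightarrow> ('a, 'e) module) \<Rightarrow> (nat \<Rightarrow> 'e \<Rightarrow> 'e) \<Rightarrow> bool" where
  "coresolution R M \<epsilon> E d \<longleftrightarrow> module R M \<and> is_complex R E d \<and> \<epsilon> \<in> mod_hom R M (E 0) \<and> inj_on \<epsilon> (carrier M) \<and>
     \<epsilon> ` carrier M = mod_ker (E 0) (E 1) (d 0) \<and>
     (\<forall>n. d n ` carrier (E n) = mod_ker (E (Suc n)) (E (Suc (Suc n))) (d (Suc n)))"

definition baer_resolution :: "('a, 'r) ring_scheme \<Rightarrow> ('a, 'm) module \<Rightarrow> ('m \<Rightarrow> 'e) \<Rightarrow>
    (nat \<Rightarrow> ('a, 'e) module) \<Rightarrow> (nat \<Rightarrow> 'e \<Rightarrow> 'e) \<Rightarrow> bool" where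
  "baer_resolution R M \<epsilon> E d \<longleftrightarrow> coresolution R M \<epsilon> E d \<and> (\<forall>n. baer_module R (E n))"

definition cocycles :: "(nat \<Rightarrow> ('a, 'e) module) \<Rightarrow> (nat \<Rightarrow> 'e \<Rightarrow> 'e) \<Rightarrow> nat \<Rightarrow> 'e set" where
  "cocycles C d n = mod_ker (C n) (C (Suc n)) (d n)"

definition coboundaries :: "(nat \<Rightarrow> ('a, 'e) module) \<Rightarrow> (nat \<Rightarrow> 'e \<Rightarrow> 'e) \<Rightarrow> nat \<Rightarrow> 'e set" where
  "coboundaries C d n = (case n of 0 \<Rightarrow> {\<zero>\<^bsub>C 0\<^esub>} | Suc j \<Rightarrow> d j ` carrier (C j))"

definition chain_map :: "('a, 'r) ring_scheme \<Rightarrow> (nat \<Rightarrow> ('a, 'e) module) \<Rightarrow> (nat \<Rightarrow> 'e \<Rightarrow> 'e) \<Rightarrow>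
    (nat \<Rightarrow> ('a, 'f) module) \<Rightarrow> (nat \<Rightarrow> 'f \<Rightarrow> 'f) \<Rightarrow> (nat \<Rightarrow> 'e \<Rightarrow> 'f) \<Rightarrow> bool" where
  "chain_map R C d C' d' \<phi> \<longleftrightarrow> (\<forall>n. \<phi> n \<in> mod_hom R (C n) (C' n)) \<and>
     (\<forall>n. \<forall>x\<in>carrier (C n). \<phi> (Suc n) (d n x) = d' n (\<phi> n x))"

text \<open>The relation that \<phi> - \<psi> equals ds + sd, written without subtraction. Degree
  zero has its own clause because nothing precedes it.\<close>

definition chain_homotopy :: "('a, 'r) ring_scheme \<Rightarrow> (nat \<Rightarrow> ('a, 'e) module) \<Rightarrow> (nat \<Rightarrow> 'e \<Rightarrow> 'e) \<Rightarrow>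
    (nat \<Rightarrow> ('a, 'f) module) \<Rightarrow> (nat \<Rightarrow> 'f \<Rightarrow> 'f) \<Rightarrow> (nat \<Rightarrow> 'e \<Rightarrow> 'f) \<Rightarrow> (nat \<Rightarrow> 'e \<Rightarrow> 'f) \<Rightarrow> (nat \<Rightarrow> 'e \<Rightarrow> 'f) \<Rightarrow> bool" where
  "chain_homotopy R C d C' d' \<phi> \<psi> s \<longleftrightarrow> (\<forall>n. s n \<in> mod_hom R (C (Suc n)) (C' n)) \<and>
     (\<forall>x\<in>carrier (C 0). \<phi> 0 x = \<psi> 0 x \<oplus>\<^bsub>C' 0\<^esub> s 0 (d 0 x)) \<and>
     (\<forall>n. \<forall>x\<in>carrier (C (Suc n)). \<phi> (Suc n) x =
       \<psi> (Suc n) x \<oplus>\<^bsub>C' (Suc n)\<^esub> (d' n (s n x) \<oplus>\<^bsub>C' (Suc n)\<^esub> s (Suc n) (d (Suc n) x)))"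

lemma cohomology_module_alt:
  "cohomology_module C d n = quotient_module ((C n)\<lparr>carrier := cocycles C d n\<rparr>) (coboundaries C d n)"
  by (simp add: cohomology_module_def kernel_module_def cocycles_def coboundaries_def)

context cring
begin

lemma complexD:
  assumes "is_complex R C d"
  shows "module R (C n)" "d n \<in> mod_hom R (C n) (C (Suc n))"
    "x \<in> carrier (C n) \<Longrightarrow> d (Suc n) (d n x) = \<zero>\<^bsub>C (Suc (Suc n))\<^esub>"
  using assms by (auto simp: is_complex_def)

lemma cocycles_iff: "x \<in> cocycles C d n \<longleftrightarrow> x \<in> carrier (C n) \<and> d n x = \<zero>\<^bsub>C (Suc n)\<^esub>"
  by (auto simp: cocycles_def mod_ker_def)

lemma coboundaries_0: "coboundaries C d 0 = {\<zero>\<^bsub>C 0\<^esub>}"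
  and coboundaries_Suc: "coboundaries C d (Suc n) = d n ` carrier (C n)"
  by (auto simp: coboundaries_def)

lemma cocycles_submodule: "is_complex R C d \<Longrightarrow> submodule (cocycles C d n) R (C n)"
  unfolding cocycles_def by (intro ker_submodule complexD)

lemma coboundaries_submodule: 
  assumes "is_complex R C d"
  shows "submodule (coboundaries C d n) R (C n)"
proof (cases n)
  case 0
  then show ?thesis using submodule_triv[OF complexD(1)[OF assms, of 0]] by (simp add: coboundaries_0)
next
  case (Suc k)
  then show ?thesis
    using img_submodule[OF complexD(1)[OF assms] complexD(1)[OF assms] complexD(2)[OF assms, of k] submodule_carrier[OF complexD(1)[OF assms]]]
    by (simp add: coboundaries_Suc)
qed

lemma coboundaries_subset:
  assumes "is_complex R C d"
  shows "coboundaries C d n \<subseteq> cocycles C d n"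
proof (cases n)
  case 0
  then show ?thesis using complexD(1)[OF assms] hom_zero[OF complexD(1)[OF assms] complexD(1)[OF assms] complexD(2)[OF assms]]
    by (simp add: coboundaries_0 cocycles_iff)
next
  case (Suc k)
  then show ?thesis using hom_closed[OF complexD(2)[OF assms]] complexD(3)[OF assms]
    by (auto simp: coboundaries_Suc cocycles_iff)
qed

lemma cocycle_module:
  assumes "is_complex R C d"
  shows "module R ((C n)\<lparr>carrier := cocycles C d n\<rparr>)"
    "submodule (coboundaries C d n) R ((C n)\<lparr>carrier := cocycles C d n\<rparr>)"
  by (intro submodule_restrict submodule_in_restrict complexD[OF assms] cocycles_submodule[OF assms]
    coboundaries_submodule[OF assms] coboundaries_subset[OF assms])+

lemma cohomology_is_module: "is_complex R C d \<Longrightarrow> module R (cohomology_module C d n)"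
  unfolding cohomology_module_alt by (intro quotient_is_module cocycle_module)

section \<open>Maps induced on quotients and on cohomology\<close>

lemma quotient_map:
  assumes M: "module R M" "submodule N R M" and M': "module R M'" "submodule N' R M'"
    and t: "t \<in> mod_hom R M M'" "\<And>x. x \<in> N \<Longrightarrow> t x \<in> N'"
  shows "\<exists>u\<in>mod_hom R (quotient_module M N) (quotient_module M' N'). 
    \<forall>x\<in>carrier M. u (N +>\<^bsub>M\<^esub> x) = N' +>\<^bsub>M'\<^esub> t x"
proof -
  define u where "u K = N' +>\<^bsub>M'\<^esub> t (SOME x. x \<in> carrier M \<and> N +>\<^bsub>M\<^esub> x = K)" for K
  have u: "u (N +>\<^bsub>M\<^esub> x) = N' +>\<^bsub>M'\<^esub> t x" if x: "x \<in> carrier M" for x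
  proof -
    define y where "y = (SOME y. y \<in> carrier M \<and> N +>\<^bsub>M\<^esub> y = N +>\<^bsub>M\<^esub> x)"
    have y: "y \<in> carrier M \<and> N +>\<^bsub>M\<^esub> y = N +>\<^bsub>M\<^esub> x"
      unfolding y_def by (rule someI[of _ x]) (use x in auto)
    then have "t (y \<oplus>\<^bsub>M\<^esub> (\<ominus> \<one>) \<odot>\<^bsub>M\<^esub> x) \<in> N'" using t(2) coset_eq_iff[OF M] x by auto
    then show ?thesis
      unfolding u_def y_def[symmetric] using x y M(1) 
      by (simp add: coset_eq_iff[OF M'] hom_closed[OF t(1)] hom_add[OF t(1)] hom_smult[OF t(1)])
  qed
  have "u \<in> mod_hom R (quotient_module M N) (quotient_module M' N')"
    using u M(1) by (intro mod_homI)
     (auto simp: quotient_carrier[OF M] quotient_carrier[OF M'] quotient_add[OF M] quotient_add[OF M']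
       quotient_smult[OF M] quotient_smult[OF M'] hom_closed[OF t(1)] hom_add[OF t(1)] hom_smult[OF t(1)])
  then show ?thesis using u by blast
qed

lemma quotient_iso:
  assumes M: "module R M" "submodule N R M" and M': "module R M'" "submodule N' R M'"
    and t: "t \<in> mod_hom R M M'" "\<And>x. x \<in> N \<Longrightarrow> t x \<in> N'"
    and inj: "\<And>x. \<lbrakk>x \<in> carrier M; t x \<in> N'\<rbrakk> \<Longrightarrow> x \<in> N"
    and surj: "\<And>y. y \<in> carrier M' \<Longrightarrow> \<exists>x\<in>carrier M. \<exists>b\<in>N'. y = t x \<oplus>\<^bsub>M'\<^esub> b"
  shows "mod_isomorphic R (quotient_module M N) (quotient_module M' N')"
proof -
  obtain u where u: "u \<in> mod_hom R (quotient_module M N) (quotient_module M' N')"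
    "\<And>x. x \<in> carrier M \<Longrightarrow> u (N +>\<^bsub>M\<^esub> x) = N' +>\<^bsub>M'\<^esub> t x"
    using quotient_map[OF M M' t] by blast
  show ?thesis
  proof (rule mod_isomorphicI[OF u(1)])
    show "inj_on u (carrier (quotient_module M N))"
      unfolding hom_inj_iff[OF quotient_is_module[OF M] quotient_is_module[OF M'] u(1)]
      using u(2) M M' inj 
      by (auto simp: quotient_carrier[OF M] coset_zero_iff[OF M] coset_zero_iff[OF M'] hom_closed[OF t(1)])
    have "N' +>\<^bsub>M'\<^esub> y \<in> u ` carrier (quotient_module M N)" if y: "y \<in> carrier M'" for y
    proof -
      obtain x b where x: "x \<in> carrier M" "b \<in> N'" "y = t x \<oplus>\<^bsub>M'\<^esub> b" using surj[OF y] by blast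
      have b: "b \<in> carrier M'" using x(2) submodule_carr[OF M'] by auto
      have "y \<oplus>\<^bsub>M'\<^esub> (\<ominus> \<one>) \<odot>\<^bsub>M'\<^esub> t x = b"
        using x b M'(1) hom_closed[OF t(1) x(1)] by (simp add: madd_comm[of M' "t x"] madd_assoc)
      then have "N' +>\<^bsub>M'\<^esub> y = N' +>\<^bsub>M'\<^esub> t x"
        using x(2) y hom_closed[OF t(1) x(1)] by (simp add: coset_eq_iff[OF M'])
      then show ?thesis using u(2)[OF x(1)] x(1) by (auto simp: quotient_carrier[OF M])
    qed
    then show "u ` carrier (quotient_module M N) = carrier (quotient_module M' N')"
      using u(1) hom_closed[OF u(1)] by (auto simp: quotient_carrier[OF M'])
  qed
qed

text \<open>A single linear map \<open>t\<close> between terms of possibly different degrees is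
  enough. This admits the connecting map of an extension of complexes, which raises the
  degree.\<close>

lemma cohomology_iso:
  assumes C: "is_complex R C d" and C': "is_complex R C' d'"
    and t: "t \<in> mod_hom R (C n) (C' m)"
      "\<And>x. x \<in> cocycles C d n \<Longrightarrow> t x \<in> cocycles C' d' m"
      "\<And>x. x \<in> coboundaries C d n \<Longrightarrow> t x \<in> coboundaries C' d' m"
      "\<And>x. \<lbrakk>x \<in> cocycles C d n; t x \<in> coboundaries C' d' m\<rbrakk> \<Longrightarrow> x \<in> coboundaries C d n"
      "\<And>y. y \<in> cocycles C' d' m \<Longrightarrow> \<exists>x\<in>cocycles C d n. \<exists>b\<in>coboundaries C' d' m. y = t x \<oplus>\<^bsub>C' m\<^esub> b"
  shows "mod_isomorphic R (cohomology_module C d n) (cohomology_module C' d' m)"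
  unfolding cohomology_module_alt
  using t submodule_carr[OF complexD(1)[OF C] cocycles_submodule[OF C]]
  by (intro quotient_iso[where t = t] cocycle_module[OF C] cocycle_module[OF C'] hom_restrict_cod hom_restrict_dom) auto

lemma chain_map_cocycles:
  assumes "is_complex R C d" "is_complex R C' d'" "chain_map R C d C' d' \<phi>" "x \<in> cocycles C d n"
  shows "\<phi> n x \<in> cocycles C' d' n"
proof -
  have x: "x \<in> carrier (C n)" "d n x = \<zero>\<^bsub>C (Suc n)\<^esub>" using assms(4) by (auto simp: cocycles_iff)
  have h: "\<phi> n \<in> mod_hom R (C n) (C' n)" for n using assms(3) by (simp add: chain_map_def)
  have "d' n (\<phi> n x) = \<phi> (Suc n) (d n x)" using assms(3) x(1) by (simp add: chain_map_def)
  then show ?thesis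
    using x hom_closed[OF h] hom_zero[OF _ _ h] complexD(1)[OF assms(1)] complexD(1)[OF assms(2)]
    by (simp add: cocycles_iff)
qed

lemma chain_map_coboundaries:
  assumes "is_complex R C d" "is_complex R C' d'" "chain_map R C d C' d' \<phi>" "x \<in> coboundaries C d n"
  shows "\<phi> n x \<in> coboundaries C' d' n"
proof -
  have h: "\<phi> n \<in> mod_hom R (C n) (C' n)" for n using assms(3) by (simp add: chain_map_def)
  show ?thesis
  proof (cases n)
    case 0
    then show ?thesis using assms(4) hom_zero[OF complexD(1)[OF assms(1)] complexD(1)[OF assms(2)] h]
      by (simp add: coboundaries_0)
  next
    case (Suc k)
    then obtain y where "y \<in> carrier (C k)" "x = d k y" using assms(4) by (auto simp: coboundaries_Suc)
    then show ?thesis using assms(3) hom_closed[OF h] Suc by (auto simp: chain_map_def coboundaries_Suc)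
  qed
qed

lemma homotopy_cocycle:
  assumes "is_complex R C d" "is_complex R C' d'" "chain_map R C d C' d' \<psi>"
    "chain_homotopy R C d C' d' \<phi> \<psi> s" "x \<in> cocycles C d n"
  shows "\<exists>b\<in>coboundaries C' d' n. \<phi> n x = \<psi> n x \<oplus>\<^bsub>C' n\<^esub> b"
proof -
  have x: "x \<in> carrier (C n)" "d n x = \<zero>\<^bsub>C (Suc n)\<^esub>" using assms(5) by (auto simp: cocycles_iff)
  have s: "s n \<in> mod_hom R (C (Suc n)) (C' n)" for n using assms(4) by (simp add: chain_homotopy_def)
  have s0: "s n (d n x) = \<zero>\<^bsub>C' n\<^esub>"
    using x hom_zero[OF complexD(1)[OF assms(1)] complexD(1)[OF assms(2)] s] by simp
  show ?thesis
  proof (cases n)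
    case 0
    then show ?thesis using assms(4) x s0 by (simp add: chain_homotopy_def coboundaries_0)
  next
    case (Suc k)
    have sx: "s k x \<in> carrier (C' k)" using hom_closed[OF s] x Suc by simp
    then have "d' k (s k x) \<in> carrier (C' n)" using hom_closed[OF complexD(2)[OF assms(2)]] Suc by simp
    then have "\<phi> n x = \<psi> n x \<oplus>\<^bsub>C' n\<^esub> d' k (s k x)"
      using assms(4) x s0 Suc complexD(1)[OF assms(2)] by (simp add: chain_homotopy_def)
    then show ?thesis using sx Suc by (auto simp: coboundaries_Suc)
  qed
qed

lemma chain_map_comp:
  "\<lbrakk>chain_map R C d C' d' \<phi>; chain_map R C' d' C'' d'' \<psi>\<rbrakk> \<Longrightarrow> chain_map R C d C'' d'' (\<lambda>n x. \<psi> n (\<phi> n x))"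
  unfolding chain_map_def by (metis hom_comp hom_closed)

lemma chain_map_id: "chain_map R C d C d (\<lambda>n x. x)"
  by (auto simp: chain_map_def hom_id)

lemma homotopy_equivalence_cohomology_iso:
  assumes C: "is_complex R C d" and C': "is_complex R C' d'"
    and f: "chain_map R C d C' d' \<phi>" and g: "chain_map R C' d' C d \<psi>"
    and s: "chain_homotopy R C d C d (\<lambda>n x. x) (\<lambda>n x. \<psi> n (\<phi> n x)) s"
    and s': "chain_homotopy R C' d' C' d' (\<lambda>n x. x) (\<lambda>n x. \<phi> n (\<psi> n x)) s'"
  shows "mod_isomorphic R (cohomology_module C d n) (cohomology_module C' d' n)"
proof (rule cohomology_iso[OF C C', where t = "\<phi> n"])
  show "\<phi> n \<in> mod_hom R (C n) (C' n)" using f by (simp add: chain_map_def)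
  show "\<phi> n x \<in> cocycles C' d' n" if "x \<in> cocycles C d n" for x
    using chain_map_cocycles[OF C C' f that] .
  show "\<phi> n x \<in> coboundaries C' d' n" if "x \<in> coboundaries C d n" for x
    using chain_map_coboundaries[OF C C' f that] .
  show "x \<in> coboundaries C d n" if x: "x \<in> cocycles C d n" "\<phi> n x \<in> coboundaries C' d' n" for x
  proof -
    obtain b where "b \<in> coboundaries C d n" "x = \<psi> n (\<phi> n x) \<oplus>\<^bsub>C n\<^esub> b"
      using homotopy_cocycle[OF C C chain_map_comp[OF f g] s x(1)] by auto
    then show ?thesis
      using submodule_add[OF complexD(1)[OF C] coboundaries_submodule[OF C]] chain_map_coboundaries[OF C' C g x(2)] by metis
  qed
  show "\<exists>x\<in>cocycles C d n. \<exists>b\<in>coboundaries C' d' n. y = \<phi> n x \<oplus>\<^bsub>C' n\<^esub> b" if y: "y \<in> cocycles C' d' n" for y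
    using homotopy_cocycle[OF C' C' chain_map_comp[OF g f] s' y] chain_map_cocycles[OF C' C g y] by blast
qed

section \<open>Comparison of injective resolutions\<close>

lemma coresolutionD:
  assumes "coresolution R M \<epsilon> E d"
  shows "module R M" "is_complex R E d" "\<epsilon> \<in> mod_hom R M (E 0)" "inj_on \<epsilon> (carrier M)"
    "m \<in> carrier M \<Longrightarrow> d 0 (\<epsilon> m) = \<zero>\<^bsub>E (Suc 0)\<^esub>"
    "\<lbrakk>x \<in> carrier (E 0); d 0 x = \<zero>\<^bsub>E (Suc 0)\<^esub>\<rbrakk> \<Longrightarrow> \<exists>m\<in>carrier M. x = \<epsilon> m"
    "\<lbrakk>x \<in> carrier (E (Suc n)); d (Suc n) x = \<zero>\<^bsub>E (Suc (Suc n))\<^esub>\<rbrakk> \<Longrightarrow> \<exists>y\<in>carrier (E n). x = d n y"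
  using assms by (auto simp: coresolution_def mod_ker_def set_eq_iff image_iff)

lemma baer_resolutionD:
  assumes "baer_resolution R M \<epsilon> E d"
  shows "coresolution R M \<epsilon> E d" "baer_module R (E n)"
  using assms by (auto simp: baer_resolution_def)

lemma coresolutionI:
  assumes "module R M" "is_complex R E d" "\<epsilon> \<in> mod_hom R M (E 0)"
    "\<And>m. \<lbrakk>m \<in> carrier M; \<epsilon> m = \<zero>\<^bsub>E 0\<^esub>\<rbrakk> \<Longrightarrow> m = \<zero>\<^bsub>M\<^esub>"
    "\<And>m. m \<in> carrier M \<Longrightarrow> d 0 (\<epsilon> m) = \<zero>\<^bsub>E (Suc 0)\<^esub>"
    "\<And>x. \<lbrakk>x \<in> carrier (E 0); d 0 x = \<zero>\<^bsub>E (Suc 0)\<^esub>\<rbrakk> \<Longrightarrow> \<exists>m\<in>carrier M. x = \<epsilon> m"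
    "\<And>n x. \<lbrakk>x \<in> carrier (E (Suc n)); d (Suc n) x = \<zero>\<^bsub>E (Suc (Suc n))\<^esub>\<rbrakk> \<Longrightarrow> \<exists>y\<in>carrier (E n). x = d n y"
  shows "coresolution R M \<epsilon> E d"
  unfolding coresolution_def
proof (intro conjI allI)
  show "inj_on \<epsilon> (carrier M)"
    using hom_inj_iff[OF assms(1) complexD(1)[OF assms(2)] assms(3)] assms(4) by blast
  show "\<epsilon> ` carrier M = mod_ker (E 0) (E 1) (d 0)"
    using assms(5,6) hom_closed[OF assms(3)] by (fastforce simp: mod_ker_def)
  show "d n ` carrier (E n) = mod_ker (E (Suc n)) (E (Suc (Suc n))) (d (Suc n))" for n
    using assms(7)[of _ n] complexD(3)[OF assms(2), of _ n] hom_closed[OF complexD(2)[OF assms(2)], of _ n]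
    by (fastforce simp: mod_ker_def)
qed fact+

text \<open>Degree by degree through injectivity of the terms of \<open>E'\<close>. Extending along
  \<open>d n\<close> requires that the prescribed map kills the cocycles, so the induction carries
  along that \<open>d' n\<close> after \<open>\<phi>\<close> vanishes on them; this is the last
  clause of \<open>?P\<close>.\<close>

lemma chain_lift:
  assumes E: "coresolution R M \<epsilon> E d" and E': "baer_resolution R N \<eta> E' d'" and f: "f \<in> mod_hom R M N"
  shows "\<exists>\<phi>. chain_map R E d E' d' \<phi> \<and> (\<forall>m\<in>carrier M. \<phi> 0 (\<epsilon> m) = \<eta> (f m))"
proof -
  note Er = coresolutionD[OF E] and Er' = coresolutionD[OF baer_resolutionD(1)[OF E']]
  note c = complexD[OF Er(2)] and c' = complexD[OF Er'(2)] and b = baer_resolutionD(2)[OF E']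
  let ?P = "\<lambda>n \<phi>. \<phi> \<in> mod_hom R (E n) (E' n) \<and> (n = 0 \<longrightarrow> (\<forall>m\<in>carrier M. \<phi> (\<epsilon> m) = \<eta> (f m))) \<and>
    (\<forall>x\<in>carrier (E n). d n x = \<zero>\<^bsub>E (Suc n)\<^esub> \<longrightarrow> d' n (\<phi> x) = \<zero>\<^bsub>E' (Suc n)\<^esub>)"
  let ?Q = "\<lambda>n \<phi> \<phi>'. \<forall>x\<in>carrier (E n). \<phi>' (d n x) = d' n (\<phi> x)"
  have base: "\<exists>\<phi>. ?P 0 \<phi>"
  proof -
    have "\<exists>h\<in>mod_hom R (E 0) (E' 0). \<forall>m\<in>carrier M. h (\<epsilon> m) = \<eta> (f m)"
      using Er(4) hom_inj_iff[OF Er(1) c(1) Er(3)] hom_zero[OF Er(1) c'(1) hom_comp[OF f Er'(3)]]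
      by (intro baer_extend[OF Er(1) c(1) b Er(3) hom_comp[OF f Er'(3)]]) auto
    then obtain h where h: "h \<in> mod_hom R (E 0) (E' 0)" "\<forall>m\<in>carrier M. h (\<epsilon> m) = \<eta> (f m)" by blast
    moreover have "d' 0 (h x) = \<zero>\<^bsub>E' (Suc 0)\<^esub>" if "x \<in> carrier (E 0)" "d 0 x = \<zero>\<^bsub>E (Suc 0)\<^esub>" for x
      using Er(6)[OF that] h(2) Er'(5) hom_closed[OF f] by auto
    ultimately show ?thesis by blast
  qed
  have step: "\<exists>\<phi>'. ?P (Suc n) \<phi>' \<and> ?Q n \<phi> \<phi>'" if P: "?P n \<phi>" for \<phi> n
  proof -
    have "\<exists>h\<in>mod_hom R (E (Suc n)) (E' (Suc n)). \<forall>x\<in>carrier (E n). h (d n x) = d' n (\<phi> x)"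
      using P by (intro baer_extend[OF c(1) c(1) b c(2)] hom_comp[OF _ c'(2)]) auto
    then obtain h where h: "h \<in> mod_hom R (E (Suc n)) (E' (Suc n))" "\<forall>x\<in>carrier (E n). h (d n x) = d' n (\<phi> x)" by blast
    moreover have "d' (Suc n) (h x) = \<zero>\<^bsub>E' (Suc (Suc n))\<^esub>"
      if "x \<in> carrier (E (Suc n))" "d (Suc n) x = \<zero>\<^bsub>E (Suc (Suc n))\<^esub>" for x
      using Er(7)[OF that] h(2) c'(3) hom_closed P by fastforce
    ultimately show ?thesis by (intro exI[of _ h]) simp
  qed
  have "\<exists>\<phi>. \<forall>n. ?P n (\<phi> n) \<and> ?Q n (\<phi> n) (\<phi> (Suc n))"
    using base step by (rule dependent_nat_choice[of ?P ?Q])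
  then obtain \<phi> where "\<forall>n. ?P n (\<phi> n) \<and> ?Q n (\<phi> n) (\<phi> (Suc n))"
    by (elim exE)
  then show ?thesis by (intro exI[of _ \<phi>]) (simp add: chain_map_def)
qed

text \<open>Each component of the homotopy extends the defect left by the previous one along the
  differential. The last clause of \<open>?P\<close> states that this defect vanishes on cocycles,
  which is what the extension requires.\<close>

lemma chain_homotopy_exists:
  assumes E: "coresolution R M \<epsilon> E d" and E': "baer_resolution R N \<eta> E' d'"
    and f: "chain_map R E d E' d' \<phi>" and g: "chain_map R E d E' d' \<psi>"
    and eq: "\<And>m. m \<in> carrier M \<Longrightarrow> \<phi> 0 (\<epsilon> m) = \<psi> 0 (\<epsilon> m)"
  shows "\<exists>s. chain_homotopy R E d E' d' \<phi> \<psi> s"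
proof -
  note Er = coresolutionD[OF E] and Er' = coresolutionD[OF baer_resolutionD(1)[OF E']]
  note c = complexD[OF Er(2)] and c' = complexD[OF Er'(2)] and b = baer_resolutionD(2)[OF E']
  have fh: "\<phi> n \<in> mod_hom R (E n) (E' n)" and gh: "\<psi> n \<in> mod_hom R (E n) (E' n)" for n
    using f g by (auto simp: chain_map_def)
  have fd: "\<phi> (Suc n) (d n x) = d' n (\<phi> n x)" and gd: "\<psi> (Suc n) (d n x) = d' n (\<psi> n x)"
    if "x \<in> carrier (E n)" for n x
    using f g that by (auto simp: chain_map_def)
  let ?P = "\<lambda>n s. s \<in> mod_hom R (E (Suc n)) (E' n) \<and>
    (n = 0 \<longrightarrow> (\<forall>x\<in>carrier (E 0). \<phi> 0 x = \<psi> 0 x \<oplus>\<^bsub>E' 0\<^esub> s (d 0 x))) \<and>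
    (\<forall>x\<in>carrier (E (Suc n)). d (Suc n) x = \<zero>\<^bsub>E (Suc (Suc n))\<^esub> \<longrightarrow>
       \<phi> (Suc n) x = \<psi> (Suc n) x \<oplus>\<^bsub>E' (Suc n)\<^esub> d' n (s x))"
  let ?Q = "\<lambda>n s s'. \<forall>x\<in>carrier (E (Suc n)). 
    \<phi> (Suc n) x = \<psi> (Suc n) x \<oplus>\<^bsub>E' (Suc n)\<^esub> (d' n (s x) \<oplus>\<^bsub>E' (Suc n)\<^esub> s' (d (Suc n) x))"
  have base: "\<exists>s. ?P 0 s"
  proof -
    let ?g = "\<lambda>x. \<phi> 0 x \<oplus>\<^bsub>E' 0\<^esub> (\<ominus> \<one>) \<odot>\<^bsub>E' 0\<^esub> \<psi> 0 x"
    have "?g \<in> mod_hom R (E 0) (E' 0)"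
      by (intro hom_plus hom_times c c' fh gh) auto
    moreover have "?g x = \<zero>\<^bsub>E' 0\<^esub>" if x: "x \<in> carrier (E 0)" "d 0 x = \<zero>\<^bsub>E (Suc 0)\<^esub>" for x
      using Er(6)[OF x] eq hom_closed[OF Er(3)] hom_closed[OF gh] c'(1) by auto
    ultimately obtain s where s: "s \<in> mod_hom R (E (Suc 0)) (E' 0)" "\<forall>x\<in>carrier (E 0). s (d 0 x) = ?g x"
      using baer_extend[OF c(1) c(1) b c(2), of ?g 0] by blast
    have 0: "\<phi> 0 x = \<psi> 0 x \<oplus>\<^bsub>E' 0\<^esub> s (d 0 x)" if x: "x \<in> carrier (E 0)" for x
      using s(2) x hom_closed[OF fh x] hom_closed[OF gh x] c'(1) by (simp add: madd_neg_cancel2)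
    have "\<phi> (Suc 0) x = \<psi> (Suc 0) x \<oplus>\<^bsub>E' (Suc 0)\<^esub> d' 0 (s x)"
      if x: "x \<in> carrier (E (Suc 0))" "d (Suc 0) x = \<zero>\<^bsub>E (Suc (Suc 0))\<^esub>" for x
    proof -
      obtain y where y: "y \<in> carrier (E 0)" "x = d 0 y" using Er(7)[OF x] by blast
      have "\<phi> (Suc 0) x = d' 0 (\<psi> 0 y \<oplus>\<^bsub>E' 0\<^esub> s (d 0 y))" using fd[OF y(1)] y(2) 0[OF y(1)] by simp
      then show ?thesis
        using gd[OF y(1)] y x(1) hom_add[OF c'(2)] hom_closed[OF gh y(1)] hom_closed[OF s(1)] by simp
    qed
    then show ?thesis using s(1) 0 by blast
  qed
  have step: "\<exists>s'. ?P (Suc n) s' \<and> ?Q n s s'" if P: "?P n s" for s n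
  proof -
    have sh: "s \<in> mod_hom R (E (Suc n)) (E' n)" using P by blast
    let ?e = "E' (Suc n)"
    let ?g = "\<lambda>x. \<phi> (Suc n) x \<oplus>\<^bsub>?e\<^esub> (\<ominus> \<one>) \<odot>\<^bsub>?e\<^esub> (\<psi> (Suc n) x \<oplus>\<^bsub>?e\<^esub> d' n (s x))"
    have u: "(\<lambda>x. \<psi> (Suc n) x \<oplus>\<^bsub>?e\<^esub> d' n (s x)) \<in> mod_hom R (E (Suc n)) ?e"
      by (intro hom_plus c c' gh hom_comp[OF sh c'(2)])
    then have "?g \<in> mod_hom R (E (Suc n)) ?e"
      by (rule hom_plus[OF c(1) c'(1) fh hom_times[OF c(1) c'(1)]]) simp
    moreover have "?g x = \<zero>\<^bsub>?e\<^esub>" if x: "x \<in> carrier (E (Suc n))" "d (Suc n) x = \<zero>\<^bsub>E (Suc (Suc n))\<^esub>" for x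
      using P x hom_closed[OF u] c'(1) by auto
    ultimately obtain s' where s': "s' \<in> mod_hom R (E (Suc (Suc n))) ?e" "\<forall>x\<in>carrier (E (Suc n)). s' (d (Suc n) x) = ?g x"
      using baer_extend[OF c(1) c(1) b c(2), of ?g "Suc n"] by blast
    have q: "\<phi> (Suc n) x = \<psi> (Suc n) x \<oplus>\<^bsub>?e\<^esub> (d' n (s x) \<oplus>\<^bsub>?e\<^esub> s' (d (Suc n) x))" if x: "x \<in> carrier (E (Suc n))" for x
    proof -
      have cl: "\<phi> (Suc n) x \<in> carrier ?e" "\<psi> (Suc n) x \<in> carrier ?e" "d' n (s x) \<in> carrier ?e" "s' (d (Suc n) x) \<in> carrier ?e"
        using x hom_closed[OF fh x] hom_closed[OF gh x] hom_closed[OF c'(2) hom_closed[OF sh x]]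
          hom_closed[OF s'(1) hom_closed[OF c(2) x]] by auto
      then have "\<phi> (Suc n) x = (\<psi> (Suc n) x \<oplus>\<^bsub>?e\<^esub> d' n (s x)) \<oplus>\<^bsub>?e\<^esub> s' (d (Suc n) x)"
        using s'(2) x c'(1)[of "Suc n"] madd_neg_cancel2[OF c'(1)[of "Suc n"]] by simp
      then show ?thesis using cl c'(1)[of "Suc n"] by (simp add: madd_assoc)
    qed
    have "\<phi> (Suc (Suc n)) x = \<psi> (Suc (Suc n)) x \<oplus>\<^bsub>E' (Suc (Suc n))\<^esub> d' (Suc n) (s' x)"
      if x: "x \<in> carrier (E (Suc (Suc n)))" "d (Suc (Suc n)) x = \<zero>\<^bsub>E (Suc (Suc (Suc n)))\<^esub>" for x
    proof -
      obtain y where y: "y \<in> carrier (E (Suc n))" "x = d (Suc n) y" using Er(7)[OF x] by blast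
      have cl: "\<psi> (Suc n) y \<in> carrier ?e" "d' n (s y) \<in> carrier ?e" "s' x \<in> carrier ?e" "s y \<in> carrier (E' n)"
        using hom_closed[OF gh y(1)] hom_closed[OF c'(2) hom_closed[OF sh y(1)]]
          hom_closed[OF s'(1) x(1)] hom_closed[OF sh y(1)] by auto
      have "\<phi> (Suc (Suc n)) x = d' (Suc n) (\<psi> (Suc n) y \<oplus>\<^bsub>?e\<^esub> (d' n (s y) \<oplus>\<^bsub>?e\<^esub> s' x))"
        using fd[OF y(1)] y(2) q[OF y(1)] by simp
      also have "\<dots> = d' (Suc n) (\<psi> (Suc n) y) \<oplus>\<^bsub>E' (Suc (Suc n))\<^esub>
          (d' (Suc n) (d' n (s y)) \<oplus>\<^bsub>E' (Suc (Suc n))\<^esub> d' (Suc n) (s' x))"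
        using cl c'(1)[of "Suc n"] by (simp add: hom_add[OF c'(2)])
      also have "\<dots> = \<psi> (Suc (Suc n)) x \<oplus>\<^bsub>E' (Suc (Suc n))\<^esub> d' (Suc n) (s' x)"
        using c'(3)[OF cl(4)] gd[OF y(1)] y(2) c'(1)[of "Suc (Suc n)"] hom_closed[OF c'(2) cl(3)] by simp
      finally show ?thesis .
    qed
    then show ?thesis using s'(1) q by (intro exI[of _ s']) simp
  qed
  have "\<exists>s. \<forall>n. ?P n (s n) \<and> ?Q n (s n) (s (Suc n))"
    using base step by (rule dependent_nat_choice[of ?P ?Q])
  then obtain s where s: "\<forall>n. ?P n (s n) \<and> ?Q n (s n) (s (Suc n))"
    by (elim exE)
  then show ?thesis by (intro exI[of _ s]) (simp add: chain_homotopy_def)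
qed

end

section \<open>Derived functors of torsion functors\<close>

text \<open>Both functors of the theorem are of this form: \<open>{I}\<close> gives the functor \<open>Hom(R/I, -)\<close>, and the
  powers of \<open>I\<close> give the \<open>I\<close>-torsion functor.\<close>

definition torsion_part :: "'a set set \<Rightarrow> ('a, 'm) module \<Rightarrow> ('a, 'm) module" where
  "torsion_part F M = M\<lparr>carrier := {x \<in> carrier M. \<exists>J\<in>F. \<forall>r\<in>J. r \<odot>\<^bsub>M\<^esub> x = \<zero>\<^bsub>M\<^esub>}\<rparr>"

text \<open>A base of a filter of ideals: any two members contain a common third, which makes the
  sum of two torsion elements torsion.\<close>

definition ideal_filter :: "('a, 'r) ring_scheme \<Rightarrow> 'a set set \<Rightarrow> bool" where
  "ideal_filter R F \<longleftrightarrow> F \<noteq> {} \<and> (\<forall>J\<in>F. ideal J R) \<and> (\<forall>J\<in>F. \<forall>K\<in>F. \<exists>L\<in>F. L \<subseteq> J \<inter> K)"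

lemma torsion_part_simps [simp]:
  "carrier (torsion_part F M) = {x \<in> carrier M. \<exists>J\<in>F. \<forall>r\<in>J. r \<odot>\<^bsub>M\<^esub> x = \<zero>\<^bsub>M\<^esub>}"
  "\<zero>\<^bsub>torsion_part F M\<^esub> = \<zero>\<^bsub>M\<^esub>" "ring.add (torsion_part F M) = ring.add M"
  "smult (torsion_part F M) = smult M"
  by (simp_all add: torsion_part_def)

context cring
begin

lemma ideal_filterD:
  assumes "ideal_filter R F"
  shows "J \<in> F \<Longrightarrow> ideal J R" "\<lbrakk>J \<in> F; r \<in> J\<rbrakk> \<Longrightarrow> r \<in> carrier R"
    "\<lbrakk>J \<in> F; K \<in> F\<rbrakk> \<Longrightarrow> \<exists>L\<in>F. L \<subseteq> J \<and> L \<subseteq> K"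
  using assms by (auto simp: ideal_filter_def dest: ideal.Icarr)

lemma torsion_submodule:
  assumes F: "ideal_filter R F" and M: "module R M"
  shows "submodule (carrier (torsion_part F M)) R M"
proof (rule submoduleI'[OF M])
  obtain J0 where J0: "J0 \<in> F" using F by (auto simp: ideal_filter_def)
  have Jc: "J \<subseteq> carrier R" if "J \<in> F" for J using F that ideal_carr by (auto simp: ideal_filter_def)
  show "\<zero>\<^bsub>M\<^esub> \<in> carrier (torsion_part F M)" using J0 Jc[OF J0] M by (auto intro!: bexI[of _ J0])
  show "x \<oplus>\<^bsub>M\<^esub> y \<in> carrier (torsion_part F M)"
    if xy: "x \<in> carrier (torsion_part F M)" "y \<in> carrier (torsion_part F M)" for x y
  proof -
    obtain J K where *: "J \<in> F" "K \<in> F" "\<forall>r\<in>J. r \<odot>\<^bsub>M\<^esub> x = \<zero>\<^bsub>M\<^esub>" "\<forall>r\<in>K. r \<odot>\<^bsub>M\<^esub> y = \<zero>\<^bsub>M\<^esub>"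
      using xy by auto
    obtain L where L: "L \<in> F" "L \<subseteq> J" "L \<subseteq> K" using ideal_filterD(3)[OF F *(1,2)] by auto
    have "r \<odot>\<^bsub>M\<^esub> (x \<oplus>\<^bsub>M\<^esub> y) = \<zero>\<^bsub>M\<^esub>" if "r \<in> L" for r
    proof -
      have "r \<in> carrier R" "r \<odot>\<^bsub>M\<^esub> x = \<zero>\<^bsub>M\<^esub>" "r \<odot>\<^bsub>M\<^esub> y = \<zero>\<^bsub>M\<^esub>"
        using that L * Jc[OF L(1)] by auto
      then show ?thesis using xy M by (simp add: msmult_add_right)
    qed
    then show ?thesis using L(1) xy M by auto
  qed
  show "r \<odot>\<^bsub>M\<^esub> x \<in> carrier (torsion_part F M)" if r: "r \<in> carrier R" and x: "x \<in> carrier (torsion_part F M)" for r x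
  proof -
    obtain J where J: "J \<in> F" "\<forall>r\<in>J. r \<odot>\<^bsub>M\<^esub> x = \<zero>\<^bsub>M\<^esub>" using x by auto
    have "s \<odot>\<^bsub>M\<^esub> (r \<odot>\<^bsub>M\<^esub> x) = \<zero>\<^bsub>M\<^esub>" if s: "s \<in> J" for s
    proof -
      have sc: "s \<in> carrier R" using Jc[OF J(1)] s by auto
      have "s \<odot>\<^bsub>M\<^esub> (r \<odot>\<^bsub>M\<^esub> x) = r \<odot>\<^bsub>M\<^esub> (s \<odot>\<^bsub>M\<^esub> x)"
        using x by (intro msmult_comm[OF M sc r]) simp
      then show ?thesis using J(2) s r M by simp
    qed
    then show ?thesis using J(1) r x M by auto
  qed
qed auto

lemma torsion_is_module: "\<lbrakk>ideal_filter R F; module R M\<rbrakk> \<Longrightarrow> module R (torsion_part F M)"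
  using submodule_restrict[OF _ torsion_submodule] by (simp add: torsion_part_def)

lemma torsion_hom:
  assumes "ideal_filter R F" "module R M" "module R N" "f \<in> mod_hom R M N" "x \<in> carrier (torsion_part F M)"
  shows "f x \<in> carrier (torsion_part F N)"
proof -
  obtain J where J: "J \<in> F" "\<forall>r\<in>J. r \<odot>\<^bsub>M\<^esub> x = \<zero>\<^bsub>M\<^esub>" and x: "x \<in> carrier M" using assms(5) by auto
  have "r \<odot>\<^bsub>N\<^esub> f x = \<zero>\<^bsub>N\<^esub>" if "r \<in> J" for r
    using J(2) that hom_smult[OF assms(4) _ x, of r] hom_zero[OF assms(2-4)] ideal_filterD(2)[OF assms(1) J(1)]
    by auto
  then show ?thesis using J(1) hom_closed[OF assms(4) x] by auto
qed

lemma torsion_reflect: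
  assumes "ideal_filter R F" "module R M" "module R N" "f \<in> mod_hom R M N" "inj_on f (carrier M)"
    "x \<in> carrier M" "f x \<in> carrier (torsion_part F N)"
  shows "x \<in> carrier (torsion_part F M)"
proof -
  obtain J where J: "J \<in> F" "\<forall>r\<in>J. r \<odot>\<^bsub>N\<^esub> f x = \<zero>\<^bsub>N\<^esub>" using assms(7) by auto
  have "r \<odot>\<^bsub>M\<^esub> x = \<zero>\<^bsub>M\<^esub>" if r: "r \<in> J" for r
  proof -
    have "r \<in> carrier R" using assms(1) J(1) r by (auto simp: ideal_filter_def dest: ideal.Icarr)
    then show ?thesis
      using J(2) r hom_smult[OF assms(4) _ assms(6), of r] assms(2,6) assms(5)[unfolded hom_inj_iff[OF assms(2-4)]] by auto
  qed
  then show ?thesis using J(1) assms(6) by auto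
qed

lemma torsion_part_hom:
  assumes "ideal_filter R F" "module R M" "module R N" "f \<in> mod_hom R M N"
  shows "f \<in> mod_hom R (torsion_part F M) (torsion_part F N)"
  using torsion_hom[OF assms] assms(4) by (auto simp: mod_hom_def)

lemma torsion_complex:
  "\<lbrakk>ideal_filter R F; is_complex R E d\<rbrakk> \<Longrightarrow> is_complex R (\<lambda>n. torsion_part F (E n)) d"
  by (auto simp: is_complex_def torsion_is_module intro: torsion_part_hom)

lemma torsion_chain_map:
  assumes "ideal_filter R F" "is_complex R C d" "is_complex R C' d'" "chain_map R C d C' d' \<phi>"
  shows "chain_map R (\<lambda>n. torsion_part F (C n)) d (\<lambda>n. torsion_part F (C' n)) d' \<phi>"
  using assms by (auto simp: chain_map_def is_complex_def intro: torsion_part_hom)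

lemma torsion_chain_homotopy:
  assumes "ideal_filter R F" "is_complex R C d" "is_complex R C' d'" "chain_homotopy R C d C' d' \<phi> \<psi> s"
  shows "chain_homotopy R (\<lambda>n. torsion_part F (C n)) d (\<lambda>n. torsion_part F (C' n)) d' \<phi> \<psi> s"
  using assms by (auto simp: chain_homotopy_def is_complex_def intro: torsion_part_hom)

text \<open>Isomorphic modules have homotopy equivalent resolutions, and a torsion functor keeps the
  underlying functions of maps, hence preserves chain maps and homotopies. So its derived functors
  may be computed from any resolution by injectives, on any type.\<close>

lemma derived_functor_iso:
  assumes F: "ideal_filter R F" and E: "baer_resolution R M \<epsilon> E d" and E': "baer_resolution R M' \<epsilon>' E' d'"
    and iso: "mod_isomorphic R M M'"
  shows "mod_isomorphic R (cohomology_module (\<lambda>n. torsion_part F (E n)) d n)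
    (cohomology_module (\<lambda>n. torsion_part F (E' n)) d' n)"
proof -
  note Er = baer_resolutionD(1)[OF E] and Er' = baer_resolutionD(1)[OF E']
  note c = coresolutionD(2)[OF Er] and c' = coresolutionD(2)[OF Er']
  obtain f where f: "f \<in> mod_hom R M M'" "inj_on f (carrier M)" "f ` carrier M = carrier M'"
    using iso by (auto simp: mod_isomorphic_def bij_betw_def)
  let ?g = "inv_into (carrier M) f"
  have g: "?g \<in> mod_hom R M' M" by (rule hom_inv[OF f(1) coresolutionD(1)[OF Er] coresolutionD(1)[OF Er'] f(2,3)])
  obtain \<phi> where p: "chain_map R E d E' d' \<phi>" "\<And>m. m \<in> carrier M \<Longrightarrow> \<phi> 0 (\<epsilon> m) = \<epsilon>' (f m)"
    using chain_lift[OF Er E' f(1)] by blast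
  obtain \<psi> where q: "chain_map R E' d' E d \<psi>" "\<And>m. m \<in> carrier M' \<Longrightarrow> \<psi> 0 (\<epsilon>' m) = \<epsilon> (?g m)"
    using chain_lift[OF Er' E g] by blast
  have "\<epsilon> m = \<psi> 0 (\<phi> 0 (\<epsilon> m))" if "m \<in> carrier M" for m
    using that p(2) q(2) f(2) hom_closed[OF f(1)] by simp
  then obtain s where s: "chain_homotopy R E d E d (\<lambda>n x. x) (\<lambda>n x. \<psi> n (\<phi> n x)) s"
    using chain_homotopy_exists[OF Er E chain_map_id chain_map_comp[OF p(1) q(1)]] by blast
  have "\<epsilon>' m = \<phi> 0 (\<psi> 0 (\<epsilon>' m))" if "m \<in> carrier M'" for m
    using that p(2) q(2) f(3) hom_closed[OF g] by (simp add: f_inv_into_f)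
  then obtain s' where s': "chain_homotopy R E' d' E' d' (\<lambda>n x. x) (\<lambda>n x. \<phi> n (\<psi> n x)) s'"
    using chain_homotopy_exists[OF Er' E' chain_map_id chain_map_comp[OF q(1) p(1)]] by blast
  show ?thesis
    using c c' p(1) q(1) s s' F
    by (intro homotopy_equivalence_cohomology_iso[where \<phi> = \<phi> and \<psi> = \<psi> and s = s and s' = s']
         torsion_complex torsion_chain_map torsion_chain_homotopy)
qed

lemma chain_iso_cohomology:
  assumes C: "is_complex R C d" and C': "is_complex R C' d'" and f: "chain_map R C d C' d' \<phi>"
    and b: "\<And>n. inj_on (\<phi> n) (carrier (C n))" "\<And>n. \<phi> n ` carrier (C n) = carrier (C' n)"
  shows "mod_isomorphic R (cohomology_module C d n) (cohomology_module C' d' n)"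
proof -
  note c = complexD[OF C] and c' = complexD[OF C']
  have fh: "\<phi> n \<in> mod_hom R (C n) (C' n)" and fd: "x \<in> carrier (C n) \<Longrightarrow> \<phi> (Suc n) (d n x) = d' n (\<phi> n x)" for n x
    using f by (auto simp: chain_map_def)
  let ?g = "\<lambda>n. inv_into (carrier (C n)) (\<phi> n)"
  have gh: "?g n \<in> mod_hom R (C' n) (C n)" for n
    by (rule hom_inv[OF fh c(1) c'(1) b])
  have gf: "?g n (\<phi> n x) = x" if "x \<in> carrier (C n)" for n x
    using b(1) that by simp
  have fg: "\<phi> n (?g n x) = x" if "x \<in> carrier (C' n)" for n x
    using b(2) that by (simp add: f_inv_into_f)
  have g: "chain_map R C' d' C d ?g"
    unfolding chain_map_def
  proof (intro conjI allI ballI gh)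
    fix n x assume x: "x \<in> carrier (C' n)"
    have "?g (Suc n) (d' n (\<phi> n (?g n x))) = ?g (Suc n) (\<phi> (Suc n) (d n (?g n x)))"
      using fd hom_closed[OF gh x] by simp
    also have "\<dots> = d n (?g n x)" using gf hom_closed[OF c(2) hom_closed[OF gh x]] .
    finally show "?g (Suc n) (d' n x) = d n (?g n x)" using fg x by simp
  qed
  show ?thesis
  proof (rule homotopy_equivalence_cohomology_iso[OF C C' f g])
    show "chain_homotopy R C d C d (\<lambda>n x. x) (\<lambda>n x. ?g n (\<phi> n x)) (\<lambda>n x. \<zero>\<^bsub>C n\<^esub>)"
      using c(1) gf hom_zero[OF c(1) c(1) c(2)] by (auto simp: chain_homotopy_def hom_const_zero)
    show "chain_homotopy R C' d' C' d' (\<lambda>n x. x) (\<lambda>n x. \<phi> n (?g n x)) (\<lambda>n x. \<zero>\<^bsub>C' n\<^esub>)"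
      using c'(1) fg hom_zero[OF c'(1) c'(1) c'(2)] by (auto simp: chain_homotopy_def hom_const_zero)
  qed
qed

lemma quotient_hom_lift:
  assumes M: "module R M" "submodule N R M" and L: "module R L"
    and t: "t \<in> mod_hom R M L" "\<And>x. x \<in> N \<Longrightarrow> t x = \<zero>\<^bsub>L\<^esub>"
  shows "\<exists>u\<in>mod_hom R (quotient_module M N) L. \<forall>x\<in>carrier M. u (N +>\<^bsub>M\<^esub> x) = t x"
proof -
  define u where "u K = t (SOME x. x \<in> carrier M \<and> N +>\<^bsub>M\<^esub> x = K)" for K
  have u: "u (N +>\<^bsub>M\<^esub> x) = t x" if x: "x \<in> carrier M" for x
  proof -
    define y where "y = (SOME y. y \<in> carrier M \<and> N +>\<^bsub>M\<^esub> y = N +>\<^bsub>M\<^esub> x)"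
    have y: "y \<in> carrier M \<and> N +>\<^bsub>M\<^esub> y = N +>\<^bsub>M\<^esub> x"
      unfolding y_def by (rule someI[of _ x]) (use x in auto)
    then have "t (y \<oplus>\<^bsub>M\<^esub> (\<ominus> \<one>) \<odot>\<^bsub>M\<^esub> x) = \<zero>\<^bsub>L\<^esub>" using t(2) coset_eq_iff[OF M] x by auto
    then have "t y = t x"
      using x y M(1) L by (simp add: meq_iff_diff hom_closed[OF t(1)] hom_add[OF t(1)] hom_smult[OF t(1)])
    then show ?thesis unfolding u_def y_def[symmetric] .
  qed
  have "u \<in> mod_hom R (quotient_module M N) L"
    using u M(1) by (intro mod_homI)
     (auto simp: quotient_carrier[OF M] quotient_add[OF M]
       quotient_smult[OF M] hom_closed[OF t(1)] hom_add[OF t(1)] hom_smult[OF t(1)])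
  then show ?thesis using u by blast
qed

lemma hom_module_is_module:
  assumes N: "module R N" and M: "module R M"
  shows "module R (hom_module R N M)"
proof -
  have r: "restrict f (carrier N) \<in> mod_hom R N M" if "f \<in> mod_hom R N M" for f
    using that N by (auto intro: hom_cong)
  show ?thesis
  proof (rule moduleI')
    show "x \<oplus>\<^bsub>hom_module R N M\<^esub> y \<in> carrier (hom_module R N M)"
      if "x \<in> carrier (hom_module R N M)" "y \<in> carrier (hom_module R N M)" for x y
      using that by (simp add: hom_module_def r hom_plus N M)
    show "\<zero>\<^bsub>hom_module R N M\<^esub> \<in> carrier (hom_module R N M)"
      by (simp add: hom_module_def r hom_const_zero M)
    show "k \<odot>\<^bsub>hom_module R N M\<^esub> y \<in> carrier (hom_module R N M)"
      if "k \<in> carrier R" "y \<in> carrier (hom_module R N M)" for k y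
      using that by (simp add: hom_module_def r hom_times N M)
  qed (auto simp: hom_module_def fun_eq_iff extensional_def hom_closed[of _ N M] M madd_assoc madd_comm madd_lcomm
        msmult_add_left msmult_add_right msmult_mult)
qed

section \<open>Hom(R/I, -) as a torsion functor\<close>

context
  fixes I assumes I: "ideal I R"
begin

abbreviation (input) "quot_ring \<equiv> quotient_module (regular_module R) I"

lemma ideal_regular_submodule: "submodule I R (regular_module R)"
  using I by (simp add: submodule_regular_iff)

lemma quot_ring_module: "module R quot_ring"
  by (rule quotient_is_module[OF regular_is_module ideal_regular_submodule])

lemma ideal_filter_single: "ideal_filter R {I}"
  using I by (simp add: ideal_filter_def)

text \<open>A linear map on the cyclic module R/I is determined by the image of the class of
  \<open>\<one>\<close>, and every element killed by \<open>I\<close> is such an image.\<close>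

lemma hom_quot_ring:
  assumes M: "module R M"
  shows "(\<lambda>f. f (I +>\<^bsub>regular_module R\<^esub> \<one>)) \<in> mod_hom R (hom_module R quot_ring M) (torsion_part {I} M)"
    and "inj_on (\<lambda>f. f (I +>\<^bsub>regular_module R\<^esub> \<one>)) (carrier (hom_module R quot_ring M))"
    and "(\<lambda>f. f (I +>\<^bsub>regular_module R\<^esub> \<one>)) ` carrier (hom_module R quot_ring M) = carrier (torsion_part {I} M)"
proof -
  let ?o = "I +>\<^bsub>regular_module R\<^esub> \<one>"
  let ?H = "hom_module R quot_ring M"
  note Q = regular_is_module ideal_regular_submodule
  have o: "?o \<in> carrier quot_ring" by (auto simp: quotient_carrier[OF Q])
  have ro: "r \<odot>\<^bsub>quot_ring\<^esub> ?o = I +>\<^bsub>regular_module R\<^esub> r" if "r \<in> carrier R" for r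
    using quotient_smult[OF Q that, of \<one>] that by simp
  have Hh: "f \<in> mod_hom R quot_ring M" if "f \<in> carrier ?H" for f using that by (simp add: hom_module_def)
  have fr: "f (I +>\<^bsub>regular_module R\<^esub> r) = r \<odot>\<^bsub>M\<^esub> f ?o" if "f \<in> carrier ?H" "r \<in> carrier R" for f r
    using hom_smult[OF Hh[OF that(1)] that(2) o] ro[OF that(2)] by simp
  have Ic: "I \<subseteq> carrier R" by (rule ideal_carr[OF I])
  have tors: "f ?o \<in> carrier (torsion_part {I} M)" if f: "f \<in> carrier ?H" for f
  proof -
    have "r \<odot>\<^bsub>M\<^esub> f ?o = \<zero>\<^bsub>M\<^esub>" if r: "r \<in> I" for r
    proof -
      have rc: "r \<in> carrier R" using r Ic by auto
      have "r \<odot>\<^bsub>M\<^esub> f ?o = f (I +>\<^bsub>regular_module R\<^esub> r)" using fr[OF f rc] by simp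
      also have "I +>\<^bsub>regular_module R\<^esub> r = \<zero>\<^bsub>quot_ring\<^esub>" using coset_zero_iff[OF Q, of r] rc r by (simp add: quotient_zero[OF Q])
      finally show ?thesis using hom_zero[OF quot_ring_module M Hh[OF f]] by simp
    qed
    then show ?thesis using hom_closed[OF Hh[OF f] o] by simp
  qed
  show 1: "(\<lambda>f. f ?o) \<in> mod_hom R ?H (torsion_part {I} M)"
    using tors o by (intro mod_homI) (auto simp: hom_module_def)
  show "inj_on (\<lambda>f. f ?o) (carrier ?H)"
  proof (rule inj_onI)
    fix f g assume fg: "f \<in> carrier ?H" "g \<in> carrier ?H" "f ?o = g ?o"
    have "f K = g K" if "K \<in> carrier quot_ring" for K
    proof -
      obtain r where r: "r \<in> carrier R" "K = I +>\<^bsub>regular_module R\<^esub> r"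
        using \<open>K \<in> carrier quot_ring\<close> by (auto simp: quotient_carrier[OF Q])
      show ?thesis unfolding r(2) fr[OF fg(1) r(1)] fr[OF fg(2) r(1)] fg(3) ..
    qed
    then show "f = g" using fg(1,2) by (intro extensionalityI[of f "carrier quot_ring"]) (auto simp: hom_module_def)
  qed
  have "e \<in> (\<lambda>f. f ?o) ` carrier ?H" if e: "e \<in> carrier (torsion_part {I} M)" for e
  proof -
    have ec: "e \<in> carrier M" and eI: "\<And>r. r \<in> I \<Longrightarrow> r \<odot>\<^bsub>M\<^esub> e = \<zero>\<^bsub>M\<^esub>" using e by auto
    have "(\<lambda>r. r \<odot>\<^bsub>M\<^esub> e) \<in> mod_hom R (regular_module R) M"
      using ec M by (intro mod_homI) (auto simp: msmult_add_left msmult_mult)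
    then obtain u where u: "u \<in> mod_hom R quot_ring M" "\<forall>r\<in>carrier R. u (I +>\<^bsub>regular_module R\<^esub> r) = r \<odot>\<^bsub>M\<^esub> e"
      using quotient_hom_lift[OF Q M, of "\<lambda>r. r \<odot>\<^bsub>M\<^esub> e"] eI by auto
    have "restrict u (carrier quot_ring) \<in> carrier ?H"
      using u(1) quot_ring_module by (auto simp: hom_module_def intro: hom_cong)
    moreover have "restrict u (carrier quot_ring) ?o = e" using o u(2) ec M by simp
    ultimately show ?thesis by (metis (no_types, lifting) image_eqI)
  qed
  then show "(\<lambda>f. f ?o) ` carrier ?H = carrier (torsion_part {I} M)"
    using tors by blast
qed

lemma hom_cohomology_iso:
  assumes E: "is_complex R E d"
  shows "mod_isomorphic R (cohomology_module (\<lambda>n. hom_module R quot_ring (E n)) (\<lambda>n. compose (carrier quot_ring) (d n)) i)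
    (cohomology_module (\<lambda>n. torsion_part {I} (E n)) d i)"
    and "is_complex R (\<lambda>n. hom_module R quot_ring (E n)) (\<lambda>n. compose (carrier quot_ring) (d n))"
proof -
  note c = complexD[OF E] and Q = quot_ring_module
  let ?d = "\<lambda>n. compose (carrier quot_ring) (d n)"
  have "?d n \<in> mod_hom R (hom_module R quot_ring (E n)) (hom_module R quot_ring (E (Suc n)))" for n
  proof (rule mod_homI)
    show "?d n f \<in> carrier (hom_module R quot_ring (E (Suc n)))" if "f \<in> carrier (hom_module R quot_ring (E n))" for f
      using that Q hom_comp[OF _ c(2), of f quot_ring n]
      by (auto simp: hom_module_def compose_def intro!: hom_cong[OF Q hom_comp[OF _ c(2)]])
  qed (auto simp: hom_module_def compose_def fun_eq_iff hom_closed[of _ quot_ring] hom_add[OF c(2)] hom_smult[OF c(2)])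
  moreover have "?d (Suc n) (?d n f) = \<zero>\<^bsub>hom_module R quot_ring (E (Suc (Suc n)))\<^esub>" if "f \<in> carrier (hom_module R quot_ring (E n))" for n f
    using that c(3) by (auto simp: hom_module_def compose_def fun_eq_iff hom_closed[of _ quot_ring])
  ultimately show H: "is_complex R (\<lambda>n. hom_module R quot_ring (E n)) ?d"
    using hom_module_is_module[OF Q c(1)] by (simp add: is_complex_def)
  have o: "I +>\<^bsub>regular_module R\<^esub> \<one> \<in> carrier quot_ring" by (auto simp: quotient_carrier[OF regular_is_module ideal_regular_submodule])
  show "mod_isomorphic R (cohomology_module (\<lambda>n. hom_module R quot_ring (E n)) ?d i)
    (cohomology_module (\<lambda>n. torsion_part {I} (E n)) d i)"
    using hom_quot_ring[OF c(1)] o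
    by (intro chain_iso_cohomology[OF H torsion_complex[OF ideal_filter_single E], where \<phi> = "\<lambda>n f. f (I +>\<^bsub>regular_module R\<^esub> \<one>)"])
      (auto simp: chain_map_def compose_def)
qed

end

end

section \<open>Existence and choice of resolutions\<close>

context noetherian_cring
begin

text \<open>\<open>Q\<close> is a property that passes from each term to the next: the trivial one
  gives ordinary resolutions, being torsion gives resolutions of torsion modules by torsion
  injectives. In \<open>step\<close> the kernel is prescribed, as exactness demands.\<close>

lemma baer_resolution_exists_with:
  fixes M :: "('a, 'u) module" and Q :: "('a, 'u) module \<Rightarrow> bool"
  assumes M: "module R M" "Q M"
    and step: "\<And>M N. \<lbrakk>module R M; Q M; submodule N R M\<rbrakk> \<Longrightarrow>
      \<exists>E f. Q E \<and> baer_module R E \<and> f \<in> mod_hom R M E \<and> mod_ker M E f = N"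
  shows "\<exists>\<epsilon> (E :: nat \<Rightarrow> ('a, 'u) module) d. baer_resolution R M \<epsilon> E d \<and> (\<forall>n. Q (E n))"
proof -
  obtain E0 \<epsilon> where E0: "Q E0" "baer_module R E0" and e: "\<epsilon> \<in> mod_hom R M E0" "mod_ker M E0 \<epsilon> = {\<zero>\<^bsub>M\<^esub>}"
    using step[OF M submodule_triv[OF M(1)]] by blast
  \<comment> \<open>\<open>B\<close> is the image of the map into \<open>E\<close>, hence the kernel
    to be prescribed for the next map.\<close>
  let ?P = "\<lambda>n (E, B). Q E \<and> baer_module R E \<and> submodule B R E \<and> (n = (0::nat) \<longrightarrow> E = E0 \<and> B = \<epsilon> ` carrier M)"
  let ?Q = "\<lambda>n (E, B) (E', B'). \<exists>f\<in>mod_hom R E E'. mod_ker E E' f = B \<and> f ` carrier E = B'"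
  have base: "\<exists>x. ?P 0 x"
    using E0 img_submodule[OF M(1) baer_is_module[OF E0(2)] e(1) submodule_carrier[OF M(1)]]
    by (intro exI[of _ "(E0, \<epsilon> ` carrier M)"]) simp
  have step': "\<exists>y. ?P (Suc n) y \<and> ?Q n x y" if P: "?P n x" for x n
  proof -
    obtain E B where x: "x = (E, B)" by (cases x)
    then have E: "Q E" "baer_module R E" "submodule B R E" using P by auto
    obtain E' f where E': "Q E'" "baer_module R E'" "f \<in> mod_hom R E E'" "mod_ker E E' f = B"
      using step[OF baer_is_module[OF E(2)] E(1,3)] by blast
    then show ?thesis
      using x img_submodule[OF baer_is_module[OF E(2)] baer_is_module[OF E'(2)] E'(3) submodule_carrier[OF baer_is_module[OF E(2)]]]
      by (intro exI[of _ "(E', f ` carrier E)"]) auto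
  qed
  have "\<exists>F. \<forall>n. ?P n (F n) \<and> ?Q n (F n) (F (Suc n))"
    using base step' by (rule dependent_nat_choice[of ?P ?Q])
  then obtain F where F: "\<forall>n. ?P n (F n) \<and> ?Q n (F n) (F (Suc n))" by (elim exE)
  define E where "E n = fst (F n)" for n
  define B where "B n = snd (F n)" for n
  have EB: "Q (E n)" "baer_module R (E n)" "submodule (B n) R (E n)" "E 0 = E0" "B 0 = \<epsilon> ` carrier M" for n
    using F[THEN spec, of n] F[THEN spec, of 0] by (auto simp: E_def B_def case_prod_unfold)
  have "\<forall>n. \<exists>f. f \<in> mod_hom R (E n) (E (Suc n)) \<and> mod_ker (E n) (E (Suc n)) f = B n \<and> f ` carrier (E n) = B (Suc n)"
    using F by (simp add: E_def B_def case_prod_unfold Bex_def)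
  then obtain d where d: "\<And>n. d n \<in> mod_hom R (E n) (E (Suc n))" "\<And>n. mod_ker (E n) (E (Suc n)) (d n) = B n"
    "\<And>n. d n ` carrier (E n) = B (Suc n)" by metis
  have cx: "is_complex R E d"
    unfolding is_complex_def
  proof (intro conjI allI ballI d baer_is_module EB)
    fix n x assume "x \<in> carrier (E n)"
    then have "d n x \<in> mod_ker (E (Suc n)) (E (Suc (Suc n))) (d (Suc n))" using d(2,3) by blast
    then show "d (Suc n) (d n x) = \<zero>\<^bsub>E (Suc (Suc n))\<^esub>" by (simp add: mod_ker_def)
  qed
  have "inj_on \<epsilon> (carrier M)"
    unfolding hom_inj_iff[OF M(1) baer_is_module[OF E0(2)] e(1)] using e(2) by (auto simp: mod_ker_def)
  moreover have "\<epsilon> ` carrier M = mod_ker (E 0) (E 1) (d 0)"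
    using d(2)[of 0] EB(5) by simp
  moreover have "d n ` carrier (E n) = mod_ker (E (Suc n)) (E (Suc (Suc n))) (d (Suc n))" for n
    using d(2)[of "Suc n"] d(3)[of n] by simp
  ultimately have "baer_resolution R M \<epsilon> E d"
    using M(1) cx e(1) EB(2,4) unfolding baer_resolution_def coresolution_def by simp
  then show ?thesis using EB(1) by blast
qed

lemma baer_resolution_exists:
  fixes M :: "('a, 'u) module" and i :: "'a \<Rightarrow> 'u"
  assumes "module R M" "infinite (UNIV :: 'u set)" "inj i"
  shows "\<exists>\<epsilon> (E :: nat \<Rightarrow> ('a, 'u) module) d. baer_resolution R M \<epsilon> E d"
  using baer_resolution_exists_with[of M "\<lambda>_. True"] small_injective_with_kernel[OF _ _ assms(2,3)] assms(1)
  by fast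

lemma baer_resolution_iso:
  assumes "baer_resolution R M' \<epsilon> E d" "module R M" "mod_isomorphic R M M'"
  shows "\<exists>\<epsilon>'. baer_resolution R M \<epsilon>' E d"
proof -
  obtain f where f: "f \<in> mod_hom R M M'" "inj_on f (carrier M)" "f ` carrier M = carrier M'"
    using assms(3) by (auto simp: mod_isomorphic_def bij_betw_def)
  have "coresolution R M (\<lambda>x. \<epsilon> (f x)) E d"
    using assms(1,2) f hom_comp[OF f(1)]
    by (auto simp: baer_resolution_def coresolution_def image_image[symmetric] inj_on_def hom_closed[OF f(1)])
  then show ?thesis using assms(1) by (auto simp: baer_resolution_def)
qed

lemma res_infinite: "infinite (UNIV :: ('a, 'm) res set)"
  by (rule infinite_UNIV_listI)

lemma res_inj: "inj (\<lambda>a. [Inl a] :: ('a, 'm) res)"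
  by (auto simp: inj_def)

lemma res_copy:
  fixes M :: "('a, 'm) module"
  assumes "module R M"
  shows "\<exists>M' :: ('a, ('a, 'm) res) module. module R M' \<and> mod_isomorphic R M M'"
proof -
  have "inj_on (\<lambda>x. [Inr x] :: ('a, 'm) res) (carrier M)" by (auto simp: inj_on_def)
  then show ?thesis using transport_module[OF assms] mod_isomorphicI by blast
qed

text \<open>The type of lists is infinite and receives both the ring type and the type of
  \<open>M\<close>, so a resolution on it exists and the choice in the definition is one. As the
  ring type embeds into it, the chosen terms satisfy Baer's criterion.\<close>

lemma chosen_resolution:
  fixes M :: "('a, 'm) module"
  assumes M: "module R M"
  shows "\<exists>\<epsilon> E d. chosen_resolution R M = (E, d) \<and> baer_resolution R M \<epsilon> E d"
proof -
  obtain M' :: "('a, ('a, 'm) res) module" where M': "module R M'" "mod_isomorphic R M M'"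
    using res_copy[OF M] by blast
  obtain \<epsilon>' and E' :: "nat \<Rightarrow> ('a, ('a, 'm) res) module" and d' where b: "baer_resolution R M \<epsilon>' E' d'"
    using baer_resolution_exists[OF M'(1) res_infinite res_inj] baer_resolution_iso[OF _ M M'(2)] by blast
  have "injective_resolution R M \<epsilon>' E' d'"
    using b complexD(2) by (auto simp: injective_resolution_def baer_resolution_def coresolution_def baer_imp_injective)
  then have "case (E', d') of (E, d) \<Rightarrow> \<exists>\<epsilon>. injective_resolution R M \<epsilon> E d" by auto
  then have "case chosen_resolution R M of (E, d) \<Rightarrow> \<exists>\<epsilon>. injective_resolution R M \<epsilon> E d"
    unfolding chosen_resolution_def by (rule someI)
  then obtain E d \<epsilon> where E: "chosen_resolution R M = (E, d)" and r: "injective_resolution R M \<epsilon> E d" by auto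
  have ba: "baer_module R (E n)" for n
    using r injective_imp_baer[OF _ res_inj] by (auto simp: injective_resolution_def)
  have dd: "d (Suc n) (d n x) = \<zero>\<^bsub>E (Suc (Suc n))\<^esub>" if "x \<in> carrier (E n)" for n x
  proof -
    have "d n x \<in> mod_ker (E (Suc n)) (E (Suc (Suc n))) (d (Suc n))" using r that unfolding injective_resolution_def by blast
    then show ?thesis by (simp add: mod_ker_def)
  qed
  have "is_complex R E d"
    using r dd baer_is_module[OF ba] by (simp add: is_complex_def injective_resolution_def)
  then have "baer_resolution R M \<epsilon> E d"
    using r ba M by (simp add: baer_resolution_def coresolution_def injective_resolution_def)
  then show ?thesis using E by blast
qed

end

section \<open>Powers of the ideal and the two derived functors\<close>

locale noetherian_ideal = noetherian_cring R for R (structure) +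
  fixes I assumes I: "ideal I R"

context noetherian_ideal
begin

definition torsion_filter :: "'a set set" where
  "torsion_filter = range (ideal_power R I)"

lemma ideal_power_0: "ideal_power R I 0 = carrier R"
  and ideal_power_Suc: "ideal_power R I (Suc n) = I \<cdot>\<^bsub>R\<^esub> ideal_power R I n"
  by (simp_all add: ideal_power_def)

lemma ideal_power_ideal: "ideal (ideal_power R I n) R"
  by (induction n) (simp_all add: ideal_power_0 ideal_power_Suc oneideal ideal_prod_is_ideal I)

lemma ideal_power_carr: "ideal_power R I n \<subseteq> carrier R"
  by (rule ideal_carr[OF ideal_power_ideal])

lemma ideal_power_antimono: "m \<le> n \<Longrightarrow> ideal_power R I n \<subseteq> ideal_power R I m"
proof (induction n rule: nat_induct_at_least)
  case (Suc n)
  have "ideal_power R I (Suc n) \<subseteq> ideal_power R I n"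
    using ideal_prod_inter[OF I ideal_power_ideal] by (auto simp: ideal_power_Suc)
  then show ?case using Suc by blast
qed simp

lemma ideal_power_mult: "\<lbrakk>x \<in> I; r \<in> ideal_power R I n\<rbrakk> \<Longrightarrow> x \<otimes> r \<in> ideal_power R I (Suc n)"
  by (auto simp: ideal_power_Suc intro: ideal_prod.prod)

lemma ideal_power_1: "ideal_power R I (Suc 0) = I"
proof
  show "ideal_power R I (Suc 0) \<subseteq> I"
    using ideal_prod_inter[OF I oneideal] by (auto simp: ideal_power_Suc ideal_power_0)
  show "I \<subseteq> ideal_power R I (Suc 0)"
  proof
    fix x assume x: "x \<in> I"
    then show "x \<in> ideal_power R I (Suc 0)"
      using ideal_power_mult[OF x, of \<one> 0] ideal_carr[OF I] by (auto simp: ideal_power_0)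
  qed
qed

lemma pow_in_ideal_power: "x \<in> I \<Longrightarrow> x [^] n \<in> ideal_power R I n"
proof (induction n)
  case (Suc n)
  then show ?case using ideal_power_mult[of x "x [^] n" n] ideal_carr[OF I]
    by (simp add: m_comm subset_iff)
qed (simp add: ideal_power_0)

lemma torsion_filter: "ideal_filter R torsion_filter"
  unfolding ideal_filter_def torsion_filter_def
proof (intro conjI ballI)
  fix J K assume "J \<in> range (ideal_power R I)" "K \<in> range (ideal_power R I)"
  then obtain m n where "J = ideal_power R I m" "K = ideal_power R I n" by auto
  then show "\<exists>L\<in>range (ideal_power R I). L \<subseteq> J \<inter> K"
    using ideal_power_antimono[of m "max m n"] ideal_power_antimono[of n "max m n"]
    by (intro bexI[of _ "ideal_power R I (max m n)"]) auto
qed (auto simp: ideal_power_ideal)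

lemma torsion_module_eq: "torsion_module R I M = torsion_part torsion_filter M"
  by (simp add: torsion_module_def torsion_part_def torsion_filter_def)

lemma torsion_carrier: "carrier (torsion_part torsion_filter M) =
    {x \<in> carrier M. \<exists>n. \<forall>r\<in>ideal_power R I n. r \<odot>\<^bsub>M\<^esub> x = \<zero>\<^bsub>M\<^esub>}"
  by (simp add: torsion_filter_def)

abbreviation "ext_module i M \<equiv> Ext R i (quotient_module (regular_module R) I) M"

text \<open>Replaces the chosen resolution by any Baer resolution of an isomorphic module, whatever
  its type.\<close>

lemma ext_iso:
  assumes E: "baer_resolution R M' \<epsilon> E d" and M: "module R M" and iso: "mod_isomorphic R M M'"
  shows "mod_isomorphic R (ext_module i M) (cohomology_module (\<lambda>n. torsion_part {I} (E n)) d i)"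
    and "module R (ext_module i M)"
proof -
  obtain \<epsilon>' E' d' where c: "chosen_resolution R M = (E', d')" "baer_resolution R M \<epsilon>' E' d'"
    using chosen_resolution[OF M] by blast
  note cx = coresolutionD(2)[OF baer_resolutionD(1)[OF c(2)]]
  show "mod_isomorphic R (ext_module i M) (cohomology_module (\<lambda>n. torsion_part {I} (E n)) d i)"
    using mod_isomorphic_trans[OF hom_cohomology_iso(1)[OF I cx] derived_functor_iso[OF ideal_filter_single[OF I] c(2) E iso]]
    by (simp add: Ext_def right_derived_def c(1))
  show "module R (ext_module i M)"
    using cohomology_is_module[OF hom_cohomology_iso(2)[OF I cx]]
    by (simp add: Ext_def right_derived_def c(1))
qed

lemma ext_fin_gen_iff:
  assumes E: "baer_resolution R M' \<epsilon> E d" and M: "module R M" and iso: "mod_isomorphic R M M'"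
  shows "fin_gen_module R (ext_module i M) \<longleftrightarrow>
    fin_gen_module R (cohomology_module (\<lambda>n. torsion_part {I} (E n)) d i)"
  using ext_iso[OF assms] coresolutionD(2)[OF baer_resolutionD(1)[OF E]]
  by (intro fin_gen_iso cohomology_is_module torsion_complex ideal_filter_single I)

lemma ext_fin_gen_cong:
  fixes M :: "('a, 'm) module" and M' :: "('a, 'n) module"
  assumes M: "module R M" "module R M'" and iso: "mod_isomorphic R M M'"
  shows "fin_gen_module R (ext_module i M) \<longleftrightarrow> fin_gen_module R (ext_module i M')"
proof -
  obtain \<epsilon>' and E' :: "nat \<Rightarrow> ('a, ('a, 'n) res) module" and d' where c: "baer_resolution R M' \<epsilon>' E' d'"
    using chosen_resolution[OF M(2)] by blast
  show ?thesis
    using ext_fin_gen_iff[OF c M(1) iso, of i] ext_fin_gen_iff[OF c M(2) mod_isomorphic_refl, of i] by simp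
qed

lemma M0_cof_cong:
  assumes "module R M" "module R M'" "mod_isomorphic R M M'"
  shows "M \<in> M0_cof R I \<longleftrightarrow> M' \<in> M0_cof R I"
  using ext_fin_gen_cong[OF assms] assms(1,2) by (simp add: M0_cof_def)

lemma local_cohomology_iso:
  assumes E: "baer_resolution R M' \<epsilon> E d" and M: "module R M" and iso: "mod_isomorphic R M M'"
  shows "mod_isomorphic R (local_cohomology R I i M) (cohomology_module (\<lambda>n. torsion_part torsion_filter (E n)) d i)"
    and "module R (local_cohomology R I i M)"
proof -
  obtain \<epsilon>' E' d' where c: "chosen_resolution R M = (E', d')" "baer_resolution R M \<epsilon>' E' d'"
    using chosen_resolution[OF M] by blast
  note cx = coresolutionD(2)[OF baer_resolutionD(1)[OF c(2)]]
  show "mod_isomorphic R (local_cohomology R I i M) (cohomology_module (\<lambda>n. torsion_part torsion_filter (E n)) d i)"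
    using derived_functor_iso[OF torsion_filter c(2) E iso]
    by (simp add: local_cohomology_def right_derived_def c(1) torsion_module_eq)
  show "module R (local_cohomology R I i M)"
    using cohomology_is_module[OF torsion_complex[OF torsion_filter cx]]
    by (simp add: local_cohomology_def right_derived_def c(1) torsion_module_eq)
qed

end

section \<open>Short exact sequences\<close>

definition short_exact :: "('a, 'r) ring_scheme \<Rightarrow> ('a, 'l) module \<Rightarrow> ('l \<Rightarrow> 'm) \<Rightarrow> ('a, 'm) module \<Rightarrow>
    ('m \<Rightarrow> 'n) \<Rightarrow> ('a, 'n) module \<Rightarrow> bool" where
  "short_exact R L f M g N \<longleftrightarrow> module R L \<and> module R M \<and> module R N \<and>
     f \<in> mod_hom R L M \<and> g \<in> mod_hom R M N \<and> inj_on f (carrier L) \<and>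
     f ` carrier L = mod_ker M N g \<and> g ` carrier M = carrier N"

text \<open>The differential of an extension of a complex \<open>C''\<close> by a complex \<open>C'\<close> that splits in every
  degree; resolutions of the outer terms of a short exact sequence yield one of the middle term of
  this form.\<close>

definition twisted_differential :: "(nat \<Rightarrow> ('a, 'e) module) \<Rightarrow> (nat \<Rightarrow> 'e \<Rightarrow> 'e) \<Rightarrow> (nat \<Rightarrow> 'f \<Rightarrow> 'f) \<Rightarrow>
    (nat \<Rightarrow> 'f \<Rightarrow> 'e) \<Rightarrow> nat \<Rightarrow> 'e \<times> 'f \<Rightarrow> 'e \<times> 'f" where
  "twisted_differential C' d' d'' t n = (\<lambda>(x, y). (d' n x \<oplus>\<^bsub>C' (Suc n)\<^esub> t n y, d'' n y))"

text \<open>The last equation says that the twisted differential squares to zero.\<close>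

definition twisting :: "('a, 'r) ring_scheme \<Rightarrow> (nat \<Rightarrow> ('a, 'e) module) \<Rightarrow> (nat \<Rightarrow> 'e \<Rightarrow> 'e) \<Rightarrow>
    (nat \<Rightarrow> ('a, 'f) module) \<Rightarrow> (nat \<Rightarrow> 'f \<Rightarrow> 'f) \<Rightarrow> (nat \<Rightarrow> 'f \<Rightarrow> 'e) \<Rightarrow> bool" where
  "twisting R C' d' C'' d'' t \<longleftrightarrow> is_complex R C' d' \<and> is_complex R C'' d'' \<and>
     (\<forall>n. t n \<in> mod_hom R (C'' n) (C' (Suc n))) \<and>
     (\<forall>n. \<forall>y\<in>carrier (C'' n). d' (Suc n) (t n y) \<oplus>\<^bsub>C' (Suc (Suc n))\<^esub> t (Suc n) (d'' n y) = \<zero>\<^bsub>C' (Suc (Suc n))\<^esub>)"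

context cring
begin

lemma short_exactD:
  assumes "short_exact R L f M g N"
  shows "module R L" "module R M" "module R N" "f \<in> mod_hom R L M" "g \<in> mod_hom R M N"
    "inj_on f (carrier L)" "x \<in> carrier L \<Longrightarrow> g (f x) = \<zero>\<^bsub>N\<^esub>"
    "\<lbrakk>y \<in> carrier M; g y = \<zero>\<^bsub>N\<^esub>\<rbrakk> \<Longrightarrow> \<exists>x\<in>carrier L. y = f x"
    "z \<in> carrier N \<Longrightarrow> \<exists>y\<in>carrier M. z = g y"
  using assms by (auto simp: short_exact_def mod_ker_def set_eq_iff image_iff)

lemma short_exact_restrict:
  assumes "module R M" "module R N" "g \<in> mod_hom R M N" "submodule L R M" "mod_ker M N g = L" "g ` carrier M = carrier N"
  shows "short_exact R (M\<lparr>carrier := L\<rparr>) (\<lambda>x. x) M g N"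
  using assms submodule_carr[OF assms(1,4)]
  by (auto simp: short_exact_def submodule_restrict intro: hom_restrict_dom hom_id)

section \<open>Cohomology of an extension with twisted differential\<close>

context
  fixes C' :: "nat \<Rightarrow> ('a, 'e) module" and d' and C'' :: "nat \<Rightarrow> ('a, 'f) module" and d'' and t
  assumes tw: "twisting R C' d' C'' d'' t"
begin

abbreviation (input) "TC \<equiv> \<lambda>n. direct_sum_module (C' n) (C'' n)"
abbreviation (input) "Td \<equiv> twisted_differential C' d' d'' t"

lemma twistingD:
  "is_complex R C' d'" "is_complex R C'' d''" "t n \<in> mod_hom R (C'' n) (C' (Suc n))"
  "y \<in> carrier (C'' n) \<Longrightarrow> d' (Suc n) (t n y) \<oplus>\<^bsub>C' (Suc (Suc n))\<^esub> t (Suc n) (d'' n y) = \<zero>\<^bsub>C' (Suc (Suc n))\<^esub>"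
  using tw by (auto simp: twisting_def)

lemmas left_complex = complexD[OF twistingD(1)] and right_complex = complexD[OF twistingD(2)] and twist_hom = twistingD(3)

lemma twisting_closed:
  "x \<in> carrier (C' n) \<Longrightarrow> d' n x \<in> carrier (C' (Suc n))"
  "y \<in> carrier (C'' n) \<Longrightarrow> d'' n y \<in> carrier (C'' (Suc n))"
  "y \<in> carrier (C'' n) \<Longrightarrow> t n y \<in> carrier (C' (Suc n))"
  using hom_closed[OF left_complex(2)] hom_closed[OF right_complex(2)] hom_closed[OF twist_hom] by auto

lemma twisting_zero: "d' n \<zero>\<^bsub>C' n\<^esub> = \<zero>\<^bsub>C' (Suc n)\<^esub>" "d'' n \<zero>\<^bsub>C'' n\<^esub> = \<zero>\<^bsub>C'' (Suc n)\<^esub>" "t n \<zero>\<^bsub>C'' n\<^esub> = \<zero>\<^bsub>C' (Suc n)\<^esub>"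
  using hom_zero[OF left_complex(1) left_complex(1) left_complex(2)] hom_zero[OF right_complex(1) right_complex(1) right_complex(2)] hom_zero[OF right_complex(1) left_complex(1) twist_hom] by auto

lemma twist_neg:
  assumes y: "y \<in> carrier (C'' n)"
  shows "d' (Suc n) (t n y) = (\<ominus> \<one>) \<odot>\<^bsub>C' (Suc (Suc n))\<^esub> t (Suc n) (d'' n y)"
    "t (Suc n) (d'' n y) = (\<ominus> \<one>) \<odot>\<^bsub>C' (Suc (Suc n))\<^esub> d' (Suc n) (t n y)"
proof -
  have cl: "d' (Suc n) (t n y) \<in> carrier (C' (Suc (Suc n)))" "t (Suc n) (d'' n y) \<in> carrier (C' (Suc (Suc n)))"
    using y by (auto intro: twisting_closed)
  show "d' (Suc n) (t n y) = (\<ominus> \<one>) \<odot>\<^bsub>C' (Suc (Suc n))\<^esub> t (Suc n) (d'' n y)"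
    using twistingD(4)[OF y] madd_eq_0_iff[OF left_complex(1) cl] by simp
  then show "t (Suc n) (d'' n y) = (\<ominus> \<one>) \<odot>\<^bsub>C' (Suc (Suc n))\<^esub> d' (Suc n) (t n y)"
    using mneg_neg[OF left_complex(1) cl(2)] by simp
qed

lemma twisted_complex: "is_complex R TC Td"
  unfolding is_complex_def
proof (intro conjI allI ballI)
  show "module R (TC n)" for n using left_complex(1) right_complex(1) by simp
  show "Td n \<in> mod_hom R (TC n) (TC (Suc n))" for n
    using left_complex(1)[of "Suc n"]
    by (intro mod_homI) (auto simp: twisted_differential_def twisting_closed hom_add[OF left_complex(2)] hom_add[OF right_complex(2)] hom_add[OF twist_hom]
      hom_smult[OF left_complex(2)] hom_smult[OF right_complex(2)] hom_smult[OF twist_hom] madd_assoc madd_lcomm msmult_add_right)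
  fix n p assume "p \<in> carrier (TC n)"
  then obtain x y where p: "p = (x, y)" "x \<in> carrier (C' n)" "y \<in> carrier (C'' n)" by auto
  then show "Td (Suc n) (Td n p) = \<zero>\<^bsub>TC (Suc (Suc n))\<^esub>"
    using left_complex(1)[of "Suc (Suc n)"] twistingD(4)[OF p(3)]
    by (simp add: twisted_differential_def twisting_closed hom_add[OF left_complex(2)] left_complex(3) right_complex(3) madd_assoc)
qed

lemma twisted_cocycle_iff:
  "(x, y) \<in> cocycles TC Td n \<longleftrightarrow> x \<in> carrier (C' n) \<and> y \<in> cocycles C'' d'' n \<and> d' n x \<oplus>\<^bsub>C' (Suc n)\<^esub> t n y = \<zero>\<^bsub>C' (Suc n)\<^esub>"
  by (auto simp: cocycles_iff twisted_differential_def)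

lemma twisted_incl_coboundary:
  assumes "x \<in> coboundaries C' d' n"
  shows "(x, \<zero>\<^bsub>C'' n\<^esub>) \<in> coboundaries TC Td n"
proof (cases n)
  case (Suc k)
  then obtain w where w: "w \<in> carrier (C' k)" "x = d' k w" using assms by (auto simp: coboundaries_Suc)
  have "Td k (w, \<zero>\<^bsub>C'' k\<^esub>) = (x, \<zero>\<^bsub>C'' n\<^esub>)"
    using w Suc left_complex(1)[of "Suc k"] by (simp add: twisted_differential_def twisting_zero twisting_closed)
  then show ?thesis unfolding Suc coboundaries_Suc using w Suc right_complex(1)[of k]
    by (intro image_eqI[of _ _ "(w, \<zero>\<^bsub>C'' k\<^esub>)"]) auto
qed (use assms in \<open>simp add: coboundaries_0\<close>)

lemma twisted_proj_coboundary:
  "(x, y) \<in> coboundaries TC Td n \<Longrightarrow> y \<in> coboundaries C'' d'' n"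
  by (cases n) (auto simp: coboundaries_0 coboundaries_Suc twisted_differential_def)

text \<open>Exactness of cohomology at the middle term, on the level of cocycles: a cocycle whose
  second component is a coboundary is cohomologous to one from the left complex.\<close>

lemma twisted_split:
  assumes z: "(x, y) \<in> cocycles TC Td n" and y: "y \<in> coboundaries C'' d'' n"
  shows "\<exists>x'\<in>cocycles C' d' n. \<exists>b\<in>coboundaries TC Td n. (x, y) = (x', \<zero>\<^bsub>C'' n\<^esub>) \<oplus>\<^bsub>TC n\<^esub> b"
proof -
  have zc: "x \<in> carrier (C' n)" "y \<in> carrier (C'' n)" "d' n x \<oplus>\<^bsub>C' (Suc n)\<^esub> t n y = \<zero>\<^bsub>C' (Suc n)\<^esub>"
    using z by (auto simp: twisted_differential_def cocycles_iff)
  show ?thesis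
  proof (cases n)
    case 0
    then have "y = \<zero>\<^bsub>C'' 0\<^esub>" using y by (simp add: coboundaries_0)
    then show ?thesis using 0 zc left_complex(1) right_complex(1)
      by (intro bexI[of _ x] bexI[of _ "(\<zero>\<^bsub>C' 0\<^esub>, \<zero>\<^bsub>C'' 0\<^esub>)"])
       (simp_all add: coboundaries_0 cocycles_iff twisting_zero twisting_closed)
  next
    case (Suc k)
    then obtain w where w: "w \<in> carrier (C'' k)" "y = d'' k w" using y by (auto simp: coboundaries_Suc)
    \<comment> \<open>What remains of \<open>(x, y)\<close> after subtracting the coboundary
      \<open>(t k w, y)\<close> of \<open>(\<zero>, w)\<close>.\<close>
    let ?x' = "x \<oplus>\<^bsub>C' n\<^esub> (\<ominus> \<one>) \<odot>\<^bsub>C' n\<^esub> t k w"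
    have tc: "t k w \<in> carrier (C' n)" using twisting_closed(3)[OF w(1)] Suc by simp
    have "d' n (t k w) = (\<ominus> \<one>) \<odot>\<^bsub>C' (Suc n)\<^esub> t n y" using twist_neg(1)[OF w(1)] w(2) Suc by simp
    then have "d' n ?x' = d' n x \<oplus>\<^bsub>C' (Suc n)\<^esub> t n y"
      using zc tc left_complex(1)[of n] left_complex(1)[of "Suc n"] by (simp add: hom_add[OF left_complex(2)] hom_smult[OF left_complex(2)] twisting_closed)
    then have x': "?x' \<in> cocycles C' d' n" using zc tc left_complex(1)[of n] by (simp add: cocycles_iff)
    have b: "(t k w, y) = Td k (\<zero>\<^bsub>C' k\<^esub>, w)" using w Suc tc left_complex(1)[of n] by (simp add: twisted_differential_def twisting_zero)
    have "(t k w, y) \<in> coboundaries TC Td n"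
      unfolding b Suc coboundaries_Suc using w left_complex(1)[of k] by (intro imageI) simp
    moreover have "(x, y) = (?x', \<zero>\<^bsub>C'' n\<^esub>) \<oplus>\<^bsub>TC n\<^esub> (t k w, y)"
      using zc tc left_complex(1)[of n] right_complex(1)[of n] by (simp add: madd_assoc)
    ultimately show ?thesis using x' by blast
  qed
qed

text \<open>Exactness of the left complex in degree \<open>n\<close> makes the projection injective
  on cohomology. Exactness in degree \<open>Suc n\<close> makes it surjective: for a cocycle
  \<open>y\<close>, the element \<open>t n y\<close> is then a coboundary, and this lifts
  \<open>y\<close>.\<close>

lemma twisted_cohomology_left:
  assumes "cocycles C' d' n \<subseteq> coboundaries C' d' n" "cocycles C' d' (Suc n) \<subseteq> coboundaries C' d' (Suc n)"
  shows "mod_isomorphic R (cohomology_module TC Td n) (cohomology_module C'' d'' n)"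
proof (rule cohomology_iso[OF twisted_complex twistingD(2), where t = snd])
  show "snd \<in> mod_hom R (TC n) (C'' n)" by (rule mod_homI) auto
  show "snd z \<in> cocycles C'' d'' n" if "z \<in> cocycles TC Td n" for z
    using that by (cases z) (simp add: twisted_cocycle_iff)
  show "snd z \<in> coboundaries C'' d'' n" if "z \<in> coboundaries TC Td n" for z
    using that twisted_proj_coboundary by (cases z) auto
  show "z \<in> coboundaries TC Td n" if z: "z \<in> cocycles TC Td n" "snd z \<in> coboundaries C'' d'' n" for z
  proof -
    obtain x y where xy: "z = (x, y)" by (cases z)
    obtain x' b where "x' \<in> cocycles C' d' n" "b \<in> coboundaries TC Td n" "z = (x', \<zero>\<^bsub>C'' n\<^esub>) \<oplus>\<^bsub>TC n\<^esub> b"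
      using twisted_split[of x y n] z xy by auto
    then show ?thesis
      using assms(1) twisted_incl_coboundary submodule_add[OF complexD(1)[OF twisted_complex] coboundaries_submodule[OF twisted_complex]]
      by blast
  qed
  show "\<exists>z\<in>cocycles TC Td n. \<exists>b\<in>coboundaries C'' d'' n. y = snd z \<oplus>\<^bsub>C'' n\<^esub> b" if y: "y \<in> cocycles C'' d'' n" for y
  proof -
    have yc: "y \<in> carrier (C'' n)" "d'' n y = \<zero>\<^bsub>C'' (Suc n)\<^esub>" using y by (auto simp: cocycles_iff)
    then have "d' (Suc n) (t n y) = \<zero>\<^bsub>C' (Suc (Suc n))\<^esub>" using twist_neg(1)[OF yc(1)] left_complex(1) by (simp add: twisting_zero)
    then have "t n y \<in> coboundaries C' d' (Suc n)" using assms(2) twisting_closed(3)[OF yc(1)] by (auto simp: cocycles_iff)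
    then obtain x where x: "x \<in> carrier (C' n)" "t n y = d' n x" by (auto simp: coboundaries_Suc)
    have "((\<ominus> \<one>) \<odot>\<^bsub>C' n\<^esub> x, y) \<in> cocycles TC Td n"
      using x y left_complex(1)[of n] left_complex(1)[of "Suc n"] by (simp add: twisted_cocycle_iff hom_smult[OF left_complex(2)] twisting_closed)
    moreover have "\<zero>\<^bsub>C'' n\<^esub> \<in> coboundaries C'' d'' n"
      by (rule submodule_zero[OF right_complex(1) coboundaries_submodule[OF twistingD(2)]])
    ultimately show ?thesis using yc right_complex(1)[of n] by force
  qed
qed

text \<open>The connecting homomorphism is \<open>t n\<close> itself, since the differential sends
  \<open>(\<zero>, y)\<close> to \<open>(t n y, \<zero>)\<close> for a cocycle \<open>y\<close>.
  Acyclicity of the middle complex in degree \<open>n\<close> gives injectivity, in degree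
  \<open>Suc n\<close> surjectivity.\<close>

lemma twisted_cohomology_shift:
  assumes "cocycles TC Td n \<subseteq> coboundaries TC Td n" "cocycles TC Td (Suc n) \<subseteq> coboundaries TC Td (Suc n)"
  shows "mod_isomorphic R (cohomology_module C'' d'' n) (cohomology_module C' d' (Suc n))"
proof (rule cohomology_iso[OF twistingD(2,1) twist_hom[of n]])
  show "t n y \<in> cocycles C' d' (Suc n)" if "y \<in> cocycles C'' d'' n" for y
    using that twist_neg(1)[of y n] left_complex(1) by (simp add: cocycles_iff twisting_zero twisting_closed)
  show "t n y \<in> coboundaries C' d' (Suc n)" if y: "y \<in> coboundaries C'' d'' n" for y
  proof (cases n)
    case 0
    then show ?thesis using y submodule_zero[OF left_complex(1) coboundaries_submodule[OF twistingD(1)]]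
      by (simp add: coboundaries_0 twisting_zero)
  next
    case (Suc k)
    then obtain w where w: "w \<in> carrier (C'' k)" "y = d'' k w" using y by (auto simp: coboundaries_Suc)
    have "t n y = (\<ominus> \<one>) \<odot>\<^bsub>C' (Suc n)\<^esub> d' n (t k w)" using twist_neg(2)[OF w(1)] w Suc by simp
    moreover have "d' n (t k w) \<in> coboundaries C' d' (Suc n)"
      using twisting_closed(3)[OF w(1)] Suc by (auto simp: coboundaries_Suc)
    ultimately show ?thesis
      by (simp add: submodule_smult[OF left_complex(1) coboundaries_submodule[OF twistingD(1)]])
  qed
  show "y \<in> coboundaries C'' d'' n" if y: "y \<in> cocycles C'' d'' n" "t n y \<in> coboundaries C' d' (Suc n)" for y
  proof -
    obtain x where x: "x \<in> carrier (C' n)" "t n y = d' n x" using y(2) by (auto simp: coboundaries_Suc)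
    have "((\<ominus> \<one>) \<odot>\<^bsub>C' n\<^esub> x, y) \<in> cocycles TC Td n"
      using x y left_complex(1)[of n] left_complex(1)[of "Suc n"] by (simp add: twisted_cocycle_iff hom_smult[OF left_complex(2)] twisting_closed)
    then show ?thesis using assms(1) twisted_proj_coboundary by blast
  qed
  show "\<exists>y\<in>cocycles C'' d'' n. \<exists>b\<in>coboundaries C' d' (Suc n). x = t n y \<oplus>\<^bsub>C' (Suc n)\<^esub> b"
    if x: "x \<in> cocycles C' d' (Suc n)" for x
  proof -
    have "(x, \<zero>\<^bsub>C'' (Suc n)\<^esub>) \<in> cocycles TC Td (Suc n)"
      using x left_complex(1) right_complex(1) by (simp add: twisted_differential_def cocycles_iff twisting_zero)
    then obtain p where p: "p \<in> carrier (TC n)" "(x, \<zero>\<^bsub>C'' (Suc n)\<^esub>) = Td n p"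
      using assms(2) by (auto simp: coboundaries_Suc)
    then obtain x' y' where p: "x' \<in> carrier (C' n)" "y' \<in> carrier (C'' n)" "x = d' n x' \<oplus>\<^bsub>C' (Suc n)\<^esub> t n y'" "d'' n y' = \<zero>\<^bsub>C'' (Suc n)\<^esub>"
      by (cases p) (auto simp: twisted_differential_def)
    then show ?thesis
      using madd_comm[OF left_complex(1) twisting_closed(1)[OF p(1)] twisting_closed(3)[OF p(2)]]
      by (intro bexI[of _ y'] bexI[of _ "d' n x'"]) (auto simp: cocycles_iff coboundaries_Suc)
  qed
qed

end

text \<open>A torsion functor commutes with finite direct sums and leaves the maps alone, so a
  twisted extension stays one, with the same formula. The splitting in each degree makes up for the
  exactness that the functor lacks.\<close>

lemma twisting_torsion:
  assumes F: "ideal_filter R F" and tw: "twisting R C' d' C'' d'' t"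
  shows "twisting R (\<lambda>n. torsion_part F (C' n)) d' (\<lambda>n. torsion_part F (C'' n)) d'' t"
    and "direct_sum_module (torsion_part F (C' n)) (torsion_part F (C'' n)) = torsion_part F (direct_sum_module (C' n) (C'' n))"
    and "twisted_differential (\<lambda>n. torsion_part F (C' n)) d' d'' t = twisted_differential C' d' d'' t"
proof -
  note D = twistingD[OF tw]
  show "twisting R (\<lambda>n. torsion_part F (C' n)) d' (\<lambda>n. torsion_part F (C'' n)) d'' t"
    using D torsion_complex[OF F D(1)] torsion_complex[OF F D(2)] torsion_part_hom[OF F complexD(1)[OF D(2)] complexD(1)[OF D(1)] D(3)]
    by (simp add: twisting_def)
  show "twisted_differential (\<lambda>n. torsion_part F (C' n)) d' d'' t = twisted_differential C' d' d'' t"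
    by (simp add: twisted_differential_def fun_eq_iff)
  let ?M = "C' n" and ?N = "C'' n"
  note M = complexD(1)[OF D(1), of n] and N = complexD(1)[OF D(2), of n]
  have "carrier (torsion_part F (direct_sum_module ?M ?N)) = carrier (torsion_part F ?M) \<times> carrier (torsion_part F ?N)"
  proof (intro equalityI subsetI)
    fix p assume p: "p \<in> carrier (torsion_part F (direct_sum_module ?M ?N))"
    have "fst \<in> mod_hom R (direct_sum_module ?M ?N) ?M" "snd \<in> mod_hom R (direct_sum_module ?M ?N) ?N"
      by (intro mod_homI; auto)+
    then have "fst p \<in> carrier (torsion_part F ?M)" "snd p \<in> carrier (torsion_part F ?N)"
      using torsion_hom[OF F direct_sum_is_module[OF M N] M _ p] torsion_hom[OF F direct_sum_is_module[OF M N] N _ p] by blast+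
    then show "p \<in> carrier (torsion_part F ?M) \<times> carrier (torsion_part F ?N)" by (simp add: mem_Times_iff)
  next
    fix p assume p: "p \<in> carrier (torsion_part F ?M) \<times> carrier (torsion_part F ?N)"
    have "(\<lambda>x. (x, \<zero>\<^bsub>?N\<^esub>)) \<in> mod_hom R ?M (direct_sum_module ?M ?N)" "(\<lambda>y. (\<zero>\<^bsub>?M\<^esub>, y)) \<in> mod_hom R ?N (direct_sum_module ?M ?N)"
      using M N by (intro mod_homI; auto)+
    then have "(fst p, \<zero>\<^bsub>?N\<^esub>) \<in> carrier (torsion_part F (direct_sum_module ?M ?N))"
        "(\<zero>\<^bsub>?M\<^esub>, snd p) \<in> carrier (torsion_part F (direct_sum_module ?M ?N))"
      using torsion_hom[OF F M direct_sum_is_module[OF M N] _, of "\<lambda>x. (x, \<zero>\<^bsub>?N\<^esub>)" "fst p"]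
        torsion_hom[OF F N direct_sum_is_module[OF M N] _, of "\<lambda>y. (\<zero>\<^bsub>?M\<^esub>, y)" "snd p"] p
      by (auto simp del: torsion_part_simps(1))
    then have "(fst p, \<zero>\<^bsub>?N\<^esub>) \<oplus>\<^bsub>direct_sum_module ?M ?N\<^esub> (\<zero>\<^bsub>?M\<^esub>, snd p) \<in> carrier (torsion_part F (direct_sum_module ?M ?N))"
      by (rule submodule_add[OF direct_sum_is_module[OF M N] torsion_submodule[OF F direct_sum_is_module[OF M N]]])
    moreover have "fst p \<in> carrier ?M" "snd p \<in> carrier ?N" using p by auto
    ultimately show "p \<in> carrier (torsion_part F (direct_sum_module ?M ?N))"
      using M N by (simp del: torsion_part_simps(1))
  qed
  then show "direct_sum_module (torsion_part F ?M) (torsion_part F ?N) = torsion_part F (direct_sum_module ?M ?N)"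
    by (simp add: torsion_part_def direct_sum_module_def)
qed

lemma direct_sum_baer:
  assumes M: "baer_module R M" and N: "baer_module R N"
  shows "baer_module R (direct_sum_module M N)"
  unfolding baer_module_def
proof (intro conjI allI impI)
  show "module R (direct_sum_module M N)" using baer_is_module[OF M] baer_is_module[OF N] by simp
  fix J g assume *: "ideal J R \<and> g \<in> mod_hom R ((regular_module R)\<lparr>carrier := J\<rparr>) (direct_sum_module M N)"
  have "fst \<in> mod_hom R (direct_sum_module M N) M" "snd \<in> mod_hom R (direct_sum_module M N) N"
    by (intro mod_homI; auto)+
  then have "(\<lambda>x. fst (g x)) \<in> mod_hom R ((regular_module R)\<lparr>carrier := J\<rparr>) M"
    "(\<lambda>x. snd (g x)) \<in> mod_hom R ((regular_module R)\<lparr>carrier := J\<rparr>) N"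
    using * hom_comp by blast+
  then obtain e e' where "e \<in> carrier M" "\<forall>r\<in>J. fst (g r) = r \<odot>\<^bsub>M\<^esub> e" "e' \<in> carrier N" "\<forall>r\<in>J. snd (g r) = r \<odot>\<^bsub>N\<^esub> e'"
    using M N * unfolding baer_module_def by blast
  then show "\<exists>e\<in>carrier (direct_sum_module M N). \<forall>r\<in>J. g r = r \<odot>\<^bsub>direct_sum_module M N\<^esub> e"
    by (intro bexI[of _ "(e, e')"]) (auto simp: prod_eq_iff)
qed

text \<open>The horseshoe lemma. The augmentation has the components \<open>p\<close>, an extension
  of \<open>\<epsilon>'\<close> to \<open>M\<close>, and \<open>\<epsilon>''\<close> after
  \<open>g\<close>. The differential kills its image if \<open>t 0\<close> sends
  \<open>\<epsilon>'' (g m)\<close> to the negative of \<open>d' 0 (p m)\<close>, and squares to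
  zero if \<open>t (Suc n)\<close> sends \<open>d'' n y\<close> to the negative of
  \<open>d' (Suc n) (t n y)\<close>. Injectivity of the terms of \<open>E'\<close> supplies such
  maps one degree at a time.\<close>

lemma twisted_resolution:
  assumes se: "short_exact R L f M g N"
    and E': "baer_resolution R L \<epsilon>' E' d'" and E'': "baer_resolution R N \<epsilon>'' E'' d''"
  shows "\<exists>t \<epsilon>. twisting R E' d' E'' d'' t \<and>
    baer_resolution R M \<epsilon> (\<lambda>n. direct_sum_module (E' n) (E'' n)) (twisted_differential E' d' d'' t)"
proof -
  note s = short_exactD[OF se]
  note r' = coresolutionD[OF baer_resolutionD(1)[OF E']] and r'' = coresolutionD[OF baer_resolutionD(1)[OF E'']]
  note c' = complexD[OF r'(2)] and c'' = complexD[OF r''(2)] and b' = baer_resolutionD(2)[OF E']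
  have "\<exists>p\<in>mod_hom R M (E' 0). \<forall>x\<in>carrier L. p (f x) = \<epsilon>' x"
    using s(6) hom_inj_iff[OF s(1,2,4)] hom_zero[OF s(1) c'(1) r'(3)]
    by (intro baer_extend[OF s(1,2) b' s(4) r'(3)]) auto
  then obtain p where p: "p \<in> mod_hom R M (E' 0)" "\<And>x. x \<in> carrier L \<Longrightarrow> p (f x) = \<epsilon>' x" by blast
  let ?q = "\<lambda>m. (\<ominus> \<one>) \<odot>\<^bsub>E' (Suc 0)\<^esub> d' 0 (p m)"
  have q: "?q \<in> mod_hom R M (E' (Suc 0))"
    by (intro hom_times s c' hom_comp[OF p(1) c'(2)]) simp
  have eg: "(\<lambda>m. \<epsilon>'' (g m)) \<in> mod_hom R M (E'' 0)" by (rule hom_comp[OF s(5) r''(3)])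
  have eg0: "\<epsilon>'' (g m) = \<zero>\<^bsub>E'' 0\<^esub> \<Longrightarrow> g m = \<zero>\<^bsub>N\<^esub>" if "m \<in> carrier M" for m
    using r''(4) hom_inj_iff[OF s(3) c''(1) r''(3)] hom_closed[OF s(5) that] by blast
  have "\<exists>h\<in>mod_hom R (E'' 0) (E' (Suc 0)). \<forall>m\<in>carrier M. h (\<epsilon>'' (g m)) = ?q m"
  proof (rule baer_extend[OF s(2) c''(1) b' eg q])
    fix m assume m: "m \<in> carrier M" "\<epsilon>'' (g m) = \<zero>\<^bsub>E'' 0\<^esub>"
    then obtain x where "x \<in> carrier L" "m = f x" using s(8)[OF m(1) eg0] by blast
    then show "?q m = \<zero>\<^bsub>E' (Suc 0)\<^esub>" using p(2) r'(5) c'(1)[of "Suc 0"] by simp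
  qed
  then obtain h where h: "h \<in> mod_hom R (E'' 0) (E' (Suc 0))" "\<And>m. m \<in> carrier M \<Longrightarrow> h (\<epsilon>'' (g m)) = ?q m" by blast
  \<comment> \<open>The condition on cocycles is what makes the next prescription vanish on the
    kernel of \<open>d'' n\<close>, so that it extends along this differential.\<close>
  let ?P = "\<lambda>n t. t \<in> mod_hom R (E'' n) (E' (Suc n)) \<and> (n = 0 \<longrightarrow> t = h) \<and>
    (\<forall>y\<in>carrier (E'' n). d'' n y = \<zero>\<^bsub>E'' (Suc n)\<^esub> \<longrightarrow> d' (Suc n) (t y) = \<zero>\<^bsub>E' (Suc (Suc n))\<^esub>)"
  let ?Q = "\<lambda>n t t'. \<forall>y\<in>carrier (E'' n). t' (d'' n y) = (\<ominus> \<one>) \<odot>\<^bsub>E' (Suc (Suc n))\<^esub> d' (Suc n) (t y)"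
  have "d' (Suc 0) (h y) = \<zero>\<^bsub>E' (Suc (Suc 0))\<^esub>" if y: "y \<in> carrier (E'' 0)" "d'' 0 y = \<zero>\<^bsub>E'' (Suc 0)\<^esub>" for y
  proof -
    obtain z where "z \<in> carrier N" "y = \<epsilon>'' z" using r''(6)[OF y] by blast
    then obtain m where m: "m \<in> carrier M" "y = \<epsilon>'' (g m)" using s(9) by blast
    then show ?thesis
      using h(2)[OF m(1)] c'(3)[OF hom_closed[OF p(1) m(1)]] c'(1)[of "Suc (Suc 0)"] hom_smult[OF c'(2)]
        hom_closed[OF c'(2) hom_closed[OF p(1) m(1)]] by simp
  qed
  then have base: "\<exists>t. ?P 0 t" using h(1) by blast
  have step: "\<exists>t'. ?P (Suc n) t' \<and> ?Q n t t'" if P: "?P n t" for t n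
  proof -
    have th: "t \<in> mod_hom R (E'' n) (E' (Suc n))" using P by blast
    have "\<exists>k\<in>mod_hom R (E'' (Suc n)) (E' (Suc (Suc n))). \<forall>y\<in>carrier (E'' n). k (d'' n y) = (\<ominus> \<one>) \<odot>\<^bsub>E' (Suc (Suc n))\<^esub> d' (Suc n) (t y)"
      using P c'(1)
      by (intro baer_extend[OF c''(1) c''(1) b' c''(2)] hom_times c''(1) c'(1) hom_comp[OF th c'(2)]) auto
    then obtain k where k: "k \<in> mod_hom R (E'' (Suc n)) (E' (Suc (Suc n)))"
      "\<And>y. y \<in> carrier (E'' n) \<Longrightarrow> k (d'' n y) = (\<ominus> \<one>) \<odot>\<^bsub>E' (Suc (Suc n))\<^esub> d' (Suc n) (t y)" by blast
    have "d' (Suc (Suc n)) (k y) = \<zero>\<^bsub>E' (Suc (Suc (Suc n)))\<^esub>" if y: "y \<in> carrier (E'' (Suc n))" "d'' (Suc n) y = \<zero>\<^bsub>E'' (Suc (Suc n))\<^esub>" for y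
    proof -
      obtain w where w: "w \<in> carrier (E'' n)" "y = d'' n w" using r''(7)[OF y] by blast
      show ?thesis
        using k(2)[OF w(1)] w(2) c'(3)[OF hom_closed[OF th w(1)]] c'(1)[of "Suc (Suc (Suc n))"] hom_smult[OF c'(2)]
          hom_closed[OF c'(2) hom_closed[OF th w(1)]] by simp
    qed
    then show ?thesis using k by (intro exI[of _ k]) simp
  qed
  have "\<exists>t. \<forall>n. ?P n (t n) \<and> ?Q n (t n) (t (Suc n))"
    using base step by (rule dependent_nat_choice[of ?P ?Q])
  then obtain t where tt: "\<forall>n. ?P n (t n) \<and> ?Q n (t n) (t (Suc n))" by (elim exE)
  then have th: "t n \<in> mod_hom R (E'' n) (E' (Suc n))" and t0: "t 0 = h" for n by blast+
  have tq: "t (Suc n) (d'' n y) = (\<ominus> \<one>) \<odot>\<^bsub>E' (Suc (Suc n))\<^esub> d' (Suc n) (t n y)" if "y \<in> carrier (E'' n)" for n y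
    using tt that by blast
  have tw: "twisting R E' d' E'' d'' t"
    using r'(2) r''(2) th c'(1) hom_closed[OF c'(2) hom_closed[OF th]] by (simp add: twisting_def tq)
  note cl = twisting_closed[OF tw] and z = twisting_zero[OF tw]
  let ?E = "\<lambda>n. direct_sum_module (E' n) (E'' n)" and ?d = "twisted_differential E' d' d'' t"
  let ?e = "\<lambda>m. (p m, \<epsilon>'' (g m))"
  have e: "?e \<in> mod_hom R M (?E 0)"
    by (rule mod_homI) (auto simp: hom_closed[OF p(1)] hom_closed[OF eg] hom_add[OF p(1)] hom_add[OF eg] hom_smult[OF p(1)] hom_smult[OF eg])
  have "coresolution R M ?e ?E ?d"
  proof (rule coresolutionI[OF s(2) twisted_complex[OF tw] e])
    fix m assume m: "m \<in> carrier M"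
    show "m = \<zero>\<^bsub>M\<^esub>" if m0: "?e m = \<zero>\<^bsub>?E 0\<^esub>"
    proof -
      obtain x where x: "x \<in> carrier L" "m = f x" using s(8)[OF m eg0[OF m]] m0 by auto
      then have "\<epsilon>' x = \<zero>\<^bsub>E' 0\<^esub>" using p(2) m0 by simp
      then have "x = \<zero>\<^bsub>L\<^esub>" using r'(4) hom_inj_iff[OF s(1) c'(1) r'(3)] x(1) by blast
      then show ?thesis using x(2) hom_zero[OF s(1,2,4)] by simp
    qed
    show "?d 0 (?e m) = \<zero>\<^bsub>?E (Suc 0)\<^esub>"
      using h(2)[OF m] t0 r''(5) hom_closed[OF s(5) m] hom_closed[OF p(1) m] c'(1)[of "Suc 0"] cl(1)
      by (simp add: twisted_differential_def)
  next
    fix u assume u: "u \<in> carrier (?E 0)" "?d 0 u = \<zero>\<^bsub>?E (Suc 0)\<^esub>"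
    then obtain x y where xy: "u = (x, y)" "x \<in> carrier (E' 0)" "y \<in> carrier (E'' 0)"
      "d' 0 x \<oplus>\<^bsub>E' (Suc 0)\<^esub> t 0 y = \<zero>\<^bsub>E' (Suc 0)\<^esub>" "d'' 0 y = \<zero>\<^bsub>E'' (Suc 0)\<^esub>"
      by (auto simp: twisted_differential_def)
    obtain w where "w \<in> carrier N" "y = \<epsilon>'' w" using r''(6)[OF xy(3,5)] by blast
    then obtain m where m: "m \<in> carrier M" "y = \<epsilon>'' (g m)" using s(9) by blast
    note pm = hom_closed[OF p(1) m(1)]
    have "t 0 y = (\<ominus> \<one>) \<odot>\<^bsub>E' (Suc 0)\<^esub> d' 0 (p m)" using h(2)[OF m(1)] m(2) t0 by simp
    then have "d' 0 (x \<oplus>\<^bsub>E' 0\<^esub> (\<ominus> \<one>) \<odot>\<^bsub>E' 0\<^esub> p m) = \<zero>\<^bsub>E' (Suc 0)\<^esub>"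
      using xy(2,4) pm c'(1)[of 0] by (simp add: hom_add[OF c'(2)] hom_smult[OF c'(2)])
    then obtain l where l: "l \<in> carrier L" "x \<oplus>\<^bsub>E' 0\<^esub> (\<ominus> \<one>) \<odot>\<^bsub>E' 0\<^esub> p m = \<epsilon>' l"
      using r'(6) xy(2) pm c'(1)[of 0] by (metis madd_closed msmult_closed a_inv_closed one_closed)
    have "x = p m \<oplus>\<^bsub>E' 0\<^esub> p (f l)" using l p(2)[OF l(1)] xy(2) pm c'(1)[of 0] by (simp add: madd_neg_cancel2 flip: l(2))
    then have "x = p (m \<oplus>\<^bsub>M\<^esub> f l)" using hom_add[OF p(1) m(1) hom_closed[OF s(4) l(1)]] by simp
    moreover have "\<epsilon>'' (g (m \<oplus>\<^bsub>M\<^esub> f l)) = y"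
      using m l s(7)[OF l(1)] hom_add[OF s(5) m(1) hom_closed[OF s(4) l(1)]] s(3) hom_closed[OF s(5) m(1)] by simp
    ultimately show "\<exists>m\<in>carrier M. u = ?e m"
      using xy(1) m(1) hom_closed[OF s(4) l(1)] s(2) by (intro bexI[of _ "m \<oplus>\<^bsub>M\<^esub> f l"]) auto
  next
    fix n u assume u: "u \<in> carrier (?E (Suc n))" "?d (Suc n) u = \<zero>\<^bsub>?E (Suc (Suc n))\<^esub>"
    then obtain x y where xy: "u = (x, y)" "x \<in> carrier (E' (Suc n))" "y \<in> carrier (E'' (Suc n))"
      "(x, y) \<in> cocycles ?E ?d (Suc n)" "d'' (Suc n) y = \<zero>\<^bsub>E'' (Suc (Suc n))\<^esub>"
      by (auto simp: twisted_differential_def cocycles_iff)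
    then have "y \<in> coboundaries E'' d'' (Suc n)" using r''(7)[OF xy(3,5)] by (auto simp: coboundaries_Suc)
    then obtain x' b where x': "x' \<in> cocycles E' d' (Suc n)" and b: "b \<in> coboundaries ?E ?d (Suc n)"
      "u = (x', \<zero>\<^bsub>E'' (Suc n)\<^esub>) \<oplus>\<^bsub>?E (Suc n)\<^esub> b"
      using twisted_split[OF tw xy(4)] xy(1) by auto
    have "x' \<in> coboundaries E' d' (Suc n)" using x' r'(7) by (fastforce simp: cocycles_iff coboundaries_Suc)
    then have "u \<in> coboundaries ?E ?d (Suc n)"
      unfolding b(2)
      by (intro submodule_add[OF complexD(1)[OF twisted_complex[OF tw]] coboundaries_submodule[OF twisted_complex[OF tw]]] b(1)
         twisted_incl_coboundary[OF tw])
    then show "\<exists>v\<in>carrier (?E n). u = ?d n v" unfolding coboundaries_Suc by blast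
  qed
  then have "baer_resolution R M ?e ?E ?d"
    using b' baer_resolutionD(2)[OF E''] by (simp add: baer_resolution_def direct_sum_baer)
  then show ?thesis using tw by blast
qed

end

context noetherian_cring
begin

text \<open>The cohomology of the middle complex sits exactly between those of the outer ones, and
  \<open>fin_gen_exact\<close> asks for exactness at that place alone.\<close>

lemma twisted_cohomology_fin_gen:
  assumes tw: "twisting R C' d' C'' d'' t"
    and fg: "fin_gen_module R (cohomology_module C' d' n)" "fin_gen_module R (cohomology_module C'' d'' n)"
  shows "fin_gen_module R (cohomology_module (\<lambda>n. direct_sum_module (C' n) (C'' n)) (twisted_differential C' d' d'' t) n)"
proof -
  let ?C = "\<lambda>n. direct_sum_module (C' n) (C'' n)" and ?d = "twisted_differential C' d' d'' t"
  note D = twistingD[OF tw] and T = twisted_complex[OF tw]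
  note c' = complexD(1)[OF D(1)] and c'' = complexD(1)[OF D(2)]
  note m' = cocycle_module[OF D(1), of n] and m'' = cocycle_module[OF D(2), of n] and mT = cocycle_module[OF T, of n]
  have i: "(\<lambda>x. (x, \<zero>\<^bsub>C'' n\<^esub>)) \<in> mod_hom R ((C' n)\<lparr>carrier := cocycles C' d' n\<rparr>) ((?C n)\<lparr>carrier := cocycles ?C ?d n\<rparr>)"
    using c'' c' twisting_zero[OF tw] by (intro mod_homI) (auto simp: twisted_differential_def cocycles_iff)
  have p: "snd \<in> mod_hom R ((?C n)\<lparr>carrier := cocycles ?C ?d n\<rparr>) ((C'' n)\<lparr>carrier := cocycles C'' d'' n\<rparr>)"
    by (rule mod_homI) (auto simp: twisted_cocycle_iff[OF tw])
  obtain u where u: "u \<in> mod_hom R (cohomology_module C' d' n) (cohomology_module ?C ?d n)"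
    "\<And>x. x \<in> cocycles C' d' n \<Longrightarrow> u (coboundaries C' d' n +>\<^bsub>(C' n)\<lparr>carrier := cocycles C' d' n\<rparr>\<^esub> x) =
      coboundaries ?C ?d n +>\<^bsub>(?C n)\<lparr>carrier := cocycles ?C ?d n\<rparr>\<^esub> (x, \<zero>\<^bsub>C'' n\<^esub>)"
    using quotient_map[OF m' mT i] twisted_incl_coboundary[OF tw] unfolding cohomology_module_alt by auto
  obtain v where v: "v \<in> mod_hom R (cohomology_module ?C ?d n) (cohomology_module C'' d'' n)"
    "\<And>z. z \<in> cocycles ?C ?d n \<Longrightarrow> v (coboundaries ?C ?d n +>\<^bsub>(?C n)\<lparr>carrier := cocycles ?C ?d n\<rparr>\<^esub> z) =
      coboundaries C'' d'' n +>\<^bsub>(C'' n)\<lparr>carrier := cocycles C'' d'' n\<rparr>\<^esub> snd z"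
    using quotient_map[OF mT m'' p] twisted_proj_coboundary[OF tw] unfolding cohomology_module_alt by fastforce
  show ?thesis
  proof (rule fin_gen_exact[OF cohomology_is_module[OF D(1)] cohomology_is_module[OF T] cohomology_is_module[OF D(2)] u(1) v(1) _ fg])
    fix K assume K: "K \<in> carrier (cohomology_module ?C ?d n)" "v K = \<zero>\<^bsub>cohomology_module C'' d'' n\<^esub>"
    then obtain x y where z: "(x, y) \<in> cocycles ?C ?d n" "K = coboundaries ?C ?d n +>\<^bsub>(?C n)\<lparr>carrier := cocycles ?C ?d n\<rparr>\<^esub> (x, y)"
      unfolding cohomology_module_alt quotient_carrier[OF mT] by auto
    have "y \<in> coboundaries C'' d'' n"
      using K(2) v(2)[OF z(1)] z coset_zero_iff[OF m'', of y] unfolding cohomology_module_alt quotient_zero[OF m'']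
      by (simp add: twisted_cocycle_iff[OF tw])
    then obtain x' b where x': "x' \<in> cocycles C' d' n" and b: "b \<in> coboundaries ?C ?d n" "(x, y) = (x', \<zero>\<^bsub>C'' n\<^esub>) \<oplus>\<^bsub>?C n\<^esub> b"
      using twisted_split[OF tw z(1)] by auto
    have xz: "(x', \<zero>\<^bsub>C'' n\<^esub>) \<in> cocycles ?C ?d n" using hom_closed[OF i] x' by simp
    have bc: "b \<in> carrier (?C n)" "(x', \<zero>\<^bsub>C'' n\<^esub>) \<in> carrier (?C n)"
      using subsetD[OF coboundaries_subset[OF T] b(1)] xz by (simp_all only: cocycles_iff)
    have "(x, y) \<oplus>\<^bsub>?C n\<^esub> (\<ominus> \<one>) \<odot>\<^bsub>?C n\<^esub> (x', \<zero>\<^bsub>C'' n\<^esub>) = b"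
      unfolding b(2) using bc complexD(1)[OF T, of n]
      by (simp add: madd_comm[of "?C n" "(x', \<zero>\<^bsub>C'' n\<^esub>)"] madd_assoc del: direct_sum_module_simps)
    then have "K = coboundaries ?C ?d n +>\<^bsub>(?C n)\<lparr>carrier := cocycles ?C ?d n\<rparr>\<^esub> (x', \<zero>\<^bsub>C'' n\<^esub>)"
      unfolding z(2) using coset_eq_iff[OF mT, of "(x, y)" "(x', \<zero>\<^bsub>C'' n\<^esub>)"] z(1) xz b(1) by simp
    then show "K \<in> u ` carrier (cohomology_module C' d' n)"
      using u(2)[OF x'] x' unfolding cohomology_module_alt quotient_carrier[OF m'] by (auto intro!: rev_image_eqI)
  qed
qed

section \<open>Torsion in injective modules\<close>

text \<open>In a noetherian ring the union of a nonempty chain of ideals is a member of the chain,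
  so Zorn's lemma applies to every nonempty family.\<close>

lemma ideal_family_has_maximal:
  assumes "C \<noteq> {}" "\<And>K. K \<in> C \<Longrightarrow> ideal K R"
  shows "\<exists>K\<in>C. \<forall>K'\<in>C. K \<subseteq> K' \<longrightarrow> K' = K"
proof (rule subset_Zorn_nonempty[OF assms(1)])
  fix D assume D: "D \<noteq> {}" "subset.chain C D"
  then have "subset.chain {I. ideal I R} D" using assms(2) by (auto simp: subset.chain_def)
  then show "\<Union>D \<in> C" using ideal_chain_is_trivial[OF D(1)] D(2) by (auto simp: subset.chain_def)
qed

end

context noetherian_ideal
begin

lemma ideal_element_carr: "x \<in> I \<Longrightarrow> x \<in> carrier R"
  using ideal_carr[OF I] by auto

lemma generators: "\<exists>S. finite S \<and> S \<subseteq> I \<and> I = Idl S"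
  using finetely_gen[OF I] genideal_self by blast

lemma ideal_power_kills_Suc:
  assumes M: "module R M" "e \<in> carrier M" and S: "S \<subseteq> I" "I = Idl S"
    and kill: "\<And>x s. \<lbrakk>x \<in> S; s \<in> ideal_power R I n\<rbrakk> \<Longrightarrow> s \<odot>\<^bsub>M\<^esub> (x \<odot>\<^bsub>M\<^esub> e) = \<zero>\<^bsub>M\<^esub>"
    and r: "r \<in> ideal_power R I (Suc n)"
  shows "r \<odot>\<^bsub>M\<^esub> e = \<zero>\<^bsub>M\<^esub>"
proof -
  have pc: "s \<in> carrier R" if "s \<in> ideal_power R I n" for s using that ideal_power_carr by auto
  have "ideal {x \<in> carrier R. \<forall>s\<in>ideal_power R I n. s \<odot>\<^bsub>M\<^esub> (x \<odot>\<^bsub>M\<^esub> e) = \<zero>\<^bsub>M\<^esub>} R"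
    using M pc by (intro ideal_intro)
      (auto simp: msmult_add_left msmult_add_right msmult_mult msmult_comm[of M _ _ "_ \<odot>\<^bsub>M\<^esub> _"])
  then have "Idl S \<subseteq> {x \<in> carrier R. \<forall>s\<in>ideal_power R I n. s \<odot>\<^bsub>M\<^esub> (x \<odot>\<^bsub>M\<^esub> e) = \<zero>\<^bsub>M\<^esub>}"
    using kill S(1) ideal_element_carr by (intro genideal_minimal) auto
  then have k: "s \<odot>\<^bsub>M\<^esub> (x \<odot>\<^bsub>M\<^esub> e) = \<zero>\<^bsub>M\<^esub>" if "x \<in> I" "s \<in> ideal_power R I n" for x s
    using that S(2) by auto
  have "r \<in> I \<cdot>\<^bsub>R\<^esub> ideal_power R I n" using r by (simp add: ideal_power_Suc)
  then have "r \<in> carrier R \<and> r \<odot>\<^bsub>M\<^esub> e = \<zero>\<^bsub>M\<^esub>"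
  proof (induction r rule: ideal_prod.induct)
    case (prod i j)
    then show ?case using k[OF prod] M ideal_element_carr pc by (simp add: msmult_mult msmult_comm[of M j i])
  next
    case (sum s1 s2)
    then show ?case using M by (simp add: msmult_add_left)
  qed
  then show ?thesis ..
qed

text \<open>Induction on the sum of the exponents: multiplying \<open>e\<close> by a generator
  \<open>x\<close> lowers the exponent of \<open>x\<close>. So a common power of \<open>I\<close>
  kills \<open>x \<odot> e\<close> for all generators \<open>x\<close>, and the next power kills
  \<open>e\<close>.\<close>

lemma ideal_power_kills:
  assumes M: "module R M" "e \<in> carrier M" and S: "finite S" "S \<subseteq> I" "I = Idl S"
    and "\<forall>x\<in>S. (x [^] (k x :: nat)) \<odot>\<^bsub>M\<^esub> e = \<zero>\<^bsub>M\<^esub>"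
  shows "\<exists>n. \<forall>r\<in>ideal_power R I n. r \<odot>\<^bsub>M\<^esub> e = \<zero>\<^bsub>M\<^esub>"
  using M(2) assms(6)
proof (induction "sum k S" arbitrary: k e rule: less_induct)
  case less
  have generator_carr: "x \<in> carrier R" if "x \<in> S" for x using that S(2) ideal_element_carr by auto
  show ?case
  proof (cases "\<exists>x\<in>S. k x = 0")
    case True
    then have "e = \<zero>\<^bsub>M\<^esub>" using less.prems M(1) by force
    then show ?thesis using M(1) by (intro exI[of _ 0]) (simp add: ideal_power_0)
  next
    case False
    have "\<exists>n. \<forall>r\<in>ideal_power R I n. r \<odot>\<^bsub>M\<^esub> (x \<odot>\<^bsub>M\<^esub> e) = \<zero>\<^bsub>M\<^esub>" if x: "x \<in> S" for x
    proof (rule less.hyps[of "k(x := k x - 1)"])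
      have kx: "k x > 0" using False x by auto
      show "sum (k(x := k x - 1)) S < sum k S"
        using S(1) x kx by (intro sum_strict_mono_ex1) auto
      show "x \<odot>\<^bsub>M\<^esub> e \<in> carrier M" using less.prems(1) generator_carr[OF x] M(1) by simp
      show "\<forall>y\<in>S. (y [^] ((k(x := k x - 1)) y)) \<odot>\<^bsub>M\<^esub> (x \<odot>\<^bsub>M\<^esub> e) = \<zero>\<^bsub>M\<^esub>"
      proof
        fix y assume y: "y \<in> S"
        show "(y [^] ((k(x := k x - 1)) y)) \<odot>\<^bsub>M\<^esub> (x \<odot>\<^bsub>M\<^esub> e) = \<zero>\<^bsub>M\<^esub>"
        proof (cases "y = x")
          case True
          have "x [^] k x = x [^] (k x - 1) \<otimes> x" using kx by (metis Suc_pred' nat_pow_Suc)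
          then have "(x [^] (k x - 1)) \<odot>\<^bsub>M\<^esub> (x \<odot>\<^bsub>M\<^esub> e) = (x [^] k x) \<odot>\<^bsub>M\<^esub> e"
            using M(1) less.prems(1) generator_carr[OF x] by (simp add: msmult_mult)
          then show ?thesis using less.prems(2) x True by simp
        next
          case False
          then show ?thesis
            using M(1) less.prems y generator_carr[OF x] generator_carr[OF y] by (simp add: msmult_comm[of M "y [^] k y" x])
        qed
      qed
    qed
    then obtain n where n: "\<And>x. x \<in> S \<Longrightarrow> \<forall>r\<in>ideal_power R I (n x). r \<odot>\<^bsub>M\<^esub> (x \<odot>\<^bsub>M\<^esub> e) = \<zero>\<^bsub>M\<^esub>"
      by metis
    have "s \<odot>\<^bsub>M\<^esub> (x \<odot>\<^bsub>M\<^esub> e) = \<zero>\<^bsub>M\<^esub>" if "x \<in> S" "s \<in> ideal_power R I (sum n S)" for x s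
      using that n ideal_power_antimono[of "n x" "sum n S"] member_le_sum[of x S n] S(1) by auto
    then show ?thesis
      using ideal_power_kills_Suc[OF M(1) less.prems(1) S(2,3)] by blast
  qed
qed

text \<open>One exponent serves all of \<open>J\<close> because \<open>J\<close> is finitely
  generated: the sum of the exponents of the generators bounds each of them.\<close>

lemma ideal_power_kills_ideal:
  assumes M: "module R M" and J: "ideal J R" and g: "g \<in> mod_hom R ((regular_module R)\<lparr>carrier := J\<rparr>) M"
    and tor: "\<And>j. j \<in> J \<Longrightarrow> \<exists>n. \<forall>s\<in>ideal_power R I n. s \<odot>\<^bsub>M\<^esub> g j = \<zero>\<^bsub>M\<^esub>"
  shows "\<exists>n. \<forall>j\<in>J. \<forall>s\<in>ideal_power R I n. s \<odot>\<^bsub>M\<^esub> g j = \<zero>\<^bsub>M\<^esub>"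
proof -
  obtain A where A: "A \<subseteq> carrier R" "finite A" "J = Idl A" using finetely_gen[OF J] by auto
  have AJ: "A \<subseteq> J" using genideal_self[OF A(1)] A(3) by simp
  obtain n where n: "\<And>j. j \<in> J \<Longrightarrow> \<forall>s\<in>ideal_power R I (n j). s \<odot>\<^bsub>M\<^esub> g j = \<zero>\<^bsub>M\<^esub>"
    using tor by metis
  let ?n = "sum n A"
  have Jm: "module R ((regular_module R)\<lparr>carrier := J\<rparr>)" by (rule ideal_module[OF J])
  have gc: "g j \<in> carrier M" if "j \<in> J" for j using hom_closed[OF g, of j] that by simp
  interpret J: ideal J R by (rule J)
  have ga: "g (i \<oplus> j) = g i \<oplus>\<^bsub>M\<^esub> g j" if "i \<in> J" "j \<in> J" for i j using hom_add[OF g, of i j] that by simp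
  have gs: "g (r \<otimes> j) = r \<odot>\<^bsub>M\<^esub> g j" if "r \<in> carrier R" "j \<in> J" for r j using hom_smult[OF g, of r j] that by simp
  have pc: "s \<in> carrier R" if "s \<in> ideal_power R I ?n" for s using that ideal_power_carr by auto
  have "ideal {j \<in> J. \<forall>s\<in>ideal_power R I ?n. s \<odot>\<^bsub>M\<^esub> g j = \<zero>\<^bsub>M\<^esub>} R"
  proof (rule ideal_intro)
    show "{j \<in> J. \<forall>s\<in>ideal_power R I ?n. s \<odot>\<^bsub>M\<^esub> g j = \<zero>\<^bsub>M\<^esub>} \<subseteq> carrier R" using J.Icarr by auto
    show "\<zero> \<in> {j \<in> J. \<forall>s\<in>ideal_power R I ?n. s \<odot>\<^bsub>M\<^esub> g j = \<zero>\<^bsub>M\<^esub>}"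
      using hom_zero[OF Jm M g] M pc by simp
  next
    fix i j assume "i \<in> {j \<in> J. \<forall>s\<in>ideal_power R I ?n. s \<odot>\<^bsub>M\<^esub> g j = \<zero>\<^bsub>M\<^esub>}"
      "j \<in> {j \<in> J. \<forall>s\<in>ideal_power R I ?n. s \<odot>\<^bsub>M\<^esub> g j = \<zero>\<^bsub>M\<^esub>}"
    then show "i \<oplus> j \<in> {j \<in> J. \<forall>s\<in>ideal_power R I ?n. s \<odot>\<^bsub>M\<^esub> g j = \<zero>\<^bsub>M\<^esub>}"
      using M pc gc by (simp add: ga msmult_add_right)
  next
    fix r j assume "r \<in> carrier R" "j \<in> {j \<in> J. \<forall>s\<in>ideal_power R I ?n. s \<odot>\<^bsub>M\<^esub> g j = \<zero>\<^bsub>M\<^esub>}"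
    then show "r \<otimes> j \<in> {j \<in> J. \<forall>s\<in>ideal_power R I ?n. s \<odot>\<^bsub>M\<^esub> g j = \<zero>\<^bsub>M\<^esub>}"
      using M pc gc by (simp add: gs J.I_l_closed msmult_comm[OF M _ \<open>r \<in> carrier R\<close>])
  qed
  moreover have "A \<subseteq> {j \<in> J. \<forall>s\<in>ideal_power R I ?n. s \<odot>\<^bsub>M\<^esub> g j = \<zero>\<^bsub>M\<^esub>}"
  proof (intro subsetI CollectI conjI ballI)
    fix a s assume a: "a \<in> A" and s: "s \<in> ideal_power R I ?n"
    have "ideal_power R I ?n \<subseteq> ideal_power R I (n a)"
      using a A(2) by (intro ideal_power_antimono member_le_sum) auto
    then show "s \<odot>\<^bsub>M\<^esub> g a = \<zero>\<^bsub>M\<^esub>" using n[of a] s a AJ by auto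
  qed (use AJ in auto)
  ultimately have "Idl A \<subseteq> {j \<in> J. \<forall>s\<in>ideal_power R I ?n. s \<odot>\<^bsub>M\<^esub> g j = \<zero>\<^bsub>M\<^esub>}"
    by (rule genideal_minimal)
  then show ?thesis using A(3) by auto
qed

text \<open>A weak form of the Artin--Rees lemma: if a power of \<open>I\<close> maps \<open>J\<close> into \<open>L\<close>, then an ideal \<open>K\<close>
  that is maximal subject to \<open>K \<inter> J = L\<close> contains a power of each element of \<open>I\<close>.\<close>

lemma artin_rees_weak:
  assumes J: "ideal J R" and L: "ideal L R" "L \<subseteq> J"
    and n: "\<And>j s. \<lbrakk>j \<in> J; s \<in> ideal_power R I n\<rbrakk> \<Longrightarrow> s \<otimes> j \<in> L"
  shows "\<exists>K. ideal K R \<and> K \<inter> J = L \<and> (\<forall>x\<in>I. \<exists>k::nat. x [^] k \<in> K)"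
proof -
  let ?C = "{K. ideal K R \<and> L \<subseteq> K \<and> K \<inter> J \<subseteq> L}"
  have "\<exists>K\<in>?C. \<forall>K'\<in>?C. K \<subseteq> K' \<longrightarrow> K' = K"
    using L by (intro ideal_family_has_maximal) auto
  then obtain K where KC: "K \<in> ?C" "\<forall>K'\<in>?C. K \<subseteq> K' \<longrightarrow> K' = K" by (elim bexE)
  then have K: "ideal K R" "L \<subseteq> K" "K \<inter> J \<subseteq> L"
    and max: "\<And>K'. \<lbrakk>ideal K' R; L \<subseteq> K'; K' \<inter> J \<subseteq> L; K \<subseteq> K'\<rbrakk> \<Longrightarrow> K' = K" by auto
  interpret K: ideal K R by (rule K(1))
  interpret J: ideal J R by (rule J)
  have "\<exists>k::nat. x [^] k \<in> K" if x: "x \<in> I" for x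
  proof -
    have xc: "x \<in> carrier R" using x ideal_element_carr by auto
    \<comment> \<open>The colon ideals of \<open>K\<close> by the powers of \<open>x\<close>. They
      ascend, so in a noetherian ring they become stationary.\<close>
    define D where "D k = {v \<in> carrier R. x [^] k \<otimes> v \<in> K}" for k :: nat
    have D: "ideal (D k) R" for k
    proof (rule ideal_intro)
      fix r v assume "r \<in> carrier R" "v \<in> D k"
      then show "r \<otimes> v \<in> D k"
        using K.I_l_closed[of "x [^] k \<otimes> v" r] xc by (simp add: m_lcomm D_def)
    qed (use xc in \<open>auto simp: r_distr D_def\<close>)
    have Dmono: "D k \<subseteq> D (k + l)" for k l
    proof
      fix v assume v: "v \<in> D k"
      then have vc: "v \<in> carrier R" and vK: "x [^] k \<otimes> v \<in> K" by (auto simp: D_def)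
      have "x [^] l \<otimes> (x [^] k \<otimes> v) \<in> K" using xc by (intro K.I_l_closed[OF vK]) simp
      moreover have "x [^] l \<otimes> (x [^] k \<otimes> v) = x [^] (k + l) \<otimes> v"
        using vc xc by (simp add: m_assoc[symmetric] nat_pow_mult add.commute)
      ultimately show "v \<in> D (k + l)" using vc by (simp add: D_def)
    qed
    have "\<exists>D0\<in>range D. \<forall>D'\<in>range D. D0 \<subseteq> D' \<longrightarrow> D' = D0"
      using D by (intro ideal_family_has_maximal) auto
    then obtain D0 where D0: "D0 \<in> range D" "\<forall>D'\<in>range D. D0 \<subseteq> D' \<longrightarrow> D' = D0" by (elim bexE)
    from D0(1) obtain k0 where "D0 = D k0" by (elim rangeE)
    then have k0: "D l = D k0" if "D k0 \<subseteq> D l" for l using D0(2) that by simp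
    have stable: "D (k0 + l) = D k0" for l
      using k0[OF Dmono] .
    \<comment> \<open>From \<open>k0\<close> on the colon ideals are stationary, and from
      \<open>n\<close> on the powers of \<open>x\<close> map \<open>J\<close> into \<open>L\<close>;
      \<open>k\<close> is large enough for both.\<close>
    define k where "k = k0 + n"
    have st: "v \<in> D k" if "v \<in> D (k + k)" for v
    proof -
      have "D (k + k) = D k0" using stable[of "n + k"] by (simp add: k_def add.assoc)
      then show ?thesis using that stable[of n] by (simp add: k_def)
    qed
    have xkJ: "x [^] k \<otimes> j \<in> L" if j: "j \<in> J" for j
    proof -
      have "x [^] k \<in> ideal_power R I n"
        using pow_in_ideal_power[OF x, of k] ideal_power_antimono[of n k] by (auto simp: k_def)
      then show ?thesis using n j by auto
    qed
    \<comment> \<open>The ideal generated by \<open>K\<close> and \<open>x [^] k\<close>. Once it is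
      shown to meet \<open>J\<close> inside \<open>L\<close>, maximality of \<open>K\<close> puts
      \<open>x [^] k\<close> into \<open>K\<close>.\<close>
    let ?K = "{u \<oplus> x [^] k \<otimes> v | u v. u \<in> K \<and> v \<in> carrier R}"
    have "ideal ?K R"
    proof (rule ideal_intro)
      show "?K \<subseteq> carrier R" using K.Icarr xc by auto
      show "\<zero> \<in> ?K" using xc by (intro CollectI exI[of _ \<zero>]) simp
    next
      fix a b assume "a \<in> ?K" "b \<in> ?K"
      then obtain u v u' v' where *: "u \<in> K" "v \<in> carrier R" "a = u \<oplus> x [^] k \<otimes> v"
        "u' \<in> K" "v' \<in> carrier R" "b = u' \<oplus> x [^] k \<otimes> v'" by blast
      have "a \<oplus> b = (u \<oplus> u') \<oplus> x [^] k \<otimes> (v \<oplus> v')"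
        using * K.Icarr xc by (simp add: r_distr a_assoc a_lcomm)
      then show "a \<oplus> b \<in> ?K" using * K.a_closed by blast
    next
      fix r a assume r: "r \<in> carrier R" and "a \<in> ?K"
      then obtain u v where *: "u \<in> K" "v \<in> carrier R" "a = u \<oplus> x [^] k \<otimes> v" by blast
      have "r \<otimes> a = r \<otimes> u \<oplus> x [^] k \<otimes> (r \<otimes> v)"
        using * r K.Icarr xc by (simp add: r_distr m_lcomm)
      then show "r \<otimes> a \<in> ?K" using * r K.I_l_closed by blast
    qed
    moreover have KK: "K \<subseteq> ?K"
    proof
      fix u assume u: "u \<in> K"
      then have "u = u \<oplus> x [^] k \<otimes> \<zero>" using K.Icarr xc by simp
      then show "u \<in> ?K" using u by blast
    qed
    moreover have "?K \<inter> J \<subseteq> L"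
    proof
      fix j assume "j \<in> ?K \<inter> J"
      then obtain u v where j: "j \<in> J" "u \<in> K" "v \<in> carrier R" "j = u \<oplus> x [^] k \<otimes> v" by blast
      have uc: "u \<in> carrier R" using j K.Icarr by auto
      have "x [^] k \<otimes> j \<in> K" using xkJ[OF j(1)] K(2) by auto
      moreover have "x [^] k \<otimes> u \<in> K" using j(2) xc by (intro K.I_l_closed) auto
      \<comment> \<open>Multiplying by \<open>x [^] k\<close> once more puts the left side into
        \<open>L\<close>, so \<open>v\<close> lies in a later colon ideal, and this equals
        \<open>D k\<close>.\<close>
      moreover have "x [^] k \<otimes> j = x [^] k \<otimes> u \<oplus> x [^] (k + k) \<otimes> v"
        using j(3,4) uc xc by (simp add: r_distr nat_pow_mult[symmetric] m_assoc)
      ultimately have "x [^] (k + k) \<otimes> v \<in> K"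
        using uc j(3) xc K.a_closed[OF K.a_inv_closed[of "x [^] k \<otimes> u"]] by (metis m_closed nat_pow_closed r_neg1)
      then have "x [^] k \<otimes> v \<in> K" using st[of v] j(3) by (simp add: D_def)
      then have "j \<in> K" using j K.a_closed by simp
      then show "j \<in> L" using K(3) j(1) by auto
    qed
    ultimately have "?K = K" using K(2) by (intro max) auto
    moreover have "x [^] k \<in> ?K" using xc by (intro CollectI exI[of _ \<zero>] exI[of _ \<one>]) simp
    ultimately show ?thesis by blast
  qed
  then show ?thesis using K L(2) by blast
qed

text \<open>A power of \<open>I\<close> kills the image of \<open>g\<close>, so it maps
  \<open>J\<close> into the kernel of \<open>g\<close>. An ideal \<open>K\<close> that meets
  \<open>J\<close> in this kernel allows \<open>g\<close> to be extended by zero to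
  \<open>J + K\<close> and then, by injectivity of \<open>E\<close>, to the ring. The resulting
  element is killed by \<open>K\<close>, which contains powers of the generators of
  \<open>I\<close>, so it is torsion.\<close>

lemma torsion_baer:
  assumes E: "baer_module R E"
  shows "baer_module R (torsion_part torsion_filter E)"
  unfolding baer_module_def
proof (intro conjI allI impI)
  let ?T = "torsion_part torsion_filter E"
  note Em = baer_is_module[OF E]
  show "module R ?T" by (rule torsion_is_module[OF torsion_filter Em])
  fix J g assume *: "ideal J R \<and> g \<in> mod_hom R ((regular_module R)\<lparr>carrier := J\<rparr>) ?T"
  let ?J = "(regular_module R)\<lparr>carrier := J\<rparr>"
  have J: "ideal J R" and gT: "g \<in> mod_hom R ?J ?T" using * by auto
  have g: "g \<in> mod_hom R ?J E"
    by (rule hom_enlarge_cod[OF gT[unfolded torsion_part_def]]) auto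
  have Jm: "module R ?J" by (rule ideal_module[OF J])
  interpret J: ideal J R by (rule J)
  have gc: "g j \<in> carrier E" if "j \<in> J" for j using hom_closed[OF g, of j] that by simp
  have gs: "g (r \<otimes> j) = r \<odot>\<^bsub>E\<^esub> g j" if "r \<in> carrier R" "j \<in> J" for r j using hom_smult[OF g, of r j] that by simp
  have ga: "g (i \<oplus> j) = g i \<oplus>\<^bsub>E\<^esub> g j" if "i \<in> J" "j \<in> J" for i j using hom_add[OF g, of i j] that by simp
  have g0: "g \<zero> = \<zero>\<^bsub>E\<^esub>" using hom_zero[OF Jm Em g] by simp
  have "\<exists>n. \<forall>s\<in>ideal_power R I n. s \<odot>\<^bsub>E\<^esub> g j = \<zero>\<^bsub>E\<^esub>" if "j \<in> J" for j
    using hom_closed[OF gT, of j] that unfolding torsion_carrier by simp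
  then obtain n where n: "\<forall>j\<in>J. \<forall>s\<in>ideal_power R I n. s \<odot>\<^bsub>E\<^esub> g j = \<zero>\<^bsub>E\<^esub>"
    using ideal_power_kills_ideal[OF Em J g] by blast
  let ?L = "{j \<in> J. g j = \<zero>\<^bsub>E\<^esub>}"
  have L: "ideal ?L R"
    using J.Icarr J.I_l_closed ga gs g0 Em by (intro ideal_intro) auto
  have nL: "s \<otimes> j \<in> ?L" if "j \<in> J" "s \<in> ideal_power R I n" for j s
    using that n ideal_power_carr gs by (auto simp: J.I_l_closed subset_iff)
  have "\<exists>K. ideal K R \<and> K \<inter> J = ?L \<and> (\<forall>x\<in>I. \<exists>k::nat. x [^] k \<in> K)"
    by (rule artin_rees_weak[OF J L _ nL]) auto
  then obtain K where K: "ideal K R" "K \<inter> J = ?L" "\<And>x. x \<in> I \<Longrightarrow> \<exists>k::nat. x [^] k \<in> K"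
    by auto
  interpret K: ideal K R by (rule K(1))
  let ?K = "(regular_module R)\<lparr>carrier := K\<rparr>"
  have Km: "module R ?K" by (rule ideal_module[OF K(1)])
  \<comment> \<open>The direct sum stands for the ideal \<open>J + K\<close>: that the extension by
    zero is well defined there becomes the condition on kernels in
    \<open>baer_extend\<close>.\<close>
  have d: "(\<lambda>(j, k). j \<oplus> k) \<in> mod_hom R (direct_sum_module ?J ?K) (regular_module R)"
    using J.Icarr K.Icarr by (intro mod_homI) (auto simp: a_assoc a_lcomm r_distr)
  have g': "(\<lambda>(j, k). g j) \<in> mod_hom R (direct_sum_module ?J ?K) E"
    by (intro mod_homI) (auto simp: gc ga gs)
  have "\<exists>h\<in>mod_hom R (regular_module R) E. \<forall>p\<in>carrier (direct_sum_module ?J ?K).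
      h ((\<lambda>(j, k). j \<oplus> k) p) = (\<lambda>(j, k). g j) p"
  proof (rule baer_extend[OF direct_sum_is_module[OF Jm Km] regular_is_module E d g'])
    fix p assume p: "p \<in> carrier (direct_sum_module ?J ?K)" "(\<lambda>(j, k). j \<oplus> k) p = \<zero>\<^bsub>regular_module R\<^esub>"
    then obtain j k where jk: "p = (j, k)" "j \<in> J" "k \<in> K" "j \<oplus> k = \<zero>" by auto
    then have "j = \<ominus> k" using J.Icarr K.Icarr by (metis minus_equality)
    then have "j \<in> K" using jk(3) K.a_inv_closed by simp
    then have "j \<in> ?L" using K(2) jk(2) by blast
    then show "(\<lambda>(j, k). g j) p = \<zero>\<^bsub>E\<^esub>" using jk(1) by simp
  qed
  then obtain h where h: "h \<in> mod_hom R (regular_module R) E" "\<And>j k. \<lbrakk>j \<in> J; k \<in> K\<rbrakk> \<Longrightarrow> h (j \<oplus> k) = g j"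
    by auto
  define e where "e = h \<one>"
  have hr: "h r = r \<odot>\<^bsub>E\<^esub> e" if "r \<in> carrier R" for r
    using hom_smult[OF h(1) that, of \<one>] that by (simp add: e_def)
  have ec: "e \<in> carrier E" using hom_closed[OF h(1), of \<one>] by (simp add: e_def)
  have gj: "g j = j \<odot>\<^bsub>E\<^esub> e" if "j \<in> J" for j
    using h(2)[OF that K.zero_closed] hr[of j] J.Icarr[OF that] by simp
  have Ke: "k \<odot>\<^bsub>E\<^esub> e = \<zero>\<^bsub>E\<^esub>" if "k \<in> K" for k
    using h(2)[OF J.zero_closed that] hr[of k] K.Icarr[OF that] g0 by simp
  obtain S where S: "finite S" "S \<subseteq> I" "I = Idl S" using generators by blast
  obtain k where "\<And>x. x \<in> I \<Longrightarrow> x [^] (k x :: nat) \<in> K" using K(3) by metis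
  then have "\<forall>x\<in>S. (x [^] (k x)) \<odot>\<^bsub>E\<^esub> e = \<zero>\<^bsub>E\<^esub>" using Ke S(2) by blast
  then have "e \<in> carrier ?T"
    unfolding torsion_carrier using ideal_power_kills[OF Em ec S] ec by blast
  then show "\<exists>e\<in>carrier ?T. \<forall>r\<in>J. g r = r \<odot>\<^bsub>?T\<^esub> e"
    using gj by (intro bexI[of _ e]) auto
qed

section \<open>Acyclicity\<close>

text \<open>The linear maps \<open>M \<rightarrow> N\<close> in the ideal \<open>I \<cdot> Hom(M, N)\<close>. If the identity of \<open>M\<close> is one of them, all
  \<open>Ext\<^sup>i(R/I, M)\<close> and all local cohomology modules of \<open>M\<close> vanish.\<close>

inductive ideal_multiple :: "('a, 'm) module \<Rightarrow> ('a, 'n) module \<Rightarrow> ('m \<Rightarrow> 'n) \<Rightarrow> bool" for M N where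
  zero: "(\<And>m. m \<in> carrier M \<Longrightarrow> f m = \<zero>\<^bsub>N\<^esub>) \<Longrightarrow> ideal_multiple M N f"
| smult: "\<lbrakk>x \<in> I; h \<in> mod_hom R M N; \<And>m. m \<in> carrier M \<Longrightarrow> f m = x \<odot>\<^bsub>N\<^esub> h m\<rbrakk> \<Longrightarrow> ideal_multiple M N f"
| add: "\<lbrakk>ideal_multiple M N f; ideal_multiple M N g; \<And>m. m \<in> carrier M \<Longrightarrow> k m = f m \<oplus>\<^bsub>N\<^esub> g m\<rbrakk> \<Longrightarrow> ideal_multiple M N k"

text \<open>The exponent of the power of \<open>I\<close> that kills an element drops by one;
  iterating such an endomorphism on a torsion element reaches zero.\<close>

definition lowers_torsion :: "('a, 'm) module \<Rightarrow> ('a, 'n) module \<Rightarrow> ('m \<Rightarrow> 'n) \<Rightarrow> bool" where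
  "lowers_torsion M N f \<longleftrightarrow> (\<forall>k. \<forall>z\<in>carrier M. (\<forall>r\<in>ideal_power R I (Suc k). r \<odot>\<^bsub>M\<^esub> z = \<zero>\<^bsub>M\<^esub>) \<longrightarrow>
     (\<forall>r\<in>ideal_power R I k. r \<odot>\<^bsub>N\<^esub> f z = \<zero>\<^bsub>N\<^esub>))"

text \<open>If \<open>\<phi>\<close> lifts \<open>h\<close> to the resolutions, then
  \<open>x\<close> times \<open>\<phi>\<close> lifts \<open>x\<close> times \<open>h\<close>, and it
  lowers torsion because \<open>x\<close> lies in \<open>I\<close>. Sums of such lifts behave
  likewise.\<close>

lemma ideal_multiple_lift:
  assumes "ideal_multiple M N f" and E: "coresolution R M \<epsilon> E d" and E': "baer_resolution R N \<eta> E' d'"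
  shows "\<exists>\<phi>. chain_map R E d E' d' \<phi> \<and> (\<forall>m\<in>carrier M. \<phi> 0 (\<epsilon> m) = \<eta> (f m)) \<and>
    (\<forall>n. lowers_torsion (E n) (E' n) (\<phi> n))"
proof -
  note r = coresolutionD[OF E] and r' = coresolutionD[OF baer_resolutionD(1)[OF E']]
  note c = complexD[OF r(2)] and c' = complexD[OF r'(2)]
  have pc: "s \<in> carrier R" if "s \<in> ideal_power R I n" for s n using that ideal_power_carr by auto
  show ?thesis
    using assms(1)
  proof (induction rule: ideal_multiple.induct)
    case (zero f)
    have "\<eta> \<zero>\<^bsub>N\<^esub> = \<zero>\<^bsub>E' 0\<^esub>" by (rule hom_zero[OF r'(1) c'(1) r'(3)])
    then show ?case
      using zero c'(1) hom_zero[OF c'(1) c'(1) c'(2)] pc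
      by (intro exI[of _ "\<lambda>n x. \<zero>\<^bsub>E' n\<^esub>"]) (auto simp: chain_map_def hom_const_zero lowers_torsion_def)
  next
    case (smult x h f)
    obtain \<phi> where p: "chain_map R E d E' d' \<phi>" "\<And>m. m \<in> carrier M \<Longrightarrow> \<phi> 0 (\<epsilon> m) = \<eta> (h m)"
      using chain_lift[OF E E' smult(2)] by blast
    have ph: "\<phi> n \<in> mod_hom R (E n) (E' n)" for n using p(1) by (simp add: chain_map_def)
    note xc = ideal_element_carr[OF smult(1)]
    show ?case
    proof (intro exI[of _ "\<lambda>n z. x \<odot>\<^bsub>E' n\<^esub> \<phi> n z"] conjI ballI allI)
      show "chain_map R E d E' d' (\<lambda>n z. x \<odot>\<^bsub>E' n\<^esub> \<phi> n z)"
        using p(1) xc c(1) c'(1) hom_times[OF c(1) c'(1) ph xc] hom_smult[OF c'(2) xc] hom_closed[OF ph]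
        by (simp add: chain_map_def)
      show "x \<odot>\<^bsub>E' 0\<^esub> \<phi> 0 (\<epsilon> m) = \<eta> (f m)" if "m \<in> carrier M" for m
        using p(2)[OF that] smult(3)[OF that] hom_smult[OF r'(3) xc hom_closed[OF smult(2) that]] by simp
      show "lowers_torsion (E n) (E' n) (\<lambda>z. x \<odot>\<^bsub>E' n\<^esub> \<phi> n z)" for n
        unfolding lowers_torsion_def
      proof (intro allI ballI impI)
        fix k z r assume z: "z \<in> carrier (E n)" and kill: "\<forall>r\<in>ideal_power R I (Suc k). r \<odot>\<^bsub>E n\<^esub> z = \<zero>\<^bsub>E n\<^esub>"
          and r: "r \<in> ideal_power R I k"
        note rc = pc[OF r] and pz = hom_closed[OF ph z]
        have "r \<odot>\<^bsub>E' n\<^esub> (x \<odot>\<^bsub>E' n\<^esub> \<phi> n z) = (x \<otimes> r) \<odot>\<^bsub>E' n\<^esub> \<phi> n z"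
          using rc xc pz c'(1)[of n] by (simp add: msmult_mult msmult_comm[of _ r x])
        also have "\<dots> = \<phi> n ((x \<otimes> r) \<odot>\<^bsub>E n\<^esub> z)"
          using rc xc z by (simp add: hom_smult[OF ph])
        also have "\<dots> = \<zero>\<^bsub>E' n\<^esub>"
          using kill ideal_power_mult[OF smult(1) r] hom_zero[OF c(1) c'(1) ph] by simp
        finally show "r \<odot>\<^bsub>E' n\<^esub> (x \<odot>\<^bsub>E' n\<^esub> \<phi> n z) = \<zero>\<^bsub>E' n\<^esub>" .
      qed
    qed
  next
    case (add f g k)
    then obtain \<phi> \<psi> where p: "chain_map R E d E' d' \<phi>" "\<forall>m\<in>carrier M. \<phi> 0 (\<epsilon> m) = \<eta> (f m)" "\<forall>n. lowers_torsion (E n) (E' n) (\<phi> n)"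
      and q: "chain_map R E d E' d' \<psi>" "\<forall>m\<in>carrier M. \<psi> 0 (\<epsilon> m) = \<eta> (g m)" "\<forall>n. lowers_torsion (E n) (E' n) (\<psi> n)"
      by blast
    have ph: "\<phi> n \<in> mod_hom R (E n) (E' n)" and qh: "\<psi> n \<in> mod_hom R (E n) (E' n)" for n
      using p(1) q(1) by (simp_all add: chain_map_def)
    have cl: "f m \<in> carrier N" "g m \<in> carrier N" if m: "m \<in> carrier M" for m
    proof -
      have "h m \<in> carrier N" if "ideal_multiple M N h" for h
        using that r'(1) m ideal_element_carr by (induction rule: ideal_multiple.induct) (auto simp: hom_closed)
      then show "f m \<in> carrier N" "g m \<in> carrier N" using add.hyps(1,2) by auto
    qed
    show ?case
    proof (intro exI[of _ "\<lambda>n z. \<phi> n z \<oplus>\<^bsub>E' n\<^esub> \<psi> n z"] conjI ballI allI)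
      show "chain_map R E d E' d' (\<lambda>n z. \<phi> n z \<oplus>\<^bsub>E' n\<^esub> \<psi> n z)"
        using p(1) q(1) hom_plus[OF c(1) c'(1) ph qh] hom_add[OF c'(2) hom_closed[OF ph] hom_closed[OF qh]]
        by (simp add: chain_map_def)
      show "\<phi> 0 (\<epsilon> m) \<oplus>\<^bsub>E' 0\<^esub> \<psi> 0 (\<epsilon> m) = \<eta> (k m)" if "m \<in> carrier M" for m
        using p(2) q(2) that add.hyps(3)[OF that] hom_add[OF r'(3) cl[OF that]] by simp
      show "lowers_torsion (E n) (E' n) (\<lambda>z. \<phi> n z \<oplus>\<^bsub>E' n\<^esub> \<psi> n z)" for n
        using p(3) q(3) pc c'(1)[of n] hom_closed[OF ph] hom_closed[OF qh]
        by (simp add: lowers_torsion_def msmult_add_right)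
    qed
  qed
qed

text \<open>The lift of the identity that lowers torsion is homotopic to the identity, also after a
  torsion functor is applied. So a cocycle \<open>z\<close> agrees with \<open>\<phi> n z\<close> up
  to a coboundary, and repetition brings the exponent down to zero, where the cocycle itself
  vanishes.\<close>

lemma ideal_multiple_acyclic:
  assumes im: "ideal_multiple M M (\<lambda>m. m)" and E: "baer_resolution R M \<epsilon> E d"
  shows "cocycles (\<lambda>n. torsion_part {I} (E n)) d n \<subseteq> coboundaries (\<lambda>n. torsion_part {I} (E n)) d n"
    and "cocycles (\<lambda>n. torsion_part torsion_filter (E n)) d n \<subseteq> coboundaries (\<lambda>n. torsion_part torsion_filter (E n)) d n"
proof -
  note Er = baer_resolutionD(1)[OF E]
  note r = coresolutionD[OF Er] and c = complexD[OF coresolutionD(2)[OF Er]]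
  obtain \<phi> where p: "chain_map R E d E d \<phi>" "\<And>m. m \<in> carrier M \<Longrightarrow> \<phi> 0 (\<epsilon> m) = \<epsilon> m"
    "\<And>n. lowers_torsion (E n) (E n) (\<phi> n)"
    using ideal_multiple_lift[OF im Er E] by auto
  obtain s where s: "chain_homotopy R E d E d (\<lambda>n x. x) \<phi> s"
    using chain_homotopy_exists[OF Er E chain_map_id p(1)] p(2) by auto
  have main: "z \<in> coboundaries (\<lambda>n. torsion_part F (E n)) d n"
    if F: "ideal_filter R F" and z: "z \<in> cocycles (\<lambda>n. torsion_part F (E n)) d n"
      and k: "\<forall>r\<in>ideal_power R I k. r \<odot>\<^bsub>E n\<^esub> z = \<zero>\<^bsub>E n\<^esub>" for F z k
    using z k
  proof (induction k arbitrary: z)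
    case 0
    have zc: "z \<in> carrier (E n)" using 0(1) by (simp add: cocycles_iff)
    have "\<one> \<odot>\<^bsub>E n\<^esub> z = \<zero>\<^bsub>E n\<^esub>" using 0(2) by (simp add: ideal_power_0)
    then have "z = \<zero>\<^bsub>torsion_part F (E n)\<^esub>" using zc c(1)[of n] by simp
    then show ?case
      using submodule_zero[OF complexD(1)[OF torsion_complex[OF F r(2)]] coboundaries_submodule[OF torsion_complex[OF F r(2)]]] by simp
  next
    case (Suc k)
    note T = torsion_complex[OF F r(2)] and Tp = torsion_chain_map[OF F r(2) r(2) p(1)]
    obtain b where b: "b \<in> coboundaries (\<lambda>n. torsion_part F (E n)) d n" "z = \<phi> n z \<oplus>\<^bsub>torsion_part F (E n)\<^esub> b"
      using homotopy_cocycle[OF T T Tp torsion_chain_homotopy[OF F r(2) r(2) s] Suc.prems(1)] by auto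
    have "z \<in> carrier (E n)" using Suc.prems(1) by (simp add: cocycles_iff)
    then have "\<forall>r\<in>ideal_power R I k. r \<odot>\<^bsub>E n\<^esub> \<phi> n z = \<zero>\<^bsub>E n\<^esub>"
      using p(3)[of n] Suc.prems(2) by (simp add: lowers_torsion_def)
    then have "\<phi> n z \<in> coboundaries (\<lambda>n. torsion_part F (E n)) d n"
      using Suc.IH[OF chain_map_cocycles[OF T T Tp Suc.prems(1)]] by simp
    then show ?case
      using b submodule_add[OF complexD(1)[OF T] coboundaries_submodule[OF T]] by metis
  qed
  show "cocycles (\<lambda>n. torsion_part {I} (E n)) d n \<subseteq> coboundaries (\<lambda>n. torsion_part {I} (E n)) d n"
    using main[OF ideal_filter_single[OF I], of _ "Suc 0"] by (auto simp: ideal_power_1 cocycles_iff[of _ "\<lambda>n. torsion_part {I} (E n)"])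
  show "cocycles (\<lambda>n. torsion_part torsion_filter (E n)) d n \<subseteq> coboundaries (\<lambda>n. torsion_part torsion_filter (E n)) d n"
  proof
    fix z assume z: "z \<in> cocycles (\<lambda>n. torsion_part torsion_filter (E n)) d n"
    then have "\<exists>k. \<forall>r\<in>ideal_power R I k. r \<odot>\<^bsub>E n\<^esub> z = \<zero>\<^bsub>E n\<^esub>"
      unfolding cocycles_iff torsion_carrier by simp
    then show "z \<in> coboundaries (\<lambda>n. torsion_part torsion_filter (E n)) d n"
      using main[OF torsion_filter z] by blast
  qed
qed

lemma fin_gen_cohomology_acyclic:
  assumes C: "is_complex R C d" and a: "cocycles C d n \<subseteq> coboundaries C d n"
  shows "fin_gen_module R (cohomology_module C d n)"
proof -
  note m = cocycle_module[OF C, of n] and H = cohomology_is_module[OF C, of n]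
  have z: "K = \<zero>\<^bsub>cohomology_module C d n\<^esub>" if K: "K \<in> carrier (cohomology_module C d n)" for K
  proof -
    obtain z where z: "z \<in> cocycles C d n" "K = coboundaries C d n +>\<^bsub>(C n)\<lparr>carrier := cocycles C d n\<rparr>\<^esub> z"
      using K unfolding cohomology_module_alt quotient_carrier[OF m] by auto
    then show ?thesis
      using a coset_zero_iff[OF m, of z] unfolding cohomology_module_alt quotient_zero[OF m] by auto
  qed
  have c: "carrier (cohomology_module C d n) = {\<zero>\<^bsub>cohomology_module C d n\<^esub>}"
    using z mzero_closed[OF H] by blast
  show ?thesis using fin_gen_zero[OF H, folded c] by simp
qed

lemma ideal_multiple_ext_fin_gen:
  assumes M: "module R M" and im: "ideal_multiple M M (\<lambda>m. m)"
  shows "fin_gen_module R (ext_module i M)"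
proof -
  obtain \<epsilon> E d where c: "chosen_resolution R M = (E, d)" "baer_resolution R M \<epsilon> E d"
    using chosen_resolution[OF M] by blast
  show ?thesis
    unfolding ext_fin_gen_iff[OF c(2) M mod_isomorphic_refl]
    by (intro fin_gen_cohomology_acyclic torsion_complex ideal_filter_single[OF I]
      coresolutionD(2)[OF baer_resolutionD(1)[OF c(2)]] ideal_multiple_acyclic[OF im c(2)])
qed

lemma torsion_part_eqI: "carrier (torsion_part F M) = carrier M \<Longrightarrow> torsion_part F M = M"
  by (simp add: torsion_part_def)

text \<open>The torsion part of an injective module is injective, and maps from a torsion module
  land in it, so each term can be replaced by its torsion part while the resolution is
  built.\<close>

lemma torsion_resolution_exists:
  fixes M :: "('a, 'm) module"
  assumes M: "module R M" and tor: "carrier (torsion_part torsion_filter M) = carrier M"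
  shows "\<exists>\<epsilon> (E :: nat \<Rightarrow> ('a, ('a, 'm) res) module) d. baer_resolution R M \<epsilon> E d \<and>
    (\<forall>n. torsion_part torsion_filter (E n) = E n)"
proof -
  obtain M' :: "('a, ('a, 'm) res) module" where M': "module R M'" "mod_isomorphic R M M'"
    using res_copy[OF M] by blast
  then obtain f where f: "f \<in> mod_hom R M M'" "f ` carrier M = carrier M'"
    by (auto simp: mod_isomorphic_def bij_betw_def)
  have "carrier M' \<subseteq> carrier (torsion_part torsion_filter M')"
    unfolding f(2)[symmetric] using torsion_hom[OF torsion_filter M M'(1) f(1)] tor by blast
  then have tor': "torsion_part torsion_filter M' = M'" by (intro torsion_part_eqI) auto
  have "\<exists>\<epsilon> (E :: nat \<Rightarrow> ('a, ('a, 'm) res) module) d. baer_resolution R M' \<epsilon> E d \<and>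
    (\<forall>n. torsion_part torsion_filter (E n) = E n)"
  proof (rule baer_resolution_exists_with[OF M'(1), where Q = "\<lambda>E. torsion_part torsion_filter E = E", OF tor'])
    fix N :: "('a, ('a, 'm) res) module" and S
    assume N: "module R N" "torsion_part torsion_filter N = N" and S: "submodule S R N"
    obtain E :: "('a, ('a, 'm) res) module" and g where g: "baer_module R E" "g \<in> mod_hom R N E" "mod_ker N E g = S"
      using small_injective_with_kernel[OF N(1) S res_infinite res_inj] by blast
    let ?E = "torsion_part torsion_filter E"
    have "torsion_part torsion_filter ?E = ?E" by (rule torsion_part_eqI) auto
    moreover have "g \<in> mod_hom R N ?E"
      using torsion_part_hom[OF torsion_filter N(1) baer_is_module[OF g(1)] g(2)] N(2) by simp
    moreover have "mod_ker N ?E g = S" using g(3) by (simp add: mod_ker_def)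
    ultimately show "\<exists>(E :: ('a, ('a, 'm) res) module) f. torsion_part torsion_filter E = E \<and> baer_module R E \<and> f \<in> mod_hom R N E \<and> mod_ker N E f = S"
      using torsion_baer[OF g(1)] by (intro exI[of _ ?E] exI[of _ g] conjI)
  qed
  then show ?thesis using baer_resolution_iso[OF _ M M'(2)] by blast
qed

lemma ext_fin_gen_middle:
  fixes L :: "('a, 'l) module" and M :: "('a, 'm) module" and N :: "('a, 'n) module"
  assumes se: "short_exact R L f M g N"
    and fg: "fin_gen_module R (ext_module i L)" "fin_gen_module R (ext_module i N)"
  shows "fin_gen_module R (ext_module i M)"
proof -
  note s = short_exactD[OF se]
  obtain \<epsilon> and E :: "nat \<Rightarrow> ('a, ('a, 'l) res) module" and d where E: "baer_resolution R L \<epsilon> E d"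
    using chosen_resolution[OF s(1)] by blast
  obtain \<epsilon>' and E' :: "nat \<Rightarrow> ('a, ('a, 'n) res) module" and d' where E': "baer_resolution R N \<epsilon>' E' d'"
    using chosen_resolution[OF s(3)] by blast
  obtain t \<eta> where t: "twisting R E d E' d' t"
    "baer_resolution R M \<eta> (\<lambda>n. direct_sum_module (E n) (E' n)) (twisted_differential E d d' t)"
    using twisted_resolution[OF se E E'] by blast
  note F = ideal_filter_single[OF I]
  note tt = twisting_torsion[OF F t(1)]
  show ?thesis
    using twisted_cohomology_fin_gen[OF tt(1), of i] fg
    unfolding ext_fin_gen_iff[OF t(2) s(2) mod_isomorphic_refl] ext_fin_gen_iff[OF E s(1) mod_isomorphic_refl]
      ext_fin_gen_iff[OF E' s(3) mod_isomorphic_refl] tt(2,3) by simp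
qed

text \<open>The local cohomology of the middle module vanishes in all degrees, zero included, so the
  connecting map is an isomorphism from degree zero on.\<close>

lemma local_cohomology_shift:
  fixes L :: "('a, 'l) module" and M :: "('a, 'm) module" and N :: "('a, 'n) module"
  assumes se: "short_exact R L f M g N" and im: "ideal_multiple M M (\<lambda>m. m)"
  shows "mod_isomorphic R (local_cohomology R I i N) (local_cohomology R I (Suc i) L)"
proof -
  note s = short_exactD[OF se]
  obtain \<epsilon> and E :: "nat \<Rightarrow> ('a, ('a, 'l) res) module" and d where E: "baer_resolution R L \<epsilon> E d"
    using chosen_resolution[OF s(1)] by blast
  obtain \<epsilon>' and E' :: "nat \<Rightarrow> ('a, ('a, 'n) res) module" and d' where E': "baer_resolution R N \<epsilon>' E' d'"
    using chosen_resolution[OF s(3)] by blast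
  obtain t \<eta> where t: "twisting R E d E' d' t"
    "baer_resolution R M \<eta> (\<lambda>n. direct_sum_module (E n) (E' n)) (twisted_differential E d d' t)"
    using twisted_resolution[OF se E E'] by blast
  note tt = twisting_torsion[OF torsion_filter t(1)]
  have iso: "mod_isomorphic R (cohomology_module (\<lambda>n. torsion_part torsion_filter (E' n)) d' i)
      (cohomology_module (\<lambda>n. torsion_part torsion_filter (E n)) d (Suc i))"
    using ideal_multiple_acyclic(2)[OF im t(2)] by (intro twisted_cohomology_shift[OF tt(1)]) (simp_all add: tt(2,3))
  note i1 = local_cohomology_iso(1)[OF E' s(3) mod_isomorphic_refl, of i]
  note i2 = local_cohomology_iso[OF E s(1) mod_isomorphic_refl, of "Suc i"]
  have iso': "mod_isomorphic R (cohomology_module (\<lambda>n. torsion_part torsion_filter (E n)) d (Suc i)) (local_cohomology R I (Suc i) L)"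
    by (rule mod_isomorphic_sym[OF i2(2) cohomology_is_module[OF twistingD(1)[OF tt(1)]] i2(1)])
  show ?thesis
    by (rule mod_isomorphic_trans[OF mod_isomorphic_trans[OF i1 iso] iso'])
qed

text \<open>A torsion module \<open>L\<close> is resolved by torsion injectives, on which the
  torsion functor is the identity. Its complex remains exact in positive degrees and drops out of
  the cohomology of the middle term there.\<close>

lemma local_cohomology_mod_torsion:
  fixes L :: "('a, 'l) module" and M :: "('a, 'm) module" and N :: "('a, 'n) module"
  assumes se: "short_exact R L f M g N" and tor: "carrier (torsion_part torsion_filter L) = carrier L"
  shows "mod_isomorphic R (local_cohomology R I (Suc i) M) (local_cohomology R I (Suc i) N)"
proof -
  note s = short_exactD[OF se]
  obtain \<epsilon> and E :: "nat \<Rightarrow> ('a, ('a, 'l) res) module" and d where E: "baer_resolution R L \<epsilon> E d"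
    and Et: "\<And>n. torsion_part torsion_filter (E n) = E n"
    using torsion_resolution_exists[OF s(1) tor] by blast
  obtain \<epsilon>' and E' :: "nat \<Rightarrow> ('a, ('a, 'n) res) module" and d' where E': "baer_resolution R N \<epsilon>' E' d'"
    using chosen_resolution[OF s(3)] by blast
  obtain t \<eta> where t: "twisting R E d E' d' t"
    "baer_resolution R M \<eta> (\<lambda>n. direct_sum_module (E n) (E' n)) (twisted_differential E d d' t)"
    using twisted_resolution[OF se E E'] by blast
  note tt = twisting_torsion[OF torsion_filter t(1)]
  have "cocycles E d (Suc n) \<subseteq> coboundaries E d (Suc n)" for n
    using coresolutionD(7)[OF baer_resolutionD(1)[OF E]] by (fastforce simp: cocycles_iff coboundaries_Suc)
  then have iso: "mod_isomorphic R (cohomology_module (\<lambda>n. torsion_part torsion_filter (direct_sum_module (E n) (E' n))) (twisted_differential E d d' t) (Suc i))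
      (cohomology_module (\<lambda>n. torsion_part torsion_filter (E' n)) d' (Suc i))"
    using twisted_cohomology_left[OF tt(1), of "Suc i"] by (simp add: tt(2)[symmetric] Et)
  note i1 = local_cohomology_iso(1)[OF t(2) s(2) mod_isomorphic_refl, of "Suc i"]
  note i2 = local_cohomology_iso[OF E' s(3) mod_isomorphic_refl, of "Suc i"]
  have iso': "mod_isomorphic R (cohomology_module (\<lambda>n. torsion_part torsion_filter (E' n)) d' (Suc i)) (local_cohomology R I (Suc i) N)"
    by (rule mod_isomorphic_sym[OF i2(2) cohomology_is_module[OF twistingD(2)[OF tt(1)]] i2(1)])
  show ?thesis
    by (rule mod_isomorphic_trans[OF mod_isomorphic_trans[OF i1 iso] iso'])
qed

end

section \<open>Torsion as the kernel of a map to an acyclic module\<close>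

definition power_module :: "('a, 'm) module \<Rightarrow> ('a, 'i \<Rightarrow> 'm) module" where
  "power_module M = \<lparr>carrier = {s. \<forall>i. s i \<in> carrier M}, monoid.mult = undefined, monoid.one = undefined,
     ring.zero = (\<lambda>i. \<zero>\<^bsub>M\<^esub>), ring.add = (\<lambda>s t i. s i \<oplus>\<^bsub>M\<^esub> t i), smult = (\<lambda>r s i. r \<odot>\<^bsub>M\<^esub> s i)\<rparr>"

lemma power_module_simps [simp]:
  "carrier (power_module M) = {s. \<forall>i. s i \<in> carrier M}" "\<zero>\<^bsub>power_module M\<^esub> = (\<lambda>i. \<zero>\<^bsub>M\<^esub>)"
  "s \<oplus>\<^bsub>power_module M\<^esub> t = (\<lambda>i. s i \<oplus>\<^bsub>M\<^esub> t i)" "r \<odot>\<^bsub>power_module M\<^esub> s = (\<lambda>i. r \<odot>\<^bsub>M\<^esub> s i)"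
  by (simp_all add: power_module_def)

context cring
begin

lemma power_module_is_module: "module R M \<Longrightarrow> module R (power_module M)"
  by (rule moduleI') (auto simp: fun_eq_iff madd_assoc madd_comm madd_lcomm msmult_add_left msmult_add_right msmult_mult)

text \<open>By the pigeonhole principle the powers of \<open>x\<close>, as maps of a finite set,
  become periodic; a multiple of the period beyond the preperiod acts idempotently.\<close>

lemma idempotent_power:
  assumes M: "module R M" "finite (carrier M)" and x: "x \<in> carrier R"
  shows "\<exists>k::nat. k \<ge> 1 \<and> (\<forall>m\<in>carrier M. (x [^] k) \<odot>\<^bsub>M\<^esub> ((x [^] k) \<odot>\<^bsub>M\<^esub> m) = (x [^] k) \<odot>\<^bsub>M\<^esub> m)"
proof -
  have pw: "(x [^] (i + j)) \<odot>\<^bsub>M\<^esub> m = (x [^] i) \<odot>\<^bsub>M\<^esub> ((x [^] j) \<odot>\<^bsub>M\<^esub> m)" if "m \<in> carrier M" for i j :: nat and m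
    using that M(1) x by (simp add: nat_pow_mult[symmetric] msmult_mult)
  let ?f = "\<lambda>n::nat. restrict (\<lambda>m. (x [^] n) \<odot>\<^bsub>M\<^esub> m) (carrier M)"
  have "range ?f \<subseteq> carrier M \<rightarrow>\<^sub>E carrier M" using M(1) x by auto
  moreover have "finite (carrier M \<rightarrow>\<^sub>E carrier M)" using M(2) by (intro finite_PiE) auto
  ultimately have "finite (range ?f)" by (rule finite_subset)
  then have "\<not> inj ?f" using finite_imageD infinite_UNIV_nat by blast
  then obtain i j where ij: "i \<noteq> j" "?f i = ?f j" by (auto simp: inj_def)
  then obtain i p where p: "p \<ge> 1" "?f i = ?f (i + p)"
  proof (cases "i < j")
    case True
    then show thesis using that[of "j - i" i] ij by simp
  next
    case False
    then show thesis using that[of "i - j" j] ij by simp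
  qed
  have period: "(x [^] (n + p)) \<odot>\<^bsub>M\<^esub> m = (x [^] n) \<odot>\<^bsub>M\<^esub> m" if "n \<ge> i" "m \<in> carrier M" for n m
  proof -
    have "(x [^] (i + p)) \<odot>\<^bsub>M\<^esub> m = (x [^] i) \<odot>\<^bsub>M\<^esub> m" using fun_cong[OF p(2), of m] that(2) by simp
    then have "(x [^] ((n - i) + (i + p))) \<odot>\<^bsub>M\<^esub> m = (x [^] ((n - i) + i)) \<odot>\<^bsub>M\<^esub> m"
      unfolding pw[OF that(2), of "n - i"] by simp
    then show ?thesis using that(1) by simp
  qed
  have periods: "(x [^] (n + l * p)) \<odot>\<^bsub>M\<^esub> m = (x [^] n) \<odot>\<^bsub>M\<^esub> m" if "n \<ge> i" "m \<in> carrier M" for n l m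
  proof (induction l)
    case (Suc l)
    have "(x [^] (n + l * p + p)) \<odot>\<^bsub>M\<^esub> m = (x [^] (n + l * p)) \<odot>\<^bsub>M\<^esub> m" using that by (intro period) auto
    then show ?case using Suc by (simp add: ac_simps)
  qed simp
  \<comment> \<open>A positive multiple of the period \<open>p\<close> that is at least the
    preperiod \<open>i\<close>.\<close>
  let ?k = "(i + 1) * p"
  have k: "?k \<ge> 1" "?k \<ge> i" using p(1) by (auto intro: order_trans[of i "i * p"])
  have "(x [^] ?k) \<odot>\<^bsub>M\<^esub> ((x [^] ?k) \<odot>\<^bsub>M\<^esub> m) = (x [^] ?k) \<odot>\<^bsub>M\<^esub> m" if m: "m \<in> carrier M" for m
    using periods[OF k(2) m, of "i + 1"] pw[OF m, of ?k ?k] by simp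
  then show ?thesis using k(1) by blast
qed

end

context noetherian_ideal
begin

lemma ideal_multiple_cong:
  assumes "ideal_multiple M N f" "\<And>m. m \<in> carrier M \<Longrightarrow> g m = f m"
  shows "ideal_multiple M N g"
  using assms(1)
proof cases
  case zero
  then show ?thesis using assms(2) by (intro ideal_multiple.zero) simp
next
  case (smult x h)
  then show ?thesis using assms(2) by (intro ideal_multiple.smult[of x h]) simp_all
next
  case (add h k)
  then show ?thesis using assms(2) by (simp add: ideal_multiple.add[OF add(1,2)])
qed

lemma ideal_multiple_hom:
  assumes "module R M" "module R N" "ideal_multiple M N f"
  shows "f \<in> mod_hom R M N"
  using assms(3)
proof (induction rule: ideal_multiple.induct)
  case (zero f)
  then show ?case using hom_cong[OF assms(1) hom_const_zero[OF assms(2)]] by simp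
next
  case (smult x h f)
  then show ?case using hom_cong[OF assms(1) hom_times[OF assms(1,2) smult(2) ideal_element_carr[OF smult(1)]]] by simp
next
  case (add f g k)
  then show ?case using hom_cong[OF assms(1) hom_plus[OF assms(1,2) add.IH]] by simp
qed

lemma ideal_multiple_comp:
  assumes M: "module R M" "module R N" "module R M'" "module R N'"
    and a: "a \<in> mod_hom R M' M" and b: "b \<in> mod_hom R N N'" and f: "ideal_multiple M N f"
  shows "ideal_multiple M' N' (\<lambda>x. b (f (a x)))"
  using f
proof (induction rule: ideal_multiple.induct)
  case (zero f)
  then show ?case using hom_zero[OF M(2,4) b] hom_closed[OF a] by (intro ideal_multiple.zero) simp
next
  case (smult x h f)
  show ?case
    using smult hom_closed[OF a] hom_comp[OF hom_comp[OF a smult(2)] b] hom_smult[OF b ideal_element_carr[OF smult(1)]] hom_closed[OF smult(2)]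
    by (intro ideal_multiple.smult[of x "\<lambda>x. b (h (a x))"]) simp_all
next
  case (add f g k)
  have "f m \<in> carrier N" "g m \<in> carrier N" if "m \<in> carrier M" for m
    using hom_closed[OF ideal_multiple_hom[OF M(1,2)] that] add.hyps by auto
  then show ?case
    using add hom_closed[OF a] hom_add[OF b] by (intro ideal_multiple.add[OF add.IH]) simp
qed

text \<open>The condition says that the elements \<open>(x [^] n) \<odot> e\<close> are eventually
  zero in \<open>n\<close>, which is how the kernel of the map to the localizations appears.\<close>

lemma torsion_iff_powers:
  assumes M: "module R M" "e \<in> carrier M" and S: "finite S" "S \<subseteq> I" "I = Idl S"
  shows "e \<in> carrier (torsion_part torsion_filter M) \<longleftrightarrow>
    (\<forall>x\<in>S. \<exists>N::nat. \<forall>n\<ge>N. (x [^] n) \<odot>\<^bsub>M\<^esub> e = \<zero>\<^bsub>M\<^esub>)"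
proof
  assume "e \<in> carrier (torsion_part torsion_filter M)"
  then obtain N where N: "\<And>r. r \<in> ideal_power R I N \<Longrightarrow> r \<odot>\<^bsub>M\<^esub> e = \<zero>\<^bsub>M\<^esub>" by (auto simp: torsion_filter_def)
  have "(x [^] n) \<odot>\<^bsub>M\<^esub> e = \<zero>\<^bsub>M\<^esub>" if "x \<in> S" "n \<ge> N" for x n
    using pow_in_ideal_power[of x n] ideal_power_antimono[OF that(2)] S(2) that(1) by (intro N) auto
  then show "\<forall>x\<in>S. \<exists>N::nat. \<forall>n\<ge>N. (x [^] n) \<odot>\<^bsub>M\<^esub> e = \<zero>\<^bsub>M\<^esub>" by blast
next
  assume "\<forall>x\<in>S. \<exists>N::nat. \<forall>n\<ge>N. (x [^] n) \<odot>\<^bsub>M\<^esub> e = \<zero>\<^bsub>M\<^esub>"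
  then have "\<forall>x\<in>S. \<exists>n::nat. (x [^] n) \<odot>\<^bsub>M\<^esub> e = \<zero>\<^bsub>M\<^esub>" by blast
  then obtain k :: "'a \<Rightarrow> nat" where "\<forall>x\<in>S. (x [^] k x) \<odot>\<^bsub>M\<^esub> e = \<zero>\<^bsub>M\<^esub>" by metis
  from ideal_power_kills[OF M S this] show "e \<in> carrier (torsion_part torsion_filter M)"
    using M(2) by (simp add: torsion_filter_def)
qed

text \<open>Some positive power of each generator acts as a projection. Commuting projections
  \<open>y\<close> and \<open>z\<close> combine to \<open>y + z - yz\<close>, a projection whose
  kernel is the intersection of theirs; this is done for one generator after the other.\<close>

lemma idempotent_in_ideal:
  assumes M: "module R M" "finite (carrier M)" and S: "finite S" "S \<subseteq> I"
  shows "\<exists>y\<in>I. (\<forall>m\<in>carrier M. y \<odot>\<^bsub>M\<^esub> (y \<odot>\<^bsub>M\<^esub> m) = y \<odot>\<^bsub>M\<^esub> m) \<and>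
    (\<forall>m\<in>carrier M. y \<odot>\<^bsub>M\<^esub> m = \<zero>\<^bsub>M\<^esub> \<longrightarrow> (\<forall>x\<in>S. \<exists>k::nat. (x [^] k) \<odot>\<^bsub>M\<^esub> m = \<zero>\<^bsub>M\<^esub>))"
  using S
proof (induction S rule: finite_induct)
  case empty
  interpret I: ideal I R by (rule I)
  show ?case using M(1) by (intro bexI[of _ \<zero>]) auto
next
  case (insert x S)
  interpret I: ideal I R by (rule I)
  obtain y where y: "y \<in> I" "\<And>m. m \<in> carrier M \<Longrightarrow> y \<odot>\<^bsub>M\<^esub> (y \<odot>\<^bsub>M\<^esub> m) = y \<odot>\<^bsub>M\<^esub> m"
    "\<And>m. \<lbrakk>m \<in> carrier M; y \<odot>\<^bsub>M\<^esub> m = \<zero>\<^bsub>M\<^esub>\<rbrakk> \<Longrightarrow> \<forall>x\<in>S. \<exists>k::nat. (x [^] k) \<odot>\<^bsub>M\<^esub> m = \<zero>\<^bsub>M\<^esub>"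
    using insert by auto
  have xI: "x \<in> I" using insert by auto
  obtain k :: nat where k: "k \<ge> 1" "\<And>m. m \<in> carrier M \<Longrightarrow> (x [^] k) \<odot>\<^bsub>M\<^esub> ((x [^] k) \<odot>\<^bsub>M\<^esub> m) = (x [^] k) \<odot>\<^bsub>M\<^esub> m"
    using idempotent_power[OF M ideal_element_carr[OF xI]] by blast
  define z where "z = x [^] k"
  \<comment> \<open>The positive exponent keeps the power inside \<open>I\<close>.\<close>
  have zI: "z \<in> I" using pow_in_ideal_power[OF xI, of k] ideal_power_antimono[OF k(1)] ideal_power_1 by (auto simp: z_def)
  have yc: "y \<in> carrier R" and zc: "z \<in> carrier R" using y(1) zI ideal_element_carr by auto
  have zz: "z \<odot>\<^bsub>M\<^esub> (z \<odot>\<^bsub>M\<^esub> m) = z \<odot>\<^bsub>M\<^esub> m" if "m \<in> carrier M" for m using k(2)[OF that] by (simp add: z_def)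
  define w where "w = y \<oplus> (z \<oplus> (\<ominus> \<one>) \<otimes> (y \<otimes> z))"
  have wI: "w \<in> I" unfolding w_def using y(1) zI yc by (intro I.a_closed I.I_l_closed) auto
  have wm: "w \<odot>\<^bsub>M\<^esub> m = y \<odot>\<^bsub>M\<^esub> m \<oplus>\<^bsub>M\<^esub> (z \<odot>\<^bsub>M\<^esub> m \<oplus>\<^bsub>M\<^esub> (\<ominus> \<one>) \<odot>\<^bsub>M\<^esub> (y \<odot>\<^bsub>M\<^esub> (z \<odot>\<^bsub>M\<^esub> m)))" if "m \<in> carrier M" for m
    using that M(1) yc zc unfolding w_def by (simp add: msmult_add_left msmult_mult)
  have yzc: "z \<odot>\<^bsub>M\<^esub> (y \<odot>\<^bsub>M\<^esub> m) = y \<odot>\<^bsub>M\<^esub> (z \<odot>\<^bsub>M\<^esub> m)" if "m \<in> carrier M" for m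
    using that M(1) yc zc by (simp add: msmult_comm[of M z y])
  have wy: "w \<odot>\<^bsub>M\<^esub> (y \<odot>\<^bsub>M\<^esub> m) = y \<odot>\<^bsub>M\<^esub> m" if m: "m \<in> carrier M" for m
    using m M(1) yc zc y(2) by (simp add: wm yzc)
  have wz: "w \<odot>\<^bsub>M\<^esub> (z \<odot>\<^bsub>M\<^esub> m) = z \<odot>\<^bsub>M\<^esub> m" if m: "m \<in> carrier M" for m
    using m M(1) yc zc zz by (simp add: wm madd_neg_cancel2)
  have wc: "w \<in> carrier R" using wI ideal_element_carr by auto
  show ?case
  proof (intro bexI[OF _ wI] conjI ballI impI)
    fix m assume m: "m \<in> carrier M"
    have "w \<odot>\<^bsub>M\<^esub> (w \<odot>\<^bsub>M\<^esub> m) = w \<odot>\<^bsub>M\<^esub> (y \<odot>\<^bsub>M\<^esub> m) \<oplus>\<^bsub>M\<^esub> (w \<odot>\<^bsub>M\<^esub> (z \<odot>\<^bsub>M\<^esub> m) \<oplus>\<^bsub>M\<^esub> (\<ominus> \<one>) \<odot>\<^bsub>M\<^esub> (w \<odot>\<^bsub>M\<^esub> (y \<odot>\<^bsub>M\<^esub> (z \<odot>\<^bsub>M\<^esub> m))))"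
      unfolding wm[OF m] using m M(1) yc zc wc
      by (simp add: msmult_add_right msmult_comm[OF M(1) wc, of "\<ominus> \<one>"])
    then show "w \<odot>\<^bsub>M\<^esub> (w \<odot>\<^bsub>M\<^esub> m) = w \<odot>\<^bsub>M\<^esub> m"
      using m M(1) zc wy wz wm[OF m] by simp
  next
    fix m u assume m: "m \<in> carrier M" and w0: "w \<odot>\<^bsub>M\<^esub> m = \<zero>\<^bsub>M\<^esub>" and u: "u \<in> insert x S"
    have "y \<odot>\<^bsub>M\<^esub> m = w \<odot>\<^bsub>M\<^esub> (y \<odot>\<^bsub>M\<^esub> m)" using wy[OF m] by simp
    also have "\<dots> = y \<odot>\<^bsub>M\<^esub> (w \<odot>\<^bsub>M\<^esub> m)" using m M(1) yc wc by (simp add: msmult_comm[of M w y])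
    finally have y0: "y \<odot>\<^bsub>M\<^esub> m = \<zero>\<^bsub>M\<^esub>" using w0 M(1) yc by simp
    have "z \<odot>\<^bsub>M\<^esub> m = w \<odot>\<^bsub>M\<^esub> (z \<odot>\<^bsub>M\<^esub> m)" using wz[OF m] by simp
    also have "\<dots> = z \<odot>\<^bsub>M\<^esub> (w \<odot>\<^bsub>M\<^esub> m)" using m M(1) zc wc by (simp add: msmult_comm[of M w z])
    finally have "z \<odot>\<^bsub>M\<^esub> m = \<zero>\<^bsub>M\<^esub>" using w0 M(1) zc by simp
    then show "\<exists>k::nat. (u [^] k) \<odot>\<^bsub>M\<^esub> m = \<zero>\<^bsub>M\<^esub>"
      using u y(3)[OF m y0] by (auto simp: z_def)
  qed
qed

text \<open>An element \<open>y\<close> of \<open>I\<close> that acts as a projection is the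
  identity on its image, so the identity there is \<open>y\<close> times a linear map.\<close>

lemma finite_acyclic_quotient:
  fixes M :: "('a, 'm) module"
  assumes M: "module R M" "finite (carrier M)"
  shows "\<exists>(E :: ('a, 'm) module) f. module R E \<and> ideal_multiple E E (\<lambda>e. e) \<and> f \<in> mod_hom R M E \<and>
    mod_ker M E f = carrier (torsion_part torsion_filter M)"
proof -
  obtain S where S: "finite S" "S \<subseteq> I" "I = Idl S" using generators by blast
  obtain y where y: "y \<in> I" "\<And>m. m \<in> carrier M \<Longrightarrow> y \<odot>\<^bsub>M\<^esub> (y \<odot>\<^bsub>M\<^esub> m) = y \<odot>\<^bsub>M\<^esub> m"
    "\<And>m. \<lbrakk>m \<in> carrier M; y \<odot>\<^bsub>M\<^esub> m = \<zero>\<^bsub>M\<^esub>\<rbrakk> \<Longrightarrow> \<forall>x\<in>S. \<exists>k::nat. (x [^] k) \<odot>\<^bsub>M\<^esub> m = \<zero>\<^bsub>M\<^esub>"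
    using idempotent_in_ideal[OF M S(1,2)] by blast
  note yc = ideal_element_carr[OF y(1)]
  let ?f = "\<lambda>m. y \<odot>\<^bsub>M\<^esub> m"
  have f: "?f \<in> mod_hom R M M" by (rule hom_times[OF M(1) M(1) hom_id yc])
  let ?E = "M\<lparr>carrier := ?f ` carrier M\<rparr>"
  have sub: "submodule (?f ` carrier M) R M" by (rule img_submodule[OF M(1) M(1) f submodule_carrier[OF M(1)]])
  have "ideal_multiple ?E ?E (\<lambda>e. e)"
    using y by (intro ideal_multiple.smult[OF y(1) hom_id]) auto
  moreover have "?f \<in> mod_hom R M ?E" by (rule hom_restrict_cod[OF f]) auto
  moreover have "mod_ker M ?E ?f = carrier (torsion_part torsion_filter M)"
  proof (intro equalityI subsetI)
    fix m assume "m \<in> mod_ker M ?E ?f"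
    then have m: "m \<in> carrier M" "y \<odot>\<^bsub>M\<^esub> m = \<zero>\<^bsub>M\<^esub>" by (auto simp: mod_ker_def)
    obtain k :: "'a \<Rightarrow> nat" where "\<forall>x\<in>S. (x [^] k x) \<odot>\<^bsub>M\<^esub> m = \<zero>\<^bsub>M\<^esub>" using y(3)[OF m] by metis
    from ideal_power_kills[OF M(1) m(1) S this] show "m \<in> carrier (torsion_part torsion_filter M)"
      using m(1) by (simp add: torsion_filter_def)
  next
    fix m assume m: "m \<in> carrier (torsion_part torsion_filter M)"
    then obtain n where n: "\<forall>r\<in>ideal_power R I n. r \<odot>\<^bsub>M\<^esub> m = \<zero>\<^bsub>M\<^esub>" by (auto simp: torsion_filter_def)
    have mc: "m \<in> carrier M" using m by simp
    \<comment> \<open>A projection equals its positive powers, and these lie in ever higher powers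
      of \<open>I\<close>, which kill a torsion element.\<close>
    have "(y [^] Suc k) \<odot>\<^bsub>M\<^esub> m = y \<odot>\<^bsub>M\<^esub> m" for k :: nat
    proof (induction k)
      case (Suc k)
      have "(y [^] Suc (Suc k)) \<odot>\<^bsub>M\<^esub> m = (y [^] Suc k) \<odot>\<^bsub>M\<^esub> (y \<odot>\<^bsub>M\<^esub> m)"
        using mc yc M(1) by (simp add: msmult_mult)
      also have "\<dots> = y \<odot>\<^bsub>M\<^esub> ((y [^] Suc k) \<odot>\<^bsub>M\<^esub> m)"
        using mc yc M(1) by (intro msmult_comm[OF M(1)]) auto
      finally show ?case using Suc y(2)[OF mc] by simp
    qed (use yc in simp)
    moreover have "y [^] Suc n \<in> ideal_power R I n"
      using subsetD[OF ideal_power_antimono[of n "Suc n"] pow_in_ideal_power[OF y(1), of "Suc n"]] by simp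
    ultimately have "y \<odot>\<^bsub>M\<^esub> m = \<zero>\<^bsub>M\<^esub>" using n by metis
    then show "m \<in> mod_ker M ?E ?f" using mc by (simp add: mod_ker_def)
  qed
  ultimately show ?thesis using submodule_restrict[OF M(1) sub] by blast
qed

text \<open>For generators \<open>S\<close> of \<open>I\<close>, the direct sum of the localizations \<open>M\<^sub>x\<close>, \<open>x \<in> S\<close>, is realized as the
  families of sequences that are eventually geometric with ratio \<open>x\<close>, modulo those that are
  eventually zero; the fraction \<open>m / x\<^sup>k\<close> is the class of a sequence that is eventually
  \<open>x\<^sup>n\<^sup>-\<^sup>k m\<close>. Shifting a sequence to the right divides by \<open>x\<close>.\<close>

context
  fixes M :: "('a, 'm) module" and S :: "'a set"
  assumes M: "module R M" and S: "finite S" "S \<subseteq> I" "I = Idl S"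
begin

abbreviation (input) "PM \<equiv> power_module M :: ('a, 'a \<times> nat \<Rightarrow> 'm) module"

definition geometric :: "('a \<times> nat \<Rightarrow> 'm) set" where
  "geometric = {s. (\<forall>i. s i \<in> carrier M) \<and> (\<forall>x\<in>S. \<exists>N. \<forall>n\<ge>N. s (x, Suc n) = x \<odot>\<^bsub>M\<^esub> s (x, n))}"

definition null_sequences :: "('a \<times> nat \<Rightarrow> 'm) set" where
  "null_sequences = {s. (\<forall>i. s i \<in> carrier M) \<and> (\<forall>x\<in>S. \<exists>N. \<forall>n\<ge>N. s (x, n) = \<zero>\<^bsub>M\<^esub>)}"

abbreviation (input) "GM \<equiv> PM\<lparr>carrier := geometric\<rparr>"

definition localizations :: "('a, ('a \<times> nat \<Rightarrow> 'm) set) module" where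
  "localizations = quotient_module GM null_sequences"

lemma generator_carr: "x \<in> S \<Longrightarrow> x \<in> carrier R"
  using S(2) ideal_element_carr by auto

lemma geometricD: "s \<in> geometric \<Longrightarrow> s i \<in> carrier M"
  "\<lbrakk>s \<in> geometric; x \<in> S\<rbrakk> \<Longrightarrow> \<exists>N. \<forall>n\<ge>N. s (x, Suc n) = x \<odot>\<^bsub>M\<^esub> s (x, n)"
  unfolding geometric_def by blast+

lemma geometric_submodule: "submodule geometric R PM"
proof (rule submoduleI'[OF power_module_is_module[OF M]])
  show "geometric \<subseteq> carrier PM" by (auto simp: geometric_def)
  show "\<zero>\<^bsub>PM\<^esub> \<in> geometric" using M generator_carr by (auto simp: geometric_def)
next
  fix s t assume st: "s \<in> geometric" "t \<in> geometric"
  have "\<exists>N. \<forall>n\<ge>N. s (x, Suc n) \<oplus>\<^bsub>M\<^esub> t (x, Suc n) = x \<odot>\<^bsub>M\<^esub> (s (x, n) \<oplus>\<^bsub>M\<^esub> t (x, n))" if x: "x \<in> S" for x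
  proof -
    obtain N N' where "\<forall>n\<ge>N. s (x, Suc n) = x \<odot>\<^bsub>M\<^esub> s (x, n)" "\<forall>n\<ge>N'. t (x, Suc n) = x \<odot>\<^bsub>M\<^esub> t (x, n)"
      using geometricD(2)[OF st(1) x] geometricD(2)[OF st(2) x] by blast
    then show ?thesis
      using M generator_carr[OF x] geometricD(1)[OF st(1)] geometricD(1)[OF st(2)]
      by (intro exI[of _ "max N N'"]) (simp add: msmult_add_right)
  qed
  then show "s \<oplus>\<^bsub>PM\<^esub> t \<in> geometric"
    using M geometricD(1)[OF st(1)] geometricD(1)[OF st(2)] by (simp add: geometric_def)
next
  fix r s assume r: "r \<in> carrier R" and s: "s \<in> geometric"
  have "\<exists>N. \<forall>n\<ge>N. r \<odot>\<^bsub>M\<^esub> s (x, Suc n) = x \<odot>\<^bsub>M\<^esub> (r \<odot>\<^bsub>M\<^esub> s (x, n))" if x: "x \<in> S" for x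
  proof -
    obtain N where "\<forall>n\<ge>N. s (x, Suc n) = x \<odot>\<^bsub>M\<^esub> s (x, n)" using geometricD(2)[OF s x] by blast
    then show ?thesis
      using M generator_carr[OF x] geometricD(1)[OF s] r by (intro exI[of _ N]) (simp add: msmult_comm[of M r x])
  qed
  then show "r \<odot>\<^bsub>PM\<^esub> s \<in> geometric"
    using M geometricD(1)[OF s] r by (simp add: geometric_def)
qed

lemma geometric_module: "module R GM"
  by (rule submodule_restrict[OF power_module_is_module[OF M] geometric_submodule])

lemma null_subset: "null_sequences \<subseteq> geometric"
proof
  fix s assume s: "s \<in> null_sequences"
  have "\<exists>N. \<forall>n\<ge>N. s (x, Suc n) = x \<odot>\<^bsub>M\<^esub> s (x, n)" if x: "x \<in> S" for x
  proof -
    obtain N where "\<forall>n\<ge>N. s (x, n) = \<zero>\<^bsub>M\<^esub>" using s x by (auto simp: null_sequences_def)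
    then show ?thesis using M generator_carr[OF x] by (intro exI[of _ N]) simp
  qed
  then show "s \<in> geometric" using s by (simp add: geometric_def null_sequences_def)
qed

lemma null_submodule: "submodule null_sequences R GM"
proof (rule submodule_in_restrict[OF power_module_is_module[OF M] geometric_submodule _ null_subset],
    rule submoduleI'[OF power_module_is_module[OF M]])
  show "null_sequences \<subseteq> carrier PM" by (auto simp: null_sequences_def)
  show "\<zero>\<^bsub>PM\<^esub> \<in> null_sequences" using M by (auto simp: null_sequences_def)
next
  fix s t assume st: "s \<in> null_sequences" "t \<in> null_sequences"
  have "\<exists>N. \<forall>n\<ge>N. s (x, n) \<oplus>\<^bsub>M\<^esub> t (x, n) = \<zero>\<^bsub>M\<^esub>" if x: "x \<in> S" for x
  proof -
    obtain N N' where "\<forall>n\<ge>N. s (x, n) = \<zero>\<^bsub>M\<^esub>" "\<forall>n\<ge>N'. t (x, n) = \<zero>\<^bsub>M\<^esub>"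
      using st x unfolding null_sequences_def by blast
    then show ?thesis using M by (intro exI[of _ "max N N'"]) simp
  qed
  then show "s \<oplus>\<^bsub>PM\<^esub> t \<in> null_sequences" using st M by (simp add: null_sequences_def)
next
  fix r s assume r: "r \<in> carrier R" and s: "s \<in> null_sequences"
  have "\<exists>N. \<forall>n\<ge>N. r \<odot>\<^bsub>M\<^esub> s (x, n) = \<zero>\<^bsub>M\<^esub>" if x: "x \<in> S" for x
  proof -
    obtain N where "\<forall>n\<ge>N. s (x, n) = \<zero>\<^bsub>M\<^esub>" using s x unfolding null_sequences_def by blast
    then show ?thesis using M r by (intro exI[of _ N]) simp
  qed
  then show "r \<odot>\<^bsub>PM\<^esub> s \<in> null_sequences" using s M r by (simp add: null_sequences_def)
qed

lemmas localization_facts = geometric_module null_submodule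

abbreviation (input) "cls \<equiv> \<lambda>s. null_sequences +>\<^bsub>GM\<^esub> s"

lemma localizations_module: "module R localizations"
  unfolding localizations_def by (rule quotient_is_module[OF localization_facts])

lemma localizations_carrier: "carrier localizations = cls ` geometric"
  unfolding localizations_def quotient_carrier[OF localization_facts] by simp

lemma cls_hom: "cls \<in> mod_hom R GM localizations"
  unfolding localizations_def by (rule quotient_proj[OF localization_facts])

lemma cls_zero_iff: "s \<in> geometric \<Longrightarrow> cls s = \<zero>\<^bsub>localizations\<^esub> \<longleftrightarrow> s \<in> null_sequences"
  using coset_zero_iff[OF localization_facts, of s] unfolding localizations_def quotient_zero[OF localization_facts] by simp

lemma cls_eqI:
  assumes "s \<in> geometric" "t \<in> geometric" "\<And>x. x \<in> S \<Longrightarrow> \<exists>N. \<forall>n\<ge>N. s (x, n) = t (x, n)"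
  shows "cls s = cls t"
proof -
  have "\<exists>N. \<forall>n\<ge>N. s (x, n) \<oplus>\<^bsub>M\<^esub> (\<ominus> \<one>) \<odot>\<^bsub>M\<^esub> t (x, n) = \<zero>\<^bsub>M\<^esub>" if x: "x \<in> S" for x
    using assms(3)[OF x] M geometricD(1)[OF assms(2)] by (metis madd_neg)
  then have "s \<oplus>\<^bsub>GM\<^esub> (\<ominus> \<one>) \<odot>\<^bsub>GM\<^esub> t \<in> null_sequences"
    using M geometricD(1)[OF assms(1)] geometricD(1)[OF assms(2)] by (simp add: null_sequences_def)
  then show ?thesis using coset_eq_iff[OF localization_facts, of s t] assms(1,2) by simp
qed

definition shift :: "'a \<Rightarrow> ('a \<times> nat \<Rightarrow> 'm) \<Rightarrow> 'a \<times> nat \<Rightarrow> 'm" where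
  "shift x s = (\<lambda>(y, n). if y = x then (case n of 0 \<Rightarrow> \<zero>\<^bsub>M\<^esub> | Suc k \<Rightarrow> s (x, k)) else \<zero>\<^bsub>M\<^esub>)"

text \<open>On classes, the projection onto the summands indexed by \<open>Y\<close>.\<close>

definition restrict_to :: "'a set \<Rightarrow> ('a \<times> nat \<Rightarrow> 'm) \<Rightarrow> 'a \<times> nat \<Rightarrow> 'm" where
  "restrict_to Y s = (\<lambda>(y, n). if y \<in> Y then s (y, n) else \<zero>\<^bsub>M\<^esub>)"

lemma shift_geometric:
  assumes s: "s \<in> geometric" and x: "x \<in> S"
  shows "shift x s \<in> geometric"
proof -
  have "\<exists>N. \<forall>n\<ge>N. shift x s (y, Suc n) = y \<odot>\<^bsub>M\<^esub> shift x s (y, n)" if y: "y \<in> S" for y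
  proof (cases "y = x")
    case True
    obtain N where N: "\<forall>n\<ge>N. s (x, Suc n) = x \<odot>\<^bsub>M\<^esub> s (x, n)" using geometricD(2)[OF s x] by blast
    have "shift x s (y, Suc n) = y \<odot>\<^bsub>M\<^esub> shift x s (y, n)" if n: "n \<ge> Suc N" for n
      using n N True by (cases n) (auto simp: shift_def)
    then show ?thesis by blast
  next
    case False
    then show ?thesis using M generator_carr[OF y] by (simp add: shift_def)
  qed
  moreover have "shift x s i \<in> carrier M" for i
    using M geometricD(1)[OF s] by (cases i) (auto simp: shift_def split: nat.split)
  ultimately show ?thesis by (simp add: geometric_def)
qed

lemma shift_hom:
  assumes x: "x \<in> S"
  shows "shift x \<in> mod_hom R GM GM"
proof (rule mod_homI)
  show "shift x s \<in> carrier GM" if "s \<in> carrier GM" for s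
    using that shift_geometric[OF _ x] by simp
qed (use M generator_carr[OF x] in \<open>auto simp: shift_def fun_eq_iff split: nat.split\<close>)

lemma shift_null:
  assumes x: "x \<in> S" and s: "s \<in> null_sequences"
  shows "shift x s \<in> null_sequences"
proof -
  have "\<exists>N. \<forall>n\<ge>N. shift x s (y, n) = \<zero>\<^bsub>M\<^esub>" if y: "y \<in> S" for y
  proof -
    obtain N where N: "\<forall>n\<ge>N. s (x, n) = \<zero>\<^bsub>M\<^esub>" using s x unfolding null_sequences_def by blast
    have "shift x s (y, n) = \<zero>\<^bsub>M\<^esub>" if n: "n \<ge> Suc N" for n
      using n N by (cases n) (auto simp: shift_def)
    then show ?thesis by blast
  qed
  then show ?thesis
    using shift_geometric[OF subsetD[OF null_subset s] x] by (simp add: null_sequences_def geometric_def)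
qed

lemma restrict_geometric:
  assumes s: "s \<in> geometric"
  shows "restrict_to Y s \<in> geometric"
proof -
  have "\<exists>N. \<forall>n\<ge>N. restrict_to Y s (y, Suc n) = y \<odot>\<^bsub>M\<^esub> restrict_to Y s (y, n)" if y: "y \<in> S" for y
    using geometricD(2)[OF s y] M generator_carr[OF y] by (auto simp: restrict_to_def)
  moreover have "restrict_to Y s i \<in> carrier M" for i
    using M geometricD(1)[OF s] by (cases i) (auto simp: restrict_to_def)
  ultimately show ?thesis by (simp add: geometric_def)
qed

text \<open>On the summand of \<open>x\<close> the identity is \<open>x\<close> times the shift,
  because \<open>x \<odot> s (x, k)\<close> and \<open>s (x, Suc k)\<close> agree for large
  \<open>k\<close>. Each further member of \<open>Y\<close> contributes one such term with
  coefficient in \<open>I\<close>.\<close>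

lemma restrict_ideal_multiple:
  assumes "finite Y" "Y \<subseteq> S"
  shows "\<exists>u. ideal_multiple localizations localizations u \<and> (\<forall>s\<in>geometric. u (cls s) = cls (restrict_to Y s))"
  using assms
proof (induction Y rule: finite_induct)
  case empty
  have "cls (restrict_to {} s) = \<zero>\<^bsub>localizations\<^esub>" if s: "s \<in> geometric" for s
  proof -
    have "restrict_to {} s \<in> null_sequences" using M by (auto simp: restrict_to_def null_sequences_def)
    then show ?thesis using cls_zero_iff[OF restrict_geometric[OF s]] by blast
  qed
  then show ?case
    by (intro exI[of _ "\<lambda>_. \<zero>\<^bsub>localizations\<^esub>"] conjI ballI ideal_multiple.zero) auto
next
  case (insert x Y)
  then obtain u where u: "ideal_multiple localizations localizations u" "\<And>s. s \<in> geometric \<Longrightarrow> u (cls s) = cls (restrict_to Y s)"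
    by auto
  have x: "x \<in> S" using insert by auto
  note xc = generator_carr[OF x]
  obtain h where h: "h \<in> mod_hom R localizations localizations" "\<And>s. s \<in> geometric \<Longrightarrow> h (cls s) = cls (shift x s)"
    using quotient_map[OF localization_facts localization_facts shift_hom[OF x] shift_null[OF x]] unfolding localizations_def by auto
  let ?k = "\<lambda>m. u m \<oplus>\<^bsub>localizations\<^esub> x \<odot>\<^bsub>localizations\<^esub> h m"
  have "ideal_multiple localizations localizations (\<lambda>m. x \<odot>\<^bsub>localizations\<^esub> h m)"
    using x S(2) by (intro ideal_multiple.smult[OF _ h(1)]) auto
  then have "ideal_multiple localizations localizations ?k"
    by (rule ideal_multiple.add[OF u(1)]) simp
  moreover have "?k (cls s) = cls (restrict_to (insert x Y) s)" if s: "s \<in> geometric" for s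
  proof -
    note g = restrict_geometric[OF s, of Y] shift_geometric[OF s x]
    have xs: "x \<odot>\<^bsub>GM\<^esub> shift x s \<in> geometric" using submodule_smult[OF power_module_is_module[OF M] geometric_submodule xc g(2)] by simp
    have "?k (cls s) = cls (restrict_to Y s \<oplus>\<^bsub>GM\<^esub> x \<odot>\<^bsub>GM\<^esub> shift x s)"
      using g xs xc hom_add[OF cls_hom, of "restrict_to Y s" "x \<odot>\<^bsub>GM\<^esub> shift x s"] hom_smult[OF cls_hom xc, of "shift x s"]
      by (simp add: u(2)[OF s] h(2)[OF s] del: power_module_simps)
    also have "\<dots> = cls (restrict_to (insert x Y) s)"
    proof (rule cls_eqI)
      show "restrict_to Y s \<oplus>\<^bsub>GM\<^esub> x \<odot>\<^bsub>GM\<^esub> shift x s \<in> geometric"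
        using submodule_add[OF power_module_is_module[OF M] geometric_submodule g(1) xs] by simp
      show "restrict_to (insert x Y) s \<in> geometric" by (rule restrict_geometric[OF s])
      fix y assume y: "y \<in> S"
      show "\<exists>N. \<forall>n\<ge>N. (restrict_to Y s \<oplus>\<^bsub>GM\<^esub> x \<odot>\<^bsub>GM\<^esub> shift x s) (y, n) = restrict_to (insert x Y) s (y, n)"
      proof (cases "y = x")
        case True
        obtain N where N: "\<forall>n\<ge>N. s (x, Suc n) = x \<odot>\<^bsub>M\<^esub> s (x, n)" using geometricD(2)[OF s x] by blast
        have "(restrict_to Y s \<oplus>\<^bsub>GM\<^esub> x \<odot>\<^bsub>GM\<^esub> shift x s) (y, n) = restrict_to (insert x Y) s (y, n)" if n: "n \<ge> Suc N" for n
        proof -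
          obtain k where k: "n = Suc k" "k \<ge> N" using n by (cases n) auto
          show ?thesis using k N True insert.hyps(2) M xc geometricD(1)[OF s]
            by (simp add: restrict_to_def shift_def)
        qed
        then show ?thesis by blast
      next
        case False
        then show ?thesis using M xc geometricD(1)[OF s] by (simp add: restrict_to_def shift_def)
      qed
    qed
    finally show ?thesis .
  qed
  ultimately show ?case by blast
qed

lemma localizations_acyclic: "ideal_multiple localizations localizations (\<lambda>m. m)"
proof -
  obtain u where u: "ideal_multiple localizations localizations u" "\<And>s. s \<in> geometric \<Longrightarrow> u (cls s) = cls (restrict_to S s)"
    using restrict_ideal_multiple[OF S(1) subset_refl] by blast
  have "cls (restrict_to S s) = cls s" if s: "s \<in> geometric" for s
    by (rule cls_eqI[OF restrict_geometric[OF s] s]) (auto simp: restrict_to_def)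
  then have "m = u m" if "m \<in> carrier localizations" for m
    using that u(2) unfolding localizations_carrier by auto
  then show ?thesis by (rule ideal_multiple_cong[OF u(1)])
qed

definition to_localizations :: "'m \<Rightarrow> ('a \<times> nat \<Rightarrow> 'm) set" where
  "to_localizations m = cls (\<lambda>(x, n). if x \<in> S then (x [^] n) \<odot>\<^bsub>M\<^esub> m else \<zero>\<^bsub>M\<^esub>)"

lemma to_localizations:
  "to_localizations \<in> mod_hom R M localizations"
  "mod_ker M localizations to_localizations = carrier (torsion_part torsion_filter M)"
proof -
  let ?s = "\<lambda>m (x, n). if x \<in> S then (x [^] n) \<odot>\<^bsub>M\<^esub> m else \<zero>\<^bsub>M\<^esub>"
  have "(x [^] Suc n) \<odot>\<^bsub>M\<^esub> m = x \<odot>\<^bsub>M\<^esub> ((x [^] n) \<odot>\<^bsub>M\<^esub> m)" if "x \<in> S" "m \<in> carrier M" for x and n :: nat and m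
    using that M generator_carr[OF that(1)] msmult_mult[OF M, of x "x [^] n" m] by (simp add: m_comm)
  then have g: "?s m \<in> geometric" if "m \<in> carrier M" for m
    using that M generator_carr by (auto simp: geometric_def simp del: nat_pow_Suc)
  have "?s \<in> mod_hom R M GM"
    using M generator_carr by (intro mod_homI) (auto simp: g fun_eq_iff msmult_add_right msmult_comm)
  then have "(\<lambda>m. cls (?s m)) \<in> mod_hom R M localizations"
    by (rule hom_comp[OF _ cls_hom])
  then show "to_localizations \<in> mod_hom R M localizations"
    by (simp add: to_localizations_def[abs_def])
  have "to_localizations m = \<zero>\<^bsub>localizations\<^esub> \<longleftrightarrow> m \<in> carrier (torsion_part torsion_filter M)" if m: "m \<in> carrier M" for m
    unfolding to_localizations_def cls_zero_iff[OF g[OF m]] torsion_iff_powers[OF M m S]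
    using m M generator_carr by (auto simp: null_sequences_def)
  then show "mod_ker M localizations to_localizations = carrier (torsion_part torsion_filter M)"
    by (auto simp: mod_ker_def)
qed

text \<open>Since \<open>S\<close> is finite, one index works for all components: from it on the
  sequence is geometric, and its class is determined by the index and the values there. Such data
  are pairs of a number and a list over the type of \<open>M\<close>, no more than the type itself
  when it is infinite.\<close>

lemma localizations_lepoll:
  assumes inf: "infinite (UNIV :: 'm set)"
  shows "carrier localizations \<lesssim> (UNIV :: 'm set)"
proof -
  obtain xs where xs: "set xs = S" using finite_list[OF S(1)] by auto
  have "\<exists>N. \<forall>x\<in>S. \<forall>n\<ge>N. s (x, Suc n) = x \<odot>\<^bsub>M\<^esub> s (x, n)" if s: "s \<in> geometric" for s
  proof -
    obtain N where N: "\<And>x. x \<in> S \<Longrightarrow> \<forall>n\<ge>N x. s (x, Suc n) = x \<odot>\<^bsub>M\<^esub> s (x, n)"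
      using geometricD(2)[OF s] by metis
    have "N x \<le> sum N S" if "x \<in> S" for x using that S(1) by (intro member_le_sum) auto
    then show ?thesis using N by (intro exI[of _ "sum N S"]) (meson order_trans)
  qed
  then obtain N where N: "\<And>s x n. \<lbrakk>s \<in> geometric; x \<in> S; n \<ge> N s\<rbrakk> \<Longrightarrow> s (x, Suc n) = x \<odot>\<^bsub>M\<^esub> s (x, n)"
    by metis
  define rep where "rep K = (SOME s. s \<in> geometric \<and> cls s = K)" for K
  have rep: "rep K \<in> geometric \<and> cls (rep K) = K" if K: "K \<in> carrier localizations" for K
  proof -
    obtain s where "s \<in> geometric \<and> cls s = K" using K unfolding localizations_carrier by blast
    then show ?thesis unfolding rep_def by (rule someI[where P = "\<lambda>s. s \<in> geometric \<and> cls s = K"])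
  qed
  let ?f = "\<lambda>K. (N (rep K), map (\<lambda>x. rep K (x, N (rep K))) xs)"
  have "inj_on ?f (carrier localizations)"
  proof (rule inj_onI)
    fix K L assume K: "K \<in> carrier localizations" and L: "L \<in> carrier localizations" and eq: "?f K = ?f L"
    let ?s = "rep K" and ?t = "rep L"
    have NN: "N ?s = N ?t" and e: "\<And>x. x \<in> S \<Longrightarrow> ?s (x, N ?s) = ?t (x, N ?s)" using eq xs by auto
    have "?s (x, n) = ?t (x, n)" if x: "x \<in> S" and n: "n \<ge> N ?s" for x n
      using n
    proof (induction n rule: nat_induct_at_least)
      case base
      then show ?case by (rule e[OF x])
    next
      case (Suc n)
      then show ?case using N[of ?s x n] N[of ?t x n] rep[OF K] rep[OF L] NN x by simp
    qed
    then have "cls ?s = cls ?t" using rep[OF K] rep[OF L] by (intro cls_eqI) auto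
    then show "K = L" using rep[OF K] rep[OF L] by simp
  qed
  then have "carrier localizations \<lesssim> (UNIV :: nat set) \<times> (UNIV :: 'm list set)"
    unfolding lepoll_def by (intro exI[of _ ?f]) auto
  also have "\<dots> \<lesssim> (UNIV :: 'm set)"
    using inf infinite_le_lepoll by (intro times_lepoll_infinite lists_lepoll_infinite) auto
  finally show ?thesis .
qed

end

lemma acyclic_quotient:
  fixes M :: "('a, 'm) module"
  assumes M: "module R M"
  shows "\<exists>(E :: ('a, 'm) module) f. module R E \<and> ideal_multiple E E (\<lambda>e. e) \<and> f \<in> mod_hom R M E \<and>
    mod_ker M E f = carrier (torsion_part torsion_filter M)"
proof (cases "finite (UNIV :: 'm set)")
  case True
  then have "finite (carrier M)" by (rule finite_subset[OF subset_UNIV])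
  then show ?thesis by (rule finite_acyclic_quotient[OF M])
next
  case False
  obtain S where S: "finite S" "S \<subseteq> I" "I = Idl S" using generators by blast
  note Q = localizations_module[OF M S] and Qa = localizations_acyclic[OF M S] and Qf = to_localizations[OF M S]
  let ?Q = "localizations M S"
  obtain j :: "_ \<Rightarrow> 'm" where j: "inj_on j (carrier ?Q)"
    using localizations_lepoll[OF M S False] by (auto simp: lepoll_def)
  obtain E :: "('a, 'm) module" where E: "module R E" "j \<in> mod_hom R ?Q E" "j ` carrier ?Q = carrier E"
    using transport_module[OF Q j] by blast
  let ?p = "inv_into (carrier ?Q) j"
  have p: "?p \<in> mod_hom R E ?Q" by (rule hom_inv[OF E(2) Q E(1) j E(3)])
  have "ideal_multiple E E (\<lambda>e. j (?p e))"
    by (rule ideal_multiple_comp[OF Q Q E(1) E(1) p E(2) Qa])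
  then have "ideal_multiple E E (\<lambda>e. e)"
    by (rule ideal_multiple_cong) (use E(3) in \<open>simp add: f_inv_into_f\<close>)
  moreover have "(\<lambda>m. j (to_localizations M S m)) \<in> mod_hom R M E" by (rule hom_comp[OF Qf(1) E(2)])
  moreover have "j q = \<zero>\<^bsub>E\<^esub> \<longleftrightarrow> q = \<zero>\<^bsub>?Q\<^esub>" if "q \<in> carrier ?Q" for q
    using j hom_inj_iff[OF Q E(1,2)] hom_zero[OF Q E(1,2)] that by blast
  then have "mod_ker M E (\<lambda>m. j (to_localizations M S m)) = carrier (torsion_part torsion_filter M)"
    unfolding Qf(2)[symmetric] using hom_closed[OF Qf(1)] by (auto simp: mod_ker_def)
  ultimately show ?thesis using E(1) by blast
qed

section \<open>Modules with cofinite local cohomology\<close>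

lemma torsion_ideal_eq:
  "carrier (torsion_part {I} (torsion_part torsion_filter M)) = carrier (torsion_part {I} M)"
proof -
  have "I \<in> torsion_filter" using ideal_power_1 by (metis torsion_filter_def rangeI)
  then show ?thesis by auto
qed

lemma torsion_part_torsion_part:
  "torsion_part {I} (torsion_part torsion_filter M) = torsion_part {I} M"
  using torsion_ideal_eq[of M] by (simp add: torsion_part_def)

text \<open>Left exactness of the torsion functor: \<open>\<epsilon>\<close> identifies the torsion
  of \<open>M\<close> with the torsion elements of \<open>E 0\<close> that the differential kills,
  and the coboundaries in degree zero are trivial.\<close>

lemma degree_zero_iso:
  assumes F: "ideal_filter R F" and E: "baer_resolution R M \<epsilon> E d"
  shows "mod_isomorphic R (torsion_part F M) (cohomology_module (\<lambda>n. torsion_part F (E n)) d 0)"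
proof -
  note Er = coresolutionD[OF baer_resolutionD(1)[OF E]]
  note c = complexD[OF Er(2)] and T = torsion_complex[OF F Er(2)]
  let ?C = "\<lambda>n. torsion_part F (E n)"
  let ?Z = "(?C 0)\<lparr>carrier := cocycles ?C d 0\<rparr>"
  note m = cocycle_module[OF T, of 0]
  note Tm = torsion_is_module[OF F Er(1)]
  have e: "\<epsilon> \<in> mod_hom R (torsion_part F M) ?Z"
  proof (rule hom_restrict_cod[OF torsion_part_hom[OF F Er(1) c(1) Er(3)]])
    fix x assume x: "x \<in> carrier (torsion_part F M)"
    then show "\<epsilon> x \<in> cocycles ?C d 0"
      using hom_closed[OF torsion_part_hom[OF F Er(1) c(1) Er(3)] x] Er(5)[of x] unfolding cocycles_iff by simp
  qed
  let ?p = "\<lambda>x. coboundaries ?C d 0 +>\<^bsub>?Z\<^esub> \<epsilon> x"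
  have p: "?p \<in> mod_hom R (torsion_part F M) (cohomology_module ?C d 0)"
    unfolding cohomology_module_alt by (rule hom_comp[OF e quotient_proj[OF m]])
  show ?thesis
  proof (rule mod_isomorphicI[OF p])
    have "x = \<zero>\<^bsub>M\<^esub>" if x: "x \<in> carrier (torsion_part F M)" "?p x = \<zero>\<^bsub>cohomology_module ?C d 0\<^esub>" for x
    proof -
      have "\<epsilon> x \<in> coboundaries ?C d 0"
        using x(2) coset_zero_iff[OF m hom_closed[OF e x(1)]] unfolding cohomology_module_alt quotient_zero[OF m] by simp
      then have "\<epsilon> x = \<zero>\<^bsub>E 0\<^esub>" by (simp add: coboundaries_0)
      then show ?thesis using x(1) Er(4) hom_inj_iff[OF Er(1) c(1) Er(3)] by auto
    qed
    then show "inj_on ?p (carrier (torsion_part F M))"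
      unfolding hom_inj_iff[OF Tm cohomology_is_module[OF T] p] by simp
    have "cocycles ?C d 0 \<subseteq> \<epsilon> ` carrier (torsion_part F M)"
    proof
      fix y assume y: "y \<in> cocycles ?C d 0"
      then have "y \<in> carrier (E 0)" "d 0 y = \<zero>\<^bsub>E (Suc 0)\<^esub>" by (auto simp: cocycles_iff)
      then obtain x where x: "x \<in> carrier M" "y = \<epsilon> x" using Er(6) by blast
      have "y \<in> carrier (torsion_part F (E 0))" using y unfolding cocycles_iff by blast
      then have "x \<in> carrier (torsion_part F M)" using torsion_reflect[OF F Er(1) c(1) Er(3,4) x(1)] x(2) by blast
      then show "y \<in> \<epsilon> ` carrier (torsion_part F M)" using x(2) by blast
    qed
    then have "cocycles ?C d 0 = \<epsilon> ` carrier (torsion_part F M)" using hom_closed[OF e] by auto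
    then show "?p ` carrier (torsion_part F M) = carrier (cohomology_module ?C d 0)"
      unfolding cohomology_module_alt quotient_carrier[OF m] by (simp add: image_image)
  qed
qed

lemma ext_zero_fin_gen:
  assumes M: "module R M" and fg: "fin_gen_module R (ext_module 0 M)"
  shows "fin_gen_module R (torsion_part {I} M)"
proof -
  obtain \<epsilon> E d where c: "chosen_resolution R M = (E, d)" "baer_resolution R M \<epsilon> E d"
    using chosen_resolution[OF M] by blast
  note F = ideal_filter_single[OF I]
  show ?thesis
    using fg fin_gen_iso[OF torsion_is_module[OF F M]
        cohomology_is_module[OF torsion_complex[OF F coresolutionD(2)[OF baer_resolutionD(1)[OF c(2)]]]] degree_zero_iso[OF F c(2)]]
    unfolding ext_fin_gen_iff[OF c(2) M mod_isomorphic_refl] by simp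
qed

text \<open>An injective \<open>M\<close> with quotient \<open>N\<close> is the degree zero term for
  \<open>L\<close>, followed by a resolution of \<open>N\<close>. \<open>M\<close> and the terms of
  \<open>J\<close> share a carrier type because a resolution is one function of the degree.\<close>

lemma splice_resolution:
  assumes se: "short_exact R L f M g N" and M: "baer_module R M" and J: "baer_resolution R N \<eta> J \<delta>"
  shows "baer_resolution R L f (case_nat M J) (case_nat (\<lambda>x. \<eta> (g x)) \<delta>)"
proof -
  note s = short_exactD[OF se] and r = coresolutionD[OF baer_resolutionD(1)[OF J]]
  note c = complexD[OF r(2)]
  let ?E = "case_nat M J" and ?d = "case_nat (\<lambda>x. \<eta> (g x)) \<delta>"
  have cx: "is_complex R ?E ?d"
    unfolding is_complex_def
    using s(2) c r(5) hom_comp[OF s(5) r(3)] hom_closed[OF s(5)] by (auto split: nat.split)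
  have "coresolution R L f ?E ?d"
  proof (rule coresolutionI[OF s(1) cx])
    show "f \<in> mod_hom R L (?E 0)" using s(4) by simp
    show "m = \<zero>\<^bsub>L\<^esub>" if "m \<in> carrier L" "f m = \<zero>\<^bsub>?E 0\<^esub>" for m
      using that s(6) hom_inj_iff[OF s(1,2,4)] by auto
    show "?d 0 (f m) = \<zero>\<^bsub>?E (Suc 0)\<^esub>" if "m \<in> carrier L" for m
      using s(7)[OF that] hom_zero[OF s(3) c(1) r(3)] by simp
    show "\<exists>m\<in>carrier L. x = f m" if x: "x \<in> carrier (?E 0)" "?d 0 x = \<zero>\<^bsub>?E (Suc 0)\<^esub>" for x
    proof -
      have "g x = \<zero>\<^bsub>N\<^esub>" using x r(4) hom_inj_iff[OF s(3) c(1) r(3)] hom_closed[OF s(5)] by auto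
      then show ?thesis using s(8) x(1) by simp
    qed
    show "\<exists>y\<in>carrier (?E n). x = ?d n y" if x: "x \<in> carrier (?E (Suc n))" "?d (Suc n) x = \<zero>\<^bsub>?E (Suc (Suc n))\<^esub>" for n x
    proof (cases n)
      case 0
      then obtain z where "z \<in> carrier N" "x = \<eta> z" using r(6)[of x] x by auto
      then show ?thesis using s(9)[of z] 0 by auto
    next
      case (Suc k)
      then show ?thesis using r(7)[of x k] x by simp
    qed
  qed
  then show ?thesis using M baer_resolutionD(2)[OF J] by (auto simp: baer_resolution_def split: nat.split)
qed

text \<open>From degree one on, \<open>Ext\<close> of \<open>N\<close> is \<open>Ext\<close> of
  \<open>L\<close> one degree up. In degree zero only the quotient of Hom(R/I, N) by the image of
  Hom(R/I, M) is reached; it is the first \<open>Ext\<close> of \<open>L\<close>.\<close>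

lemma ext_dimension_shift:
  fixes M :: "('a, ('a, 'm) res) module" and N :: "('a, ('a, 'm) res) module"
  assumes se: "short_exact R L f M g N" and M: "baer_module R M"
    and fg: "\<And>j. fin_gen_module R (ext_module (Suc j) L)"
  shows "fin_gen_module R (ext_module (Suc j) N)"
    and "fin_gen_module R (quotient_module (torsion_part {I} N) (g ` carrier (torsion_part {I} M)))"
proof -
  note s = short_exactD[OF se] and F = ideal_filter_single[OF I]
  obtain \<eta> and J :: "nat \<Rightarrow> ('a, ('a, 'm) res) module" and \<delta> where J: "baer_resolution R N \<eta> J \<delta>"
    using baer_resolution_exists[OF s(3) res_infinite res_inj] by blast
  note sp = splice_resolution[OF se M J]
  let ?E = "case_nat M J" and ?d = "case_nat (\<lambda>x. \<eta> (g x)) \<delta>"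
  note r = coresolutionD[OF baer_resolutionD(1)[OF J]]
  note c = complexD[OF r(2)] and T = torsion_complex[OF F r(2)]
  let ?C = "\<lambda>n. torsion_part {I} (J n)"
  have fgE: "fin_gen_module R (cohomology_module (\<lambda>n. torsion_part {I} (?E n)) ?d (Suc j))" for j
    using fg[of j] unfolding ext_fin_gen_iff[OF sp s(1) mod_isomorphic_refl] .
  have "cohomology_module (\<lambda>n. torsion_part {I} (?E n)) ?d (Suc (Suc j)) = cohomology_module ?C \<delta> (Suc j)"
    by (simp add: cohomology_module_def)
  then show "fin_gen_module R (ext_module (Suc j) N)"
    using fgE[of "Suc j"] unfolding ext_fin_gen_iff[OF J s(3) mod_isomorphic_refl] by simp
  let ?Z = "(?C 0)\<lparr>carrier := cocycles ?C \<delta> 0\<rparr>"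
  let ?B = "(\<lambda>x. \<eta> (g x)) ` carrier (torsion_part {I} M)"
  have co: "cohomology_module (\<lambda>n. torsion_part {I} (?E n)) ?d (Suc 0) = quotient_module ?Z ?B"
    by (simp add: cohomology_module_def kernel_module_def cocycles_def)
  have Zm: "module R ?Z" by (rule cocycle_module[OF T])
  note TN = torsion_is_module[OF F s(3)] and TM = torsion_is_module[OF F s(2)]
  have e: "\<eta> \<in> mod_hom R (torsion_part {I} N) ?Z"
  proof (rule hom_restrict_cod[OF torsion_part_hom[OF F s(3) c(1) r(3)]])
    fix x assume x: "x \<in> carrier (torsion_part {I} N)"
    then show "\<eta> x \<in> cocycles ?C \<delta> 0"
      using hom_closed[OF torsion_part_hom[OF F s(3) c(1) r(3)] x] r(5)[of x] unfolding cocycles_iff by simp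
  qed
  note gT = torsion_part_hom[OF F s(2,3,5)]
  have D: "submodule (g ` carrier (torsion_part {I} M)) R (torsion_part {I} N)"
    by (rule img_submodule[OF TM TN gT submodule_carrier[OF TM]])
  have B: "submodule ?B R ?Z"
    using img_submodule[OF TN Zm e D] by (simp add: image_image)
  have iso: "mod_isomorphic R (quotient_module (torsion_part {I} N) (g ` carrier (torsion_part {I} M))) (quotient_module ?Z ?B)"
  proof (rule quotient_iso[OF TN D Zm B e])
    show "\<eta> x \<in> ?B" if "x \<in> g ` carrier (torsion_part {I} M)" for x using that by blast
    show "x \<in> g ` carrier (torsion_part {I} M)" if x: "x \<in> carrier (torsion_part {I} N)" "\<eta> x \<in> ?B" for x
    proof -
      obtain m where m: "m \<in> carrier (torsion_part {I} M)" "\<eta> x = \<eta> (g m)" using x(2) by blast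
      moreover have "g m \<in> carrier N" using m(1) hom_closed[OF s(5)] by simp
      ultimately have "x = g m" using x(1) r(4) by (auto simp: inj_on_def)
      then show ?thesis using m(1) by blast
    qed
    show "\<exists>x\<in>carrier (torsion_part {I} N). \<exists>b\<in>?B. y = \<eta> x \<oplus>\<^bsub>?Z\<^esub> b" if y: "y \<in> carrier ?Z" for y
    proof -
      have yZ: "y \<in> carrier (?C 0)" "\<delta> 0 y = \<zero>\<^bsub>J (Suc 0)\<^esub>" using y by (simp_all add: cocycles_iff)
      then obtain x where x: "x \<in> carrier N" "y = \<eta> x" using r(6)[of y] by auto
      have xT: "x \<in> carrier (torsion_part {I} N)" using torsion_reflect[OF F s(3) c(1) r(3,4) x(1)] yZ(1) x(2) by blast
      have z: "\<zero>\<^bsub>?Z\<^esub> \<in> ?B" by (rule submodule_zero[OF Zm B])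
      have "y = \<eta> x \<oplus>\<^bsub>?Z\<^esub> \<zero>\<^bsub>?Z\<^esub>" using y x(2) madd_0_right[OF Zm y] by simp
      then show ?thesis using xT z by blast
    qed
  qed
  show "fin_gen_module R (quotient_module (torsion_part {I} N) (g ` carrier (torsion_part {I} M)))"
    using fgE[of 0] unfolding co fin_gen_iso[OF quotient_is_module[OF TN D] quotient_is_module[OF Zm B] iso] .
qed

text \<open>The torsion functor is left exact, and exactness in the middle survives division of the
  first two terms by a submodule \<open>D\<close> of the first. In the application \<open>D\<close>
  consists of coboundaries of the complex of \<open>I\<close>-torsion.\<close>

lemma torsion_quotient_fin_gen:
  assumes se: "short_exact R L (\<lambda>x. x) M g N" and D: "submodule D R (torsion_part {I} L)" "submodule D R (torsion_part {I} M)"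
    and fg: "fin_gen_module R (quotient_module (torsion_part {I} L) D)" "fin_gen_module R (torsion_part {I} N)"
  shows "fin_gen_module R (quotient_module (torsion_part {I} M) D)"
proof -
  note s = short_exactD[OF se] and F = ideal_filter_single[OF I]
  note TL = torsion_is_module[OF F s(1)] and TM = torsion_is_module[OF F s(2)] and TN = torsion_is_module[OF F s(3)]
  note iT = torsion_part_hom[OF F s(1,2,4)] and gT = torsion_part_hom[OF F s(2,3,5)]
  have DL: "D \<subseteq> carrier L" using submodule_carr[OF TL D(1)] by auto
  obtain u where u: "u \<in> mod_hom R (quotient_module (torsion_part {I} L) D) (quotient_module (torsion_part {I} M) D)"
    "\<And>x. x \<in> carrier (torsion_part {I} L) \<Longrightarrow> u (D +>\<^bsub>torsion_part {I} L\<^esub> x) = D +>\<^bsub>torsion_part {I} M\<^esub> x"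
    using quotient_map[OF TL D(1) TM D(2) iT] by blast
  have "g x = \<zero>\<^bsub>torsion_part {I} N\<^esub>" if "x \<in> D" for x using s(7) that DL by auto
  then obtain v where v: "v \<in> mod_hom R (quotient_module (torsion_part {I} M) D) (torsion_part {I} N)"
    "\<And>x. x \<in> carrier (torsion_part {I} M) \<Longrightarrow> v (D +>\<^bsub>torsion_part {I} M\<^esub> x) = g x"
    using quotient_hom_lift[OF TM D(2) TN gT] by blast
  show ?thesis
  proof (rule fin_gen_exact[OF quotient_is_module[OF TL D(1)] quotient_is_module[OF TM D(2)] TN u(1) v(1) _ fg])
    fix K assume K: "K \<in> carrier (quotient_module (torsion_part {I} M) D)" "v K = \<zero>\<^bsub>torsion_part {I} N\<^esub>"
    then obtain x where x: "x \<in> carrier (torsion_part {I} M)" "K = D +>\<^bsub>torsion_part {I} M\<^esub> x"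
      unfolding quotient_carrier[OF TM D(2)] by blast
    have "g x = \<zero>\<^bsub>N\<^esub>" using K(2) v(2)[OF x(1)] x(2) by simp
    then have "x \<in> carrier L" using s(8)[of x] x(1) by auto
    then have xL: "x \<in> carrier (torsion_part {I} L)" using torsion_reflect[OF F s(1,2,4,6)] x(1) by blast
    then show "K \<in> u ` carrier (quotient_module (torsion_part {I} L) D)"
      using u(2)[OF xL] x(2) unfolding quotient_carrier[OF TL D(1)] by (metis (no_types, lifting) image_eqI)
  qed
qed

lemma fin_gen_quotient:
  assumes "module R M" "submodule N R M" "fin_gen_module R M"
  shows "fin_gen_module R (quotient_module M N)"
  using quotient_carrier[OF assms(1,2)]
  by (intro fin_gen_surj[OF assms(1) quotient_is_module[OF assms(1,2)] quotient_proj[OF assms(1,2)] _ assms(3)]) auto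

text \<open>Let \<open>G\<close> be the torsion part of an injective resolution of \<open>M\<close>, a complex of injective modules with
  \<open>Hom(R/I, G) = Hom(R/I, E)\<close>. The sequences \<open>0 \<rightarrow> B\<^sup>i \<rightarrow> Z\<^sup>i \<rightarrow> H\<^sup>i \<rightarrow> 0\<close> and
  \<open>0 \<rightarrow> Z\<^sup>i \<rightarrow> G\<^sup>i \<rightarrow> B\<^sup>i\<^sup>+\<^sup>1 \<rightarrow> 0\<close> propagate finiteness from the local cohomology \<open>H\<^sup>i\<close> to \<open>Ext\<^sup>i(R/I, M)\<close>.\<close>

lemma L_cof_subset_M0_cof: "(L_cof R I :: ('a, 'm) module set) \<subseteq> M0_cof R I"
proof
  fix M :: "('a, 'm) module" assume "M \<in> L_cof R I"
  then have M: "module R M" and lc: "\<And>i. local_cohomology R I i M \<in> M0_cof R I"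
    by (simp_all add: L_cof_def cofinite_module_def)
  obtain \<epsilon> and E :: "nat \<Rightarrow> ('a, ('a, 'm) res) module" and d where E: "baer_resolution R M \<epsilon> E d"
    using chosen_resolution[OF M] by blast
  note F = ideal_filter_single[OF I]
  define G where "G n = torsion_part torsion_filter (E n)" for n
  have Gb: "baer_module R (G n)" for n
    unfolding G_def by (rule torsion_baer[OF baer_resolutionD(2)[OF E]])
  have Gc: "is_complex R G d"
    unfolding G_def by (rule torsion_complex[OF torsion_filter coresolutionD(2)[OF baer_resolutionD(1)[OF E]]])
  note c = complexD[OF Gc] and T = torsion_complex[OF F Gc]
  let ?T = "\<lambda>n. torsion_part {I} (G n)"
  let ?H = "\<lambda>i. cohomology_module G d i"
  let ?Z = "\<lambda>i. (G i)\<lparr>carrier := cocycles G d i\<rparr>" and ?B = "\<lambda>i. (G i)\<lparr>carrier := coboundaries G d i\<rparr>"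
  have Hext: "fin_gen_module R (ext_module j (?H i))" for i j
    using local_cohomology_iso[OF E M mod_isomorphic_refl, of i] lc[of i]
      M0_cof_cong[OF _ cohomology_is_module[OF Gc], of "local_cohomology R I i M" i]
    by (simp add: M0_cof_def G_def[abs_def])
  have Zm: "module R (?Z i)" and Bs: "submodule (coboundaries G d i) R (?Z i)" for i
    by (rule cocycle_module[OF Gc])+
  have Bm: "module R (?B i)" for i
    by (rule submodule_restrict[OF c(1) coboundaries_submodule[OF Gc]])
  have ZH: "short_exact R (?B i) (\<lambda>x. x) (?Z i) (\<lambda>x. coboundaries G d i +>\<^bsub>?Z i\<^esub> x) (?H i)" for i
  proof -
    have "short_exact R ((?Z i)\<lparr>carrier := coboundaries G d i\<rparr>) (\<lambda>x. x) (?Z i) (\<lambda>x. coboundaries G d i +>\<^bsub>?Z i\<^esub> x) (?H i)"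
    proof (rule short_exact_restrict[OF Zm cohomology_is_module[OF Gc] _ Bs])
      show "(\<lambda>x. coboundaries G d i +>\<^bsub>?Z i\<^esub> x) \<in> mod_hom R (?Z i) (?H i)"
        unfolding cohomology_module_alt by (rule quotient_proj[OF Zm Bs])
      show "mod_ker (?Z i) (?H i) (\<lambda>x. coboundaries G d i +>\<^bsub>?Z i\<^esub> x) = coboundaries G d i"
        using coset_zero_iff[OF Zm Bs] unfolding cohomology_module_alt mod_ker_def quotient_zero[OF Zm Bs]
        by (auto intro: subsetD[OF coboundaries_subset[OF Gc]])
      show "(\<lambda>x. coboundaries G d i +>\<^bsub>?Z i\<^esub> x) ` carrier (?Z i) = carrier (?H i)"
        unfolding cohomology_module_alt quotient_carrier[OF Zm Bs] ..
    qed
    then show ?thesis by simp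
  qed
  have GB: "short_exact R (?Z i) (\<lambda>x. x) (G i) (d i) (?B (Suc i))" for i
  proof (rule short_exact_restrict[OF c(1) Bm _ cocycles_submodule[OF Gc]])
    show "d i \<in> mod_hom R (G i) (?B (Suc i))" by (rule hom_restrict_cod[OF c(2)]) (auto simp: coboundaries_Suc)
    show "mod_ker (G i) (?B (Suc i)) (d i) = cocycles G d i" by (simp add: cocycles_def mod_ker_def)
    show "d i ` carrier (G i) = carrier (?B (Suc i))" by (simp add: coboundaries_Suc)
  qed
  \<comment> \<open>For positive \<open>i\<close> these are the images of the
    \<open>I\<close>-torsion of the preceding term of \<open>G\<close>, in general fewer than the
    coboundaries of \<open>G\<close> that \<open>I\<close> kills.\<close>
  let ?D = "\<lambda>i. coboundaries ?T d i"
  have TZ: "torsion_part {I} (?Z i) = (?T i)\<lparr>carrier := cocycles ?T d i\<rparr>" for i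
    by (simp add: torsion_part_def cocycles_def mod_ker_def conj_ac)
  have DZ: "submodule (?D i) R (torsion_part {I} (?Z i))" for i
    unfolding TZ by (rule cocycle_module[OF T])
  have DB: "submodule (?D i) R (torsion_part {I} (?B i))" for i
  proof -
    have "?D i \<subseteq> carrier (torsion_part {I} (?B i))"
    proof
      fix x assume x: "x \<in> ?D i"
      then have "x \<in> carrier (?T i)" using submodule_carr[OF complexD(1)[OF T] coboundaries_submodule[OF T]] by blast
      moreover have "x \<in> coboundaries G d i" using x by (cases i) (auto simp: coboundaries_0 coboundaries_Suc)
      ultimately show "x \<in> carrier (torsion_part {I} (?B i))" by simp
    qed
    moreover have "carrier (torsion_part {I} (?B i)) \<subseteq> carrier (?T i)"
      using submodule_carr[OF c(1) coboundaries_submodule[OF Gc]] by auto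
    moreover have "torsion_part {I} (?B i) = (?T i)\<lparr>carrier := carrier (torsion_part {I} (?B i))\<rparr>"
      by (simp add: torsion_part_def)
    moreover have "submodule (carrier (torsion_part {I} (?B i))) R (?T i)"
      using calculation(2,3) torsion_is_module[OF F Bm] module.module_incl_imp_submodule[OF complexD(1)[OF T]] by metis
    ultimately show ?thesis
      using submodule_in_restrict[OF complexD(1)[OF T] _ coboundaries_submodule[OF T]] by metis
  qed
  \<comment> \<open>In degree zero the induction carries only quotients by \<open>?D i\<close>:
    Hom(R/I, -) of cocycles and coboundaries contains the image of Hom(R/I, -) of a term of
    \<open>G\<close>, about whose finiteness nothing is known.\<close>
  let ?P = "\<lambda>i. (\<forall>j. fin_gen_module R (ext_module (Suc j) (?Z i))) \<and> fin_gen_module R (cohomology_module ?T d i)"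
  let ?Q = "\<lambda>i. (\<forall>j. fin_gen_module R (ext_module (Suc j) (?B i))) \<and> fin_gen_module R (quotient_module (torsion_part {I} (?B i)) (?D i))"
  have QP: "?P i" if Q: "?Q i" for i
  proof
    show "\<forall>j. fin_gen_module R (ext_module (Suc j) (?Z i))"
      using ext_fin_gen_middle[OF ZH] Q Hext by blast
    have "fin_gen_module R (quotient_module (torsion_part {I} (?Z i)) (?D i))"
      using torsion_quotient_fin_gen[OF ZH DB DZ] Q ext_zero_fin_gen[OF cohomology_is_module[OF Gc] Hext] by blast
    then show "fin_gen_module R (cohomology_module ?T d i)" unfolding TZ cohomology_module_alt .
  qed
  have PQ: "?Q (Suc i)" if P: "?P i" for i
  proof
    have e: "\<And>j. fin_gen_module R (ext_module (Suc j) (?Z i))" using P by blast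
    show "\<forall>j. fin_gen_module R (ext_module (Suc j) (?B (Suc i)))"
      using ext_dimension_shift(1)[OF GB Gb e] by blast
    \<comment> \<open>By definition \<open>?D (Suc i)\<close> is the image of the
      \<open>I\<close>-torsion of \<open>G i\<close> under \<open>d i\<close>, so this is the degree
      zero part of the dimension shift.\<close>
    show "fin_gen_module R (quotient_module (torsion_part {I} (?B (Suc i))) (?D (Suc i)))"
      using ext_dimension_shift(2)[OF GB Gb e] unfolding coboundaries_Suc .
  qed
  have Q0: "?Q 0"
  proof
    have "ideal_multiple (?B 0) (?B 0) (\<lambda>m. m)" by (rule ideal_multiple.zero) (simp add: coboundaries_0)
    then show "\<forall>j. fin_gen_module R (ext_module (Suc j) (?B 0))" using ideal_multiple_ext_fin_gen[OF Bm] by blast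
    have "fin_gen_module R (?B 0)" using fin_gen_zero[OF c(1), of 0] by (simp add: coboundaries_0)
    moreover have "torsion_part {I} (?B 0) = ?B 0"
      using c(1)[of 0] ideal_element_carr by (intro torsion_part_eqI) (auto simp: coboundaries_0)
    ultimately have "fin_gen_module R (torsion_part {I} (?B 0))" by simp
    then show "fin_gen_module R (quotient_module (torsion_part {I} (?B 0)) (?D 0))"
      by (rule fin_gen_quotient[OF torsion_is_module[OF F Bm] DB])
  qed
  have P: "?P i" for i
    by (induction i) (use QP PQ Q0 in blast)+
  \<comment> \<open>Elements killed by \<open>I\<close> are torsion, so \<open>G\<close> and the
    resolution \<open>E\<close> have the same \<open>I\<close>-torsion and \<open>?T\<close>
    computes \<open>Ext\<close> of \<open>M\<close>.\<close>
  have "fin_gen_module R (ext_module i M)" for i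
    unfolding ext_fin_gen_iff[OF E M mod_isomorphic_refl] using P[of i] by (simp add: G_def torsion_part_torsion_part)
  then show "M \<in> M0_cof R I" using M by (simp add: M0_cof_def)
qed

text \<open>An element of \<open>I\<close> outside \<open>P\<close> has powers that kill any two
  given elements of \<open>M\<close>, and these powers are denominators. Hence all fractions with
  respect to \<open>P\<close> are equal and the localization is trivial.\<close>

lemma torsion_Supp:
  assumes M: "module R M" and tor: "carrier (torsion_part torsion_filter M) = carrier M"
  shows "Supp R M \<subseteq> V_ideal R I"
proof
  fix P assume P: "P \<in> Supp R M"
  then have prime: "primeideal P R" by (simp add: Supp_def)
  interpret P: primeideal P R by (rule prime)
  have "I \<subseteq> P"
  proof (rule ccontr)
    assume "\<not> I \<subseteq> P"
    then obtain s where s: "s \<in> I" "s \<notin> P" by auto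
    have sc: "s \<in> carrier R" by (rule ideal_element_carr[OF s(1)])
    have sp: "s [^] n \<notin> P" for n :: nat
    proof (induction n)
      case 0
      then show ?case using P.I_notcarr P.one_imp_carrier by auto
    next
      case (Suc n)
      then show ?case using P.I_prime[of "s [^] n" s] s(2) sc by auto
    qed
    have kill: "\<exists>n::nat. \<forall>k\<ge>n. (s [^] k) \<odot>\<^bsub>M\<^esub> x = \<zero>\<^bsub>M\<^esub>" if x: "x \<in> carrier M" for x
    proof -
      obtain n where n: "\<forall>r\<in>ideal_power R I n. r \<odot>\<^bsub>M\<^esub> x = \<zero>\<^bsub>M\<^esub>"
        using x tor unfolding torsion_carrier by blast
      have "s [^] k \<in> ideal_power R I n" if "k \<ge> n" for k
        using subsetD[OF ideal_power_antimono[OF that] pow_in_ideal_power[OF s(1)]] .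
      then show ?thesis using n by blast
    qed
    have rel: "((x, a), (y, b)) \<in> fraction_rel R M P"
      if xy: "x \<in> carrier M" "y \<in> carrier M" "a \<in> carrier R - P" "b \<in> carrier R - P" for x y a b
    proof -
      obtain m n :: nat where "\<forall>k\<ge>m. (s [^] k) \<odot>\<^bsub>M\<^esub> (b \<odot>\<^bsub>M\<^esub> x) = \<zero>\<^bsub>M\<^esub>" "\<forall>k\<ge>n. (s [^] k) \<odot>\<^bsub>M\<^esub> (a \<odot>\<^bsub>M\<^esub> y) = \<zero>\<^bsub>M\<^esub>"
        using kill[of "b \<odot>\<^bsub>M\<^esub> x"] kill[of "a \<odot>\<^bsub>M\<^esub> y"] xy M by auto
      then have "(s [^] max m n) \<odot>\<^bsub>M\<^esub> (b \<odot>\<^bsub>M\<^esub> x) = (s [^] max m n) \<odot>\<^bsub>M\<^esub> (a \<odot>\<^bsub>M\<^esub> y)" by simp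
      moreover have "s [^] max m n \<in> carrier R - P" using sp sc by simp
      ultimately show ?thesis using xy unfolding fraction_rel_def by blast
    qed
    have one: "\<one> \<in> carrier R - P" using sp[of 0] by simp
    have "fraction_rel R M P `` {(x, a)} = carrier M \<times> (carrier R - P)" if "x \<in> carrier M" "a \<in> carrier R - P" for x a
    proof
      show "fraction_rel R M P `` {(x, a)} \<subseteq> carrier M \<times> (carrier R - P)" by (auto simp: fraction_rel_def)
      show "carrier M \<times> (carrier R - P) \<subseteq> fraction_rel R M P `` {(x, a)}" using rel that by blast
    qed
    then have cls: "fraction_rel R M P `` {p} = carrier M \<times> (carrier R - P)" if "p \<in> carrier M \<times> (carrier R - P)" for p
      using that by (cases p) auto
    have p1: "(\<zero>\<^bsub>M\<^esub>, \<one>) \<in> carrier M \<times> (carrier R - P)" using one M by simp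
    have "localized_carrier R M P = (\<Union>p\<in>carrier M \<times> (carrier R - P). {carrier M \<times> (carrier R - P)})"
      unfolding localized_carrier_def quotient_def by (rule SUP_cong[OF refl]) (simp only: cls)
    also have "\<dots> = {fraction_rel R M P `` {(\<zero>\<^bsub>M\<^esub>, \<one>)}}"
      unfolding cls[OF p1] using p1 by blast
    finally have "localized_carrier R M P = {fraction_rel R M P `` {(\<zero>\<^bsub>M\<^esub>, \<one>)}}" .
    then show False using P by (simp add: Supp_def)
  qed
  then show "P \<in> V_ideal R I" using prime by (simp add: V_ideal_def)
qed

text \<open>A quotient of cocycles in a complex of torsion modules is torsion. Together with
  \<open>torsion_Supp\<close> this gives the condition on supports in cofiniteness.\<close>

lemma local_cohomology_torsion:
  fixes M :: "('a, 'm) module"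
  assumes M: "module R M"
  shows "module R (local_cohomology R I i M)"
    and "carrier (torsion_part torsion_filter (local_cohomology R I i M)) = carrier (local_cohomology R I i M)"
proof -
  obtain \<epsilon> E d where c: "chosen_resolution R M = (E, d)" "baer_resolution R M \<epsilon> E d"
    using chosen_resolution[OF M] by blast
  note T = torsion_complex[OF torsion_filter coresolutionD(2)[OF baer_resolutionD(1)[OF c(2)]]]
  let ?T = "\<lambda>n. torsion_part torsion_filter (E n)"
  have eq: "local_cohomology R I i M = cohomology_module ?T d i"
    by (simp add: local_cohomology_def right_derived_def c(1) torsion_module_eq)
  show lm: "module R (local_cohomology R I i M)" unfolding eq by (rule cohomology_is_module[OF T])
  note m = cocycle_module[OF T, of i]
  let ?Z = "(?T i)\<lparr>carrier := cocycles ?T d i\<rparr>"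
  have "carrier (local_cohomology R I i M) \<subseteq> carrier (torsion_part torsion_filter (local_cohomology R I i M))"
  proof
    fix K assume "K \<in> carrier (local_cohomology R I i M)"
    then obtain z where z: "z \<in> cocycles ?T d i" "K = coboundaries ?T d i +>\<^bsub>?Z\<^esub> z"
      unfolding eq cohomology_module_alt quotient_carrier[OF m] by auto
    have "z \<in> carrier (torsion_part torsion_filter ?Z)" using z(1) by (auto simp: cocycles_iff)
    then have "coboundaries ?T d i +>\<^bsub>?Z\<^esub> z \<in> carrier (torsion_part torsion_filter (quotient_module ?Z (coboundaries ?T d i)))"
      by (rule torsion_hom[OF torsion_filter m(1) quotient_is_module[OF m] quotient_proj[OF m]])
    then show "K \<in> carrier (torsion_part torsion_filter (local_cohomology R I i M))"
      unfolding eq cohomology_module_alt z(2) .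
  qed
  then show "carrier (torsion_part torsion_filter (local_cohomology R I i M)) = carrier (local_cohomology R I i M)" by auto
qed

section \<open>Closure under local cohomology in the abelian case\<close>

lemma local_cohomology_zero_iso:
  fixes M :: "('a, 'm) module"
  assumes M: "module R M"
  shows "mod_isomorphic R (torsion_module R I M) (local_cohomology R I 0 M)"
proof -
  obtain \<epsilon> E d where c: "chosen_resolution R M = (E, d)" "baer_resolution R M \<epsilon> E d"
    using chosen_resolution[OF M] by blast
  show ?thesis
    using degree_zero_iso[OF torsion_filter c(2)]
    by (simp add: local_cohomology_def right_derived_def c(1) torsion_module_eq)
qed

text \<open>With \<Gamma> the torsion part of \<open>M\<close>, the map \<open>f\<close> splits into
  the sequences \<Gamma> to \<open>M\<close> to \<open>M/\<Gamma>\<close> and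
  \<open>M/\<Gamma>\<close> to \<open>E\<close> to \<open>C\<close>. The first identifies local
  cohomology of \<open>M\<close> and \<open>M/\<Gamma>\<close> in positive degrees, the second
  shifts that of \<open>C\<close> up by one. The module \<open>M\<close> is arbitrary in the
  induction because the step replaces it by \<open>C\<close>.\<close>

lemma local_cohomology_in_M0_cof:
  assumes ab: "abelian_subcategory R (M0_cof R I :: ('a, 'm) module set)"
    and M: "(M :: ('a, 'm) module) \<in> M0_cof R I"
  shows "local_cohomology R I i M \<in> M0_cof R I"
  using M
proof (induction i arbitrary: M)
  case (0 M)
  note M = 0
  have Mm: "module R M" using M by (simp add: M0_cof_def)
  obtain E :: "('a, 'm) module" and f where E: "module R E" "ideal_multiple E E (\<lambda>e. e)" "f \<in> mod_hom R M E"
    "mod_ker M E f = carrier (torsion_part torsion_filter M)"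
    using acyclic_quotient[OF Mm] by blast
  have EM: "E \<in> M0_cof R I" using E(1) ideal_multiple_ext_fin_gen[OF E(1,2)] by (simp add: M0_cof_def)
  have k: "kernel_module M E f = torsion_module R I M"
    unfolding kernel_module_def E(4) by (simp add: torsion_module_eq torsion_part_def)
  have tm: "module R (torsion_module R I M)"
    unfolding torsion_module_eq by (rule torsion_is_module[OF torsion_filter Mm])
  then have "torsion_module R I M \<in> M0_cof R I"
    using ab M EM E(3) mod_isomorphic_refl[of "torsion_module R I M"] k unfolding abelian_subcategory_def by metis
  then show ?case
    using M0_cof_cong[OF tm local_cohomology_torsion(1)[OF Mm] local_cohomology_zero_iso[OF Mm]] by simp
next
  case (Suc i M)
  note M = Suc.prems
  have Mm: "module R M" using M by (simp add: M0_cof_def)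
  obtain E :: "('a, 'm) module" and f where E: "module R E" "ideal_multiple E E (\<lambda>e. e)" "f \<in> mod_hom R M E"
    "mod_ker M E f = carrier (torsion_part torsion_filter M)"
    using acyclic_quotient[OF Mm] by blast
  have EM: "E \<in> M0_cof R I" using E(1) ideal_multiple_ext_fin_gen[OF E(1,2)] by (simp add: M0_cof_def)
  note img = img_submodule[OF Mm E(1,3) submodule_carrier[OF Mm]]
  \<comment> \<open>The hypothesis on the subcategory speaks of modules on the type of
    \<open>M\<close>, so the cokernel is copied to that type.\<close>
  obtain C :: "('a, 'm) module" and p where C: "module R C" "p \<in> mod_hom R E C" "p ` carrier E = carrier C"
    "\<And>x. x \<in> carrier E \<Longrightarrow> p x = \<zero>\<^bsub>C\<^esub> \<longleftrightarrow> x \<in> f ` carrier M" "mod_isomorphic R (quotient_module E (f ` carrier M)) C"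
    using quotient_copy[OF E(1) img] by blast
  have "mod_isomorphic R C (cokernel_module M E f)"
    unfolding cokernel_module_def by (rule mod_isomorphic_sym[OF quotient_is_module[OF E(1) img] C(1,5)])
  then have CM: "C \<in> M0_cof R I" using ab M EM E(3) C(1) unfolding abelian_subcategory_def by metis
  let ?N = "E\<lparr>carrier := f ` carrier M\<rparr>"
  note Nm = submodule_restrict[OF E(1) img]
  have se1: "short_exact R (M\<lparr>carrier := carrier (torsion_part torsion_filter M)\<rparr>) (\<lambda>x. x) M f ?N"
  proof (rule short_exact_restrict[OF Mm Nm])
    show "f \<in> mod_hom R M ?N" by (rule hom_restrict_cod[OF E(3)]) auto
    show "submodule (carrier (torsion_part torsion_filter M)) R M" by (rule torsion_submodule[OF torsion_filter Mm])
    show "mod_ker M ?N f = carrier (torsion_part torsion_filter M)" using E(4) by (simp add: mod_ker_def)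
  qed simp
  have se2: "short_exact R ?N (\<lambda>x. x) E p C"
    by (rule short_exact_restrict[OF E(1) C(1,2) img _ C(3)])
      (use C(4) submodule_carr[OF E(1) img] in \<open>auto simp: mod_ker_def\<close>)
  have "carrier (torsion_part torsion_filter (M\<lparr>carrier := carrier (torsion_part torsion_filter M)\<rparr>)) =
      carrier (M\<lparr>carrier := carrier (torsion_part torsion_filter M)\<rparr>)"
    by auto
  then have i1: "mod_isomorphic R (local_cohomology R I (Suc i) M) (local_cohomology R I (Suc i) ?N)"
    by (rule local_cohomology_mod_torsion[OF se1])
  have i2: "mod_isomorphic R (local_cohomology R I i C) (local_cohomology R I (Suc i) ?N)"
    by (rule local_cohomology_shift[OF se2 E(2)])
  have "local_cohomology R I i C \<in> M0_cof R I" by (rule Suc.IH[OF CM])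
  then show ?case
    using M0_cof_cong[OF local_cohomology_torsion(1)[OF C(1)] local_cohomology_torsion(1)[OF Nm] i2]
      M0_cof_cong[OF local_cohomology_torsion(1)[OF Mm] local_cohomology_torsion(1)[OF Nm] i1] by simp
qed

lemma M0_cof_subset_L_cof:
  assumes "abelian_subcategory R (M0_cof R I :: ('a, 'm) module set)"
  shows "(M0_cof R I :: ('a, 'm) module set) \<subseteq> L_cof R I"
proof
  fix M :: "('a, 'm) module" assume M: "M \<in> M0_cof R I"
  then have Mm: "module R M" by (simp add: M0_cof_def)
  show "M \<in> L_cof R I"
    using Mm local_cohomology_in_M0_cof[OF assms M] torsion_Supp[OF local_cohomology_torsion[OF Mm]]
    by (simp add: L_cof_def cofinite_module_def)
qed

end

theorem proposition4p5:
  fixes A :: "('a, 'r) ring_scheme" and \<aa> :: "'a set"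
  assumes "cring A" and "noetherian_ring A" and "ideal \<aa> A"
  shows "(L_cof A \<aa> :: ('a, 'm) module set) \<subseteq> M0_cof A \<aa> \<and>
    (abelian_subcategory A (M0_cof A \<aa> :: ('a, 'm) module set) \<longrightarrow>
       (L_cof A \<aa> :: ('a, 'm) module set) = M0_cof A \<aa>)"
proof -
  interpret noetherian_ideal A \<aa>
    using assms by (intro noetherian_ideal.intro noetherian_cring.intro noetherian_ideal_axioms.intro)
  show ?thesis
    using L_cof_subset_M0_cof M0_cof_subset_L_cof by blast
qed

end
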